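(* Let $(G,t)$ be a rooted graph with $n$ nodes where $G$ is planar and biconnected, and let $S$ be the set of separating links of $G$. Given a perfectly resilient right-hand forwarding pattern for $(G\setminus S,t)$ together with a corresponding planar embedding of $G\setminus S$, one can construct a perfectly resilient skipping forwarding pattern for $(G,t)$ in $O(n^2)$ time.
   Context: Graphs are finite, simple, undirected; $t$ is the target; $E_v$ is the set of links at $v$. Biconnected: connected with no cut node. A link $\{u,v\}$ is separating if removing both $u$ and $v$ disconnects the graph. A skipping forwarding pattern assigns to each node $v\neq t$ and each in-port (a link at $v$, or $\bot$ if the packet starts at $v$) a permutation of $E_v$; the out-port is the first non-failed link in it. The routing from $s$ under failure set $F$ follows the out-ports, stopping at $t$; a pattern is perfectly resilient for $(H,t)$ if for every $s$ and $F$ with $s,t$ connected in $H$ minus $F$ the routing reaches $t$. Given a plane embedding, the right-hand rule at $v$ assigns to in-port $f\in E_v$ the list of all links at $v$ in counterclockwise order starting with the link following $f$ and ending with $f$; the updated right-hand rule moves $\{v,t\}$ (if present) to the front of every list; $\lambda_v^{e}$ ($e\in E_v$) is the updated right-hand rule whose list for in-port $\bot$ equals that for in-port $e$. A right-hand forwarding pattern is one of the form $(\lambda_v^{e_v})_{v\neq t}$ for some choice of $e_v\in E_v$. *)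

theory Defs
  imports "HOL-Analysis.Analysis" "HOL-Library.Landau_Symbols"
begin

section \<open>Graphs\<close>

text \<open>A graph is a node set \<open>V\<close> together with a set \<open>E\<close> of links, each link being a two-element
  set of nodes.\<close>

definition simple_graph :: "'a set \<Rightarrow> 'a set set \<Rightarrow> bool" where
  "simple_graph V E \<longleftrightarrow> finite V \<and> (\<forall>e\<in>E. \<exists>u\<in>V. \<exists>v\<in>V. u \<noteq> v \<and> e = {u, v})"

definition links_at :: "'a set set \<Rightarrow> 'a \<Rightarrow> 'a set set" where
  "links_at E v = {e \<in> E. v \<in> e}"

definition linked :: "'a set set \<Rightarrow> 'a \<Rightarrow> 'a \<Rightarrow> bool" where
  "linked E u v \<longleftrightarrow> (u, v) \<in> {(x, y). {x, y} \<in> E}\<^sup>*"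

text \<open>The graph without nodes counts as connected, so the link of a single-link graph is not
  separating.\<close>

definition graph_connected :: "'a set \<Rightarrow> 'a set set \<Rightarrow> bool" where
  "graph_connected V E \<longleftrightarrow> (\<forall>u\<in>V. \<forall>v\<in>V. linked E u v)"

definition connected_without :: "'a set \<Rightarrow> 'a set set \<Rightarrow> 'a set \<Rightarrow> bool" where
  "connected_without V E X \<longleftrightarrow> graph_connected (V - X) {e \<in> E. e \<inter> X = {}}"

definition biconnected :: "'a set \<Rightarrow> 'a set set \<Rightarrow> bool" where
  "biconnected V E \<longleftrightarrow> graph_connected V E \<and> (\<forall>v\<in>V. connected_without V E {v})"

definition separating_links :: "'a set \<Rightarrow> 'a set set \<Rightarrow> 'a set set" where
  "separating_links V E = {e \<in> E. \<not> connected_without V E e}"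

definition other_end :: "'a \<Rightarrow> 'a set \<Rightarrow> 'a" where
  "other_end v e = (THE w. e = {v, w})"


section \<open>Plane embeddings\<close>

text \<open>Links are drawn as polygonal arcs, as is usual for plane graphs. This gives every link
  a direction at each of its ends, and hence makes the counterclockwise order around a node
  meaningful. \<open>bends D u v\<close> lists the interior corners of the arc of \<open>{u, v}\<close> from \<open>u\<close>
  to \<open>v\<close>.\<close>

record 'a drawing =
  pos :: "'a \<Rightarrow> complex"
  bends :: "'a \<Rightarrow> 'a \<Rightarrow> complex list"

fun polyline :: "complex list \<Rightarrow> real \<Rightarrow> complex" where
  "polyline [] = linepath 0 0"
| "polyline [a] = linepath a a"
| "polyline [a, b] = linepath a b"
| "polyline (a # b # c # xs) = linepath a b +++ polyline (b # c # xs)"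

definition link_arc :: "'a drawing \<Rightarrow> 'a \<Rightarrow> 'a \<Rightarrow> real \<Rightarrow> complex" where
  "link_arc D u v = polyline (pos D u # bends D u v @ [pos D v])"

definition plane_embedding :: "'a set \<Rightarrow> 'a set set \<Rightarrow> 'a drawing \<Rightarrow> bool" where
  "plane_embedding V E D \<longleftrightarrow>
     inj_on (pos D) V \<and>
     (\<forall>u v. {u, v} \<in> E \<longrightarrow>
        bends D v u = rev (bends D u v) \<and>
        arc (link_arc D u v) \<and>
        (\<forall>w\<in>V - {u, v}. pos D w \<notin> path_image (link_arc D u v))) \<and>
     (\<forall>u v x y. {u, v} \<in> E \<and> {x, y} \<in> E \<and> {u, v} \<noteq> {x, y} \<longrightarrow>
        path_image (link_arc D u v) \<inter> path_image (link_arc D x y)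
          \<subseteq> pos D ` ({u, v} \<inter> {x, y}))"

definition planar :: "'a set \<Rightarrow> 'a set set \<Rightarrow> bool" where
  "planar V E \<longleftrightarrow> (\<exists>D. plane_embedding V E D)"

definition link_direction :: "'a drawing \<Rightarrow> 'a \<Rightarrow> 'a set \<Rightarrow> complex" where
  "link_direction D v e =
     (let w = other_end v e in hd (bends D v w @ [pos D w]) - pos D v)"

text \<open>The counterclockwise angle at \<open>v\<close> from link \<open>f\<close> to link \<open>e\<close>, a full turn for \<open>e = f\<close>.\<close>

definition link_angle :: "'a drawing \<Rightarrow> 'a \<Rightarrow> 'a set \<Rightarrow> 'a set \<Rightarrow> real" where
  "link_angle D v f e =
     (if e = f then 2 * pi else Arg2pi (link_direction D v e / link_direction D v f))"

definition right_hand :: "'a set set \<Rightarrow> 'a drawing \<Rightarrow> 'a \<Rightarrow> 'a set \<Rightarrow> 'a set list" where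
  "right_hand E D v f =
     (THE xs. set xs = links_at E v \<and> sorted_wrt (<) (map (link_angle D v f) xs))"


section \<open>Forwarding patterns\<close>

text \<open>A pattern maps a node and an in-port to a list of links; the in-port \<open>None\<close> is used for a
  packet that starts at the node.\<close>

type_synonym 'a pattern = "'a \<Rightarrow> 'a set option \<Rightarrow> 'a set list"

definition in_ports :: "'a set set \<Rightarrow> 'a \<Rightarrow> 'a set option set" where
  "in_ports E v = insert None (Some ` links_at E v)"

definition skipping_pattern :: "'a set \<Rightarrow> 'a set set \<Rightarrow> 'a \<Rightarrow> 'a pattern \<Rightarrow> bool" where
  "skipping_pattern V E t \<pi> \<longleftrightarrow>
     (\<forall>v\<in>V - {t}. \<forall>p\<in>in_ports E v. distinct (\<pi> v p) \<and> set (\<pi> v p) = links_at E v)"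

text \<open>\<open>reaches \<pi> t F v p\<close>: a packet located at \<open>v\<close> that arrived through in-port \<open>p\<close> reaches \<open>t\<close>
  after finitely many hops if the links in \<open>F\<close> fail.\<close>

inductive reaches :: "'a pattern \<Rightarrow> 'a \<Rightarrow> 'a set set \<Rightarrow> 'a \<Rightarrow> 'a set option \<Rightarrow> bool"
  for \<pi> :: "'a pattern" and t :: 'a and F :: "'a set set" where
  arrived: "reaches \<pi> t F t p"
| hop: "v \<noteq> t \<Longrightarrow> find (\<lambda>e. e \<notin> F) (\<pi> v p) = Some e \<Longrightarrow>
    reaches \<pi> t F (other_end v e) (Some e) \<Longrightarrow> reaches \<pi> t F v p"

definition perfectly_resilient :: "'a set \<Rightarrow> 'a set set \<Rightarrow> 'a \<Rightarrow> 'a pattern \<Rightarrow> bool" where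
  "perfectly_resilient V E t \<pi> \<longleftrightarrow>
     (\<forall>F\<subseteq>E. \<forall>s\<in>V. linked (E - F) s t \<longrightarrow> reaches \<pi> t F s None)"

definition move_to_front :: "'b \<Rightarrow> 'b list \<Rightarrow> 'b list" where
  "move_to_front x xs = (if x \<in> set xs then x # remove1 x xs else xs)"

text \<open>The updated right-hand rule at \<open>v\<close> that treats a starting packet like one arriving
  through \<open>e\<close>.\<close>

definition updated_right_hand ::
  "'a set set \<Rightarrow> 'a drawing \<Rightarrow> 'a \<Rightarrow> 'a \<Rightarrow> 'a set \<Rightarrow> 'a set option \<Rightarrow> 'a set list" where
  "updated_right_hand E D t v e p =
     move_to_front {v, t} (right_hand E D v (case p of None \<Rightarrow> e | Some f \<Rightarrow> f))"

definition right_hand_pattern ::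
  "'a set \<Rightarrow> 'a set set \<Rightarrow> 'a drawing \<Rightarrow> 'a \<Rightarrow> 'a pattern \<Rightarrow> bool" where
  "right_hand_pattern V E D t \<pi> \<longleftrightarrow>
     (\<forall>v\<in>V - {t}. \<exists>e\<in>links_at E v. \<forall>p\<in>in_ports E v. \<pi> v p = updated_right_hand E D t v e p)"


section \<open>Machine model\<close>

text \<open>A unit-cost random access machine on natural numbers with addition and truncated subtraction,
  but without multiplication, programmed in a structured language. A program uses finitely many
  unbounded arrays, named by numbers; cell \<open>i\<close> of array \<open>a\<close> has content \<open>\<sigma> a i\<close>. Every
  assignment and every evaluation of a test costs one unit: the expressions of a fixed program
  have bounded size, so this is the unit-cost measure up to a constant factor.\<close>

type_synonym store = "nat \<Rightarrow> nat \<Rightarrow> nat"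

datatype aexp = Const nat | Read nat aexp | Add aexp aexp | Sub aexp aexp

datatype bexp = Less aexp aexp | Equal aexp aexp | Neg bexp | Conj bexp bexp

datatype com =
    Skip
  | Write nat aexp aexp
  | Seq com com
  | Cond bexp com com
  | While bexp com

primrec aval :: "aexp \<Rightarrow> store \<Rightarrow> nat" where
  "aval (Const k) \<sigma> = k"
| "aval (Read a x) \<sigma> = \<sigma> a (aval x \<sigma>)"
| "aval (Add x y) \<sigma> = aval x \<sigma> + aval y \<sigma>"
| "aval (Sub x y) \<sigma> = aval x \<sigma> - aval y \<sigma>"

primrec bval :: "bexp \<Rightarrow> store \<Rightarrow> bool" where
  "bval (Less x y) \<sigma> \<longleftrightarrow> aval x \<sigma> < aval y \<sigma>"
| "bval (Equal x y) \<sigma> \<longleftrightarrow> aval x \<sigma> = aval y \<sigma>"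
| "bval (Neg b) \<sigma> \<longleftrightarrow> \<not> bval b \<sigma>"
| "bval (Conj b c) \<sigma> \<longleftrightarrow> bval b \<sigma> \<and> bval c \<sigma>"

definition set_cell :: "nat \<Rightarrow> nat \<Rightarrow> nat \<Rightarrow> store \<Rightarrow> store" where
  "set_cell a i x \<sigma> = \<sigma>(a := (\<sigma> a)(i := x))"

text \<open>\<open>exec c \<sigma> k \<tau>\<close>: started in store \<open>\<sigma>\<close>, the program \<open>c\<close> halts in store \<open>\<tau>\<close> after
  \<open>k\<close> steps.\<close>

inductive exec :: "com \<Rightarrow> store \<Rightarrow> nat \<Rightarrow> store \<Rightarrow> bool" where
  Skip: "exec Skip \<sigma> 1 \<sigma>"
| Write: "exec (Write a x y) \<sigma> 1 (set_cell a (aval x \<sigma>) (aval y \<sigma>) \<sigma>)"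
| Seq: "exec c \<sigma> k \<sigma>' \<Longrightarrow> exec d \<sigma>' l \<tau> \<Longrightarrow> exec (Seq c d) \<sigma> (k + l) \<tau>"
| CondTrue: "bval b \<sigma> \<Longrightarrow> exec c \<sigma> k \<tau> \<Longrightarrow> exec (Cond b c d) \<sigma> (Suc k) \<tau>"
| CondFalse: "\<not> bval b \<sigma> \<Longrightarrow> exec d \<sigma> k \<tau> \<Longrightarrow> exec (Cond b c d) \<sigma> (Suc k) \<tau>"
| WhileFalse: "\<not> bval b \<sigma> \<Longrightarrow> exec (While b c) \<sigma> 1 \<sigma>"
| WhileTrue: "bval b \<sigma> \<Longrightarrow> exec c \<sigma> k \<sigma>' \<Longrightarrow> exec (While b c) \<sigma>' l \<tau> \<Longrightarrow>
    exec (While b c) \<sigma> (Suc (k + l)) \<tau>"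


section \<open>Encoding of inputs and outputs\<close>

text \<open>A list of lists is stored as the concatenation of its rows together with the array of the
  starting offsets of the rows, followed by the total length.\<close>

definition offsets :: "nat list list \<Rightarrow> nat list" where
  "offsets xss = map (\<lambda>j. length (concat (take j xss))) [0..<Suc (length xss)]"

definition adjacency_lists :: "nat \<Rightarrow> nat set set \<Rightarrow> nat list list \<Rightarrow> bool" where
  "adjacency_lists n E adj \<longleftrightarrow>
     length adj = n \<and> (\<forall>v<n. distinct (adj ! v) \<and> set (adj ! v) = {w. {v, w} \<in> E})"

text \<open>The combinatorial description of an embedding: the neighbours of each node in
  counterclockwise order, starting from an arbitrary one.\<close>

definition rotation_lists ::
  "nat \<Rightarrow> nat set set \<Rightarrow> nat drawing \<Rightarrow> nat list list \<Rightarrow> bool" where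
  "rotation_lists n E D rot \<longleftrightarrow>
     length rot = n \<and>
     (\<forall>v<n. if links_at E v = {} then rot ! v = []
            else \<exists>f\<in>links_at E v. rot ! v = map (other_end v) (right_hand E D v f))"

text \<open>Row \<open>v\<close> of the table of a pattern consists of the lists of \<open>v\<close> for the in-port \<open>None\<close> and for
  the links to the neighbours of \<open>v\<close>, in the order \<open>nbs ! v\<close> of these neighbours. A link at \<open>v\<close> is
  represented by its other end; all these lists have length \<open>length (nbs ! v)\<close>.\<close>

definition pattern_table :: "nat list list \<Rightarrow> nat \<Rightarrow> nat pattern \<Rightarrow> nat list list" where
  "pattern_table nbs t \<pi> =
     map (\<lambda>v. if v = t then []
              else concat (map (\<lambda>p. map (other_end v) (\<pi> v p))
                               (None # map (\<lambda>w. Some {v, w}) (nbs ! v))))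
         [0..<length nbs]"

definition store_of :: "nat list list \<Rightarrow> store" where
  "store_of as a i = (if a < length as \<and> i < length (as ! a) then as ! a ! i else 0)"

definition input_store ::
  "nat \<Rightarrow> nat \<Rightarrow> nat list list \<Rightarrow> nat list list \<Rightarrow> nat list list \<Rightarrow> store" where
  "input_store n t adj rot tab =
     store_of [[n, t], offsets adj, concat adj, offsets rot, concat rot, offsets tab, concat tab]"

definition holds_list :: "store \<Rightarrow> nat \<Rightarrow> nat list \<Rightarrow> bool" where
  "holds_list \<sigma> a xs \<longleftrightarrow> (\<forall>i<length xs. \<sigma> a i = xs ! i)"

text \<open>The output is expected in arrays 7 and 8, the first two that are not used by the input.\<close>

definition output_table :: "store \<Rightarrow> nat list list \<Rightarrow> bool" where
  "output_table \<sigma> tab \<longleftrightarrow> holds_list \<sigma> 7 (offsets tab) \<and> holds_list \<sigma> 8 (concat tab)"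

end

theory Submission
  imports Defs "HOL-Library.Sublist"
begin

text \<open>Write \<open>S\<close> for the separating links. For a link \<open>e = {u, v}\<close> in \<open>S\<close> without \<open>t\<close>, its near side
  consists of the nodes linked to \<open>t\<close> without passing through \<open>e\<close>, its far side of all others.
  Resilience on \<open>G - S\<close> forces the neighbours of \<open>u\<close> on the near side to be consecutive in the cyclic
  order at \<open>u\<close>: otherwise a packet could be caught on a cycle. Hence \<open>e\<close> has a natural place in this
  order, between the two sides, where it plays the role of a path from \<open>u\<close> to \<open>v\<close> through the far side.
  Only for packets that come from the far side does the place depend on the end of \<open>e\<close>: one end sends
  them to \<open>e\<close> before, the other after it has tried the near side. The ends are told apart by the
  direction in which some node of such a path prefers to start. The far sides are laminar, and adding
  the links in the order of increasing far sides preserves resilience. Links at \<open>t\<close> go to the front.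

  The far sides number at most \<open>n\<close>, and resilience of a pattern that follows cyclic orders bounds the
  number of links linearly: in \<open>G - S - t\<close>, no cycle has two nodes that prefer to start forwards and
  two that prefer to start backwards, and rotating a longest path at its first node then yields a
  node of small degree. So two graph searches for each separating link, and a linear-time
  computation of each list of the new pattern, take quadratic time altogether. To write a list in
  linear time, the separating links are sorted once by the sizes of their sides; then all
  insertions into the cyclic order happen directly after nodes known in advance.\<close>

section \<open>Positions in lists, the language in which forwarding lists are compared\<close>

section \<open>Ranks in lists\<close>

text \<open>Resilience speaks of packets that start at a node, but inserting \<open>{x, y}\<close>
  requires that a packet already under way, arriving at an end through this link, gets to
  \<open>t\<close>. Such an arrival can only be produced by starting a packet inside the far side,
  and a node on a far-side path turns towards one of the two ends, whichever its own list prefers.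
  So success of an arrival through the new link is known in advance at one end only. All packets
  leaving the far side are therefore funnelled into this one arrival: at the other end they cross
  the link, at this end they continue as if they had just crossed it. This is the origin of the
  asymmetry.

  The lists are fixed once for the complete graph, and a smaller graph is obtained by treating links
  as failed; the induction never modifies a list. Increasing far sides are the right order because
  every separating link already present at an end of the new link then has the other end of the new
  link on its near side.

  The table has degree times degree plus one entries for each node other than \<open>t\<close>, so
  even writing it in quadratic time depends on the linear bound for the links.\<close>

definition rank :: "'b list => 'b => nat" where
 "rank L a = length (takeWhile (%b. b ~= a) L)"

lemma rank_less: "a \<in> set L ==> rank L a < length L"
 by (induction L) (auto simp: rank_def)

lemma nth_rank: "a \<in> set L ==> L ! rank L a = a"
 by (induction L) (auto simp: rank_def)

lemma rank_nth: "distinct L ==> i < length L ==> rank L (L ! i) = i"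
 by (metis nth_eq_iff_index_eq nth_mem nth_rank rank_less)

lemma rank_inj: "a \<in> set L ==> b \<in> set L ==> rank L a = rank L b \<longleftrightarrow> a = b"
 by (metis nth_rank)

lemma rank_append:
 "rank (xs @ ys) a = (if a \<in> set xs then rank xs a else length xs + rank ys a)"
 by (induction xs) (auto simp: rank_def)

lemma rank_Cons: "rank (x # xs) a = (if x = a then 0 else Suc (rank xs a))"
 by (auto simp: rank_def)

lemma rank_sorted:
 fixes key :: "'b => nat"
 assumes "sorted_wrt (<) (map key L)" "a \<in> set L" "b \<in> set L"
 shows "rank L a < rank L b \<longleftrightarrow> key a < key b"
proof -
 have *: "key x < key y" if "rank L x < rank L y" "x \<in> set L" "y \<in> set L" for x y
  using sorted_wrt_nth_less[OF assms(1), of "rank L x" "rank L y"] that rank_less[of x L]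
   rank_less[of y L] by (simp add: nth_rank)
 show ?thesis
  using *[of a b] *[of b a] assms(2,3) rank_inj[of a L b] by (cases "rank L a" "rank L b" rule: linorder_cases) auto
qed

lemma rank_map_inj:
 "inj_on f (insert a (set L)) ==> rank (map f L) (f a) = rank L a"
proof (induction L)
 case (Cons x L)
 then have "f x = f a \<longleftrightarrow> x = a" by (auto simp: inj_on_def)
 moreover have "inj_on f (insert a (set L))" using Cons.prems by (auto simp: inj_on_def)
 ultimately show ?case using Cons.IH by (simp add: rank_Cons)
qed (simp add: rank_def)

text \<open>This turns forwarding into comparisons of positions: the out-port is the surviving link
  of smallest rank, so two lists agree on a decision as soon as the relevant rank comparisons
  agree.\<close>

lemma find_rank:
 "find P L = Some a \<longleftrightarrow> a \<in> set L & P a & (\<forall>b\<in>set L. P b --> rank L a <= rank L b)"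
 by (induction L) (auto simp: rank_Cons)

lemma find_Some_ex: "\<exists>a\<in>set L. P a ==> \<exists>a. find P L = Some a"
 by (induction L) auto




section \<open>Reachability\<close>

lemma linked_refl [simp]: "linked L x x"
 by (simp add: linked_def)

lemma linked_trans [trans]: "linked L x y ==> linked L y z ==> linked L x z"
 unfolding linked_def by (rule rtrancl_trans)

lemma linked_link: "{x, y} \<in> L ==> linked L x y"
 unfolding linked_def by auto

lemma linked_mono: "linked L x y ==> L \<subseteq> L' ==> linked L' x y"
 unfolding linked_def by (erule rtrancl_mono[THEN subsetD, rotated]) auto

lemma linked_sym: "linked L x y ==> linked L y x"
proof -
 have "sym {(x, y). {x, y} \<in> L}" by (auto simp: sym_def insert_commute)
 then show "linked L x y ==> linked L y x" unfolding linked_def by (metis sym_rtrancl symD)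
qed

lemma linked_induct [consumes 1, case_names base step]:
 assumes "linked L x y" "P x"
  and "!!a b. linked L x a ==> {a, b} \<in> L ==> P a ==> P b"
 shows "P y"
 using assms(1) unfolding linked_def
 by (induction rule: rtrancl_induct) (use assms(2,3) in "auto simp: linked_def")

lemma linked_converse_induct [consumes 1, case_names base step]:
 assumes "linked L x y" "P y"
  and "!!a b. {a, b} \<in> L ==> linked L b y ==> P b ==> P a"
 shows "P x"
 using assms(1) unfolding linked_def
 by (induction rule: converse_rtrancl_induct) (use assms(2,3) in "auto simp: linked_def")

lemma linked_subst:
 assumes "linked L x y" "!!a b. {a, b} \<in> L ==> linked L' a b"
 shows "linked L' x y"
 using assms(1) by (induction rule: linked_induct) (auto intro: linked_trans assms(2))

lemma linked_node: "linked L x y ==> x = y | (\<exists>l\<in>L. y \<in> l)"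
 by (induction rule: linked_induct) auto

lemma linked_stays:
 assumes "linked L x y" "x \<in> C" "!!l. l \<in> L ==> l Int C ~= {} ==> l \<subseteq> C"
 shows "y \<in> C & linked {l \<in> L. l \<subseteq> C} x y"
 using assms(1)
proof (induction rule: linked_induct)
 case (step a b)
 then have "{a, b} \<subseteq> C" using assms(3)[of "{a, b}"] by auto
 then show ?case using step by (auto intro: linked_trans linked_link)
qed (use assms(2) in auto)

text \<open>The step from \<open>a\<close> to \<open>b\<close> is the last one by which the walk
  leaves \<open>D\<close>; what follows it never meets \<open>D\<close> again.\<close>

lemma linked_exit:
 assumes "linked L x y" "x \<in> D" "y \<notin> D"
 shows "\<exists>a\<in>D. \<exists>b. b \<notin> D & {a, b} \<in> L & linked {l \<in> L. l Int D = {}} b y"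
proof -
 have "linked {l \<in> L. l Int D = {}} x y & x \<notin> D |
   (\<exists>a\<in>D. \<exists>b. b \<notin> D & {a, b} \<in> L & linked {l \<in> L. l Int D = {}} b y)"
  using assms(1)
 proof (induction rule: linked_converse_induct)
  case (step a b)
  then show ?case
   by (cases "a \<in> D") (auto intro!: linked_trans[OF linked_link[of a b]])
 qed (use assms(3) in simp)
 then show ?thesis using assms(2) by auto
qed

definition link_path :: "'a set set => 'a list => bool" where
 "link_path L q \<longleftrightarrow> q ~= [] & distinct q & (\<forall>i. Suc i < length q --> {q ! i, q ! Suc i} \<in> L)"

lemma link_pathD: "link_path L q ==> Suc i < length q ==> {q ! i, q ! Suc i} \<in> L"
 by (simp add: link_path_def)

lemma link_path_Cons:
 "link_path L q ==> {x, hd q} \<in> L ==> x \<notin> set q ==> link_path L (x # q)"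
 by (auto simp: link_path_def nth_Cons hd_conv_nth split: nat.split)

lemma link_path_drop: "link_path L q ==> k < length q ==> link_path L (drop k q)"
 by (auto simp: link_path_def)

lemma link_path_take: "link_path L q ==> 0 < k ==> link_path L (take k q)"
 by (auto simp: link_path_def)

lemma link_path_rev: "link_path L q ==> link_path L (rev q)"
proof -
 assume q: "link_path L q"
 show "link_path L (rev q)"
  unfolding link_path_def
 proof (intro conjI allI impI)
  fix i assume i: "Suc i < length (rev q)"
  then have "{q ! (length q - Suc (Suc i)), q ! Suc (length q - Suc (Suc i))} \<in> L"
   by (intro link_pathD[OF q]) simp
  then show "{rev q ! i, rev q ! Suc i} \<in> L"
   using i by (simp add: rev_nth Suc_diff_Suc insert_commute)
 qed (use q in "auto simp: link_path_def")
qed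

lemma link_path_mono: "link_path L q ==> L \<subseteq> L' ==> link_path L' q"
 by (auto simp: link_path_def)

lemma link_path_append:
 assumes "link_path L p" "link_path L q" "{last p, hd q} \<in> L" "set p Int set q = {}"
 shows "link_path L (p @ q)"
 unfolding link_path_def
proof (intro conjI allI impI)
 fix i assume i: "Suc i < length (p @ q)"
 consider "Suc i < length p" | "Suc i = length p" | "Suc i > length p" by linarith
 then show "{(p @ q) ! i, (p @ q) ! Suc i} \<in> L"
 proof cases
  case 2
  then have "p ! i = last p" by (metis assms(1) diff_Suc_1 last_conv_nth link_path_def)
  moreover have "q ! 0 = hd q" using assms(2) by (simp add: hd_conv_nth link_path_def)
  ultimately show ?thesis using 2 assms(3) by (simp add: nth_append)
 next
  case 3
  then show ?thesis using i link_pathD[OF assms(2), of "i - length p"]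
   by (simp add: nth_append Suc_diff_le)
 qed (use link_pathD[OF assms(1), of i] in "simp add: nth_append")
qed (use assms in "auto simp: link_path_def")

lemma linked_link_path:
 assumes "linked L x y"
 shows "\<exists>q. link_path L q & hd q = x & last q = y"
 using assms
proof (induction rule: linked_converse_induct)
 case base
 have "link_path L [y]" by (simp add: link_path_def)
 then show ?case by (intro exI[of _ "[y]"]) auto
next
 case (step a b)
 then obtain q where q: "link_path L q" "hd q = b" "last q = y" by auto
 show ?case
 proof (cases "a \<in> set q")
  case True
  then have "rank q a < length q" "q ! rank q a = a" by (simp_all add: rank_less nth_rank)
  then show ?thesis
   using q by (intro exI[of _ "drop (rank q a) q"]) (auto simp: link_path_drop hd_drop_conv_nth)
 next
  case False
  then have "link_path L (a # q)" using q step.hyps by (intro link_path_Cons) auto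
  moreover have "q ~= []" using q(1) by (simp add: link_path_def)
  ultimately show ?thesis using q by (intro exI[of _ "a # q"]) auto
 qed
qed

lemma link_path_linked_nth:
 assumes "link_path L q" "i <= j" "j < length q"
 shows "linked {l \<in> L. l \<subseteq> set q} (q ! i) (q ! j)"
 using assms(2,3)
proof (induction j rule: dec_induct)
 case (step j)
 then have "linked {l \<in> L. l \<subseteq> set q} (q ! j) (q ! Suc j)"
  using link_pathD[OF assms(1), of j] by (intro linked_link) auto
 then show ?case using step by (auto intro: linked_trans)
qed simp

lemma link_path_nodes:
 assumes "link_path L q" "x \<in> set q" "x ~= hd q"
 shows "\<exists>l\<in>L. x \<in> l"
proof -
 from assms(2) obtain i where i: "i < length q" "q ! i = x" by (auto simp: in_set_conv_nth)
 with assms have "i ~= 0" by (metis hd_conv_nth link_path_def)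
 then show ?thesis using link_pathD[OF assms(1), of "i - 1"] i by auto
qed

section \<open>Separating links\<close>

abbreviation avoid :: "'a set set => 'a set => 'a set set" where
 "avoid L X \<equiv> {l \<in> L. l Int X = {}}"

lemma connected_withoutD:
 "connected_without V K X ==> a \<in> V ==> b \<in> V ==> a \<notin> X ==> b \<notin> X ==> linked (avoid K X) a b"
 by (simp add: connected_without_def graph_connected_def)

text \<open>As \<open>y\<close> is no cut node, some walk from \<open>w\<close> to \<open>x\<close>
  avoids \<open>y\<close>, and up to its first visit of \<open>x\<close> it cannot leave
  \<open>C\<close>.\<close>

lemma linked_to_attachment:
 assumes "connected_without V K {y}" "w \<in> C" "w \<in> V" "x \<in> V" "x ~= y" "y \<notin> C"
  and "!!l. l \<in> K ==> l Int C ~= {} ==> l \<subseteq> insert x (insert y C)"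
 shows "linked {l \<in> K. l \<subseteq> insert x C} w x"
proof -
 define L where "L = {l \<in> K. l \<subseteq> insert x C}"
 have "z \<in> C & linked L w z | linked L w x" if "linked (avoid K {y}) w z" for z
  using that
 proof (induction rule: linked_induct)
  case (step a b)
  show ?case
  proof (cases "linked L w x")
   case False
   then have a: "a \<in> C" "linked L w a" using step by auto
   moreover have ab: "{a, b} \<subseteq> insert x C" using assms(7)[of "{a, b}"] step(2) a by auto
   ultimately have "linked L w b"
    using step(2) by (auto simp: L_def intro: linked_trans linked_link)
   then show ?thesis using False ab by auto
  qed auto
 qed (use assms in auto)
 moreover have "linked (avoid K {y}) w x"
  using assms by (intro connected_withoutD[OF assms(1)]) auto
 ultimately have "linked L w x" by blast
 then show ?thesis by (simp add: L_def)
qed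

locale rooted_graph =
 fixes V :: "'a set" and E :: "'a set set" and t :: 'a
 assumes simple: "simple_graph V E" and t_in: "t \<in> V" and biconn: "biconnected V E"
begin

abbreviation "S \<equiv> separating_links V E"
abbreviation "H \<equiv> E - S"

lemma finite_V: "finite V" using simple by (simp add: simple_graph_def)

lemma linkE:
 assumes "l \<in> E" obtains u v where "u \<in> V" "v \<in> V" "u ~= v" "l = {u, v}"
 using assms simple by (auto simp: simple_graph_def)

lemma link_ends: "{u, v} \<in> E ==> u ~= v & u \<in> V & v \<in> V"
 by (auto elim!: linkE simp: doubleton_eq_iff)

lemma link_diff: "e \<in> E ==> f \<in> E ==> e ~= f ==> \<exists>z. z \<in> e - f"
 by (elim linkE) blast

lemma finite_E: "finite E"
proof -
 have "E \<subseteq> Pow V" by (auto elim: linkE)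
 then show ?thesis using finite_V by (auto intro: finite_subset)
qed

lemma S_E: "S \<subseteq> E" by (auto simp: separating_links_def)

definition comp :: "'a set => 'a => 'a set" where
 "comp e a = {w. linked (avoid E e) a w}"

lemma comp_closed:
 assumes "a \<notin> e" "l \<in> E" "l Int comp e a ~= {}"
 shows "l \<subseteq> comp e a Un e"
proof -
 obtain p q where pq: "l = {p, q}" "p \<in> comp e a"
  using assms(2,3) by (auto elim!: linkE)
 then have "p \<notin> e" using linked_node[of "avoid E e" a p] assms(1) by (auto simp: comp_def)
 moreover have "p \<in> comp e a" by fact
 ultimately show ?thesis using pq assms(2)
  by (auto simp: comp_def intro: linked_trans linked_link)
qed

lemma comp_disj:
 assumes "a \<notin> e" shows "comp e a Int e = {}"
 using linked_node[of "avoid E e" a] assms by (auto simp: comp_def)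

lemma comp_V: "a \<in> V ==> comp e a \<subseteq> V"
proof
 fix w assume "a \<in> V" "w \<in> comp e a"
 then show "w \<in> V" using linked_node[of "avoid E e" a w] by (auto simp: comp_def elim!: linkE)
qed

lemma comp_self [simp]: "a \<in> comp e a" by (simp add: comp_def)

lemma comp_disjoint: "b \<notin> comp e a ==> comp e a Int comp e b = {}"
 by (auto simp: comp_def dest: linked_sym intro: linked_trans)

lemma separating_split:
 assumes "e \<in> S"
 obtains a b where "a \<in> V - e" "b \<in> V - e" "b \<notin> comp e a"
 using assms by (auto simp: separating_links_def connected_without_def graph_connected_def comp_def)

text \<open>Every component left after removing both ends of \<open>e\<close> is attached to both
  ends, since otherwise one end would be a cut node. So each component offers a detour for
  \<open>e\<close>.\<close>

lemma bridge_component: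
 assumes "K \<subseteq> E" "biconnected V K" "e = {x, y}" "x \<in> V" "y \<in> V" "x ~= y" "a \<in> V - e"
 shows "linked {l \<in> K - {e}. l \<subseteq> comp e a Un e} x y"
proof -
 have c: "comp e a Int e = {}" using comp_disj[of a e] assms by auto
 have 1: "linked {l \<in> K. l \<subseteq> insert x (comp e a)} a x"
  by (rule linked_to_attachment[where V = V and y = y])
   (use assms c comp_closed[of a e] in "auto simp: biconnected_def")
 have 2: "linked {l \<in> K. l \<subseteq> insert y (comp e a)} a y"
  by (rule linked_to_attachment[where V = V and y = x])
   (use assms c comp_closed[of a e] in "auto simp: biconnected_def")
 have "linked {l \<in> K - {e}. l \<subseteq> comp e a Un e} a x"
  by (rule linked_mono[OF 1]) (use assms c in auto)
 moreover have "linked {l \<in> K - {e}. l \<subseteq> comp e a Un e} a y"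
  by (rule linked_mono[OF 2]) (use assms c in auto)
 ultimately show ?thesis by (meson linked_sym linked_trans)
qed

text \<open>A separating link leaves at least two components. A set \<open>D\<close> that is
  connected without the ends of \<open>e\<close> meets at most one of them, so another one provides
  a detour disjoint from \<open>D\<close>.\<close>

lemma bridge:
 assumes "K \<subseteq> E" "biconnected V K" "e \<in> S" "e = {x, y}" "D Int e = {}"
  and "!!p q. p \<in> D ==> q \<in> D ==> linked (avoid E e) p q"
 shows "linked (avoid (K - {e}) D) x y"
proof -
 obtain a b where ab: "a \<in> V - e" "b \<in> V - e" "b \<notin> comp e a"
  using separating_split[OF assms(3)] .
 have "\<exists>c\<in>V - e. comp e c Int D = {}"
 proof (cases "comp e a Int D = {}")
  case False
  then have "D \<subseteq> comp e a" using assms(6) by (auto simp: comp_def intro: linked_trans)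
  then show ?thesis using comp_disjoint[OF ab(3)] ab(2) by auto
 qed (use ab in auto)
 then obtain c where c: "c \<in> V - e" "comp e c Int D = {}" by auto
 have xy: "x \<in> V" "y \<in> V" "x ~= y" using assms(3,4) S_E link_ends by auto
 show ?thesis
  by (rule linked_mono[OF bridge_component[OF assms(1,2,4) xy c(1)]]) (use c(2) assms(5) in auto)
qed

text \<open>Separating links can be deleted one at a time, each being replaced by a detour. The
  second conjunct says that deletion never splits a component belonging to another link, so sides
  defined in \<open>E\<close> remain connected in \<open>H\<close>.\<close>

lemma biconnected_Diff:
 assumes "finite X" "X \<subseteq> S"
 shows "biconnected V (E - X) &
  (\<forall>e\<in>E. \<forall>a b. linked (avoid E e) a b --> linked (avoid (E - X) e) a b)"
 using assms
proof (induction X rule: finite_induct)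
 case empty
 with biconn show ?case by simp
next
 case (insert e X)
 then obtain x y where e: "e = {x, y}" "e \<in> E" "x ~= y" "e \<in> S" using S_E by (metis insert_subset linkE subsetD)
 let ?K = "E - X"
 have K: "?K \<subseteq> E" "biconnected V ?K" using insert by auto
 have eq: "E - insert e X = ?K - {e}" by auto
 \<comment> \<open>A single claim with three uses: \<open>D\<close> empty gives connectedness, a
   singleton gives the absence of cut nodes, and \<open>D\<close> equal to a link \<open>f\<close>
   preserves the components that \<open>f\<close> leaves.\<close>
 have *: "linked (avoid (?K - {e}) D) a b"
  if "linked (avoid ?K D) a b" "!!p q. p \<in> D ==> q \<in> D ==> D Int e = {} ==> linked (avoid E e) p q" for D a b
  using that(1)
 proof (rule linked_subst)
  fix p q assume pq: "{p, q} \<in> avoid ?K D"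
  show "linked (avoid (?K - {e}) D) p q"
  proof (cases "{p, q} = e")
   case True
   then have "linked (avoid (?K - {e}) D) x y"
    using pq that(2) by (intro bridge[OF K e(4) e(1)]) auto
   then show ?thesis using True e(1) by (auto simp: doubleton_eq_iff dest: linked_sym)
  qed (use pq in "auto intro: linked_link")
 qed
 have "graph_connected V (?K - {e})"
  using K(2) *[of "{}"] by (auto simp: biconnected_def graph_connected_def set_diff_eq)
 moreover have "connected_without V (?K - {e}) {v}" if "v \<in> V" for v
  using K(2) *[of "{v}"] that by (auto simp: biconnected_def graph_connected_def connected_without_def)
 moreover have "linked (avoid (?K - {e}) f) a b" if "f \<in> E" "linked (avoid E f) a b" for f a b
 proof (rule *)
  show "linked (avoid ?K f) a b" using insert that by auto
  fix p q assume "p \<in> f" "q \<in> f" "f Int e = {}"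
  moreover then have "p = q | f = {p, q}" using \<open>f \<in> E\<close> by (auto elim!: linkE)
  ultimately show "linked (avoid E e) p q" using \<open>f \<in> E\<close>
   by (cases "p = q") (simp, intro linked_link, blast)
 qed
 ultimately show ?case unfolding eq biconnected_def by blast
qed

lemma biconnected_between: "H \<subseteq> K ==> K \<subseteq> E ==> biconnected V K"
proof -
 assume "H \<subseteq> K" "K \<subseteq> E"
 then have "E - K \<subseteq> S" "E - (E - K) = K" by auto
 then show "biconnected V K" using biconnected_Diff[of "E - K"] finite_E by simp
qed

lemma linked_H: "e \<in> E ==> linked (avoid E e) a b ==> linked (avoid H e) a b"
 using biconnected_Diff[of S] finite_E S_E finite_subset by blast

section \<open>Near and far sides of the separating links without \<open>t\<close>, and their
  laminarity\<close>

definition S0 :: "'a set set" where "S0 = {e \<in> S. t \<notin> e}"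

definition sideA :: "'a set => 'a set" where "sideA e = comp e t"
text \<open>The far side may consist of several components; only the near side is connected by
  itself.\<close>

definition sideB :: "'a set => 'a set" where "sideB e = V - e - sideA e"

lemma S0_E: "e \<in> S0 ==> e \<in> E" using S_E by (auto simp: S0_def)

lemma S0_D: "{u, v} \<in> S0 ==> u ~= v & u \<in> V & v \<in> V & u ~= t & v ~= t & {u, v} \<in> E & {u, v} \<notin> H"
 using S0_E[of "{u, v}"] link_ends by (auto simp: S0_def)

lemma sides:
 assumes "e \<in> S0"
 shows "t \<in> sideA e" "sideA e Int sideB e = {}" "sideA e Int e = {}" "sideB e Int e = {}"
  "sideA e Un sideB e Un e = V" "t \<notin> sideB e"
proof -
 have t: "t \<notin> e" using assms by (simp add: S0_def)
 show 1: "t \<in> sideA e" by (simp add: sideA_def)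
 show "sideA e Int e = {}" using comp_disj[OF t] by (simp add: sideA_def)
 show "sideA e Un sideB e Un e = V" using comp_V[OF t_in, of e] S0_E[OF assms]
  by (auto simp: sideB_def sideA_def elim!: linkE)
 show "t \<notin> sideB e" using 1 by (auto simp: sideB_def)
qed (auto simp: sideB_def)

lemma side_links:
 assumes "e \<in> S0" "l \<in> E"
 shows "l Int sideA e ~= {} ==> l \<subseteq> sideA e Un e" "l Int sideB e ~= {} ==> l \<subseteq> sideB e Un e"
proof -
 have t: "t \<notin> e" using assms by (simp add: S0_def)
 show 1: "l Int sideA e ~= {} ==> l \<subseteq> sideA e Un e"
  using comp_closed[OF t assms(2)] by (simp add: sideA_def)
 assume b: "l Int sideB e ~= {}"
 then have "l Int sideA e = {}" using 1 sides[OF assms(1)] by blast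
 moreover have "l \<subseteq> V" using assms(2) by (auto elim!: linkE)
 ultimately show "l \<subseteq> sideB e Un e" by (auto simp: sideB_def)
qed

lemma sideA_linked:
 assumes "e \<in> S0" "w \<in> sideA e"
 shows "linked {l \<in> H. l \<subseteq> sideA e} t w"
proof -
 have l: "linked (avoid H e) t w" using linked_H[OF S0_E[OF assms(1)]] assms(2) by (auto simp: sideA_def comp_def)
 have "linked {l \<in> avoid H e. l \<subseteq> sideA e} t w"
  using linked_stays[OF l, of "sideA e"] side_links[OF assms(1)] sides[OF assms(1)] by blast
 then show ?thesis by (rule linked_mono) auto
qed

lemma H_biconnected: "biconnected V H"
 by (rule biconnected_between) auto

text \<open>Used to route through one side alone: any two nodes of a side are joined by a walk whose
  only further node is one chosen end of \<open>e\<close>. On the far side this yields the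
  replacement paths and cycles of the later arguments.\<close>

lemma side_attach:
 assumes "e \<in> S0" "z \<in> e" "C = sideA e | C = sideB e" "w \<in> C"
 shows "linked {l \<in> H. l \<subseteq> insert z C} w z"
proof -
 obtain z' where z': "e = {z, z'}" "z ~= z'" "z \<in> V" "z' \<in> V"
  using S0_E[OF assms(1)] assms(2) by (auto elim!: linkE)
 have "l \<subseteq> insert z (insert z' C)" if "l \<in> H" "l Int C ~= {}" for l
  using side_links[OF assms(1), of l] that assms(3) z'(1) by blast
 moreover have "z' \<notin> C" "w \<in> V" using z' assms sides[OF assms(1)] by auto
 ultimately show ?thesis using H_biconnected z' assms(4)
  by (intro linked_to_attachment[where V = V and y = z']) (auto simp: biconnected_def)
qed

lemma sideB_nonempty: "e \<in> S0 ==> sideB e ~= {}"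
proof
 assume e: "e \<in> S0" "sideB e = {}"
 obtain a b where "a \<in> V - e" "b \<in> V - e" "b \<notin> comp e a"
  using separating_split[of e] e(1) by (auto simp: S0_def)
 moreover then have "a \<in> comp e t" "b \<in> comp e t" using e(2) by (auto simp: sideB_def sideA_def)
 ultimately show False by (auto simp: comp_def intro: linked_trans linked_sym)
qed

lemma side_neighbour:
 assumes "{u, v} \<in> S0" "C = sideA {u, v} | C = sideB {u, v}"
 shows "\<exists>w\<in>C. {u, w} \<in> H"
proof -
 obtain c where c: "c \<in> C" using assms sideB_nonempty[OF assms(1)] sides[OF assms(1)] by auto
 have "linked {l \<in> H. l \<subseteq> insert u C} c u" using side_attach[OF assms(1) _ assms(2) c] by simp
 then have "linked {l \<in> H. l \<subseteq> insert u C} u c" by (rule linked_sym)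
 moreover have "u \<notin> C" using assms sides[OF assms(1)] by auto
 ultimately show ?thesis using linked_exit[of _ u c "{u}"] c by auto
qed

text \<open>If \<open>f\<close> lies on the far side of \<open>e\<close>, apart from common ends,
  then the near side of \<open>e\<close> together with an end of \<open>e\<close> not on
  \<open>f\<close> stays connected to \<open>t\<close> without \<open>f\<close>. So these nodes are
  near for \<open>f\<close> as well; the inclusion is strict because \<open>f\<close> has an end
  inside the far side of \<open>e\<close>.\<close>

lemma far_side_nested:
 assumes "e \<in> S0" "f \<in> S0" "f - e \<subseteq> sideB e" "f ~= e"
 shows "sideB f \<subset> sideB e"
proof -
 have A: "sideA e \<subseteq> sideA f"
 proof
  fix w assume "w \<in> sideA e"
  then have "linked {l \<in> H. l \<subseteq> sideA e} t w" by (rule sideA_linked[OF assms(1)])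
  then have "linked (avoid E f) t w"
   by (rule linked_mono) (use assms(3) sides[OF assms(1)] in blast)
  then show "w \<in> sideA f" by (simp add: sideA_def comp_def)
 qed
 have B: "z \<in> sideA f" if "z \<in> e - f" for z
 proof -
  have "linked {l \<in> H. l \<subseteq> insert z (sideA e)} t z"
   using side_attach[OF assms(1), of z "sideA e" t] that sides[OF assms(1)] by auto
  then have "linked (avoid E f) t z"
   by (rule linked_mono) (use assms(3) sides[OF assms(1)] that in blast)
  then show ?thesis by (simp add: sideA_def comp_def)
 qed
 have "sideB f \<subseteq> sideB e" using A B sides[OF assms(2)] sides[OF assms(1)] by (auto simp: sideB_def)
 moreover have "f - e ~= {}" using assms S0_E link_diff by blast
 then have "sideB f ~= sideB e" using assms(3) sides[OF assms(2)] by auto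
 ultimately show ?thesis by auto
qed

lemma outside_one_side:
 assumes "e \<in> S0" "f \<in> E"
 shows "f - e \<subseteq> sideA e | f - e \<subseteq> sideB e"
proof -
 have "f \<subseteq> V" using assms(2) by (auto elim!: linkE)
 then have "f - e \<subseteq> sideA e Un sideB e" using sides[OF assms(1)] by auto
 then show ?thesis using side_links[OF assms] sides[OF assms(1)] by blast
qed

text \<open>Each link lies on one side of the other. If one of them lies on a far side, the far
  sides are nested; otherwise both lie on near sides, and then the far sides are disjoint.\<close>

lemma laminar:
 assumes "e \<in> S0" "f \<in> S0" "f ~= e"
 shows "(f - e \<subseteq> sideB e & sideB f \<subset> sideB e) | (e - f \<subseteq> sideB f & sideB e \<subset> sideB f) |
  (f - e \<subseteq> sideA e & e - f \<subseteq> sideA f & sideB e \<subseteq> sideA f & sideB f \<subseteq> sideA e)"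
proof -
 \<comment> \<open>A far node \<open>w\<close> of \<open>e\<close> is joined through the far side of
   \<open>e\<close> to an end \<open>z\<close> of \<open>e\<close> not on \<open>f\<close>; this
   walk avoids \<open>f\<close>, and \<open>z\<close> is near for \<open>f\<close>.\<close>
 have dis: "sideB e \<subseteq> sideA f" if ef: "e \<in> S0" "f \<in> S0" "f ~= e" "f - e \<subseteq> sideA e" "e - f \<subseteq> sideA f" for e f
 proof
  fix w assume w: "w \<in> sideB e"
  obtain z where z: "z \<in> e - f" using ef S0_E link_diff by metis
  have "linked {l \<in> H. l \<subseteq> insert z (sideB e)} w z"
   using side_attach[OF ef(1), of z "sideB e" w] z w by auto
  then have "linked (avoid E f) w z"
   by (rule linked_mono) (use ef(4) sides[OF ef(1)] z in blast)
  moreover have "linked (avoid E f) t z" using ef(5) z by (auto simp: sideA_def comp_def)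
  ultimately show "w \<in> sideA f" by (auto simp: sideA_def comp_def intro: linked_trans linked_sym)
 qed
 consider "f - e \<subseteq> sideB e" | "e - f \<subseteq> sideB f" | "f - e \<subseteq> sideA e" "e - f \<subseteq> sideA f"
  using outside_one_side[OF assms(1) S0_E[OF assms(2)]] outside_one_side[OF assms(2) S0_E[OF assms(1)]]
  by metis
 then show ?thesis
 proof cases
  case 1
  with far_side_nested[OF assms(1,2)] assms(3) show ?thesis by simp
 next
  case 2
  with far_side_nested[OF assms(2,1)] assms(3) show ?thesis by simp
 next
  case 3
  with dis[OF assms 3] dis[OF assms(2,1) _ 3(2,1)] assms(3) show ?thesis by simp
 qed
qed

text \<open>The form of laminarity needed at a common node \<open>u\<close>. In both cases
  \<open>v\<close> is near for the link with the smaller far side; this is what makes insertion by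
  increasing far sides work.\<close>

lemma laminar_neighbour:
 assumes "{u, v} \<in> S0" "{u, w} \<in> S0" "w ~= v" "card (sideB {u, w}) <= card (sideB {u, v})"
 shows "(w \<in> sideB {u, v} & v \<in> sideA {u, w} & sideB {u, w} \<subset> sideB {u, v} & sideA {u, v} \<subseteq> sideA {u, w}) |
  (w \<in> sideA {u, v} & v \<in> sideA {u, w} & sideB {u, v} \<subseteq> sideA {u, w} & sideB {u, w} \<subseteq> sideA {u, v})"
proof -
 have fin: "finite (sideB e)" for e using finite_V by (auto simp: sideB_def)
 have ne: "u ~= v" "u ~= w" "{u, w} ~= {u, v}" "{u, w} - {u, v} = {w}" "{u, v} - {u, w} = {v}"
  using S0_D[OF assms(1)] S0_D[OF assms(2)] assms(3) by (auto simp: doubleton_eq_iff)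
 have n: "~  sideB {u, v} \<subset> sideB {u, w}"
 proof
  assume "sideB {u, v} \<subset> sideB {u, w}"
  then have "card (sideB {u, v}) < card (sideB {u, w})" by (rule psubset_card_mono[OF fin])
  then show False using assms(4) by simp
 qed
 show ?thesis
 proof (cases "w \<in> sideB {u, v}")
  case True
  then have sub: "sideB {u, w} \<subset> sideB {u, v}"
   using far_side_nested[OF assms(1,2)] ne by auto
  have nb: "x \<notin> sideB {u, w}" if "x \<notin> sideB {u, v}" for x using sub that by auto
  have "sideA {u, v} \<subseteq> sideA {u, w}"
  proof
   fix x assume x: "x \<in> sideA {u, v}"
   then have "x \<notin> sideB {u, v}" "x \<in> V" "x ~= u" using sides[OF assms(1)] by auto
   moreover have "x ~= w" using x True sides(2)[OF assms(1)] by auto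
   ultimately show "x \<in> sideA {u, w}" using nb[of x] by (auto simp: sideB_def)
  qed
  moreover have "v \<in> sideA {u, w}"
   using nb[of v] sides(4)[OF assms(1)] S0_D[OF assms(1)] assms(3) by (auto simp: sideB_def)
  ultimately show ?thesis using True sub by simp
 next
  case False
  with laminar[OF assms(1,2) ne(3)] n ne(4,5) show ?thesis by simp
 qed
qed

text \<open>Every link gets a private node: one of its far side that lies in no strictly smaller far
  side. If there are smaller far sides, an end of a link whose far side is a largest one among them
  serves. By laminarity two links cannot share such a node.\<close>

lemma card_S0: "card S0 <= card V"
proof -
 have fin: "finite (sideB e)" for e using finite_V by (auto simp: sideB_def)
 have finS: "finite S0" using finite_E S0_E by (meson finite_subset subsetI)
 have "\<exists>q\<in>sideB e. \<forall>f\<in>S0. sideB f \<subset> sideB e --> q \<notin> sideB f" if e: "e \<in> S0" for e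
 proof (cases "\<exists>f\<in>S0. sideB f \<subset> sideB e")
  case False
  then show ?thesis using sideB_nonempty[OF e] by auto
 next
  case True
  let ?F = "{f \<in> S0. sideB f \<subset> sideB e}"
  have "Max ((%f. card (sideB f)) ` ?F) \<in> (%f. card (sideB f)) ` ?F"
   using True finS by (intro Max_in) auto
  then obtain f where "f \<in> ?F"
   and fm: "card (sideB f) = Max ((%f. card (sideB f)) ` ?F)" by (metis (no_types, lifting) imageE)
  then have f: "f \<in> S0" "sideB f \<subset> sideB e" by simp_all
  have fmax: "~  card (sideB g) > card (sideB f)" if "g \<in> S0" "sideB g \<subset> sideB e" for g
  proof -
   have "card (sideB g) <= Max ((%f. card (sideB f)) ` ?F)"
    using that finS by (intro Max_ge) (simp_all add: image_iff, blast)
   then show ?thesis by (simp only: fm not_less)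
  qed
  have fe: "f ~= e" using f by auto
  have sub: "f - e \<subseteq> sideB e"
   using laminar[OF e f(1) fe] f(2) sideB_nonempty[OF f(1)] sides[OF e] by blast
  obtain z where z: "z \<in> f - e" using e f(1) fe S0_E link_diff by metis
  have "z \<notin> sideB g" if g: "g \<in> S0" "sideB g \<subset> sideB e" for g
  proof
   assume zg: "z \<in> sideB g"
   then have "g ~= f" using z sides[OF f(1)] by auto
   have "f - g \<subseteq> sideB g"
    using outside_one_side[OF g(1) S0_E[OF f(1)]] zg z sides[OF g(1)] by blast
   then have "sideB f \<subset> sideB g" using far_side_nested[OF g(1) f(1)] \<open>g ~= f\<close> by auto
   then show False using fmax[OF g] psubset_card_mono[OF fin] by blast
  qed
  then show ?thesis using z sub by auto
 qed
 then obtain q where q: "!!e. e \<in> S0 ==> q e \<in> sideB e"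
  "!!e f. e \<in> S0 ==> f \<in> S0 ==> sideB f \<subset> sideB e ==> q e \<notin> sideB f" by metis
 have "inj_on q S0"
 proof (rule inj_onI, rule ccontr)
  fix e f assume ef: "e \<in> S0" "f \<in> S0" "q e = q f" "e ~= f"
  then show False using laminar[OF ef(1,2)] q sides[OF ef(1)] sides[OF ef(2)] by (metis disjoint_iff subset_iff)
 qed
 moreover have "q ` S0 \<subseteq> V" using q(1) by (auto simp: sideB_def)
 ultimately show ?thesis using card_inj_on_le finite_V by blast
qed

end

section \<open>Adding links to a resilient pattern\<close>

lemma other_end_eq [simp]: "v ~= w ==> other_end v {v, w} = w"
 unfolding other_end_def by (rule the_equality) (auto simp: doubleton_eq_iff)

lemma other_end_eq' [simp]: "v ~= w ==> other_end v {w, v} = w"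
 by (simp add: insert_commute)

text \<open>Here \<open>lt w a b\<close> says that the list for the in-port \<open>w\<close> has \<open>a\<close> before \<open>b\<close>, the links at the node
 other than the new link \<open>v\<close> lead to the near side (\<open>A\<close>) or to the far side (\<open>B\<close>), and \<open>y\<close> selects
 the end that tries \<open>v\<close> before the near side.\<close>

definition placed :: "('b => 'b => 'b => bool) => 'b set => 'b set => 'b => bool => 'b set => bool" where
 "placed lt A B v y Q \<longleftrightarrow>
  (\<forall>w\<in>A. \<forall>b\<in>B. lt w v b & (\<forall>a\<in>A. lt w a v \<longleftrightarrow> lt w a b)) & (\<forall>a\<in>A. lt v a v) &
  (\<forall>b\<in>B. lt v v b & (\<forall>a\<in>A. \<forall>a'\<in>A. lt v a a' \<longleftrightarrow> lt b a a')) &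
  (\<forall>w\<in>B. (\<forall>b\<in>B. A ~= {} & lt w b v & (\<forall>a\<in>A. lt w b a) | lt w v b & (\<forall>a\<in>A. lt w a b)) &
   (\<forall>a\<in>A. (if y then lt w v a else lt w a v) & (w \<in> Q --> lt w a w)))"

lemma placedD:
 assumes "placed lt A B v y Q"
 shows "a \<in> A ==> b \<in> B ==> lt a v b" "a \<in> A ==> b \<in> B ==> a' \<in> A ==> lt a a' v \<longleftrightarrow> lt a a' b"
  "a \<in> A ==> lt v a v" "b \<in> B ==> lt v v b" "a \<in> A ==> a' \<in> A ==> b \<in> B ==> lt v a a' \<longleftrightarrow> lt b a a'"
  "b \<in> B ==> b' \<in> B ==> A ~= {} & lt b b' v & (\<forall>a\<in>A. lt b b' a) | lt b v b' & (\<forall>a\<in>A. lt b a b')"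
  "a \<in> A ==> b \<in> B ==> if y then lt b v a else lt b a v" "a \<in> A ==> b \<in> B ==> b \<in> Q ==> lt b a b"
 using assms unfolding placed_def by blast+

lemma placed_image:
 assumes P: "placed lt A B v y Q" and f: "!!p a b. p \<in> insert v (A Un B) ==> a \<in> insert v (A Un B) ==>
   b \<in> insert v (A Un B) ==> lt' (f p) (f a) (f b) \<longleftrightarrow> lt p a b"
  and Q: "!!b. b \<in> B ==> f b \<in> Q' ==> b \<in> Q"
 shows "placed lt' (f ` A) (f ` B) (f v) y Q'"
 unfolding placed_def
proof (simp only: ball_simps image_is_empty, intro conjI ballI impI, goal_cases)
 case (6 w b)
 have "(\<forall>a\<in>A. lt' (f w) (f b) (f a)) \<longleftrightarrow> (\<forall>a\<in>A. lt w b a)" "(\<forall>a\<in>A. lt' (f w) (f a) (f b)) \<longleftrightarrow> (\<forall>a\<in>A. lt w a b)"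
  using 6 f by (auto intro!: ball_cong)
 with placedD(6)[OF P 6] f 6 show ?case by simp
next
 case (7 w a)
 with placedD(7)[OF P 7(2,1)] f show ?case by simp
qed (use placedD[OF P] f Q in simp_all)

section \<open>Packet runs in terms of surviving links, and the insertion of one link\<close>

locale routed_graph = rooted_graph V E t for V :: "'a set" and E t +
 fixes \<pi> :: "'a pattern"
 assumes skipping: "skipping_pattern V E t \<pi>"
begin

text \<open>Runs are indexed by the surviving links, so that the same lists can be run on several
  subgraphs and the runs compared.\<close>

definition rch :: "'a set set => 'a => 'a set option => bool" where
 "rch L v p \<longleftrightarrow> reaches \<pi> t (- L) v p"

abbreviation "nxt L v p \<equiv> find (%e. e \<in> L) (\<pi> v p)"
abbreviation "rk v p l \<equiv> rank (\<pi> v p) l"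

lemma rch_arrived [simp]: "rch L t p"
 by (simp add: rch_def reaches.arrived)

lemma rch_hop:
 assumes "nxt L v p = Some {v, w}" "v ~= w" "rch L w (Some {v, w})"
 shows "rch L v p"
proof (cases "v = t")
 case False
 then show ?thesis using assms by (auto simp: rch_def intro!: reaches.hop[of v t "- L"])
qed simp

lemma rch_next:
 assumes "rch L v p" "v ~= t" "nxt L v p = Some {v, w}" "v ~= w"
 shows "rch L w (Some {v, w})"
 using assms(1) unfolding rch_def
 by cases (use assms(2-) in auto)

lemma rch_induct [consumes 1, case_names arrived hop]:
 assumes "rch L v p" "!!p. P t p"
  and "!!v p e. v ~= t ==> nxt L v p = Some e ==> rch L (other_end v e) (Some e) ==>
   P (other_end v e) (Some e) ==> P v p"
 shows "P v p"
 using assms(1) unfolding rch_def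
 by (induction rule: reaches.induct) (use assms(2,3) in "auto simp: rch_def")

lemma ports [simp]:
 "v \<in> V ==> v ~= t ==> p \<in> in_ports E v ==> set (\<pi> v p) = links_at E v"
 using skipping by (auto simp: skipping_pattern_def)

lemma None_port [simp]: "None \<in> in_ports E v" and
 Some_port [simp]: "Some f \<in> in_ports E v \<longleftrightarrow> f \<in> E & v \<in> f"
 by (auto simp: in_ports_def links_at_def)

lemma nxt_eq:
 assumes "v \<in> V" "v ~= t" "p \<in> in_ports E v" "L \<subseteq> E"
 shows "nxt L v p = Some a \<longleftrightarrow> a \<in> L & v \<in> a & (\<forall>b\<in>L. v \<in> b --> rk v p a <= rk v p b)"
 using assms by (auto simp: find_rank links_at_def)

lemma nxt_cong:
 assumes "v \<in> V" "v ~= t" "p \<in> in_ports E v" "!!l. v \<in> l ==> l \<in> E ==> l \<in> L \<longleftrightarrow> l \<in> L'"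
 shows "nxt L v p = nxt L' v p"
 by (rule find_cong) (use assms in "auto simp: links_at_def")

lemma rk_inj:
 assumes "v \<in> V" "v ~= t" "p \<in> in_ports E v" "a \<in> E" "v \<in> a" "b \<in> E" "v \<in> b"
 shows "rk v p a = rk v p b \<longleftrightarrow> a = b"
 by (rule rank_inj) (use assms in "auto simp: links_at_def")

text \<open>Resilience on the subgraph \<open>K\<close> of a pattern whose lists still contain all
  links of \<open>E\<close>: links outside \<open>K\<close> count as failed. Enlarging
  \<open>K\<close> therefore leaves the pattern untouched.\<close>

definition Res :: "'a set set => bool" where
 "Res K \<longleftrightarrow> (\<forall>L\<subseteq>K. \<forall>s\<in>V. linked L s t --> rch L s None)"

lemma ResD: "Res K ==> L \<subseteq> K ==> s \<in> V ==> linked L s t ==> rch L s None"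
 by (simp add: Res_def)

lemma Res_perfectly_resilient: "Res E ==> perfectly_resilient V E t \<pi>"
 unfolding perfectly_resilient_def
proof (intro allI ballI impI)
 fix F s assume *: "Res E" "F \<subseteq> E" "s \<in> V" "linked (E - F) s t"
 then have "rch (E - F) s None" by (auto simp: Res_def)
 then have "s \<in> V --> None \<in> in_ports E s --> reaches \<pi> t F s None"
 proof (induction rule: rch_induct)
  case (hop v p e)
  show ?case
  proof (intro impI)
   assume v: "v \<in> V" "p \<in> in_ports E v"
   have e: "e \<in> E" "v \<in> e" using hop(2) v hop(1) by (auto simp: find_rank links_at_def)
   then obtain w where w: "e = {v, w}" "w \<in> V" "v ~= w" by (auto elim!: linkE)
   have "find (%e. e \<notin> F) (\<pi> v p) = nxt (E - F) v p"
    by (rule find_cong) (use v hop(1) in "auto simp: links_at_def")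
   then show "reaches \<pi> t F v p"
    using hop w e by (intro reaches.hop[of v t F]) auto
  qed
 qed (auto intro: reaches.arrived)
 then show "reaches \<pi> t F s None" using * by simp
qed

text \<open>A packet that reaches \<open>u\<close> is delivered at once, as \<open>e\<close> heads
  every list there. So it suffices to follow the packet inside the component of its start until it
  meets an end of \<open>e\<close>, and for this a run on \<open>K\<close> without \<open>e\<close>
  can be imitated.\<close>

lemma Res_insert_root_link:
 assumes "Res K" "H \<subseteq> K" "K \<subseteq> E" "e \<in> S" "e = {u, t}"
  and front: "!!p l. p \<in> in_ports E u ==> l \<in> E ==> u \<in> l ==> rk u p e <= rk u p l"
 shows "Res (insert e K)"
 unfolding Res_def
proof (intro allI ballI impI)
 fix L s assume L: "L \<subseteq> insert e K" "s \<in> V" "linked L s t"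
 have eE: "e \<in> E" and ut: "u ~= t" "u \<in> V" using S_E assms(4,5) link_ends by auto
 have LE: "L \<subseteq> E" using L assms(3) eE by auto
 have at_u: "rch L u p" if "p \<in> in_ports E u" "e \<in> L" for p
  by (rule rch_hop[of L u p t]) (use front ut LE that assms(5) in "auto simp: nxt_eq")
 consider "e \<notin> L" | "e \<in> L" "s = t" | "e \<in> L" "s = u" | "e \<in> L" "s \<notin> e" using assms(5) by auto
 then show "rch L s None"
 proof cases
  case 1
  then show ?thesis using L assms(1) by (intro ResD[of K]) auto
 next
  case 4
  define C where "C = comp e s"
  obtain a b where ab: "a \<in> V - e" "b \<in> V - e" "b \<notin> comp e a" using separating_split[OF assms(4)] .
  \<comment> \<open>Besides the component \<open>C\<close> of the start there is another one; it
    supplies a connection from \<open>u\<close> to \<open>t\<close> that does not influence any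
    decision in \<open>C\<close>.\<close>
  obtain c where c: "c \<in> V - e" "comp e c Int C = {}"
  proof -
   have "a \<notin> C | b \<notin> C" using ab(3) by (auto simp: C_def comp_def intro: linked_trans linked_sym)
   then show thesis using that ab comp_disjoint[of _ e s] by (auto simp: C_def Int_commute)
  qed
  have Ce: "C Int e = {}" "C \<subseteq> V" using comp_disj 4 comp_V L(2) by (auto simp: C_def)
  have cl: "l \<subseteq> C Un e" if "l \<in> E" "l Int C ~= {}" for l
   using comp_closed[OF 4(2) that(1)] that(2) by (simp add: C_def)
  \<comment> \<open>The surviving links at \<open>C\<close>, with the link \<open>e\<close> replaced
    by all detours through the component of \<open>c\<close>. At nodes of \<open>C\<close> it agrees
    with \<open>L\<close>.\<close>
  define L' where "L' = {l \<in> L. l Int C ~= {}} Un {l \<in> K - {e}. l \<subseteq> comp e c Un e}"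
  have L'K: "L' \<subseteq> K" using L(1) Ce by (auto simp: L'_def)
  have "linked {l \<in> K - {e}. l \<subseteq> comp e c Un e} u t"
   using bridge_component[OF assms(3) biconnected_between[OF assms(2,3)] assms(5) ut(2) t_in ut(1) c(1)] .
  then have ut': "linked L' u t" by (rule linked_mono) (auto simp: L'_def)
  have "x \<in> C Un e --> linked L' x t" if "linked L x t" for x
   using that
  proof (induction rule: linked_converse_induct)
   case (step a b)
   show ?case
   proof
    assume a: "a \<in> C Un e"
    show "linked L' a t"
    proof (cases "a \<in> e")
     case True
     then show ?thesis using ut' assms(5) by auto
    next
     case False
     then have "{a, b} \<subseteq> C Un e" using a cl[of "{a, b}"] step(1) LE by auto
     then show ?thesis using step a False by (auto simp: L'_def intro: linked_trans[OF linked_link])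
    qed
   qed
  qed simp
  then have "linked L' s t" using L(3) by (simp add: C_def)
  then have "rch L' s None" using ResD[OF assms(1) L'K L(2)] by simp
  then have "s \<in> C Un e --> None \<in> in_ports E s --> rch L s None"
  proof (induction rule: rch_induct)
   case (hop v p l)
   show ?case
   proof (intro impI)
    assume v: "v \<in> C Un e" "p \<in> in_ports E v"
    show "rch L v p"
    proof (cases "v = u")
     case False
     then have vC: "v \<in> C" using hop(1) v assms(5) by auto
     have "nxt L' v p = nxt L v p"
      by (rule nxt_cong) (use v hop(1) vC Ce c(2) in "auto simp: L'_def")
     moreover have l: "l \<in> L" "v \<in> l" using hop(2) calculation vC v Ce LE hop(1) by (auto simp: nxt_eq)
     moreover from l obtain w where w: "l = {v, w}" "v ~= w" using l LE by (auto elim!: linkE)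
     moreover have "w \<in> C Un e" "w \<in> V" using cl[of l] l LE vC w link_ends by auto
     moreover have "l \<in> E" using l(1) LE by auto
     ultimately have "rch L w (Some l)" using hop(4) by auto
     then show ?thesis using hop(2) \<open>nxt L' v p = nxt L v p\<close> w by (intro rch_hop[of L v p w]) simp_all
    qed (use v at_u 4 in auto)
   qed
  qed auto
  then show ?thesis by (simp add: C_def)
 qed (auto intro: at_u)
qed

lemma link_at_cases:
 assumes "l \<in> E" "z \<in> l"
 obtains w where "l = {z, w}" "z ~= w" "w \<in> V"
 using assms by (auto elim!: linkE simp: insert_commute)

text \<open>The link \<open>e = {x, y}\<close> is added to \<open>K\<close>. For a packet on the side of \<open>t\<close>, it takes the role of
 the path \<open>q\<close> through the far side. A packet from the far side enters the side of \<open>t\<close> through \<open>x\<close>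
 only, and the node \<open>q ! j\<close>, which sends its own packets towards \<open>x\<close>, witnesses that such a packet
 reaches \<open>t\<close>.\<close>

lemma Res_insert_link:
 fixes e K x y
 defines "La z \<equiv> {l \<in> K. z \<in> l & l Int sideA e ~= {} & t \<notin> l}"
  and "Lb z \<equiv> {l \<in> K. z \<in> l & l Int sideB e ~= {}}"
 assumes K: "Res K" "H \<subseteq> K" "K \<subseteq> E" "e \<notin> K" and e: "e \<in> S0" "e = {x, y}"
  and q: "link_path H q" "hd q = y" "last q = x" "!!i. 0 < i ==> Suc i < length q ==> q ! i \<in> sideB e"
  and j: "0 < j" "Suc j < length q" "rk (q ! j) None {q ! j, q ! Suc j} < rk (q ! j) None {q ! (j - 1), q ! j}"
  and inport_last: "!!v f l. v \<in> sideB e ==> f \<in> H ==> l \<in> H ==> v \<in> f ==> v \<in> l ==> l ~= f ==>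
    rk v (Some f) l < rk v (Some f) f"
  and T: "!!z p l. z \<in> e ==> p \<in> in_ports E z ==> {z, t} \<in> E ==> l \<in> E ==> z \<in> l ==> rk z p {z, t} <= rk z p l"
  and P: "!!z. z \<in> e ==> placed (%p a b. rk z (Some p) a < rk z (Some p) b) (La z) (Lb z) e (z = y) H"
  and N: "!!z. z \<in> e ==> \<exists>f\<in>La z Un Lb z. \<pi> z None = \<pi> z (Some f)"
 shows "Res (insert e K)"
 unfolding Res_def
proof (intro allI ballI impI)
 fix L s assume L: "L \<subseteq> insert e K" "s \<in> V" "linked L s t"
 have eE: "e \<in> E" and xy: "x ~= y" "x \<in> V" "y \<in> V" "x ~= t" "y ~= t"
  using S0_E e S0_D[of x y] by auto
 note C1 = placedD(1,2)[OF P] and C2 = placedD(3-5)[OF P] and C4 = placedD(8)[OF P]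
 have C3: "z \<in> e ==> b \<in> Lb z ==> b' \<in> Lb z ==> La z ~= {} & rk z (Some b) b' < rk z (Some b) e & (\<forall>a\<in>La z. rk z (Some b) b' < rk z (Some b) a) |
   rk z (Some b) e < rk z (Some b) b' & (\<forall>a\<in>La z. rk z (Some b) a < rk z (Some b) b')"
  "a \<in> La x ==> b \<in> Lb x ==> rk x (Some b) a < rk x (Some b) e" "a \<in> La y ==> b \<in> Lb y ==> rk y (Some b) e < rk y (Some b) a" for z a b b'
  using placedD(6)[OF P[of z], of b b'] placedD(7)[OF P[of x], of a b] placedD(7)[OF P[of y], of a b] e(2) xy(1) by auto
 note sd = sides[OF e(1)] and sl = side_links[OF e(1)]
 have LE: "L \<subseteq> E" using L(1) K(3) eE by auto
 have te: "t \<notin> e" using xy e(2) by auto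
 have eV: "z \<in> V" "z ~= t" if "z \<in> e" for z using that xy e(2) by auto
 have BV: "z \<in> V" "z ~= t" "z \<notin> e" "z \<notin> sideA e" if "z \<in> sideB e" for z using that sd by auto
 have AV: "z \<in> V" "z \<notin> e" "z \<notin> sideB e" if "z \<in> sideA e" for z using that sd by auto
 have Kside: "l Int sideA e ~= {} | l Int sideB e ~= {}" if "l \<in> K" for l
 proof (rule ccontr)
  assume "~  ?thesis"
  then have "l \<subseteq> e" using that K(3) sd(5) by (auto elim!: linkE)
  then have "l = e" using link_diff[of e l] that K(3) eE link_diff[of l e] by auto
  then show False using that K(4) by simp
 qed
 show "rch L s None"
 proof (cases "e \<in> L")
  case False
  then show ?thesis using L K(1) by (intro ResD[of K]) auto
 next
  case eL: True
  define m where "m = length q - 1"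
  have m: "2 <= m" "length q = Suc m" using j by (auto simp: m_def)
  have q0: "q ! 0 = y" "q ! m = x" using q(1-3) by (auto simp: m_def link_path_def hd_conv_nth last_conv_nth)
  have qB: "q ! i \<in> sideB e" if "0 < i" "i < m" for i using q(4) that m by auto
  define PB where "PB = {{q ! i, q ! Suc i} | i. i < m}"
  have PBI: "{q ! i, q ! Suc i} \<in> PB" if "i < m" for i using that unfolding PB_def by auto
  have PBH: "PB \<subseteq> H" using link_pathD[OF q(1)] m by (auto simp: PB_def)
  have qinj: "q ! i = q ! k \<longleftrightarrow> i = k" if "i <= m" "k <= m" for i k
   using q(1) that m by (auto simp: link_path_def nth_eq_iff_index_eq)
  have PBat: "k = i | k = Suc i" if "q ! k \<in> {q ! i, q ! Suc i}" "k <= m" "i < m" for i k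
   using that qinj by auto
  have PBmid: "l = {q ! (k - 1), q ! k} | l = {q ! k, q ! Suc k}" if "l \<in> PB" "q ! k \<in> l" "k <= m" for l k
   using that PBat by (fastforce simp: PB_def)
  have PBsub: "l \<subseteq> sideB e Un e & l Int sideB e ~= {}" if "l \<in> PB" for l
  proof -
   obtain i where i: "l = {q ! i, q ! Suc i}" "i < m" using \<open>l \<in> PB\<close> by (auto simp: PB_def)
   have "l Int sideB e ~= {}" using qB[of i] qB[of "Suc i"] i m(1) by (cases i) auto
   then show ?thesis using sl(2)[of l] PBH \<open>l \<in> PB\<close> by auto
  qed
  \<comment> \<open>The link of the path \<open>q\<close> at the end \<open>z\<close>; for packets
    from the near side, \<open>e\<close> imitates it.\<close>
  define bd where "bd z = (if z = y then {q ! 0, q ! 1} else {q ! (m - 1), q ! m})" for z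
  have bd: "bd z \<in> PB & z \<in> bd z & (\<forall>l\<in>PB. z \<in> l --> l = bd z)" if "z \<in> e" for z
  proof (cases "z = y")
   case True
   have "l = bd z" if "l \<in> PB" "z \<in> l" for l
   proof -
    obtain i where i: "l = {q ! i, q ! Suc i}" "i < m" using \<open>l \<in> PB\<close> by (auto simp: PB_def)
    then have "i = 0" using PBat[of 0 i] that True q0 by auto
    then show ?thesis using i True by (auto simp: bd_def)
   qed
   moreover have b: "bd z = {q ! 0, q ! Suc 0}" using True by (simp add: bd_def)
   then have "bd z \<in> PB" using PBI[of 0] m(1) by simp
   moreover have "z \<in> bd z" unfolding b using True q0 by simp
   ultimately show ?thesis by blast
  next
   case False
   then have z: "z = q ! m" using that e(2) q0 by auto
   have b: "bd z = {q ! (m - 1), q ! Suc (m - 1)}" using False m(1) by (simp add: bd_def)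
   then have "bd z \<in> PB" using PBI[of "m - 1"] m(1) by simp
   moreover have "z \<in> bd z" unfolding b using m(1) z by simp
   moreover have "l = bd z" if "l \<in> PB" "z \<in> l" for l
   proof -
    obtain i where i: "l = {q ! i, q ! Suc i}" "i < m" using \<open>l \<in> PB\<close> by (auto simp: PB_def)
    then have "Suc i = m" using PBat[of m i] that z by auto
    then show ?thesis using i False by (auto simp: bd_def)
   qed
   ultimately show ?thesis by blast
  qed
  have bdLb: "bd z \<in> Lb z" "bd z \<in> H" if "z \<in> e" for z
   using bd[OF that] PBsub[of "bd z"] PBH K(2) by (auto simp: Lb_def)
  define LA where "LA = {l \<in> L. l Int sideA e ~= {}}"
  define LB where "LB = {l \<in> L. l Int sideB e ~= {}}"
  have LAK: "LA \<subseteq> K" "LB \<subseteq> K" using L(1) sd by (auto simp: LA_def LB_def)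
  have Lsplit: "l = e | l \<in> LA | l \<in> LB" if "l \<in> L" for l
   using that L(1) Kside by (auto simp: LA_def LB_def)
  have LAsub: "l \<subseteq> sideA e Un e" if "l \<in> LA" for l using sl(1)[of l] that LE by (auto simp: LA_def)
  have LBsub: "l \<subseteq> sideB e Un e" if "l \<in> LB" for l using sl(2)[of l] that LE by (auto simp: LB_def)
  have LALa: "l \<in> La z | l = {z, t}" if "l \<in> LA" "z \<in> l" "z \<in> e" for l z
  proof -
   have "l \<in> E" "z \<in> l" using that LAK K(3) by auto
   then obtain w where "l = {z, w}" "z ~= w" by (elim link_at_cases)
   then show ?thesis using that LAK te by (auto simp: La_def LA_def)
  qed
  have LBLb: "l \<in> Lb z" if "l \<in> LB" "z \<in> l" for l z using that LAK by (auto simp: Lb_def LB_def)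
  have Laend: "\<exists>w\<in>sideA e. l = {z, w} & w ~= z & w ~= t" if "l \<in> La z" "z \<in> e" for l z
   using that K(3) te AV by (auto simp: La_def elim!: link_at_cases[of l z])
  have Lbend: "\<exists>w\<in>sideB e. l = {z, w} & w ~= z" if "l \<in> Lb z" "z \<in> e" for l z
   using that K(3) BV by (auto simp: Lb_def elim!: link_at_cases[of l z])
  have zt: "rch L z p" if "z \<in> e" "p \<in> in_ports E z" "{z, t} \<in> L" for z p
   by (rule rch_hop[of L z p t]) (use that T[of z p] eV[of z] LE in "auto simp: nxt_eq")
  have e_hop: "rch L z p" if "z \<in> e" "p \<in> in_ports E z" "nxt L z p = Some e"
   "rch L (if z = y then x else y) (Some e)" for z p
   using that e(2) xy by (intro rch_hop[of L z p "if z = y then x else y"]) (auto simp: insert_commute split: if_splits)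
  \<comment> \<open>The far side is reduced to the path \<open>q\<close>, which stands in for
    \<open>e\<close>; near links are those that survive.\<close>
  define L1 where "L1 = LA Un PB"
  have L1K: "L1 \<subseteq> K" "L1 \<subseteq> E" using LAK PBH K by (auto simp: L1_def)
  \<comment> \<open>Translation of a run on \<open>L1\<close> into a run on \<open>L\<close>. Near
    positions correspond to themselves, an arrival at an end through \<open>q\<close> corresponds to
    an arrival through \<open>e\<close>, and a packet inside \<open>q\<close> moving towards an end
    counts as one that has crossed \<open>e\<close> to this end already.\<close>
  have A: "(w \<in> sideA e --> p \<in> in_ports E w --> rch L w p) &
   (w \<in> e --> p \<in> in_ports E w --> (\<exists>a\<in>La w. \<pi> w p = \<pi> w (Some a)) --> rch L w p) &
   (w \<in> e --> p = Some (bd w) --> rch L w (Some e)) &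
   (\<forall>i. 0 < i --> i < m --> w = q ! i --> p = Some {q ! (i - 1), q ! i} --> rch L x (Some e)) &
   (\<forall>i. 0 < i --> i < m --> w = q ! i --> p = Some {q ! i, q ! Suc i} --> rch L y (Some e))"
   if "rch L1 w p" for w p
   using that
  proof (induction rule: rch_induct)
   case (arrived p)
   then show ?case using te qB BV(2) by auto
  next
   case (hop w p l)
   have ih4: "rch L x (Some e)" if "0 < i" "i < m" "other_end w l = q ! i" "l = {q ! (i - 1), q ! i}" for i
    using hop.IH that by blast
   have ih5: "rch L y (Some e)" if "0 < i" "i < m" "other_end w l = q ! i" "l = {q ! i, q ! Suc i}" for i
    using hop.IH that by blast
   have exit: "rch L (if z = y then x else y) (Some e)" if z: "z \<in> e" "w = z" "l = bd z" for z
   proof (cases "z = y")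
    case True
    then have "other_end w l = q ! 1" using z q0 qinj[of 0 1] m(1) by (auto simp: bd_def)
    with ih4[of 1] z(3) m(1) True show ?thesis by (simp add: bd_def)
   next
    case False
    then have "w = q ! m" using z q0 e(2) by auto
    then have "other_end w l = q ! (m - 1)" using z q0 qinj[of "m - 1" m] m(1) False by (auto simp: bd_def)
    with ih5[of "m - 1"] z(3) m(1) False show ?thesis by (simp add: bd_def)
   qed
   have 1: "rch L w p" if w: "w \<in> sideA e" "p \<in> in_ports E w"
   proof -
    have "nxt L1 w p = nxt L w p"
    proof (rule nxt_cong)
     fix l assume "w \<in> l" "l \<in> E"
     then show "l \<in> L1 \<longleftrightarrow> l \<in> L" using w AV[of w] PBsub[of l] by (auto simp: L1_def LA_def)
    qed (use w hop(1) AV in auto)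
    then have n: "nxt L w p = Some l" using hop(2) by simp
    then have "l \<in> L" "w \<in> l" using hop(1) w AV[of w] LE by (auto simp: nxt_eq)
    note n = n this
    then obtain w' where w': "l = {w, w'}" "w ~= w'" using LE by (auto elim!: link_at_cases[of l w])
    have lA: "l \<in> LA" using n w by (auto simp: LA_def)
    have "rch L w' (Some l)"
    proof (cases "w' \<in> sideA e")
     case True
     then show ?thesis using hop.IH w' n LE by auto
    next
     case False
     then have z: "w' \<in> e" using LAsub[OF lA] w' by auto
     then have "l \<in> La w'" using LALa[OF lA] w' hop(1) te w AV by (auto simp: doubleton_eq_iff)
     then show ?thesis using hop.IH w' n LE z by auto
    qed
    then show ?thesis using n w' by (intro rch_hop[of L w p w']) auto
   qed
   have 2: "rch L w p" if w: "w \<in> e" "p \<in> in_ports E w" and a: "a \<in> La w" "\<pi> w p = \<pi> w (Some a)" for a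
   proof (cases "{w, t} \<in> L")
    case True
    with zt w show ?thesis by simp
   next
    case False
    have l: "l \<in> L1" "w \<in> l" "!!l'. l' \<in> L1 ==> w \<in> l' ==> rk w p l <= rk w p l'"
     using hop(1,2) w eV L1K by (auto simp: nxt_eq)
    have lbd: "rk w p l <= rk w p (bd w)" using l(3) bd[OF w(1)] by (auto simp: L1_def)
    note c1 = C1(1)[OF w(1) a(1)] C1(2)[OF w(1) a(1)]
    have LLa: "l' \<in> La w" if "l' \<in> LA" "w \<in> l'" for l' using LALa[OF that w(1)] False that by (auto simp: LA_def)
    show ?thesis
    proof (cases "l \<in> PB")
     case True
     then have lb: "l = bd w" using bd[OF w(1)] l by auto
     \<comment> \<open>Relative to the near links, \<open>e\<close> stands exactly where the far
       links stand, and before all of these; so it is chosen whenever \<open>bd w\<close> is chosen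
       on \<open>L1\<close>.\<close>
     have "rk w p e <= rk w p l'" if "l' \<in> L" "w \<in> l'" for l'
     proof -
      consider "l' = e" | "l' \<in> LA" | "l' \<in> LB" using Lsplit \<open>l' \<in> L\<close> by auto
      then show ?thesis
      proof cases
       case 2
       then have "rk w p (bd w) <= rk w p l'" using l(3)[of l'] lb \<open>w \<in> l'\<close> by (auto simp: L1_def)
       then show ?thesis using c1(2)[OF bdLb(1)[OF w(1)] LLa[OF 2 \<open>w \<in> l'\<close>]] a(2) by auto
      next
       case 3
       then show ?thesis using c1(1)[OF LBLb[OF 3 \<open>w \<in> l'\<close>]] a(2) by auto
      qed simp
     qed
     then have "nxt L w p = Some e" using w eV LE eL by (auto simp: nxt_eq)
     then show ?thesis using e_hop w exit[OF w(1) refl lb] by auto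
    next
     case False
     then have lA: "l \<in> LA" using l by (auto simp: L1_def)
     note lLa = LLa[OF lA l(2)]
     have "rk w p l ~= rk w p (bd w)"
     proof
      have "bd w \<in> E" "w \<in> bd w" "l \<in> E" using bd[OF w(1)] PBH l L1K by auto
      moreover assume "rk w p l = rk w p (bd w)"
      ultimately have "l = bd w" using rk_inj[of w p l "bd w"] w eV[OF w(1)] l(2) by blast
      then show False using False bd[OF w(1)] by simp
     qed
     then have lt: "rk w p l < rk w p (bd w)" using lbd by simp
     have "rk w p l <= rk w p l'" if "l' \<in> L" "w \<in> l'" for l'
     proof -
      consider "l' = e" | "l' \<in> LA" | "l' \<in> LB" using Lsplit \<open>l' \<in> L\<close> by auto
      then show ?thesis
      proof cases
       case 1
       then show ?thesis using c1(2)[OF bdLb(1)[OF w(1)] lLa] lt a(2) by auto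
      next
       case 2
       then show ?thesis using l(3)[of l'] \<open>w \<in> l'\<close> by (auto simp: L1_def)
      next
       case 3
       then show ?thesis using c1(2)[OF bdLb(1)[OF w(1)] lLa] lt
         c1(2)[OF LBLb[OF 3 \<open>w \<in> l'\<close>] lLa] a(2) by auto
      qed
     qed
     then have n: "nxt L w p = Some l" using w eV LE lA l by (auto simp: nxt_eq LA_def)
     obtain w' where w': "l = {w, w'}" "w ~= w'" "w' \<in> sideA e" using Laend[OF lLa w(1)] by auto
     then show ?thesis using n hop.IH lA LE by (intro rch_hop[of L w p w']) (auto simp: LA_def)
    qed
   qed
   have 3: "rch L w (Some e)" if w: "w \<in> e" "p = Some (bd w)"
   proof (cases "{w, t} \<in> L")
    case True
    with zt w eE show ?thesis by simp
   next
    case False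
    have pin: "p \<in> in_ports E w" using w bd[OF w(1)] PBH by auto
    have l: "l \<in> L1" "w \<in> l" "!!l'. l' \<in> L1 ==> w \<in> l' ==> rk w p l <= rk w p l'"
     using hop(1,2) w pin eV L1K by (auto simp: nxt_eq)
    have LLa: "l' \<in> La w" if "l' \<in> LA" "w \<in> l'" for l' using LALa[OF that w(1)] False that by (auto simp: LA_def)
    show ?thesis
    proof (cases "l \<in> PB")
     case True
     then have lb: "l = bd w" using bd[OF w(1)] l by auto
     \<comment> \<open>The list for the in-port \<open>bd w\<close> names all near links before
       \<open>bd w\<close> itself. If the packet returns on \<open>L1\<close>, no near link
       survives, and it may return through \<open>e\<close> on \<open>L\<close>.\<close>
     have noA: "l' \<notin> LA" if "w \<in> l'" for l'
     proof
      assume "l' \<in> LA"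
      then show False using C4[OF w(1) LLa[of l'] bdLb[OF w(1)]] l(3)[of l'] lb w that
       by (auto simp: L1_def)
     qed
     have "rk w (Some e) e <= rk w (Some e) l'" if "l' \<in> L" "w \<in> l'" for l'
     proof -
      have "l' = e | l' \<in> LB" using Lsplit that noA by auto
      then show ?thesis using C2(2)[OF w(1) LBLb[OF _ \<open>w \<in> l'\<close>]] by auto
     qed
     then have "nxt L w (Some e) = Some e" using w(1) eV LE eL eE by (subst nxt_eq) simp_all
     then show ?thesis using e_hop w exit[OF w(1) refl lb] eE by auto
    next
     case False
     then have lA: "l \<in> LA" using l by (auto simp: L1_def)
     note lLa = LLa[OF lA l(2)]
     have "rk w (Some e) l <= rk w (Some e) l'" if "l' \<in> L" "w \<in> l'" for l'
     proof -
      consider "l' = e" | "l' \<in> LA" | "l' \<in> LB" using Lsplit \<open>l' \<in> L\<close> by auto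
      then show ?thesis
      proof cases
       case 1
       then show ?thesis using C2(1)[OF w(1) lLa] by auto
      next
       case 2
       then have "~  rk w p l' < rk w p l" using l(3)[of l'] \<open>w \<in> l'\<close> by (auto simp: L1_def)
       then show ?thesis using C2(3)[OF w(1) LLa[OF 2 \<open>w \<in> l'\<close>] lLa bdLb(1)[OF w(1)]] w(2) by auto
      next
       case 3
       then show ?thesis using C2(1)[OF w(1) lLa] C2(2)[OF w(1) LBLb[OF 3 \<open>w \<in> l'\<close>]] by auto
      qed
     qed
     then have n: "nxt L w (Some e) = Some l" using w eV LE lA l eE by (auto simp: nxt_eq LA_def)
     obtain w' where w': "l = {w, w'}" "w ~= w'" "w' \<in> sideA e" using Laend[OF lLa w(1)] by auto
     then show ?thesis using n hop.IH lA LE by (intro rch_hop[of L w "Some e" w']) (auto simp: LA_def)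
    qed
   qed
   \<comment> \<open>Only two links survive at an inner node of \<open>q\<close>, and the in-port is
     the later of them: the packet runs on without turning.\<close>
   have inner: "l \<in> PB & w \<in> l & l ~= f" if i: "0 < i" "i < m" "w = q ! i" "p = Some f"
    "f = {q ! (i - 1), q ! i} | f = {q ! i, q ! Suc i}" for i f
   proof -
    have w: "w \<in> sideB e" using i qB by auto
    have P: "{q ! (i - 1), q ! i} \<in> PB" "{q ! i, q ! Suc i} \<in> PB"
     using PBI[of "i - 1"] PBI[of i] i(1,2) by simp_all
    have fPB: "f \<in> PB" "w \<in> f" using P i(3,5) by auto
    have pin: "p \<in> in_ports E w" using i fPB PBH by auto
    have l: "l \<in> L1" "w \<in> l" "!!l'. l' \<in> L1 ==> w \<in> l' ==> rk w p l <= rk w p l'"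
     using hop(1,2) pin BV[OF w] L1K by (auto simp: nxt_eq)
    have lPB: "l \<in> PB" using l(1,2) LAsub[of l] w BV[OF w] by (auto simp: L1_def)
    have ne: "{q ! (i - 1), q ! i} ~= {q ! i, q ! Suc i}" using i qinj[of "i - 1" "Suc i"] qinj[of i "Suc i"]
     qinj[of i "i - 1"] by (auto simp: doubleton_eq_iff)
    define f' where "f' = (if f = {q ! i, q ! Suc i} then {q ! (i - 1), q ! i} else {q ! i, q ! Suc i})"
    have f': "f' \<in> PB" "w \<in> f'" "f' ~= f"
     using P i(3,5) ne by (simp_all add: f'_def split: if_splits)
    have "rk w p f' < rk w p f" using inport_last[OF w, of f f'] fPB f' PBH i by auto
    then show ?thesis using l(3)[of f'] l(2) f' lPB by (auto simp: L1_def)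
   qed
   have 4: "rch L x (Some e)" if i: "0 < i" "i < m" "w = q ! i" "p = Some {q ! (i - 1), q ! i}" for i
   proof -
    have "l = {q ! i, q ! Suc i}" using inner[OF i disjI1[OF refl]] PBmid[of l i] i by auto
    moreover then have "other_end w l = q ! Suc i" using i qinj[of i "Suc i"] by auto
    ultimately have o: "other_end w l = q ! Suc i" "l = {q ! i, q ! Suc i}" by simp_all
    show ?thesis
    proof (cases "Suc i = m")
     case True
     then have "other_end w l = x" "l = bd x" using o q0 xy(1) by (auto simp: bd_def)
     with hop.IH e(2) show ?thesis by simp
    next
     case False
     with ih4[of "Suc i"] o i show ?thesis by simp
    qed
   qed
   have 5: "rch L y (Some e)" if i: "0 < i" "i < m" "w = q ! i" "p = Some {q ! i, q ! Suc i}" for i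
   proof -
    have l: "l = {q ! (i - 1), q ! i}" using inner[OF i disjI2[OF refl]] PBmid[of l i] i by auto
    moreover then have "other_end w l = q ! (i - 1)" using i qinj[of i "i - 1"] by auto
    ultimately have o: "other_end w l = q ! (i - 1)" by simp
    show ?thesis
    proof (cases "i = 1")
     case True
     then have "other_end w l = y" "l = bd y" using o l q0 by (auto simp: bd_def)
     with hop.IH e(2) show ?thesis by simp
    next
     case False
     with ih5[of "i - 1"] o l i show ?thesis by simp
    qed
   qed
   show ?case using 1 2 3 4 5 by blast
  qed
  have PBlinked: "linked PB (q ! i) (q ! k)" if "i <= k" "k <= m" for i k
   using that
  proof (induction k rule: dec_induct)
   case (step k)
   then have "linked PB (q ! k) (q ! Suc k)" by (intro linked_link) (auto simp: PB_def)
   then show ?case using step by (auto intro: linked_trans)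
  qed simp
  have PBe: "linked L1 z z'" if "z \<in> e" "z' \<in> e" for z z'
  proof -
   have yx: "linked L1 y x" using PBlinked[of 0 m] q0 by (auto simp: L1_def elim: linked_mono)
   then show ?thesis using that e(2) linked_sym[OF yx] by auto
  qed
  \<comment> \<open>The only place where the choice of \<open>x\<close> matters: a packet started at
    \<open>q ! j\<close> heads for \<open>x\<close>, and resilience on \<open>L1\<close> then tells
    that an arrival at \<open>x\<close> through \<open>e\<close> is successful.\<close>
  have X: "rch L x (Some e)" if t1: "linked L1 x t"
  proof -
   have jm: "0 < j" "j < m" using j m by auto
   have "linked L1 (q ! j) x" using PBlinked[of j m] jm q0 by (auto simp: L1_def elim: linked_mono)
   then have "linked L1 (q ! j) t" using t1 by (rule linked_trans)
   moreover have w: "q ! j \<in> sideB e" using qB jm by auto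
   ultimately have r: "rch L1 (q ! j) None" using ResD[OF K(1) L1K(1)] BV by auto
   have "nxt L1 (q ! j) None = Some {q ! j, q ! Suc j}"
   proof -
    have "{q ! j, q ! Suc j} \<in> L1" using jm by (auto simp: L1_def PB_def)
    moreover have "l = {q ! (j - 1), q ! j} | l = {q ! j, q ! Suc j}" if "l \<in> L1" "q ! j \<in> l" for l
     using that PBmid[of l j] jm LAsub[of l] BV[OF w] by (auto simp: L1_def)
    ultimately have "\<forall>l\<in>L1. q ! j \<in> l --> rk (q ! j) None {q ! j, q ! Suc j} <= rk (q ! j) None l"
     using j(3) by (metis less_imp_le order_refl)
    then show ?thesis using BV[OF w] L1K(2) \<open>{q ! j, q ! Suc j} \<in> L1\<close> by (subst nxt_eq) simp_all
   qed
   then have "rch L1 (q ! Suc j) (Some {q ! j, q ! Suc j})"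
    using rch_next[OF r] BV[OF w] qinj[of j "Suc j"] jm by auto
   note a = A[OF this]
   show ?thesis
   proof (cases "Suc j = m")
    case True
    then have "q ! Suc j = x" "bd x = {q ! j, q ! Suc j}" using q0 xy(1) by (auto simp: bd_def)
    with a e(2) show ?thesis by simp
   next
    case False
    then show ?thesis using a[THEN conjunct2, THEN conjunct2, THEN conjunct2, THEN conjunct1, rule_format, of "Suc j"] jm
     by simp
   qed
  qed
  \<comment> \<open>All near links of \<open>K\<close> are declared alive, so that the run on
    \<open>L2\<close> shows whether a list prefers the near side to the far links. A link
    \<open>{z, t}\<close> would always win and hide this; it is kept only if \<open>z\<close> has no
    other near link and needs it to be connected.\<close>
  define L2 where "L2 = LB Un {l \<in> K. l Int sideA e ~= {} & ~  (\<exists>z\<in>e. l = {z, t} & La z ~= {})}"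
  have L2K: "L2 \<subseteq> K" "L2 \<subseteq> E" using LAK K by (auto simp: L2_def)
  have nbA: "La z ~= {} | {z, t} \<in> L2" if z: "z \<in> e" for z
  proof -
   obtain z' where "e = {z, z'}" using z e(2) by auto
   then obtain w where w: "w \<in> sideA e" "{z, w} \<in> H" using side_neighbour[of z z' "sideA e"] e(1) by auto
   show ?thesis
   proof (cases "w = t")
    case True
    then show ?thesis using w K(2) sd(1) te by (auto simp: L2_def doubleton_eq_iff)
   next
    case False
    then have "{z, w} \<in> La z" using w K(2) eV[OF z] by (auto simp: La_def)
    then show ?thesis by auto
   qed
  qed
  have L2t: "linked L2 z t" if z: "z \<in> e" for z
  proof (cases "La z = {}")
   case True
   then show ?thesis using nbA[OF z] by (auto intro: linked_link)
  next
   case False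
   then obtain l where l: "l \<in> La z" by auto
   then obtain w where w: "w \<in> sideA e" "l = {z, w}" "w ~= t" using Laend[OF l z] by auto
   then have "l \<in> L2" using l by (auto simp: L2_def La_def doubleton_eq_iff)
   then have "linked L2 z w" unfolding w(2) by (rule linked_link)
   also have "linked L2 t w"
   proof (rule linked_mono[OF sideA_linked[OF e(1) w(1)]], rule subsetI)
    fix l' assume l': "l' \<in> {l \<in> H. l \<subseteq> sideA e}"
    then obtain p p' where "l' = {p, p'}" by (auto elim!: linkE)
    moreover have "z' \<notin> l'" if "z' \<in> e" for z' using l' that sd(3) by auto
    ultimately show "l' \<in> L2" using l' K(2) by (auto simp: L2_def)
   qed
   then have "linked L2 w t" by (rule linked_sym)
   finally show ?thesis .
  qed
  \<comment> \<open>Here the run on \<open>L2\<close> is imitated only up to the moment when it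
    leaves the far side; from then on \<open>X\<close> takes over.\<close>
  have B: "(w \<in> sideB e --> p \<in> in_ports E w --> rch L w p) &
    (w \<in> e --> p \<in> in_ports E w --> (\<exists>b\<in>Lb w. \<pi> w p = \<pi> w (Some b)) --> rch L w p)"
   if "rch L2 w p" and X: "rch L x (Some e)" for w p
   using that(1)
  proof (induction rule: rch_induct)
   case (arrived p)
   then show ?case using te sd by auto
  next
   case (hop w p l)
   have 1: "rch L w p" if w: "w \<in> sideB e" "p \<in> in_ports E w"
   proof -
    have "nxt L2 w p = nxt L w p"
    proof (rule nxt_cong)
     fix l assume "w \<in> l" "l \<in> E"
     then show "l \<in> L2 \<longleftrightarrow> l \<in> L" using w BV[of w] sl(1)[of l] by (auto simp: L2_def LB_def)
    qed (use w hop(1) BV in auto)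
    then have n: "nxt L w p = Some l" using hop(2) by simp
    then have "l \<in> L" "w \<in> l" using hop(1) w BV[of w] LE by (auto simp: nxt_eq)
    note n = n this
    then obtain w' where w': "l = {w, w'}" "w ~= w'" using LE by (auto elim!: link_at_cases[of l w])
    have lB: "l \<in> LB" using n w by (auto simp: LB_def)
    have "rch L w' (Some l)"
    proof (cases "w' \<in> sideB e")
     case True
     then show ?thesis using hop.IH w' n LE by auto
    next
     case False
     then have z: "w' \<in> e" using LBsub[OF lB] w' by auto
     then have "l \<in> Lb w'" using LBLb[OF lB] w' by auto
     then show ?thesis using hop.IH w' n LE z by auto
    qed
    then show ?thesis using n w' by (intro rch_hop[of L w p w']) auto
   qed
   have 2: "rch L w p" if w: "w \<in> e" "p \<in> in_ports E w" and b: "b \<in> Lb w" "\<pi> w p = \<pi> w (Some b)" for b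
   proof (cases "{w, t} \<in> L")
    case True
    with zt w show ?thesis by simp
   next
    case False
    have l: "l \<in> L2" "w \<in> l" "!!l'. l' \<in> L2 ==> w \<in> l' ==> rk w p l <= rk w p l'"
     using hop(1,2) w eV L2K by (auto simp: nxt_eq)
    have LLa: "l' \<in> La w" if "l' \<in> LA" "w \<in> l'" for l' using LALa[OF that w(1)] False that by (auto simp: LA_def)
    have LaL2: "La w \<subseteq> L2" by (auto simp: L2_def La_def)
    note c3 = C3(1)[OF w(1) b(1), folded b(2)]
    show ?thesis
    proof (cases "l \<in> LB")
     case True
     \<comment> \<open>A far link precedes either all near links and \<open>e\<close>, or none of
       them. As all near links are alive in \<open>L2\<close>, a far link chosen there belongs to
       the first kind and is chosen in \<open>L\<close> too.\<close>
     have alt: "rk w p l < rk w p e" "\<forall>a\<in>La w. rk w p l < rk w p a"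
     proof -
      have "~  (rk w p e < rk w p l & (\<forall>a\<in>La w. rk w p a < rk w p l))"
      proof
       assume *: "rk w p e < rk w p l & (\<forall>a\<in>La w. rk w p a < rk w p l)"
       show False
       proof (cases "La w = {}")
        case La: True
        then have t2: "{w, t} \<in> L2" using nbA[OF w(1)] by auto
        then have "rk w p {w, t} = rk w p l" using T[OF w, of l] l L2K by (intro antisym) auto
        then have "{w, t} = l" using rk_inj[OF eV[OF w(1)] w(2), of "{w, t}" l] l(1,2) L2K(2) t2 by auto
        then show False using False True by (auto simp: LB_def)
       next
        case False
        then show False using * l(3) LaL2 by (fastforce simp: La_def)
       qed
      qed
      then show "rk w p l < rk w p e" "\<forall>a\<in>La w. rk w p l < rk w p a"
       using c3[OF LBLb[OF True l(2)]] by blast+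
     qed
     have "rk w p l <= rk w p l'" if "l' \<in> L" "w \<in> l'" for l'
     proof -
      consider "l' = e" | "l' \<in> LA" | "l' \<in> LB" using Lsplit \<open>l' \<in> L\<close> by auto
      then show ?thesis
       by cases (use alt LLa[of l'] that l(3)[of l'] in "auto simp: L2_def intro: less_imp_le")
     qed
     then have n: "nxt L w p = Some l" using w eV LE True l by (auto simp: nxt_eq LB_def)
     obtain w' where w': "l = {w, w'}" "w ~= w'" "w' \<in> sideB e" using Lbend[OF LBLb[OF True l(2)] w(1)] by auto
     then show ?thesis using n hop.IH True LE by (intro rch_hop[of L w p w']) (auto simp: LB_def)
    next
     case lnB: False
     then have lA: "l \<in> K" "l Int sideA e ~= {}" "~  (l = {w, t} & La w ~= {})" using l w by (auto simp: L2_def)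
     have lcase: "l \<in> La w | La w = {}"
     proof -
      have "l \<in> E" using lA(1) K(3) by auto
      then obtain w' where "l = {w, w'}" using l(2) by (elim link_at_cases)
      then show ?thesis using lA l(2) eV[OF w(1)] by (auto simp: La_def)
     qed
     have Bafter: "rk w p e < rk w p b' & (\<forall>a\<in>La w. rk w p a < rk w p b')" if "b' \<in> LB" "w \<in> b'" for b'
     proof -
      have "rk w p l <= rk w p b'" using l(3)[of b'] that by (auto simp: L2_def)
      then show ?thesis using c3[OF LBLb[OF that]] lcase by auto
     qed
     show ?thesis
     proof (cases "w = y")
      case True
      \<comment> \<open>At \<open>y\<close> the new link precedes the near links and all surviving
        far ones, so the packet crosses it and arrives at \<open>x\<close> through
        \<open>e\<close>.\<close>
      have "rk w p e <= rk w p l'" if "l' \<in> L" "w \<in> l'" for l'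
      proof -
       consider "l' = e" | "l' \<in> LA" | "l' \<in> LB" using Lsplit \<open>l' \<in> L\<close> by auto
       then show ?thesis
        by cases (use Bafter[of l'] C3(3)[of l' b] LLa[of l'] that b True in "auto intro: less_imp_le")
      qed
      then have "nxt L w p = Some e" using w eV LE eL by (auto simp: nxt_eq)
      then show ?thesis using e_hop w X True by auto
     next
      case False
      then have wx: "w = x" using w e(2) by auto
      have "\<exists>l'. nxt L w p = Some l'"
       by (rule find_Some_ex) (use w eV[OF w(1)] eL eE in "auto simp: links_at_def intro!: bexI[of _ e]")
      then obtain l' where n: "nxt L w p = Some l'" by auto
      then have l': "l' \<in> L" "w \<in> l'" "!!l''. l'' \<in> L ==> w \<in> l'' ==> rk w p l' <= rk w p l''"
       using w eV LE by (auto simp: nxt_eq)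
      have "l' \<notin> LB" using Bafter[of l'] l'(2) l'(3)[of e] eL w by fastforce
      then have l'c: "l' = e | l' \<in> La w" using Lsplit[OF l'(1)] LLa l'(2) by auto
      \<comment> \<open>At \<open>x\<close> the near links come first, in the same order as for the
        in-port \<open>e\<close>, and then \<open>e\<close>. So the packet takes the out-port of a
        packet arriving through \<open>e\<close>, whose success is given by
        \<open>X\<close>.\<close>
      have "rk w (Some e) l' <= rk w (Some e) l''" if l'': "l'' \<in> L" "w \<in> l''" for l''
      proof (cases "l' = e")
       case True
       have "l'' \<notin> LA"
       proof
        assume "l'' \<in> LA"
        then have "rk w p l'' < rk w p e" using C3(2)[of l'' b] LLa[of l''] l'' b wx by auto
        then show False using l'(3)[OF l''] True by auto
       qed
       then show ?thesis using Lsplit[OF l''(1)] C2(2)[OF w(1) LBLb[of l'' w]] l'' True by fastforce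
      next
       case False
       then have la: "l' \<in> La w" using l'c by auto
       consider "l'' = e" | "l'' \<in> LA" | "l'' \<in> LB" using Lsplit \<open>l'' \<in> L\<close> by auto
       then show ?thesis
       proof cases
        case 1
        with C2(1)[OF w(1) la] show ?thesis by simp
       next
        case 2
        then have "~  rk w p l'' < rk w p l'" using l'(3)[OF l''] by simp
        then show ?thesis using C2(3)[OF w(1) LLa[OF 2 l''(2)] la b(1)] b(2) by auto
       next
        case 3
        with C2(1)[OF w(1) la] C2(2)[OF w(1) LBLb[OF 3 l''(2)]] show ?thesis by simp
       qed
      qed
      then have n': "nxt L w (Some e) = Some l'" using w eV LE eE l' by (auto simp: nxt_eq)
      obtain w' where w': "l' = {w, w'}" "w ~= w'" using l' LE by (auto elim!: link_at_cases[of l' w])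
      have "rch L w' (Some {w, w'})"
       using rch_next[OF X] n' w' wx xy by auto
      then show ?thesis using rch_hop[of L w p w'] n w' by auto
     qed
    qed
   qed
   show ?case using 1 2 by blast
  qed
  \<comment> \<open>Connections in \<open>L\<close> survive the passage to \<open>L1\<close> because
    any excursion into the far side between the ends can be replaced by \<open>q\<close>. A far node
    keeps its walk up to the first end that it meets.\<close>
  have link: "(w \<in> sideA e Un e --> linked L1 w t) & (w \<in> sideB e --> (\<exists>z\<in>e. linked LB w z & linked L1 z t))"
   if "linked L w t" for w
   using that
  proof (induction rule: linked_converse_induct)
   case base
   show ?case using sd by auto
  next
   case (step a b)
   consider "{a, b} = e" | "{a, b} \<in> LA" | "{a, b} \<in> LB" using Lsplit step(1) by auto
   then show ?case
   proof cases
    case 1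
    then have "a \<in> e" "b \<in> e" by auto
    then show ?thesis using step PBe[of a b] sd by (auto intro: linked_trans)
   next
    case 2
    then have "a \<in> sideA e Un e" "b \<in> sideA e Un e" "linked L1 a b"
     using LAsub by (auto simp: L1_def intro: linked_link)
    then show ?thesis using step sd by (auto intro: linked_trans)
   next
    case 3
    then have ab: "a \<in> sideB e Un e" "b \<in> sideB e Un e" using LBsub by auto
    have l: "linked LB a b" using 3 by (rule linked_link)
    show ?thesis
    proof (cases "b \<in> e")
     case True
     then have "linked L1 b t" using step by auto
     then show ?thesis using ab l True PBe[of a b] sd by (auto intro: linked_trans)
    next
     case False
     then obtain z where z: "z \<in> e" "linked LB b z" "linked L1 z t" using ab step by auto
     then show ?thesis using ab l PBe[of a z] sd by (auto intro: linked_trans)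
    qed
   qed
  qed
  have fin: "linked L1 x t ==> linked L2 s t ==> rch L2 s None" using ResD[OF K(1) L2K(1) L(2)] by simp
  consider "s \<in> sideA e" | "s \<in> e" | "s \<in> sideB e" using sd L(2) by auto
  then show ?thesis
  proof cases
   case 1
   then have "rch L1 s None" using ResD[OF K(1) L1K(1) L(2)] link[OF L(3)] by auto
   then show ?thesis using A 1 by auto
  next
   case 2
   then have s1: "linked L1 s t" using link[OF L(3)] by auto
   have x1: "linked L1 x t" using linked_trans[OF PBe[of x s] s1] 2 e(2) by auto
   obtain f where "f \<in> La s Un Lb s" "\<pi> s None = \<pi> s (Some f)" using N[OF 2] by auto
   then consider "\<exists>a\<in>La s. \<pi> s None = \<pi> s (Some a)" | "\<exists>b\<in>Lb s. \<pi> s None = \<pi> s (Some b)" by auto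
   then show ?thesis
   proof cases
    case 1
    then show ?thesis using A[OF ResD[OF K(1) L1K(1) L(2) s1]] 2 None_port by blast
   next
    case 2
    then show ?thesis using B[OF fin[OF x1 L2t] X[OF x1]] \<open>s \<in> e\<close> None_port by blast
   qed
  next
   case 3
   then obtain z where z: "z \<in> e" "linked LB s z" "linked L1 z t" using link[OF L(3)] by auto
   have x1: "linked L1 x t" using linked_trans[OF PBe[of x z] z(3)] z(1) e(2) by auto
   have "linked L2 s z" using z(2) by (rule linked_mono) (auto simp: L2_def)
   then have "linked L2 s t" using L2t[OF z(1)] by (rule linked_trans)
   then show ?thesis using B[OF fin[OF x1] X[OF x1]] 3 None_port by blast
  qed
 qed
qed

end

section \<open>Cyclic orders\<close>

text \<open>The cyclic order \<open>xs\<close> read from the element after \<open>p\<close> up to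
  \<open>p\<close> itself: the list of the right-hand rule for the in-port \<open>p\<close>.\<close>

definition cut :: "'b => 'b list => 'b list" where
 "cut p xs = drop (Suc (rank xs p)) xs @ take (Suc (rank xs p)) xs"

lemma set_cut [simp]: "set (cut p xs) = set xs"
 unfolding cut_def by (metis append_take_drop_id set_append sup_commute)

lemma distinct_cut [simp]: "distinct (cut p xs) = distinct xs"
 unfolding cut_def by (metis append_take_drop_id distinct_append inf_commute)

lemma length_cut [simp]: "length (cut p xs) = length xs"
 by (simp add: cut_def)

lemma rank_cut:
 assumes "distinct xs" "p \<in> set xs" "z \<in> set xs"
 shows "rank (cut p xs) z = (if rank xs p < rank xs z then rank xs z - rank xs p - 1
  else rank xs z + length xs - rank xs p - 1)" (is "_ = ?i")
proof -
 have l: "rank xs p < length xs" "rank xs z < length xs" using assms by (simp_all add: rank_less)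
 have "?i < length xs" using l by auto
 moreover have "cut p xs ! ?i = z" using l assms by (auto simp: cut_def nth_append nth_rank)
 ultimately show ?thesis using rank_nth[of "cut p xs" ?i] assms(1) by simp
qed

lemma cut_split: "distinct (as @ p # bs) ==> cut p (as @ p # bs) = bs @ as @ [p]"
 by (auto simp: cut_def rank_append rank_Cons)

lemma cut_rotate:
 assumes "distinct (xs @ ys)" "p \<in> set (xs @ ys)"
 shows "cut p (ys @ xs) = cut p (xs @ ys)"
proof -
 consider as bs where "xs = as @ p # bs" | as bs where "ys = as @ p # bs"
  using assms(2) by (auto dest: split_list)
 then show ?thesis
 proof cases
  case 1
  then show ?thesis using assms cut_split[of "ys @ as" p bs] cut_split[of as p "bs @ ys"] by auto
 next
  case 2
  then show ?thesis using assms cut_split[of as p "bs @ xs"] cut_split[of "xs @ as" p bs] by auto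
 qed
qed

text \<open>An element \<open>r\<close> other than \<open>p\<close> and \<open>q\<close> lies on
  just one of the two arcs between \<open>p\<close> and \<open>q\<close>, so it cannot be met first
  in both readings.\<close>

lemma cut_antisym:
 assumes "distinct xs" "p \<in> set xs" "q \<in> set xs" "r \<in> set xs" "p ~= q"
  and "rank (cut p xs) r < rank (cut p xs) q" "rank (cut q xs) r < rank (cut q xs) p"
 shows False
 using assms rank_less[of p xs] rank_less[of q xs] rank_less[of r xs] rank_inj[of p xs q]
 by (auto simp: rank_cut split: if_splits)

lemma ascent_or_split:
 "(\<exists>us x y vs. R = us @ x # y # vs & ~  P x & P y) |
  (\<exists>as bs. R = as @ bs & (\<forall>a\<in>set as. P a) & (\<forall>b\<in>set bs. ~  P b))"
proof (induction R)
 case (Cons z R)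
 from Cons.IH show ?case
 proof
  assume "\<exists>us x y vs. R = us @ x # y # vs & ~  P x & P y"
  then show ?thesis by (metis append_Cons)
 next
  assume "\<exists>as bs. R = as @ bs & (\<forall>a\<in>set as. P a) & (\<forall>b\<in>set bs. ~  P b)"
  then obtain as bs where R: "R = as @ bs" "\<forall>a\<in>set as. P a" "\<forall>b\<in>set bs. ~  P b" by auto
  show ?thesis
  proof (cases "P z")
   case True
   then show ?thesis using R by (intro disjI2 exI[of _ "z # as"] exI[of _ bs]) auto
  next
   case False
   then show ?thesis
   proof (cases as)
    case Nil
    then show ?thesis using R False by (intro disjI2 exI[of _ "[]"] exI[of _ "z # bs"]) auto
   next
    case (Cons y as')
    then show ?thesis using R False by (intro disjI1 exI[of _ "[]"] exI[of _ z] exI[of _ y] exI[of _ "as' @ bs"]) auto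
   qed
  qed
 qed
qed auto

text \<open>By \<open>sep\<close>, all elements with \<open>P\<close> lie on one of the two arcs
  between any two elements without \<open>P\<close>. After a rotation that starts with
  \<open>P\<close> and ends without it, a second block with \<open>P\<close> would contradict
  this.\<close>

lemma contiguous_rotation:
 assumes "distinct R" "\<exists>a\<in>set R. P a" "\<exists>b\<in>set R. ~  P b"
  and sep: "!!b c. b \<in> set R ==> c \<in> set R ==> ~  P b ==> ~  P c ==> b ~= c ==>
   (\<forall>a\<in>set R. P a --> rank (cut b R) a < rank (cut b R) c) |
   (\<forall>a\<in>set R. P a --> rank (cut c R) a < rank (cut c R) b)"
 shows "\<exists>xs ys As Bs. R = xs @ ys & ys @ xs = As @ Bs & As ~= [] & Bs ~= [] &
  (\<forall>a\<in>set As. P a) & (\<forall>b\<in>set Bs. ~  P b)"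
proof -
 obtain xs ys where R: "R = xs @ ys" "ys @ xs ~= []" "P (hd (ys @ xs))" "~  P (last (ys @ xs))"
 proof -
  from ascent_or_split[of R P] show thesis
  proof
   assume "\<exists>us x y vs. R = us @ x # y # vs & ~  P x & P y"
   then obtain us x y vs where "R = us @ x # y # vs" "~  P x" "P y" by auto
   then show thesis by (intro that[of "us @ [x]" "y # vs"]) auto
  next
   assume "\<exists>as bs. R = as @ bs & (\<forall>a\<in>set as. P a) & (\<forall>b\<in>set bs. ~  P b)"
   then obtain as bs where "R = as @ bs" "\<forall>a\<in>set as. P a" "\<forall>b\<in>set bs. ~  P b" by auto
   moreover then have "as ~= []" "bs ~= []" using assms(2,3) by auto
   ultimately show thesis by (intro that[of "[]" R]) auto
  qed
 qed
 define R' where "R' = ys @ xs"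
 have dR: "distinct R'" "set R' = set R" using assms(1) R(1) by (auto simp: R'_def)
 have cutR: "cut p R = cut p R'" if "p \<in> set R" for p
  using cut_rotate[of xs ys p] that assms(1) R(1) by (simp add: R'_def)
 from ascent_or_split[of R' P] show ?thesis
 proof
  assume "\<exists>us x y vs. R' = us @ x # y # vs & ~  P x & P y"
  then obtain us x y vs where e: "R' = us @ x # y # vs" "~  P x" "P y" by auto
  have us: "us ~= []" using R(3) e by (cases us) (auto simp: R'_def)
  have vs: "vs ~= []" using R(4) e by (cases vs) (auto simp: R'_def)
  define h l where "h = hd us" and "l = last vs"
  have hl: "hd R' = h" "last R' = l" "h \<in> set us" "l \<in> set vs" using us vs e(1) by (auto simp: h_def l_def)
  have P: "P h" "~  P l" using R(3,4) hl by (auto simp: R'_def)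
  have rx: "rank R' x = length us" "rank R' y = Suc (length us)" "x \<in> set R'" "y \<in> set R'"
   using e(1) dR(1) by (auto simp: rank_append rank_Cons)
  have rh: "rank R' h = 0" "h \<in> set R'" using us e(1) by (auto simp: h_def hd_conv_nth rank_append neq_Nil_conv rank_Cons)
  have "R' ! (length R' - 1) = l" using hl e(1) last_conv_nth[of R'] by simp
  then have rl: "rank R' l = length R' - 1" "l \<in> set R'" using rank_nth[OF dR(1), of "length R' - 1"] e(1) hl by auto
  have lx: "l ~= x" using hl dR e(1) by auto
  have len: "length R' = length us + length vs + 2" "length us > 0" "length vs > 0" using e(1) us vs by auto
  \<comment> \<open>The cyclic order shows \<open>h\<close>, \<open>x\<close>, \<open>y\<close>,
    \<open>l\<close>. Read from \<open>x\<close>, \<open>h\<close> comes after \<open>l\<close>;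
    read from \<open>l\<close>, \<open>y\<close> comes after \<open>x\<close>; so both alternatives
    fail.\<close>
  have "(rank (cut x R') h < rank (cut x R') l) | (rank (cut l R') y < rank (cut l R') x)"
   using sep[of x l] rx rl rh e(2,3) P lx dR(2) cutR[of x] cutR[of l] by auto
  with rx rl rh len dR(1) show ?thesis by (simp add: rank_cut)
 next
  assume "\<exists>as bs. R' = as @ bs & (\<forall>a\<in>set as. P a) & (\<forall>b\<in>set bs. ~  P b)"
  then obtain as bs where e: "R' = as @ bs" "\<forall>a\<in>set as. P a" "\<forall>b\<in>set bs. ~  P b" by auto
  then have "as ~= []" "bs ~= []" using assms(2,3) dR(2) by auto
  then show ?thesis using e R(1) unfolding R'_def by blast
 qed
qed


section \<open>Packets on cycles\<close>

context routed_graph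
begin

text \<open>Let everything fail that touches the cycle except its own links and one exit
  \<open>{c ! k, r}\<close>. A packet started at \<open>c ! i\<close> in the forward direction goes
  round, since the in-port is always the last choice. To be delivered it must prefer the exit to the
  next cycle link at \<open>c ! k\<close>.\<close>

lemma cycle_escape:
 assumes res: "Res E" and c: "distinct c" "3 <= length c" "t \<notin> set c"
  "!!i. i < length c ==> {c ! i, c ! (Suc i mod length c)} \<in> E"
  and k: "k < length c" and r: "{c ! k, r} \<in> E" "r \<notin> set c" "r ~= t" "linked (avoid E (set c)) r t"
  and i: "i < length c" "i ~= k" "j < length c" "Suc j mod length c = i"
   "rk (c ! i) None {c ! i, c ! (Suc i mod length c)} < rk (c ! i) None {c ! j, c ! i}"
  and m: "m < length c" "Suc m mod length c = k"
  and inport_last: "!!v f l. v \<in> set c ==> f \<in> E ==> l \<in> E ==> v \<in> f ==> v \<in> l ==> t \<notin> f ==> l ~= f ==>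
    rk v (Some f) l < rk v (Some f) f"
 shows "rk (c ! k) (Some {c ! m, c ! k}) {c ! k, r} < rk (c ! k) (Some {c ! m, c ! k}) {c ! k, c ! (Suc k mod length c)}"
proof (rule ccontr)
 assume neg: "~  ?thesis"
 define n where "n = length c"
 define l where "l a = {c ! a, c ! (Suc a mod n)}" for a
 have n: "0 < n" "3 <= n" using c by (auto simp: n_def)
 have lE: "l a \<in> E" if "a < n" for a using c(4) that by (simp add: l_def n_def)
 have cV: "c ! a \<in> V" "c ! a ~= t" "c ! a \<in> set c" if "a < n" for a
  using lE[OF that] link_ends that c(3) by (auto simp: l_def n_def)
 have cinj: "c ! a = c ! b \<longleftrightarrow> a = b" if "a < n" "b < n" for a b
  using that c(1) by (simp add: n_def nth_eq_iff_index_eq)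
 have SM: "Suc a mod n < n" for a using n by simp
 have Sinj: "Suc a mod n = Suc b mod n \<longleftrightarrow> a = b" if "a < n" "b < n" for a b
  using that by (auto simp: mod_Suc split: if_splits)
 have l_at: "b = a | Suc b mod n = a" if "c ! a \<in> l b" "a < n" "b < n" for a b
  using that cinj SM by (auto simp: l_def)
 have l_inj: "l a ~= l b" if "a < n" "b < n" "a ~= b" for a b
 proof
  assume eq: "l a = l b"
  then have "c ! a \<in> l b" "c ! b \<in> l a" by (auto simp: l_def)
  then have h: "Suc b mod n = a" "Suc a mod n = b"
   using l_at[OF _ that(1,2)] l_at[OF _ that(2,1)] that(3) by auto
  show False
  proof (cases "Suc b = n")
   case True
   then have a0: "a = 0" using h(1) by simp
   have "b = 1" using h(2) n(2) unfolding a0 by simp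
   then show False using True n(2) by simp
  next
   case False
   then have ab: "a = Suc b" using h(1) that(2) by simp
   show False
   proof (cases "Suc (Suc b) = n")
    case True
    then have "b = 0" using h(2) unfolding ab by simp
    then show False using True n(2) by simp
   next
    case False
    then have "Suc (Suc b) = b" using h(2) that(1) unfolding ab by simp
    then show False by simp
   qed
  qed
 qed
 define L where "L = l ` {..<n} Un {{c ! k, r}} Un avoid E (set c)"
 have LE: "L \<subseteq> E" using lE r by (auto simp: L_def)
 have kn: "k < n" and i_n: "i < n" and jn: "j < n" and mn: "m < n" using k i m by (simp_all add: n_def)
 have Lat: "x \<in> l ` {..<n} | (x = {c ! k, r} & a = k)" if "x \<in> L" "c ! a \<in> x" "a < n" for x a
  using that cV[of a] cinj[of a k] kn r(2) by (auto simp: L_def)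
 have at: "x = l a | (\<exists>b<n. Suc b mod n = a & x = l b) | (x = {c ! k, r} & a = k)"
  if "x \<in> L" "c ! a \<in> x" "a < n" for x a
  using Lat[OF that] l_at that(2,3) by fastforce
 have lin: "linked L (c ! a) (c ! (Suc a mod n))" if "a < n" for a
  by (rule linked_link) (use that in "auto simp: L_def l_def")
 have lin0: "linked L (c ! 0) (c ! a)" if "a < n" for a
  using that
 proof (induction a)
  case (Suc a)
  then show ?case using lin[of a] by (auto intro: linked_trans)
 qed simp
 have "linked L (c ! i) (c ! k)" using lin0[OF i_n] lin0[OF kn] by (meson linked_sym linked_trans)
 also have "linked L (c ! k) r" by (rule linked_link) (simp add: L_def)
 also have "linked L r t" by (rule linked_mono[OF r(4)]) (auto simp: L_def)
 finally have run: "rch L (c ! i) None" using ResD[OF res LE] cV[OF i_n] by simp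
 have pin: "Some (l a) \<in> in_ports E (c ! (Suc a mod n))" if "a < n" for a using lE[OF that] by (simp add: l_def)
 have step: "nxt L (c ! a) p = Some (l a)"
  if a: "a < n" and pa: "p = None & a = i | (\<exists>b<n. Suc b mod n = a & p = Some (l b))" for a p
 proof -
  have pin': "p \<in> in_ports E (c ! a)" using pa pin by auto
  have la: "l a \<in> L" "c ! a \<in> l a" using a by (auto simp: L_def l_def)
  have "rk (c ! a) p (l a) <= rk (c ! a) p x" if x: "x \<in> L" "c ! a \<in> x" for x
  proof -
   from at[OF x a] consider "x = l a" | b where "b < n" "Suc b mod n = a" "x = l b" | "x = {c ! k, r}" "a = k"
    by blast
   then show ?thesis
   proof cases
    case (2 b)
    from pa show ?thesis
    proof
     assume pN: "p = None & a = i"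
     then have "b = j" using Sinj[of b j] 2 i(4) jn by (simp add: n_def)
     then have "x = {c ! j, c ! i}" using 2 pN by (simp add: l_def)
     with i(5) pN show ?thesis by (simp add: l_def n_def)
    next
     assume "\<exists>b<n. Suc b mod n = a & p = Some (l b)"
     then have pb: "p = Some (l b)" using Sinj 2 by auto
     have "a ~= b"
     proof
      assume "a = b"
      then have "Suc a mod n = a" using 2(2) by simp
      then show False using a n(2) by (cases "Suc a = n") auto
     qed
     then have "rk (c ! a) p (l a) < rk (c ! a) p (l b)" unfolding pb
      using 2 a lE la(2) x cV[OF a] l_inj[of a b] cV[of b] cV[OF SM]
      by (intro inport_last) (auto simp: l_def)
     with 2 show ?thesis by simp
    qed
   next
    case 3
    then have "p ~= None" using pa i(2) by auto
    then obtain b where b: "b < n" "Suc b mod n = a" "p = Some (l b)" using pa by auto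
    then have "b = m" using Sinj[of b m] m 3 mn by (simp add: n_def)
    then have "p = Some {c ! m, c ! k}" using b 3 by (simp add: l_def)
    with neg 3 show ?thesis by (simp add: l_def n_def not_less)
   qed simp
  qed
  then show ?thesis using la cV[OF a] pin' LE by (subst nxt_eq) auto
 qed
 \<comment> \<open>If the exit were not preferred, the positions reached on the cycle would be
   closed under forwarding, so none of them could be successful.\<close>
 have "~  (\<exists>a<n. v = c ! a & (p = None & a = i | (\<exists>b<n. Suc b mod n = a & p = Some (l b))))"
  if "rch L v p" for v p
  using that
 proof (induction rule: rch_induct)
  case (arrived p)
  show ?case using cV(2) by auto
 next
  case (hop v p e)
  show ?case
  proof
   assume "\<exists>a<n. v = c ! a & (p = None & a = i | (\<exists>b<n. Suc b mod n = a & p = Some (l b)))"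
   then obtain a where a: "a < n" "v = c ! a" "p = None & a = i | (\<exists>b<n. Suc b mod n = a & p = Some (l b))" by auto
   then have e: "e = l a" using step[OF a(1,3)] hop(2) by simp
   have "c ! a ~= c ! (Suc a mod n)" using link_ends lE[OF a(1)] by (auto simp: l_def)
   then have "other_end v e = c ! (Suc a mod n)" using e a by (simp add: l_def)
   then show False using hop.IH e a(1) SM[of a] by auto
  qed
 qed
 then show False using run i_n by blast
qed

lemma Res_E: "perfectly_resilient V E t \<pi> ==> Res E"
 unfolding Res_def
proof (intro allI ballI impI)
 fix L s assume *: "perfectly_resilient V E t \<pi>" "L \<subseteq> E" "s \<in> V" "linked L s t"
 have "E - (E - L) = L" using *(2) by auto
 then have "reaches \<pi> t (E - L) s None" using * by (auto simp: perfectly_resilient_def)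
 then have "s \<in> V --> None \<in> in_ports E s --> rch L s None"
 proof (induction rule: reaches.induct)
  case (hop v p e)
  show ?case
  proof (intro impI)
   assume v: "v \<in> V" "p \<in> in_ports E v"
   have "find (%e. e \<notin> E - L) (\<pi> v p) = nxt L v p"
    by (rule find_cong) (use v hop(1) in "auto simp: links_at_def")
   then have n: "nxt L v p = Some e" using hop(2) by simp
   then have e: "e \<in> L" "e \<in> E" "v \<in> e" using *(2) v hop(1) by (auto simp: nxt_eq)
   then obtain w where w: "e = {v, w}" "v ~= w" "w \<in> V" by (elim link_at_cases)
   then show "rch L v p" using n hop.IH e by (intro rch_hop[of L v p w]) auto
  qed
 qed simp
 then show "rch L s None" using * by simp
qed

end

text \<open>All that is later used of the updated right-hand rule, stated for neighbours. For the
  in-port \<open>{u, t}\<close> only the leading position of \<open>t\<close> is demanded, because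
  packets stop at \<open>t\<close> and never arrive from it.\<close>

definition rotational :: "'a set set => 'a => 'a pattern => 'a list => 'a => bool" where
 "rotational L t \<pi> R u \<longleftrightarrow> distinct R & set R = {w. {u, w} \<in> L} - {t} &
  (\<forall>w\<in>set R. \<forall>a\<in>set R. \<forall>b\<in>set R. rank (\<pi> u (Some {u, w})) {u, a} < rank (\<pi> u (Some {u, w})) {u, b} \<longleftrightarrow>
   rank (cut w R) a < rank (cut w R) b) &
  (\<forall>p l. p \<in> in_ports L u --> {u, t} \<in> L --> l \<in> L --> u \<in> l --> rank (\<pi> u p) {u, t} <= rank (\<pi> u p) l) &
  (R ~= [] --> (\<exists>w\<in>set R. \<pi> u None = \<pi> u (Some {u, w})))"

lemma rank_cut_last:
 assumes "distinct xs" "p \<in> set xs" "z \<in> set xs" "z ~= p"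
 shows "rank (cut p xs) z < rank (cut p xs) p"
 using assms rank_less[of p xs] rank_less[of z xs] rank_inj[of z xs p] by (auto simp: rank_cut)

context routed_graph
begin

lemma rotational_inport_last:
 assumes "rotational E t \<pi> R v" "v \<in> V" "v ~= t" "f \<in> E" "l \<in> E" "v \<in> f" "v \<in> l" "t \<notin> f" "l ~= f"
 shows "rk v (Some f) l < rk v (Some f) f"
proof -
 obtain w where w: "f = {v, w}" "v ~= w" using assms(4,6) by (elim link_at_cases)
 obtain z where z: "l = {v, z}" "v ~= z" using assms(5,7) by (elim link_at_cases)
 show ?thesis
 proof (cases "z = t")
  case True
  then have "rk v (Some f) l <= rk v (Some f) f" using assms z by (auto simp: rotational_def)
  moreover have "rk v (Some f) l ~= rk v (Some f) f" using assms by (subst rk_inj) auto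
  ultimately show ?thesis by simp
 next
  case False
  then have "z \<in> set R" "w \<in> set R" "z ~= w" using assms w z by (auto simp: rotational_def)
  then show ?thesis using assms(1) w z rank_cut_last[of R w z] by (auto simp: rotational_def)
 qed
qed

end

lemma routed_graph_H:
 assumes "rooted_graph V E t" "skipping_pattern V (E - separating_links V E) t \<pi>"
 shows "routed_graph V (E - separating_links V E) t \<pi>"
proof -
 interpret rooted_graph V E t by fact
 show ?thesis
  by unfold_locales (use simple t_in H_biconnected assms(2) in "auto simp: simple_graph_def")
qed

text \<open>Two far neighbours \<open>b\<close>, \<open>c\<close> of \<open>u\<close> are joined by
  a path that avoids \<open>u\<close> and the near side; with \<open>u\<close> it forms a cycle. Any
  near neighbour is an exit of this cycle at \<open>u\<close>, so \<open>cycle_escape\<close> forces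
  all near neighbours onto the same arc between \<open>b\<close> and \<open>c\<close>.\<close>

lemma (in rooted_graph) side_contiguous:
 assumes sk: "skipping_pattern V H t \<pi>" and res: "perfectly_resilient V H t \<pi>"
  and rot: "!!v. v \<in> V ==> v ~= t ==> rotational H t \<pi> (R v) v"
  and e: "{u, v} \<in> S0" and ex: "set (R u) Int sideA {u, v} ~= {}"
 shows "\<exists>xs ys As Bs. R u = xs @ ys & ys @ xs = As @ Bs & As ~= [] & Bs ~= [] &
  set As \<subseteq> sideA {u, v} & set Bs \<subseteq> sideB {u, v}"
proof -
 interpret h: routed_graph V H t \<pi> by (rule routed_graph_H[OF rooted_graph_axioms sk])
 let ?A = "sideA {u, v}" and ?B = "sideB {u, v}"
 note sd = sides[OF e]
 have u: "u \<in> V" "u ~= t" "u ~= v" using S0_D[OF e] by auto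
 note ru = rot[OF u(1,2)]
 have R: "distinct (R u)" "set (R u) = {w. {u, w} \<in> H} - {t}" using ru by (auto simp: rotational_def)
 have RAB: "w \<in> ?A | w \<in> ?B" if "w \<in> set (R u)" for w
  using that R(2) sd link_ends[of u w] S0_D[OF e] by auto
 have inl: "h.rk w (Some f) l < h.rk w (Some f) f"
  if "w ~= t" "f \<in> H" "l \<in> H" "w \<in> f" "w \<in> l" "t \<notin> f" "l ~= f" for w f l
  using that link_ends by (intro h.rotational_inport_last[OF rot]) (auto elim!: linkE)
 have main: "(\<forall>a\<in>set (R u). a \<in> ?A --> rank (cut b R') a < rank (cut b R') c) |
   (\<forall>a\<in>set (R u). a \<in> ?A --> rank (cut c R') a < rank (cut c R') b)"
  if R': "R' = R u" and bc: "b \<in> set (R u)" "c \<in> set (R u)" "b \<in> ?B" "c \<in> ?B" "b ~= c" for b c R'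
 proof -
  let ?L = "{l \<in> H. l \<subseteq> insert v ?B}"
  have "linked ?L b v" "linked ?L c v" using side_attach[OF e, of v ?B] bc by auto
  then have "linked ?L b c" by (blast intro: linked_sym linked_trans)
  from linked_link_path[OF this] obtain q where q: "link_path ?L q" "hd q = b" "last q = c" by blast
  have qs: "set q \<subseteq> insert v ?B"
  proof
   fix x assume "x \<in> set q"
   then show "x \<in> insert v ?B" using link_path_nodes[OF q(1)] q(2) bc(3) by (cases "x = b") auto
  qed
  define N where "N = length q"
  have N: "2 <= N" "q ~= []" using q bc(5) by (cases q; cases "tl q"; auto simp: link_path_def N_def)+
  have ends: "q ! 0 = b" "q ! (N - 1) = c" using q N by (auto simp: hd_conv_nth last_conv_nth N_def)
  have uq: "u \<notin> set q" using qs sd u by auto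
  have tq: "t \<notin> set (u # q)" using qs sd u S0_D[OF e] by auto
  have inlq: "h.rk w (Some f) l < h.rk w (Some f) f"
   if "w \<in> set (u # q)" "f \<in> H" "l \<in> H" "w \<in> f" "w \<in> l" "t \<notin> f" "l ~= f" for w f l
   using inl that tq by metis
  have Hbc: "{u, b} \<in> H" "{u, c} \<in> H" using bc R by auto
  have dq: "distinct (u # q)" "distinct (u # rev q)" using q(1) uq by (auto simp: link_path_def)
  have cyc: "{(u # p) ! i, (u # p) ! (Suc i mod length (u # p))} \<in> H"
   if p: "p = q | p = rev q" and i: "i < length (u # p)" for p i
  proof -
   have lp: "link_path H p" using p q(1) link_path_rev[OF q(1)] by (auto elim!: link_path_mono)
   have len: "length p = N" using p by (auto simp: N_def)
   have h: "p ! 0 = b & p ! (N - 1) = c | p ! 0 = c & p ! (N - 1) = b"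
    using p ends N by (auto simp: rev_nth N_def)
   consider "i = 0" | "0 < i" "i < N" | "i = N" using i len by fastforce
   then show ?thesis
   proof cases
    case 1
    then show ?thesis using h Hbc len N by auto
   next
    case 2
    with link_pathD[OF lp, of "i - 1"] len show ?thesis by (simp add: nth_Cons')
   next
    case 3
    then show ?thesis using h Hbc len N by (auto simp: nth_Cons' insert_commute)
   qed
  qed
  have tail: "{u, a} \<in> H" "a \<notin> set (u # q)" "a ~= t" "linked (avoid H (set (u # q))) a t"
   if "a \<in> set (R u)" "a \<in> ?A" for a
  proof -
   show "{u, a} \<in> H" "a ~= t" using that R by auto
   show "a \<notin> set (u # q)" using that qs sd by auto
   have "linked {l \<in> H. l \<subseteq> ?A} a t" using sideA_linked[OF e that(2)] by (rule linked_sym)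
   then show "linked (avoid H (set (u # q))) a t"
    by (rule linked_mono) (use qs sd in auto)
  qed
  have b: "b ~= t" "b \<in> V" "u ~= b" "u ~= c" using bc sd by auto
  show ?thesis
  \<comment> \<open>The direction in which a packet starts at \<open>b\<close> fixes the direction
    of travel around the cycle, and thereby the arc that has to contain the near neighbours.\<close>
  proof (cases "h.rk b None {b, q ! 1} < h.rk b None {u, b}")
   case True
   have "h.rk u (Some {c, u}) {u, a} < h.rk u (Some {c, u}) {u, b}" if a: "a \<in> set (R u)" "a \<in> ?A" for a
   proof -
    have "h.rk ((u # q) ! 0) (Some {(u # q) ! N, (u # q) ! 0}) {(u # q) ! 0, a} <
     h.rk ((u # q) ! 0) (Some {(u # q) ! N, (u # q) ! 0}) {(u # q) ! 0, (u # q) ! (Suc 0 mod length (u # q))}"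
     by (rule h.cycle_escape[OF h.Res_E[OF res] dq(1) _ tq cyc[of q, OF disjI1[OF refl]], where i = 1 and j = 0])
      (use tail[OF a] N True ends inlq in "simp_all add: N_def")
    with N ends show ?thesis by (simp add: nth_Cons' N_def)
   qed
   then show ?thesis using ru bc R R' by (auto simp: rotational_def insert_commute)
  next
   case False
   have bq: "{b, q ! 1} \<in> H" "q ! 1 ~= u" using link_pathD[OF q(1), of 0] ends N uq by (auto simp: N_def)
   then have "{b, q ! 1} ~= {u, b}" using b by (auto simp: doubleton_eq_iff)
   then have "h.rk b None {b, q ! 1} ~= h.rk b None {u, b}"
    using h.rk_inj[of b None "{b, q ! 1}" "{u, b}"] b bq Hbc by auto
   then have lt: "h.rk b None {b, u} < h.rk b None {q ! 1, b}" using False by (simp add: insert_commute)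
   have rq: "rev q ! (N - 1) = b" "rev q ! (N - 2) = q ! 1" "rev q ! 0 = c"
    using N ends by (simp_all add: rev_nth N_def Suc_diff_Suc numeral_2_eq_2)
   have "h.rk u (Some {b, u}) {u, a} < h.rk u (Some {b, u}) {u, c}" if a: "a \<in> set (R u)" "a \<in> ?A" for a
   proof -
    let ?c = "u # rev q"
    have "h.rk (?c ! 0) (Some {?c ! N, ?c ! 0}) {?c ! 0, a} <
     h.rk (?c ! 0) (Some {?c ! N, ?c ! 0}) {?c ! 0, ?c ! (Suc 0 mod length ?c)}"
     by (rule h.cycle_escape[OF h.Res_E[OF res] dq(2) _ _ cyc[of "rev q", OF disjI2[OF refl]], where i = N and j = "N - 1"])
      (use tail[OF a] N lt rq tq inlq in "simp_all add: N_def numeral_2_eq_2")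
    with N rq show ?thesis by (simp add: nth_Cons' N_def)
   qed
   then show ?thesis using ru bc R R' by (auto simp: rotational_def insert_commute)
  qed
 qed
 have "\<exists>xs ys As Bs. R u = xs @ ys & ys @ xs = As @ Bs & As ~= [] & Bs ~= [] &
   (\<forall>a\<in>set As. a \<in> ?A) & (\<forall>b\<in>set Bs. b \<notin> ?A)"
 proof (rule contiguous_rotation)
  obtain w where "w \<in> ?B" "{u, w} \<in> H" using side_neighbour[OF e, of ?B] by auto
  then have "w \<in> set (R u)" "w \<notin> ?A" using R sd by auto
  then show "\<exists>b\<in>set (R u). b \<notin> ?A" by auto
  fix b c assume "b \<in> set (R u)" "c \<in> set (R u)" "b \<notin> ?A" "c \<notin> ?A" "b ~= c"
  then show "(\<forall>a\<in>set (R u). a \<in> ?A --> rank (cut b (R u)) a < rank (cut b (R u)) c) |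
   (\<forall>a\<in>set (R u). a \<in> ?A --> rank (cut c (R u)) a < rank (cut c (R u)) b)"
   using main[OF refl] RAB by blast
 qed (use R(1) ex in auto)
 then obtain xs ys As Bs where *: "R u = xs @ ys" "ys @ xs = As @ Bs" "As ~= []" "Bs ~= []"
  "\<forall>a\<in>set As. a \<in> ?A" "\<forall>b\<in>set Bs. b \<notin> ?A" by auto
 have "set Bs \<subseteq> set (R u)" using arg_cong[OF *(2), of set] *(1) by auto
 then have "set Bs \<subseteq> ?B" using *(6) RAB by blast
 then show ?thesis using * by blast
qed

section \<open>Few links\<close>

text \<open>\<open>lt s a b\<close> is to be read as: a packet starting at \<open>s\<close> prefers
  \<open>a\<close> to \<open>b\<close>. So \<open>s\<close>, an inner entry of \<open>c\<close>,
  sends its own packets onwards along \<open>c\<close>.\<close>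

definition forward :: "('a => 'a => 'a => bool) => 'a list => 'a => bool" where
 "forward lt c s \<longleftrightarrow> (\<exists>a b. sublist [a, s, b] c & lt s b a)"

text \<open>Two nodes per direction are excluded rather than one, because one of them may be the
  node where packets leave the cycle, which says nothing about circulation.\<close>

definition consistent :: "('a => 'a => 'a => bool) => 'a set set => bool" where
 "consistent lt L \<longleftrightarrow> ~  (\<exists>c s1 s2 s3 s4. link_path L c & 3 <= length c & {last c, hd c} \<in> L & s1 ~= s2 & s3 ~= s4 &
  forward lt c s1 & forward lt c s2 & forward (%s a b. lt s b a) c s3 & forward (%s a b. lt s b a) c s4)"

lemma consistentD:
 assumes "consistent lt L" "link_path L c" "3 <= length c" "{last c, hd c} \<in> L"
  "forward lt c s1" "forward lt c s2" "s1 ~= s2"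
  "forward (%s a b. lt s b a) c s3" "forward (%s a b. lt s b a) c s4" "s3 ~= s4"
 shows False
 using assms unfolding consistent_def by blast

lemma consistent_mono: "consistent lt L ==> L' \<subseteq> L ==> consistent lt L'"
 unfolding consistent_def by (meson link_path_mono subsetD)



lemma sublist_triple:
 assumes "Suc (Suc i) < length xs"
 shows "sublist [xs ! i, xs ! Suc i, xs ! Suc (Suc i)] xs"
proof -
 have "xs = take i xs @ [xs ! i, xs ! Suc i, xs ! Suc (Suc i)] @ drop (Suc (Suc (Suc i))) xs"
  using assms by (simp add: Cons_nth_drop_Suc)
 then show ?thesis unfolding sublist_def by blast
qed

lemma sublist_triple_append1: "sublist [a, b, c] xs ==> sublist [a, b, c] (xs @ ys)"
 and sublist_triple_append2: "sublist [a, b, c] ys ==> sublist [a, b, c] (xs @ ys)"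
 by (auto simp: sublist_append)

lemma sublist_triple_rev: "sublist [a, b, c] (rev xs) \<longleftrightarrow> sublist [c, b, a] xs"
 using sublist_rev[of "[c, b, a]" xs] by simp

text \<open>A path of maximal length can be rotated at a neighbour of its first node. If all degrees were
 large, choosing the path such that the sixth neighbour of its first node comes as early as possible
 would make such a rotation contradict this choice: by consistency, the first node of the rotated path
 has nearly all of its neighbours among the few nodes just behind it.\<close>

lemma consistent_degree:
 assumes fin: "finite N" "N ~= {}" and L: "!!l. l \<in> L ==> \<exists>a\<in>N. \<exists>b\<in>N. a ~= b & l = {a, b}"
  and lt: "!!s a b. {s, a} \<in> L ==> {s, b} \<in> L ==> a ~= b ==> lt s a b | lt s b a"
  and con: "consistent lt L"
 shows "\<exists>s\<in>N. card {y. {s, y} \<in> L} <= 14"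
proof (rule ccontr)
 assume "~  ?thesis"
 then have deg: "14 < card {y. {s, y} \<in> L}" if "s \<in> N" for s using that by force
 have loop: "{x, x} \<notin> L" for x using L[of "{x, x}"] by (auto simp: doubleton_eq_iff)
 have LN: "x \<in> N & y \<in> N" if "{x, y} \<in> L" for x y using L[OF that] by (auto simp: doubleton_eq_iff)
 define Long where "Long p \<longleftrightarrow> link_path L p & set p \<subseteq> N & (\<forall>p'. link_path L p' --> set p' \<subseteq> N --> length p' <= length p)" for p
 define nb where "nb p = {i. i < length p & {p ! 0, p ! i} \<in> L}" for p :: "'a list"
 have finnb: "finite (nb p)" for p by (simp add: nb_def)
 have Long_nb: "\<exists>i\<in>nb p. p ! i = y" if "Long p" "{p ! 0, y} \<in> L" for p y
 proof (rule ccontr)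
  assume *: "~  ?thesis"
  have p: "link_path L p" "set p \<subseteq> N" "p ~= []" using that by (auto simp: Long_def link_path_def)
  have "y \<notin> set p" using * that(2) by (auto simp: nb_def in_set_conv_nth)
  then have "link_path L (y # p)" "set (y # p) \<subseteq> N"
   using p that(2) LN[OF that(2)] by (auto intro!: link_path_Cons simp: hd_conv_nth insert_commute)
  then have "length (y # p) <= length p" using that(1) unfolding Long_def by blast
  then show False by simp
 qed
 have card_nb: "14 < card (nb p)" if "Long p" for p
 proof -
  have p: "link_path L p" "p ~= []" "p ! 0 \<in> N" using that by (auto simp: Long_def link_path_def subset_iff)
  have "{y. {p ! 0, y} \<in> L} = (!) p ` nb p" using Long_nb[OF that] by (auto simp: nb_def)
  then have "card {y. {p ! 0, y} \<in> L} <= card (nb p)" using card_image_le[OF finnb] by metis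
  with deg[OF p(3)] show ?thesis by simp
 qed
 have "\<exists>p. Long p"
 proof -
  obtain s where s: "s \<in> N" using fin by auto
  define P where "P n \<longleftrightarrow> (\<exists>p. link_path L p & set p \<subseteq> N & length p = n)" for n
  have "P 1" using s by (auto simp: P_def link_path_def intro!: exI[of _ "[s]"])
  moreover have "\<forall>n. P n --> n <= card N"
   using fin by (auto simp: P_def link_path_def) (metis card_mono distinct_card)
  ultimately obtain n where "P n" "\<forall>k. P k --> k <= n" using Nat.ex_has_greatest_nat[of P 1 "card N"] by blast
  then show ?thesis unfolding P_def Long_def by auto
 qed
 \<comment> \<open>Six neighbours up to \<open>M\<close> leave room for three inner nodes between
   the first of them and \<open>M\<close>, since they force \<open>a + 5 <= M\<close>.\<close>
 define Q where "Q M \<longleftrightarrow> (\<exists>p. Long p & 6 <= card {i \<in> nb p. i <= M})" for M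
 have "\<exists>M. Q M"
 proof -
  obtain p where p: "Long p" using \<open>\<exists>p. Long p\<close> by auto
  have "{i \<in> nb p. i <= length p} = nb p" by (auto simp: nb_def)
  then have "Q (length p)" using p card_nb[OF p] unfolding Q_def by (intro exI[of _ p]) simp
  then show ?thesis by auto
 qed
 define M where "M = (LEAST M. Q M)"
 have QM: "Q M" unfolding M_def using \<open>\<exists>M. Q M\<close> by (rule LeastI_ex)
 have Qmin: "~  Q m" if "m < M" for m using not_less_Least[of m Q] that by (simp add: M_def)
 obtain p where p: "Long p" "6 <= card {i \<in> nb p. i <= M}" using QM by (auto simp: Q_def)
 have lp: "link_path L p" "set p \<subseteq> N" "distinct p" using p(1) by (auto simp: Long_def link_path_def)
 have nb0: "0 \<notin> nb p" using loop by (auto simp: nb_def)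
 have M0: "0 < M"
 proof (rule ccontr)
  assume "~  0 < M"
  then have "{i \<in> nb p. i <= M} = {}" using nb0 by auto
  from p(2) this show False by (simp only: card.empty not_numeral_le_zero)
 qed
 have less6: "card {i \<in> nb p. i <= M - 1} < 6" using Qmin[of "M - 1"] M0 p(1) by (auto simp: Q_def not_le)
 have sub: "{i \<in> nb p. i <= M} \<subseteq> insert M {i \<in> nb p. i <= M - 1}" by auto
 have Mnb: "M \<in> nb p"
 proof (rule ccontr)
  assume "M \<notin> nb p"
  then have "{i \<in> nb p. i <= M} = {i \<in> nb p. i <= M - 1}" using le_eq_less_or_eq by auto
  then show False using p(2) less6 by simp
 qed
 have c6: "card {i \<in> nb p. i <= M} <= 6"
  using card_mono[OF _ sub] less6 finnb card_insert_le_m1[of 6 "{i \<in> nb p. i <= M - 1}" M] by simp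
 define a where "a = Min {i \<in> nb p. i <= M}"
 have ne: "{i \<in> nb p. i <= M} ~= {}" using Mnb by auto
 have a: "a \<in> nb p" "a <= M" using Min_in[OF _ ne] finnb by (auto simp: a_def)
 have "{i \<in> nb p. i <= M} \<subseteq> {a..M}" using finnb by (auto simp: a_def)
 then have "6 <= card {a..M}" using p(2) card_mono[of "{a..M}"] by (meson finite_atLeastAtMost le_trans)
 then have aM: "a + 5 <= M" by simp
 have a0: "0 < a" using a nb0 by (cases a) auto
 \<comment> \<open>There are six neighbours up to \<open>M\<close> and at most seven in the
   following gap, together fewer than the assumed degree. The link from \<open>p ! d\<close> closes
   a cycle containing all nodes whose preferences are compared below.\<close>
 obtain d where d: "d \<in> nb p" "M + 8 <= d"
 proof (rule ccontr)
  assume "~  thesis"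
  then have "\<forall>d\<in>nb p. d < M + 8" using that by force
  then have "nb p \<subseteq> {i \<in> nb p. i <= M} Un {M<..<M + 8}" by auto
  then have "card (nb p) <= card ({i \<in> nb p. i <= M} Un {M<..<M + 8})" using finnb by (intro card_mono) auto
  also have "\<dots> <= 6 + 7" using card_Un_le[of "{i \<in> nb p. i <= M}" "{M<..<M + 8}"] c6 by simp
  finally show False using card_nb[OF p(1)] by simp
 qed
 have dl: "d < length p" "{p ! d, p ! 0} \<in> L" "{p ! a, p ! 0} \<in> L" "{p ! M, p ! 0} \<in> L" "M < length p"
  using d(1) a(1) Mnb by (auto simp: nb_def insert_commute)
 have step: "{p ! i, p ! Suc i} \<in> L" if "Suc i < length p" for i using link_pathD[OF lp(1) that] .
 define up where "up i \<longleftrightarrow> lt (p ! i) (p ! Suc i) (p ! (i - 1))" for i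
 define dn where "dn i \<longleftrightarrow> lt (p ! i) (p ! (i - 1)) (p ! Suc i)" for i
 have updn: "up i | dn i" if "0 < i" "i < d" for i
 proof -
  have "p ! (i - 1) ~= p ! Suc i" using lp(3) that dl(1) by (simp add: nth_eq_iff_index_eq)
  moreover have "{p ! i, p ! (i - 1)} \<in> L" "{p ! i, p ! Suc i} \<in> L"
   using step[of "i - 1"] step[of i] that dl(1) by (auto simp: insert_commute)
  ultimately show ?thesis using lt by (auto simp: up_def dn_def)
 qed
 have asc: "sublist [p ! (i - 1), p ! i, p ! Suc i] (drop k (take j p))"
  if "k < i" "Suc i < j" "j <= length p" for i j k
  using sublist_triple[of "i - 1 - k" "drop k (take j p)"] that by simp
 have one: "~  (i ~= i' & up i & up i' & k ~= k' & dn k & dn k')"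
  if "0 < i" "i < d" "0 < i'" "i' < d" "0 < k" "k < d" "0 < k'" "k' < d" for i i' k k'
 proof
  assume *: "i ~= i' & up i & up i' & k ~= k' & dn k & dn k'"
  have ne: "p ! i ~= p ! i'" "p ! k ~= p ! k'" using * lp(3) that dl(1) by (auto simp: nth_eq_iff_index_eq)
  have s: "sublist [p ! (i - 1), p ! i, p ! Suc i] (take (Suc d) p)" if "0 < i" "i < d" for i
   using asc[of 0 i "Suc d"] that dl(1) by simp
  show False
  proof (rule consistentD[OF con, of "take (Suc d) p" "p ! i" "p ! i'" "p ! k" "p ! k'"])
   show "{last (take (Suc d) p), hd (take (Suc d) p)} \<in> L"
    using dl(1,2) d(2) by (cases "p = []") (simp_all add: take_Suc_conv_app_nth hd_append hd_conv_nth)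
  qed (use link_path_take[OF lp(1)] s that ne * dl(1) d(2) in "auto simp: forward_def up_def dn_def")
 qed
 \<comment> \<open>On the cycle closed at \<open>d\<close>, one of the directions \<open>up\<close>
   and \<open>dn\<close> is preferred at all inner nodes with at most one exception;
   \<open>U\<close> is this direction.\<close>
 define U where "U i \<longleftrightarrow> (if \<exists>k k'. 0 < k & k < d & 0 < k' & k' < d & k ~= k' & dn k & dn k' then dn i else up i)" for i
 have U: "\<exists>i i'. i ~= i' & i \<in> {k, Suc k, Suc (Suc k)} & i' \<in> {k, Suc k, Suc (Suc k)} & U i & U i'"
  if k: "0 < k" "Suc (Suc k) < d" for k
 proof -
  have "U i | U i'" if "i \<in> {k, Suc k, Suc (Suc k)}" "i' \<in> {k, Suc k, Suc (Suc k)}" "i ~= i'" for i i'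
  proof -
   have i: "0 < i" "i < d" "0 < i'" "i' < d" using that k by auto
   show ?thesis
   proof (cases "\<exists>k k'. 0 < k & k < d & 0 < k' & k' < d & k ~= k' & dn k & dn k'")
    case True
    then obtain k k' where "0 < k" "k < d" "0 < k'" "k' < d" "k ~= k'" "dn k" "dn k'" by auto
    then have "~  (up i & up i')" using one[OF i, of k k'] that(3) by auto
    then show ?thesis using True updn[of i] updn[of i'] i by (auto simp: U_def)
   next
    case False
    then show ?thesis using updn[of i] updn[of i'] i that(3) unfolding U_def by metis
   qed
  qed
  then have "U k | U (Suc k)" "U k | U (Suc (Suc k))" "U (Suc k) | U (Suc (Suc k))" by auto
  then show ?thesis by (metis insertCI n_not_Suc_n less_SucI less_irrefl_nat lessI)
 qed
 \<comment> \<open>Among three consecutive inner nodes at least two have the prevailing preference.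
   A cycle through one such triple upwards and another one downwards thus has two forward and two
   backward nodes.\<close>
 have contra: False
  if c: "link_path L c" "3 <= length c" "{last c, hd c} \<in> L"
   and k: "0 < k" "Suc (Suc k) < d" "!!i. i \<in> {k, Suc k, Suc (Suc k)} ==> sublist [p ! (i - 1), p ! i, p ! Suc i] c"
   and k': "0 < k'" "Suc (Suc k') < d" "!!i. i \<in> {k', Suc k', Suc (Suc k')} ==> sublist [p ! Suc i, p ! i, p ! (i - 1)] c"
  for c k k'
 proof -
  obtain i1 i2 where i: "i1 ~= i2" "i1 \<in> {k, Suc k, Suc (Suc k)}" "i2 \<in> {k, Suc k, Suc (Suc k)}" "U i1" "U i2"
   using U[OF k(1,2)] by (elim exE conjE) (rule that; assumption)
  obtain j1 j2 where j: "j1 ~= j2" "j1 \<in> {k', Suc k', Suc (Suc k')}" "j2 \<in> {k', Suc k', Suc (Suc k')}" "U j1" "U j2"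
   using U[OF k'(1,2)] by (elim exE conjE) (rule that; assumption)
  have ne: "p ! i1 ~= p ! i2" "p ! j1 ~= p ! j2"
   using i(1-3) j(1-3) k(2) k'(2) lp(3) dl(1) by (auto simp: nth_eq_iff_index_eq)
  have si: "sublist [p ! (i - 1), p ! i, p ! Suc i] c" if "i = i1 | i = i2" for i using k(3) i that by blast
  have sj: "sublist [p ! Suc i, p ! i, p ! (i - 1)] c" if "i = j1 | i = j2" for i using k'(3) j that by blast
  show False
  proof (cases "\<exists>k k'. 0 < k & k < d & 0 < k' & k' < d & k ~= k' & dn k & dn k'")
   case True
   then have "U = dn" by (auto simp: U_def fun_eq_iff)
   then have "forward (%s a b. lt s b a) c (p ! i1)" "forward (%s a b. lt s b a) c (p ! i2)"
    "forward lt c (p ! j1)" "forward lt c (p ! j2)"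
    using i j si sj by (auto simp: forward_def dn_def)
   then show False using consistentD[OF con c] ne by blast
  next
   case False
   then have "U = up" by (auto simp: U_def fun_eq_iff)
   then have "forward lt c (p ! i1)" "forward lt c (p ! i2)"
    "forward (%s a b. lt s b a) c (p ! j1)" "forward (%s a b. lt s b a) c (p ! j2)"
    using i j si sj by (auto simp: forward_def up_def)
   then show False using consistentD[OF con c] ne by blast
  qed
 qed
 have desc: "sublist [p ! Suc i, p ! i, p ! (i - 1)] (rev (drop k (take j p)))"
  if "k < i" "Suc i < j" "j <= length p" for i j k
  using asc[OF that] by (simp add: sublist_triple_rev)
 have disj: "set (drop k (take j p)) Int set (drop k' (take j' p)) = {}" if "j <= k'" "j' <= length p" for k j k' j'
  using that lp(3) by (auto simp: set_conv_nth nth_eq_iff_index_eq)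
 have seg: "link_path L (drop k (take j p))" if "k < j" "j <= length p" for k j
  using that link_path_take[OF lp(1), of j] by (intro link_path_drop) auto
 have segends: "hd (drop k (take j p)) = p ! k" "last (drop k (take j p)) = p ! (j - 1)" if "k < j" "j <= length p" for k j
  using that by (auto simp: hd_drop_conv_nth last_conv_nth)
 \<comment> \<open>Any other neighbour of \<open>p ! (M - 1)\<close> closes a forbidden cycle: the
   initial piece upwards and then from \<open>k\<close> down to \<open>M\<close>, or the piece from
   \<open>a\<close> upwards and then from \<open>k\<close> down to the first node. The margin of
   four leaves room for a descending triple.\<close>
 have nbs: "(M <= k & k < M + 4) | k < 4 | (a <= k & k <= M - 2)"
  if k: "k < length p" "{p ! (M - 1), p ! k} \<in> L" for k
 proof (rule ccontr)
  assume neg: "~  ?thesis"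
  have "k ~= M - 1" using loop k by auto
  then consider "M + 4 <= k" | "4 <= k" "k < a" using neg by linarith
  then show False
  proof cases
   case 1
   let ?c = "drop 0 (take M p) @ rev (drop M (take (Suc k) p))"
   have s: "0 < M" "M <= length p" "M < Suc k" "Suc k <= length p" using 1 k M0 by auto
   show False
   proof (rule contra[of ?c 1 "Suc M"])
    show "link_path L ?c"
     using seg[OF s(1,2)] link_path_rev[OF seg[OF s(3,4)]] segends[OF s(1,2)] segends[OF s(3,4)] k disj[of M M "Suc k" 0] s
     by (intro link_path_append) (auto simp: hd_rev)
    show "3 <= length ?c" using s aM by simp
    show "{last ?c, hd ?c} \<in> L"
     using segends[OF s(1,2)] segends[OF s(3,4)] dl(4) s by (cases "p = []") (simp_all add: last_rev hd_append)
    show "sublist [p ! (i - 1), p ! i, p ! Suc i] ?c" if "i \<in> {1, Suc 1, Suc (Suc 1)}" for i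
     by (intro sublist_triple_append1 asc) (use that aM a0 s in auto)
    show "sublist [p ! Suc i, p ! i, p ! (i - 1)] ?c" if "i \<in> {Suc M, Suc (Suc M), Suc (Suc (Suc M))}" for i
     by (intro sublist_triple_append2 desc) (use that 1 s in auto)
   qed (use d aM in auto)
  next
   case 2
   let ?c = "drop a (take M p) @ rev (drop 0 (take (Suc k) p))"
   have s: "a < M" "M <= length p" "0 < Suc k" "Suc k <= length p" using 2 k aM dl by auto
   show False
   proof (rule contra[of ?c "Suc a" 1])
    show "link_path L ?c"
     using seg[OF s(1,2)] link_path_rev[OF seg[OF s(3,4)]] segends[OF s(1,2)] segends[OF s(3,4)] k
      disj[of "Suc k" a M 0] 2(2) s
     by (intro link_path_append) (auto simp: hd_rev)
    show "3 <= length ?c" using s 2 by simp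
    show "{last ?c, hd ?c} \<in> L"
     using segends[OF s(1,2)] segends[OF s(3,4)] dl(3) s by (cases "p = []") (simp_all add: last_rev hd_append insert_commute)
    show "sublist [p ! (i - 1), p ! i, p ! Suc i] ?c" if "i \<in> {Suc a, Suc (Suc a), Suc (Suc (Suc a))}" for i
     by (intro sublist_triple_append1 asc) (use that aM s in auto)
    show "sublist [p ! Suc i, p ! i, p ! (i - 1)] ?c" if "i \<in> {1, Suc 1, Suc (Suc 1)}" for i
     by (intro sublist_triple_append2 desc) (use that 2 s in auto)
   qed (use d aM in auto)
  qed
 qed
 \<comment> \<open>Rotation of \<open>p\<close> at its neighbour \<open>p ! M\<close>: a path of the
   same length that starts with \<open>p ! (M - 1)\<close>.\<close>
 define p' where "p' = rev (drop 0 (take M p)) @ drop M (take (length p) p)"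
 have lenp': "length p' = length p" using dl by (simp add: p'_def)
 have p'L: "Long p'"
 proof -
  have s: "0 < M" "M <= length p" "M < length p" "length p <= length p" using M0 dl by auto
  have "link_path L p'" unfolding p'_def
   using link_path_rev[OF seg[OF s(1,2)]] seg[OF s(3,4)] segends[OF s(1,2)] segends[OF s(3,4)] dl(4) disj[of M M "length p" 0] s
   by (intro link_path_append) (auto simp: last_rev insert_commute)
  moreover have "set p' \<subseteq> N" using lp(2) by (auto simp: p'_def dest: in_set_dropD in_set_takeD)
  ultimately show ?thesis using p(1) lenp' by (simp add: Long_def)
 qed
 have p'nth: "p' ! i = p ! (M - 1 - i)" if "i < M" for i
  using that dl(5) by (simp add: p'_def nth_append rev_nth)
 have big: "p' ! i = p ! i" if "M <= i" "i < length p" for i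
  using that dl(5) by (simp add: p'_def nth_append)
 let ?f = "%i. if i < M then M - 1 - i else i"
 have fi: "p' ! i = p ! ?f i" "?f i < length p" if "i < length p" for i
  using p'nth[of i] big[of i] that dl(5) by auto
 \<comment> \<open>At most four plus four neighbours lie outside the initial piece of length
   \<open>M - a\<close>; as the degree exceeds 14, at least six lie inside it, contrary to the
   minimality of \<open>M\<close>.\<close>
 have "nb p' \<subseteq> {M..<M + 4} Un {M - 4..<M} Un {i \<in> nb p'. i <= M - 1 - a}"
 proof
  fix i assume i: "i \<in> nb p'"
  then have il: "i < length p" "{p' ! 0, p' ! i} \<in> L" by (auto simp: nb_def lenp')
  then have "{p ! (M - 1), p ! ?f i} \<in> L" using fi[of i] p'nth[of 0] M0 by simp
  then have "(M <= ?f i & ?f i < M + 4) | ?f i < 4 | (a <= ?f i & ?f i <= M - 2)"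
   using nbs[of "?f i"] fi[OF il(1)] by blast
  then show "i \<in> {M..<M + 4} Un {M - 4..<M} Un {i \<in> nb p'. i <= M - 1 - a}"
   using i aM by (auto split: if_splits)
 qed
 then have "card (nb p') <= card ({M..<M + 4} Un {M - 4..<M} Un {i \<in> nb p'. i <= M - 1 - a})"
  using finnb by (intro card_mono) auto
 also have "\<dots> <= card ({M..<M + 4} Un {M - 4..<M}) + card {i \<in> nb p'. i <= M - 1 - a}" by (rule card_Un_le)
 also have "card ({M..<M + 4} Un {M - 4..<M}) <= 4 + 4" using card_Un_le[of "{M..<M + 4}" "{M - 4..<M}"] by simp
 finally have "14 < 8 + card {i \<in> nb p'. i <= M - 1 - a}" using card_nb[OF p'L] by simp
 then have "Q (M - 1 - a)" unfolding Q_def using p'L by (intro exI[of _ p']) simp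
 then show False using Qmin[of "M - 1 - a"] M0 a0 by simp
qed

lemma consistent_card:
 assumes "finite N" "!!l. l \<in> L ==> \<exists>a\<in>N. \<exists>b\<in>N. a ~= b & l = {a, b}"
  "!!s a b. {s, a} \<in> L ==> {s, b} \<in> L ==> a ~= b ==> lt s a b | lt s b a" "consistent lt L"
 shows "card L <= 14 * card N"
 using assms
proof (induction "card N" arbitrary: N L)
 case 0
 then have "L = {}" by fastforce
 then show ?case by simp
next
 case (Suc n)
 then have "N ~= {}" by auto
 then obtain s where s: "s \<in> N" "card {y. {s, y} \<in> L} <= 14"
  using consistent_degree[OF Suc.prems(1) _ Suc.prems(2-4)] by blast
 have LN: "x \<in> N & y \<in> N" if "{x, y} \<in> L" for x y using Suc.prems(2)[OF that] by (auto simp: doubleton_eq_iff)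
 let ?L = "{l \<in> L. s \<notin> l}"
 have "card ?L <= 14 * card (N - {s})"
 proof (rule Suc.hyps(1))
  show "n = card (N - {s})" using Suc.hyps(2) s Suc.prems(1) by simp
  show "\<exists>a\<in>N - {s}. \<exists>b\<in>N - {s}. a ~= b & l = {a, b}" if "l \<in> ?L" for l
   using Suc.prems(2)[of l] that by auto
  show "consistent lt ?L" by (rule consistent_mono[OF Suc.prems(4)]) auto
 qed (use Suc.prems in auto)
 moreover have "L \<subseteq> ?L Un (%y. {s, y}) ` {y. {s, y} \<in> L}"
  using Suc.prems(2) by (fastforce simp: insert_commute)
 moreover have fin: "finite {y. {s, y} \<in> L}" using LN Suc.prems(1) by (auto intro: finite_subset[of _ N])
 moreover have "finite L" using Suc.prems(1,2) by (auto intro!: finite_subset[of L "Pow N"])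
 ultimately have "card L <= card (?L Un (%y. {s, y}) ` {y. {s, y} \<in> L})"
  by (intro card_mono) simp_all
 also have "\<dots> <= card ?L + card ((%y. {s, y}) ` {y. {s, y} \<in> L})" by (rule card_Un_le)
 also have "card ((%y. {s, y}) ` {y. {s, y} \<in> L}) <= 14" using card_image_le[OF fin] s(2) le_trans by blast
 finally have "card L <= 14 * card (N - {s}) + 14" using \<open>card ?L <= 14 * card (N - {s})\<close> by simp
 with s(1) Suc.prems(1) Suc.hyps(2) show ?case by simp
qed

text \<open>Let \<open>w\<close> be a neighbour of \<open>t\<close>, and consider a cycle avoiding
  both. Since \<open>t\<close> is no cut node, some node \<open>x\<close> of the cycle has an exit
  \<open>r\<close> leading to \<open>w\<close> and then to \<open>t\<close>. Circulation in either
  direction must leave at \<open>x\<close>, which puts \<open>r\<close> on both arcs between the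
  cycle neighbours of \<open>x\<close>. The 16 is 14 for the links without \<open>t\<close> and
  \<open>w\<close>, plus two stars.\<close>

lemma (in routed_graph) card_links:
 assumes res: "Res E" and rot: "!!v. v \<in> V ==> v ~= t ==> rotational E t \<pi> (R v) v"
 shows "card E <= 16 * card V"
proof (cases "\<exists>w. {t, w} \<in> E")
 case False
 have "E = {}"
 proof (rule ccontr)
  assume "E ~= {}"
  then obtain l where l: "l \<in> E" by auto
  then obtain x y where xy: "{x, y} \<in> E" "x ~= y" "x \<in> V" "y \<in> V" by (metis linkE)
  define z where "z = (if x = t then y else x)"
  have z: "z \<in> V" "z ~= t" using xy by (auto simp: z_def)
  then have "linked E t z" using biconn t_in by (auto simp: biconnected_def graph_connected_def)
  then show False using linked_exit[of E t z "{t}"] z(2) False by auto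
 qed
 then show ?thesis by simp
next
 case True
 then obtain w where w: "{t, w} \<in> E" by auto
 have wt: "w ~= t" "w \<in> V" using link_ends[OF w] by auto
 define N where "N = V - {t, w}"
 define L where "L = {l \<in> E. l \<subseteq> N}"
 define lt where "lt s a b \<longleftrightarrow> rk s None {s, a} < rk s None {s, b}" for s a b
 have esc: "rk x (Some {P, x}) {x, r} < rk x (Some {P, x}) {x, Q}"
  if c: "link_path L c" "3 <= length c" "{last c, hd c} \<in> L"
   and r: "{x, r} \<in> E" "r \<notin> set c" "r ~= t" "linked (avoid E (set c)) r t"
   and s: "forward lt c s" "s ~= x"
   and x: "k < length c" "x = c ! k" "m < length c" "Suc m mod length c = k" "P = c ! m" "Q = c ! (Suc k mod length c)"
  for c x r s k m P Q
 proof -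
  obtain a b where ab: "sublist [a, s, b] c" "lt s b a" using s(1) by (auto simp: forward_def)
  then obtain X Z where c': "c = X @ [a, s, b] @ Z" by (auto simp: sublist_def)
  let ?i = "Suc (length X)"
  have i: "c ! ?i = s" "c ! length X = a" "Suc ?i < length c" "c ! Suc ?i = b" by (simp_all add: c' nth_append)
  have cyc: "{c ! i, c ! (Suc i mod length c)} \<in> L" if "i < length c" for i
  proof (cases "Suc i = length c")
   case True
   then have "i = length c - 1" by simp
   moreover have "c ~= []" using c(2) by auto
   ultimately have "c ! i = last c" "c ! 0 = hd c" by (simp_all add: last_conv_nth hd_conv_nth)
   with True c show ?thesis by simp
  next
   case False
   with link_pathD[OF c(1), of i] that show ?thesis by simp
  qed
  have cN: "v \<in> N" if "v \<in> set c" for v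
   using that cyc by (auto simp: in_set_conv_nth L_def)
  have "rk (c ! k) (Some {c ! m, c ! k}) {c ! k, r} < rk (c ! k) (Some {c ! m, c ! k}) {c ! k, c ! (Suc k mod length c)}"
  proof (rule cycle_escape[OF res, where i = ?i and j = "length X"])
   show "distinct c" using c(1) by (simp add: link_path_def)
   show "t \<notin> set c" using cN by (auto simp: N_def)
   show "?i ~= k" using s(2) x(2) i(1) by auto
   show "rk (c ! ?i) None {c ! ?i, c ! (Suc ?i mod length c)} < rk (c ! ?i) None {c ! length X, c ! ?i}"
    using ab(2) i by (simp add: lt_def insert_commute)
   show "rk v (Some f) l < rk v (Some f) f"
    if "v \<in> set c" "f \<in> E" "l \<in> E" "v \<in> f" "v \<in> l" "t \<notin> f" "l ~= f" for v f l
    using that cN[OF that(1)] by (intro rotational_inport_last[OF rot]) (auto simp: N_def)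
  qed (use c r x cyc i in "auto simp: L_def")
  with x show ?thesis by simp
 qed
 have "consistent lt L"
  unfolding consistent_def
 proof (intro notI, elim exE conjE)
  fix c s1 s2 s3 s4
  assume c: "link_path L c" "3 <= length c" "{last c, hd c} \<in> L" and ne: "s1 ~= s2" "s3 ~= s4"
   and f: "forward lt c s1" "forward lt c s2"
   and b: "forward (%s a b. lt s b a) c s3" "forward (%s a b. lt s b a) c s4"
  define n where "n = length c"
  have n: "3 <= n" "c ~= []" using c by (auto simp: n_def)
  have dc: "distinct c" using c(1) by (simp add: link_path_def)
  have cN: "v \<in> N" if "v \<in> set c" for v
   using that link_path_nodes[OF c(1) that] c(3) n by (cases "v = hd c") (auto simp: L_def)
  have h: "hd c \<in> set c" using n by simp
  have "linked (avoid E {t}) (hd c) w"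
   by (rule connected_withoutD[where V = V]) (use biconn t_in wt cN[OF h] in "auto simp: biconnected_def N_def")
  moreover have "w \<notin> set c" using cN by (auto simp: N_def)
  ultimately obtain x r where x: "x \<in> set c" "r \<notin> set c" "{x, r} \<in> avoid E {t}"
   "linked {l \<in> avoid E {t}. l Int set c = {}} r w"
   using linked_exit[of _ "hd c" w "set c"] h by blast
  have "linked (avoid E (set c)) r w" by (rule linked_mono[OF x(4)]) auto
  moreover have "linked (avoid E (set c)) w t"
   using w \<open>w \<notin> set c\<close> cN by (intro linked_link) (auto simp: N_def insert_commute)
  ultimately have tail: "{x, r} \<in> E" "r \<notin> set c" "r ~= t" "linked (avoid E (set c)) r t"
   using x by (auto intro: linked_trans)
  obtain k where k: "k < n" "x = c ! k" using x(1) by (auto simp: in_set_conv_nth n_def)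
  define m where "m = (if k = 0 then n - 1 else k - 1)"
  define m' where "m' = (if Suc k = n then 0 else Suc k)"
  have m: "m < n" "Suc m mod n = k" and m': "m' < n" "Suc k mod n = m'"
   using k n by (auto simp: m_def m'_def)
  have mm: "m ~= m'" "m ~= k" "m' ~= k" using n k by (auto simp: m_def m'_def split: if_splits)
  \<comment> \<open>Of two forward nodes at least one differs from the exit node \<open>x\<close>,
    as \<open>cycle_escape\<close> demands.\<close>
  obtain s where s: "forward lt c s" "s ~= x" using f ne(1) by metis
  have 1: "rk x (Some {c ! m, x}) {x, r} < rk x (Some {c ! m, x}) {x, c ! m'}"
   by (rule esc[OF c tail s]) (use k m m' in "auto simp: n_def")
  obtain s' where s': "forward (%s a b. lt s b a) c s'" "s' ~= x" using b ne(2) by metis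
  have "forward lt (rev c) s'" using s'(1) unfolding forward_def by (metis sublist_triple_rev)
  have 2: "rk x (Some {c ! m', x}) {x, r} < rk x (Some {c ! m', x}) {x, c ! m}"
  proof (rule esc[of "rev c" x r s' "n - 1 - k" "n - 1 - m'"])
   show "link_path L (rev c)" by (rule link_path_rev[OF c(1)])
   show "{last (rev c), hd (rev c)} \<in> L" using c(3) n by (simp add: last_rev hd_rev insert_commute)
   show "Suc (n - 1 - m') mod length (rev c) = n - 1 - k"
    using k n by (auto simp: m'_def n_def[symmetric] Suc_diff_Suc)
   show "c ! m = rev c ! (Suc (n - 1 - k) mod length (rev c))"
    using k n by (auto simp: m_def n_def[symmetric] rev_nth Suc_diff_Suc)
  qed (use tail s' k m' c(2) \<open>forward lt (rev c) s'\<close> in "auto simp: rev_nth n_def")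
  have xV: "x \<in> V" "x ~= t" using cN[OF x(1)] by (auto simp: N_def)
  note ro = rot[OF xV]
  have nbr: "c ! i \<in> set (R x)" if "i = m | i = m'" for i
  proof -
   have ii: "i < n" using that m m' by auto
   have "{x, c ! i} \<in> L"
   proof (cases "i = m'")
    case True
    show ?thesis
    proof (cases "Suc k = n")
     case last: True
     then have "k = length c - 1" by (simp add: n_def)
     then have "c ! k = last c" "c ! m' = hd c" using n last by (simp_all add: last_conv_nth hd_conv_nth m'_def)
     with c(3) True k show ?thesis by simp
    next
     case False
     with link_pathD[OF c(1), of k] k True show ?thesis by (simp add: m'_def n_def)
    qed
   next
    case False
    then have "i = m" using that by simp
    then show ?thesis using link_pathD[OF c(1), of "k - 1"] k c(3) n
     by (auto simp: m_def n_def last_conv_nth hd_conv_nth insert_commute split: if_splits)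
   qed
   moreover have "c ! i ~= t" using cN[of "c ! i"] ii by (auto simp: N_def n_def)
   ultimately show ?thesis using ro by (auto simp: rotational_def L_def)
  qed
  have rR: "r \<in> set (R x)" using tail ro by (auto simp: rotational_def)
  have "c ! m ~= c ! m'" using dc m m' mm by (simp add: nth_eq_iff_index_eq n_def)
  moreover have key: "rk x (Some {q, x}) {x, r} < rk x (Some {q, x}) {x, q'} \<longleftrightarrow>
    rank (cut q (R x)) r < rank (cut q (R x)) q'" if "q \<in> set (R x)" "q' \<in> set (R x)" for q q'
  proof -
   have "\<forall>w\<in>set (R x). \<forall>a\<in>set (R x). \<forall>b\<in>set (R x). rk x (Some {x, w}) {x, a} < rk x (Some {x, w}) {x, b} \<longleftrightarrow>
     rank (cut w (R x)) a < rank (cut w (R x)) b"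
    using ro unfolding rotational_def by (elim conjE)
   from bspec[OF bspec[OF bspec[OF this that(1)] rR] that(2)] show ?thesis by (simp add: insert_commute)
  qed
  moreover have "distinct (R x)" using ro by (simp add: rotational_def)
  ultimately show False
   using cut_antisym[of "R x" "c ! m" "c ! m'" r] 1 2 nbr rR by simp
 qed
 moreover have "lt s a b | lt s b a" if "{s, a} \<in> L" "{s, b} \<in> L" "a ~= b" for s a b
 proof -
  have "s \<in> V" "s ~= t" "{s, a} ~= {s, b}" using that by (auto simp: L_def N_def doubleton_eq_iff)
  then have "rk s None {s, a} ~= rk s None {s, b}" using that by (subst rk_inj) (auto simp: L_def)
  then show ?thesis by (auto simp: lt_def)
 qed
 ultimately have "card L <= 14 * card N"
 proof (intro consistent_card[where lt = lt])
  show "\<exists>a\<in>N. \<exists>b\<in>N. a ~= b & l = {a, b}" if "l \<in> L" for l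
  proof -
   have "l \<in> E" "l \<subseteq> N" using that by (auto simp: L_def)
   then show ?thesis by (metis insert_subset linkE)
  qed
 qed (use finite_V in "simp_all add: N_def")
 moreover have "card N <= card V" using finite_V by (auto simp: N_def intro: card_mono)
 moreover have star: "card {l \<in> E. z \<in> l} <= card V" for z
 proof -
  have "{l \<in> E. z \<in> l} \<subseteq> (%y. {z, y}) ` V" by (auto elim!: linkE simp: insert_commute)
  then show ?thesis by (meson card_image_le card_mono finite_V finite_imageI le_trans)
 qed
 moreover have lV: "l \<subseteq> V" if "l \<in> E" for l using that by (auto elim!: linkE)
 have "E \<subseteq> L Un {l \<in> E. t \<in> l} Un {l \<in> E. w \<in> l}" using lV by (auto simp: L_def N_def)
 then have "card E <= card (L Un {l \<in> E. t \<in> l} Un {l \<in> E. w \<in> l})"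
  using finite_E by (intro card_mono) (auto simp: L_def)
 then have "card E <= card L + card {l \<in> E. t \<in> l} + card {l \<in> E. w \<in> l}"
  using card_Un_le[of "L Un {l \<in> E. t \<in> l}" "{l \<in> E. w \<in> l}"] card_Un_le[of L "{l \<in> E. t \<in> l}"] by linarith
 ultimately show ?thesis using star[of t] star[of w] by linarith
qed

section \<open>Right-hand rules of plane embeddings\<close>

lemma pathstart_polyline: "pathstart (polyline (a # xs)) = a"
 by (cases "(a # xs)" rule: polyline.cases) auto

lemma polyline_segment: "closed_segment a b \<subseteq> path_image (polyline (a # b # xs))"
proof (cases xs)
 case (Cons c ys)
 have "path_image (linepath a b +++ polyline (b # c # ys)) = path_image (linepath a b) Un path_image (polyline (b # c # ys))"
  by (rule path_image_join) (simp add: pathstart_polyline)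
 with Cons show ?thesis by simp
qed simp

lemma polyline_arc_ne: "arc (polyline (a # b # xs)) ==> a ~= b"
proof
 assume *: "arc (polyline (a # b # xs))" "a = b"
 show False
 proof (cases xs)
  case Nil
  with * arc_distinct_ends[of "linepath a b"] show ?thesis by simp
 next
  case (Cons c ys)
  then have "inj_on (linepath a a +++ polyline (a # c # ys)) {0..1}" using * by (simp add: arc_def)
  moreover have "(linepath a a +++ polyline (a # c # ys)) 0 = (linepath a a +++ polyline (a # c # ys)) (1/2)"
   by (simp add: joinpaths_def linepath_def)
  ultimately show False using inj_onD[of "linepath a a +++ polyline (a # c # ys)" "{0..1}" 0 "1/2"] by simp
 qed
qed

text \<open>The first segments of two arcs leaving \<open>v\<close> in the same direction would
  overlap beyond \<open>v\<close>. Hence angles distinguish the links at \<open>v\<close>.\<close>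

lemma link_directions:
 assumes D: "plane_embedding V E D" and G: "simple_graph V E"
  and e: "e \<in> links_at E v" "f \<in> links_at E v"
 shows "link_direction D v e ~= 0"
  and "e ~= f ==> 0 < c ==> link_direction D v f ~= of_real c * link_direction D v e"
proof -
 have *: "\<exists>w h xs. e = {v, w} & v ~= w & v \<in> V & bends D v w @ [pos D w] = h # xs & link_direction D v e = h - pos D v &
   h ~= pos D v & closed_segment (pos D v) h \<subseteq> path_image (link_arc D v w)" if "e \<in> links_at E v" for e
 proof -
  have "e \<in> E" "v \<in> e" "\<exists>x\<in>V. \<exists>y\<in>V. x ~= y & e = {x, y}"
   using that G by (simp_all add: links_at_def simple_graph_def)
  then obtain x y where "x \<in> V" "y \<in> V" "x ~= y" "e = {x, y}" by blast
  then obtain w where w: "e = {v, w}" "v ~= w" "v \<in> V" "e \<in> E"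
   using \<open>e \<in> E\<close> \<open>v \<in> e\<close> by (intro that[of "if v = x then y else x"]) auto
  obtain h xs where h: "bends D v w @ [pos D w] = h # xs" by (cases "bends D v w") auto
  have arc: "link_arc D v w = polyline (pos D v # h # xs)" using h by (simp add: link_arc_def)
  have "arc (link_arc D v w)" using D w by (auto simp: plane_embedding_def)
  then have "h ~= pos D v" using polyline_arc_ne arc by metis
  moreover have "link_direction D v e = h - pos D v" using w h by (simp add: link_direction_def Let_def)
  moreover have "closed_segment (pos D v) h \<subseteq> path_image (link_arc D v w)"
   unfolding arc by (rule polyline_segment)
  ultimately show ?thesis using w h by blast
 qed
 obtain w h xs where w: "e = {v, w}" "v ~= w" "v \<in> V" "bends D v w @ [pos D w] = h # xs" "link_direction D v e = h - pos D v"
  "h ~= pos D v" "closed_segment (pos D v) h \<subseteq> path_image (link_arc D v w)" using *[OF e(1)] by blast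
 show "link_direction D v e ~= 0" using w by simp
 assume ne: "e ~= f" and c: "0 < c"
 obtain w' h' xs' where w': "f = {v, w'}" "v ~= w'" "link_direction D v f = h' - pos D v"
  "h' ~= pos D v" "closed_segment (pos D v) h' \<subseteq> path_image (link_arc D v w')" using *[OF e(2)] by blast
 show "link_direction D v f ~= of_real c * link_direction D v e"
 proof
  assume eq: "link_direction D v f = of_real c * link_direction D v e"
  \<comment> \<open>Scaling by \<open>min 1 c\<close> gives a point that lies on both first segments
    and differs from \<open>v\<close>.\<close>
  define s where "s = min 1 c"
  have s: "0 < s" "s <= 1" "s <= c" using c by (auto simp: s_def)
  define z where "z = pos D v + of_real s * (h - pos D v)"
  have "z \<in> closed_segment (pos D v) h"
   unfolding in_segment using s by (intro exI[of _ s]) (simp add: z_def algebra_simps scaleR_conv_of_real)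
  moreover have "z \<in> closed_segment (pos D v) h'"
  proof -
   have "h' - pos D v = of_real c * (h - pos D v)" using eq w(5) w'(3) by simp
   then have "of_real (s / c) * (h' - pos D v) = of_real s * (h - pos D v)" using c by simp
   then have "z = pos D v + of_real (s / c) * (h' - pos D v)" by (simp only: z_def)
   moreover have "p + k * (q - p) = (1 - k) * p + k * q" for p q k :: complex by (simp add: algebra_simps)
   ultimately have "z = (1 - s / c) *\<^sub>R pos D v + (s / c) *\<^sub>R h'"
    by (simp only: scaleR_conv_of_real of_real_diff of_real_1)
   then show ?thesis unfolding in_segment using s c by (intro exI[of _ "s / c"]) simp
  qed
  ultimately have "z \<in> path_image (link_arc D v w) Int path_image (link_arc D v w')" using w(7) w'(5) by blast
  also have "\<dots> \<subseteq> pos D ` ({v, w} Int {v, w'})"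
  proof -
   have "{v, w} \<in> E" "{v, w'} \<in> E" "{v, w} ~= {v, w'}" using e w(1) w'(1) ne by (auto simp: links_at_def)
   then show ?thesis using D unfolding plane_embedding_def by blast
  qed
  also have "\<dots> \<subseteq> {pos D v}" using ne w(1,2) w'(1,2) by auto
  finally show False using s(1) w(6) by (simp add: z_def)
 qed
qed

lemma right_hand_eqI:
 assumes "set xs = links_at E v" "sorted_wrt (<) (map (link_angle D v f) xs)"
 shows "right_hand E D v f = xs"
 unfolding right_hand_def
proof (rule the_equality)
 fix ys assume ys: "set ys = links_at E v & sorted_wrt (<) (map (link_angle D v f) ys)"
 let ?g = "link_angle D v f"
 have "map ?g ys = map ?g xs"
  by (rule strict_sorted_equal) (use assms ys in auto)
 moreover have "distinct (map ?g xs)" using assms(2) strict_sorted_iff by blast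
 then have "inj_on ?g (set xs Un set ys)" using assms(1) ys by (simp add: distinct_map)
 ultimately show "ys = xs" using map_inj_on[of ?g ys xs] by (simp add: sup_commute)
qed (use assms in simp)

section \<open>Angles around a node and the cyclic order that they define\<close>

locale plane_node =
 fixes V :: "'a set" and E :: "'a set set" and D :: "'a drawing" and v :: 'a
 assumes plane: "plane_embedding V E D" and graph: "simple_graph V E"
begin

abbreviation "d \<equiv> link_direction D v"

lemma finite_links_at: "finite (links_at E v)"
proof -
 have "E \<subseteq> Pow V" using graph by (auto simp: simple_graph_def)
 then show ?thesis using graph by (auto simp: simple_graph_def links_at_def intro: finite_subset)
qed

lemma d_nonzero: "e \<in> links_at E v ==> d e ~= 0"
 using link_directions(1)[OF plane graph] by blast

lemma angle_pos:
 assumes "e \<in> links_at E v" "f \<in> links_at E v" "e ~= f"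
 shows "0 < Arg2pi (d e / d f)"
proof (rule ccontr)
 assume "~  ?thesis"
 then have "Arg2pi (d e / d f) = 0" using Arg2pi_ge_0[of "d e / d f"] by linarith
 then have r: "d e / d f \<in> \<real>" "0 <= Re (d e / d f)" by (simp_all add: Arg2pi_eq_0)
 then have "d e / d f = of_real (Re (d e / d f))" by simp
 moreover have "d e / d f ~= 0" using d_nonzero assms by simp
 ultimately have "d e = of_real (Re (d e / d f)) * d f" "0 < Re (d e / d f)"
  using r d_nonzero[OF assms(2)] by (metis nonzero_divide_eq_eq, metis antisym_conv2 of_real_0)
 then show False using link_directions(2)[OF plane graph assms(2,1)] assms(3) by blast
qed

text \<open>A new reference link shifts all angles by a constant, up to a full turn. The two cases
  with \<open>e = f\<close> or \<open>f' = f\<close> need care since the angle of the reference link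
  itself is a full turn and not 0.\<close>

lemma angle_change:
 assumes "e \<in> links_at E v" "f \<in> links_at E v" "f' \<in> links_at E v" "e ~= f'"
 shows "link_angle D v f' e = link_angle D v f e - link_angle D v f f' +
  (if link_angle D v f e < link_angle D v f f' then 2 * pi else 0)"
proof -
 have nz: "d e ~= 0" "d f ~= 0" "d f' ~= 0" using assms d_nonzero by auto
 have eq: "(d e / d f') * (d f' / d f) = d e / d f" using nz by simp
 define A B C where "A = Arg2pi (d e / d f')" and "B = Arg2pi (d f' / d f)" and "C = Arg2pi (d e / d f)"
 have t: "C = (if A + B < 2 * pi then A + B else A + B - 2 * pi)"
  using Arg2pi_times[of "d e / d f'" "d f' / d f"] nz eq by (simp add: A_def B_def C_def)
 have bounds: "A < 2 * pi" "0 <= B" "B < 2 * pi" "0 <= C" "C < 2 * pi"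
  by (simp_all add: A_def B_def C_def Arg2pi_ge_0 Arg2pi_lt_2pi)
 have p: "0 < A" using angle_pos assms by (simp add: A_def)
 have self: "Arg2pi (d f / d f) = 0" using nz by (simp add: Arg2pi_of_real[of 1, simplified])
 have l: "link_angle D v f' e = A" using assms(4) by (simp add: link_angle_def A_def)
 consider "e = f" "f' ~= f" | "e ~= f" "f' = f" | "e ~= f" "f' ~= f" using assms(4) by blast
 then show ?thesis
 proof cases
  case 1
  then have v: "link_angle D v f e = 2 * pi" "link_angle D v f f' = B" "C = 0"
   using self by (simp_all add: link_angle_def B_def C_def)
  have "A + B = 2 * pi"
  proof (cases "A + B < 2 * pi")
   case True
   with t v(3) p bounds show ?thesis by simp
  next
   case False
   with t v(3) show ?thesis by simp
  qed
  then show ?thesis unfolding v l using bounds by simp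
 next
  case 2
  then have v: "link_angle D v f e = C" "link_angle D v f f' = 2 * pi" "B = 0"
   using self by (simp_all add: link_angle_def B_def C_def)
  then show ?thesis unfolding v(1,2) l using t bounds by simp
 next
  case 3
  then have v: "link_angle D v f e = C" "link_angle D v f f' = B"
   by (simp_all add: link_angle_def B_def C_def)
  show ?thesis
  proof (cases "A + B < 2 * pi")
   case True
   then show ?thesis unfolding v l using t p by simp
  next
   case False
   then show ?thesis unfolding v l using t bounds by simp
  qed
 qed
qed

lemma angle_inj: "f \<in> links_at E v ==> inj_on (link_angle D v f) (links_at E v)"
proof (rule inj_onI, rule ccontr)
 fix e e' assume *: "f \<in> links_at E v" "e \<in> links_at E v" "e' \<in> links_at E v" "link_angle D v f e = link_angle D v f e'" "e ~= e'"
 then have "link_angle D v e' e = 0" using angle_change[of e f e'] by simp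
 then show False using angle_pos[of e e'] * by (simp add: link_angle_def)
qed

lemma right_hand_props:
 assumes "f \<in> links_at E v"
 shows "set (right_hand E D v f) = links_at E v" "sorted_wrt (<) (map (link_angle D v f) (right_hand E D v f))"
  "distinct (right_hand E D v f)"
proof -
 let ?g = "link_angle D v f"
 define xs where "xs = map (inv_into (links_at E v) ?g) (sorted_list_of_set (?g ` links_at E v))"
 have "map ?g xs = sorted_list_of_set (?g ` links_at E v)"
  unfolding xs_def map_map by (rule map_idI) (use finite_links_at in "auto simp: f_inv_into_f")
 moreover have "set xs = links_at E v"
  using finite_links_at inv_into_image_cancel[OF angle_inj[OF assms] subset_refl] by (simp add: xs_def)
 ultimately have "right_hand E D v f = xs" "set xs = links_at E v" "sorted_wrt (<) (map ?g xs)"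
  by (auto intro!: right_hand_eqI)
 moreover then have "distinct (map ?g xs)" using strict_sorted_iff by blast
 ultimately show "set (right_hand E D v f) = links_at E v" "sorted_wrt (<) (map (link_angle D v f) (right_hand E D v f))"
  "distinct (right_hand E D v f)" by (auto simp: distinct_map)
qed

text \<open>Under the new reference \<open>f'\<close>, links up to \<open>f'\<close> gain a full
  turn and move behind the others: the right-hand lists at a node are rotations of a single cyclic
  order.\<close>

lemma right_hand_cut:
 assumes "f \<in> links_at E v" "f' \<in> links_at E v"
 shows "right_hand E D v f' = cut f' (right_hand E D v f)"
proof -
 let ?g = "link_angle D v f" and ?g' = "link_angle D v f'"
 note rf = right_hand_props[OF assms(1)]
 obtain as bs where ab: "right_hand E D v f = as @ f' # bs" using split_list[of f' "right_hand E D v f"] assms rf by auto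
 have d: "distinct (as @ f' # bs)" using rf(3) ab by simp
 have s: "sorted_wrt (<) (map ?g (as @ f' # bs))" using rf(2) ab by simp
 have mem: "e \<in> links_at E v & e ~= f'" if "e \<in> set as Un set bs" for e using that rf(1) d ab by auto
 have A: "?g' e = ?g e - ?g f' + 2 * pi" "?g e < ?g f'" if "e \<in> set as" for e
  using angle_change[of e f f'] mem[of e] that s assms by (auto simp: sorted_wrt_append)
 have B: "?g' e = ?g e - ?g f'" "?g f' < ?g e" if "e \<in> set bs" for e
  using angle_change[of e f f'] mem[of e] that s assms by (fastforce simp: sorted_wrt_append)+
 have top: "?g' e <= 2 * pi" "e ~= f' ==> ?g' e < 2 * pi" "?g e <= 2 * pi" "0 < ?g e" if "e \<in> links_at E v" for e
  using Arg2pi_lt_2pi angle_pos[OF that assms(1)] by (auto simp: link_angle_def less_imp_le)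
 have "sorted_wrt (<) (map ?g' (bs @ as @ [f']))"
 proof -
  have "sorted_wrt (<) (map ?g' bs)"
  proof -
   have "map ?g' bs = map (%x. x - ?g f') (map ?g bs)" using B by simp
   moreover have "sorted_wrt (<) (map ?g bs)" using s by (simp add: sorted_wrt_append)
   ultimately show ?thesis by (simp only: sorted_wrt_map) (simp add: sorted_wrt_map)
  qed
  moreover have "sorted_wrt (<) (map ?g' as)"
  proof -
   have "map ?g' as = map (%x. x - ?g f' + 2 * pi) (map ?g as)" using A by simp
   moreover have "sorted_wrt (<) (map ?g as)" using s by (simp add: sorted_wrt_append)
   ultimately show ?thesis by (simp only: sorted_wrt_map) (simp add: sorted_wrt_map)
  qed
  moreover have "?g' b < ?g' a" if "b \<in> set bs" "a \<in> set as" for a b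
   using A[OF that(2)] B[OF that(1)] top(3)[of b] top(4)[of a] mem[of a] mem[of b] that by auto
  moreover have "?g' e < ?g' f'" if "e \<in> set as Un set bs" for e
   using top(2)[of e] mem[OF that] by (simp add: link_angle_def)
  ultimately show ?thesis by (auto simp: sorted_wrt_append)
 qed
 moreover have "set (bs @ as @ [f']) = links_at E v" using rf(1) ab by auto
 ultimately have "right_hand E D v f' = bs @ as @ [f']" by (intro right_hand_eqI)
 with cut_split[OF d] ab show ?thesis by simp
qed

end

lemma cut_map: "inj_on g (insert p (set xs)) ==> cut (g p) (map g xs) = map g (cut p xs)"
 by (simp add: cut_def rank_map_inj drop_map take_map)

lemma filter_cut:
 assumes "distinct xs" "w \<in> set xs" "P w"
 shows "filter P (cut w xs) = cut w (filter P xs)"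
proof -
 obtain as bs where xs: "xs = as @ w # bs" using assms(2) by (auto dest: split_list)
 then have f: "filter P xs = filter P as @ w # filter P bs" using assms(3) by simp
 then have "distinct (filter P as @ w # filter P bs)" using distinct_filter[OF assms(1), of P] by simp
 with assms(1,3) cut_split[of as w bs] cut_split[of "filter P as" w "filter P bs"] xs f show ?thesis by simp
qed

lemma set_move_to_front [simp]: "set (move_to_front x xs) = set xs"
 by (induction xs) (auto simp: move_to_front_def)

lemma move_to_front_map: "inj_on g (insert x (set xs)) ==> move_to_front (g x) (map g xs) = map g (move_to_front x xs)"
proof -
 assume i: "inj_on g (insert x (set xs))"
 have "map g (remove1 x xs) = remove1 (g x) (map g xs)"
  using i by (induction xs) (auto simp: inj_on_def)
 moreover have "g x \<in> g ` set xs \<longleftrightarrow> x \<in> set xs" using i by (auto simp: inj_on_def)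
 ultimately show ?thesis by (simp add: move_to_front_def)
qed

lemma move_to_front_filter:
 "distinct xs ==> move_to_front x xs = (if x \<in> set xs then [x] else []) @ filter (%y. y ~= x) xs"
proof (cases "x \<in> set xs")
 case True
 assume "distinct xs"
 moreover have "filter (%y. x ~= y) xs = filter (%y. y ~= x) xs" by (rule filter_cong) auto
 ultimately show ?thesis using True by (simp add: move_to_front_def distinct_remove1_removeAll removeAll_filter_not_eq)
next
 case False
 moreover have "filter (%y. y ~= x) xs = xs" by (rule filter_True) (use False in auto)
 ultimately show ?thesis by (simp add: move_to_front_def)
qed

lemma (in plane_node) right_hand_neighbours:
 assumes f: "f \<in> links_at E v"
 defines "ro \<equiv> map (other_end v) (right_hand E D v f)"
 shows "map (%w. {v, w}) ro = right_hand E D v f" "distinct ro" "set ro = {w. {v, w} \<in> E}"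
proof -
 let ?g = "%w. {v, w}"
 note r = right_hand_props[OF f]
 have "\<exists>w. e = {v, w} & v ~= w" if "e \<in> links_at E v" for e
  using that graph by (auto simp: links_at_def simple_graph_def insert_commute)
 then have "map ?g ro = map (%e. e) (right_hand E D v f)"
  unfolding ro_def map_map by (intro map_cong) (use r(1) in "fastforce+")
 then show m: "map ?g ro = right_hand E D v f" by simp
 show "distinct ro" using r(3) unfolding m[symmetric] by (simp add: distinct_map)
 have "?g ` set ro = links_at E v" using r(1) unfolding m[symmetric] by simp
 moreover have "{v, w} \<in> links_at E v \<longleftrightarrow> {v, w} \<in> E" for w by (simp add: links_at_def)
 moreover have "inj ?g" by (auto simp: inj_on_def doubleton_eq_iff)
 ultimately show "set ro = {w. {v, w} \<in> E}" using inj_on_image_mem_iff[of ?g UNIV _ "set ro"] by blast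
qed

lemma right_hand_pattern_lists:
 assumes plane: "plane_embedding V L D" and G: "simple_graph V L" and rh: "right_hand_pattern V L D t \<pi>"
  and v: "v \<in> V" "v ~= t" and f0: "f0 \<in> links_at L v"
 defines "ro \<equiv> map (other_end v) (right_hand L D v f0)"
 defines "R \<equiv> filter (%w. w ~= t) ro"
 shows "distinct ro" "set ro = {w. {v, w} \<in> L}"
  "w \<in> set R ==> \<pi> v (Some {v, w}) = map (%w. {v, w}) ((if t \<in> set ro then [t] else []) @ cut w R)"
  "R ~= [] ==> \<exists>w\<in>set R. \<pi> v None = \<pi> v (Some {v, w})"
  "!!p. p \<in> in_ports L v ==> distinct (\<pi> v p) & set (\<pi> v p) = links_at L v"
proof -
 interpret plane_node V L D v by unfold_locales fact+
 let ?g = "%w. {v, w}"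
 have inj: "inj_on ?g X" for X by (auto simp: inj_on_def doubleton_eq_iff)
 have lw: "\<exists>w. e = {v, w} & v ~= w" if "e \<in> links_at L v" for e
  using that G by (auto simp: links_at_def simple_graph_def insert_commute)
 note m = right_hand_neighbours(1)[OF f0, folded ro_def]
 show dro: "distinct ro" and sro: "set ro = {w. {v, w} \<in> L}"
  unfolding ro_def by (rule right_hand_neighbours[OF f0])+
 have "\<exists>e\<in>links_at L v. \<forall>p\<in>in_ports L v. \<pi> v p = updated_right_hand L D t v e p"
  using rh v by (simp add: right_hand_pattern_def)
 then obtain ev where ev: "ev \<in> links_at L v" "!!p. p \<in> in_ports L v ==> \<pi> v p = updated_right_hand L D t v ev p"
  by blast
 have cutro: "right_hand L D v {v, w} = map ?g (cut w ro)" if "w \<in> set ro" for w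
  using right_hand_cut[OF f0, of "{v, w}"] that sro cut_map[OF inj, of w ro] m by (auto simp: links_at_def)
 have mtf: "move_to_front {v, t} (right_hand L D v {v, w}) = map ?g ((if t \<in> set ro then [t] else []) @ filter (%w. w ~= t) (cut w ro))"
  if "w \<in> set ro" for w
  unfolding cutro[OF that] move_to_front_map[OF inj] using move_to_front_filter[of "cut w ro" t] dro by simp
 have cutR: "filter (%w. w ~= t) (cut w ro) = cut w R" if "w \<in> set ro" "w ~= t" for w
  unfolding R_def using filter_cut[OF dro that(1), of "%w. w ~= t"] that by simp
 show S: "\<pi> v (Some {v, w}) = map ?g ((if t \<in> set ro then [t] else []) @ cut w R)" if "w \<in> set R" for w
 proof -
  have w: "w \<in> set ro" "w ~= t" using that by (auto simp: R_def)
  then have "Some {v, w} \<in> in_ports L v" using sro by (auto simp: in_ports_def links_at_def)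
  with ev(2) mtf[OF w(1)] cutR[OF w] show ?thesis by (simp add: updated_right_hand_def)
 qed
 obtain w where w: "ev = {v, w}" "v ~= w" using lw[OF ev(1)] by auto
 have wro: "w \<in> set ro" using w ev(1) sro by (auto simp: links_at_def)
 have N: "\<pi> v None = map ?g ((if t \<in> set ro then [t] else []) @ filter (%w. w ~= t) (cut w ro))"
  using ev(2)[of None] mtf[OF wro] w by (simp add: updated_right_hand_def in_ports_def)
 show "\<exists>w\<in>set R. \<pi> v None = \<pi> v (Some {v, w})" if ne: "R ~= []"
 proof (cases "w = t")
  case False
  then show ?thesis using N S[of w] wro cutR[OF wro] by (intro bexI[of _ w]) (auto simp: R_def)
 next
  case True
  obtain as bs where ab: "ro = as @ t # bs" using split_list[of t ro] wro True by auto
  have nt: "t \<notin> set as" "t \<notin> set bs" using dro ab by auto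
  have c: "cut w ro = bs @ as @ [t]" using cut_split[of as t bs] dro ab True by simp
  have fl: "filter (%w. w ~= t) as = as" "filter (%w. w ~= t) bs = bs"
   by (rule filter_True; use nt in auto)+
  have R: "R = as @ bs" using fl by (simp add: R_def ab)
  have f: "filter (%w. w ~= t) (cut w ro) = bs @ as" using fl by (simp add: c)
  \<comment> \<open>If the start behaves like the in-port \<open>{v, t}\<close>, no neighbour in
    \<open>R\<close> is the in-port. Once \<open>t\<close> has been removed, reading from
    \<open>t\<close> is the same as reading from its cyclic predecessor \<open>z\<close>.\<close>
  define z where "z = last (bs @ as)"
  have "bs @ as ~= []" using ne R by auto
  then have bsas: "bs @ as = butlast (bs @ as) @ [z]" unfolding z_def by (rule append_butlast_last_id[symmetric])
  have z: "z \<in> set R" using ne R by (metis UnI1 UnI2 last_in_set set_append z_def append_is_Nil_conv sup_commute)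
  have d: "distinct (bs @ as)" "distinct R" using dro ab by (auto simp: R_def)
  have "cut z R = cut z (bs @ as)" using cut_rotate[of as bs z] R d z by simp
  also have "\<dots> = cut z (butlast (bs @ as) @ z # [])" using bsas by simp
  also have "\<dots> = bs @ as" using cut_split[of "butlast (bs @ as)" z "[]"] bsas d(1) by simp
  finally show ?thesis using N S[OF z] f z by (intro bexI[of _ z]) simp_all
 qed
 fix p assume p: "p \<in> in_ports L v"
 have dm: "distinct (move_to_front x xs)" if "distinct xs" for x and xs :: "'b list"
  using that by (auto simp: move_to_front_filter)
 show "distinct (\<pi> v p) & set (\<pi> v p) = links_at L v"
 proof -
  define f where "f = (case p of None => ev | Some f => f)"
  have "f \<in> links_at L v" using p ev(1) by (auto simp: f_def in_ports_def)
  with ev(2)[OF p] right_hand_props[of f] dm show ?thesis by (simp add: updated_right_hand_def f_def[symmetric])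
 qed
qed

lemma right_hand_rotational:
 assumes plane: "plane_embedding V L D" and G: "simple_graph V L" and rh: "right_hand_pattern V L D t \<pi>"
  and v: "v \<in> V" "v ~= t" and f0: "f0 \<in> links_at L v"
 shows "rotational L t \<pi> (filter (%w. w ~= t) (map (other_end v) (right_hand L D v f0))) v"
proof -
 define ro where "ro = map (other_end v) (right_hand L D v f0)"
 define R where "R = filter (%w. w ~= t) ro"
 note l = right_hand_pattern_lists[OF assms, folded ro_def, folded R_def]
 have inj: "inj_on (%w. {v, w}) X" for X by (auto simp: inj_on_def doubleton_eq_iff)
 have R: "distinct R" "set R = {w. {v, w} \<in> L} - {t}" using l(1,2) by (auto simp: R_def)
 have rk: "rank (\<pi> v (Some {v, w})) {v, a} = (if t \<in> set ro then 1 else 0) + rank (cut w R) a"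
  if "w \<in> set R" "a \<in> set R" for w a
 proof -
  have "a ~= t" using that R by auto
  then show ?thesis unfolding l(3)[OF that(1)] rank_map_inj[OF inj] by (simp add: rank_append rank_Cons)
 qed
 interpret plane_node V L D v by unfold_locales fact+
 have "\<exists>e\<in>links_at L v. \<forall>p\<in>in_ports L v. \<pi> v p = updated_right_hand L D t v e p"
  using rh v by (simp add: right_hand_pattern_def)
 then obtain ev where ev: "ev \<in> links_at L v" "!!p. p \<in> in_ports L v ==> \<pi> v p = updated_right_hand L D t v ev p"
  by blast
 have front: "rank (\<pi> v p) {v, t} <= rank (\<pi> v p) l" if p: "p \<in> in_ports L v" "{v, t} \<in> L" for p l
 proof -
  define f where "f = (case p of None => ev | Some f => f)"
  have "f \<in> links_at L v" using p ev(1) by (auto simp: f_def in_ports_def)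
  then have "{v, t} \<in> set (right_hand L D v f)" using right_hand_props[of f] p(2) by (simp add: links_at_def)
  with ev(2)[OF p(1)] show ?thesis by (simp add: updated_right_hand_def f_def[symmetric] move_to_front_def rank_Cons)
 qed
 show ?thesis
  unfolding ro_def[symmetric] R_def[symmetric] rotational_def using R rk front l(4) by auto
qed

section \<open>The order of the links at a node\<close>

lemma lex_less:
 fixes W :: nat
 assumes "s < W" "s' < W"
 shows "m * W + s < m' * W + s' \<longleftrightarrow> m < m' | m = m' & s < s'"
proof -
 have *: "m * W + s < m' * W + s'" if "m < m'" "s < W" for m m' s s'
 proof -
  have "Suc m * W <= m' * W" using that by (intro mult_le_mono1) simp
  with that show ?thesis by simp
 qed
 show ?thesis using *[of m m' s s'] *[of m' m s' s] assms by (cases m m' rule: linorder_cases) auto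
qed

text \<open>Number of the gap directly behind \<open>x\<close> when the cyclic order is read from
  behind \<open>s\<close>. The element \<open>s\<close> is read last, but the gap behind it is the
  one in front of the reading, hence the value 0.\<close>

definition slot_after :: "'a list => 'a => 'a => nat" where
 "slot_after R s x = (if x = s then 0 else Suc (rank (cut s R) x))"

context rooted_graph
begin

lemma links_at_image: "links_at E u = (%v. {u, v}) ` {v. {u, v} \<in> E}"
proof
 show "links_at E u \<subseteq> (%v. {u, v}) ` {v. {u, v} \<in> E}"
 proof
  fix l assume "l \<in> links_at E u"
  then have l: "l \<in> E" "u \<in> l" by (simp_all add: links_at_def)
  then obtain x y where "l = {x, y}" by (elim linkE)
  then show "l \<in> (%v. {u, v}) ` {v. {u, v} \<in> E}" using l by (cases "u = x") (auto simp: insert_commute)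
 qed
qed (auto simp: links_at_def)

lemma card_sideB: "card (sideB e) < card V"
proof (rule psubset_card_mono[OF finite_V])
 have "t \<notin> sideB e" by (simp add: sideB_def sideA_def)
 then show "sideB e \<subset> V" using t_in by (auto simp: sideB_def)
qed

definition front :: "('a => 'a list) => 'a => 'a => bool" where
 "front R u v \<longleftrightarrow> set (R u) Int sideA {u, v} = {}"

text \<open>A packet through a separating link is treated as coming from its far side, whose last
  neighbour is \<open>bl u w\<close>; the reading then begins with the near side. In the remaining
  cases any fixed place would do.\<close>

definition start :: "('a => 'a list) => ('a => 'a => 'a) => 'a => 'a => 'a" where
 "start R bl u w = (if w \<in> set (R u) then w else if {u, w} \<in> S0 & ~  front R u w then bl u w else last (R u))"

text \<open>The list of \<open>u\<close> for the in-port \<open>{u, w}\<close> is sorted by \<open>key\<close>: it starts with \<open>t\<close>, followed by the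
 separating links \<open>{u, v}\<close> without other neighbours of \<open>u\<close> on the side of \<open>t\<close>, and by the cyclic
 order \<open>R u\<close> read from the neighbour after \<open>start\<close>. The remaining separating links \<open>{u, v}\<close> are placed
 in this reading either just before the neighbours on the far side or, if \<open>Y u v\<close> and the packet
 comes from the far side, just before the neighbours on the side of \<open>t\<close>; in both cases a link with
 a larger far side is closer to the side of \<open>t\<close>.\<close>

definition slot :: "('a => 'a list) => ('a => 'a => 'a) => ('a => 'a => 'a) => ('a => 'a => bool) => 'a => 'a => 'a => nat" where
 "slot R al bl Y u w v = (if v = t | v \<notin> set (R u) & front R u v then 0
  else if v \<in> set (R u) then Suc (rank (cut (start R bl u w) (R u)) v)
  else if Y u v & w \<in> sideB {u, v} then Suc (slot_after (R u) (start R bl u w) (bl u v))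
  else Suc (slot_after (R u) (start R bl u w) (al u v)))"

text \<open>A gap shares its slot with the neighbour behind it; the value \<open>2 * card V\<close>
  makes this neighbour the last entry of the slot, as far sides are nonempty.\<close>

definition sub :: "('a => 'a list) => ('a => 'a => bool) => 'a => 'a => 'a => nat" where
 "sub R Y u w v = (if v = t then 0 else if v \<in> set (R u) then 2 * card V
  else if ~  front R u v & Y u v & w \<in> sideB {u, v} then card (sideB {u, v})
  else 2 * card V - card (sideB {u, v}))"

text \<open>Slot and tie-breaker as one number: the factor exceeds every value of
  \<open>sub\<close>, so the comparison is lexicographic.\<close>

definition key :: "('a => 'a list) => ('a => 'a => 'a) => ('a => 'a => 'a) => ('a => 'a => bool) => 'a => 'a => 'a => nat" where
 "key R al bl Y u w v = slot R al bl Y u w v * (2 * card V + 1) + sub R Y u w v"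

lemma key_less:
 "key R al bl Y u w x < key R al bl Y u w y \<longleftrightarrow> slot R al bl Y u w x < slot R al bl Y u w y |
  slot R al bl Y u w x = slot R al bl Y u w y & sub R Y u w x < sub R Y u w y"
proof -
 have "sub R Y u w z < 2 * card V + 1" for z
  using card_sideB[of "{u, z}"] by (auto simp: sub_def)
 then show ?thesis unfolding key_def by (intro lex_less)
qed

end

text \<open>The interface between correctness and computation: any choice of block ends,
  orientations and sorted lists with these properties gives a resilient pattern, however it has been
  found.\<close>

locale assembled = rooted_graph V E t for V :: "'a set" and E t +
 fixes \<pi> \<pi>' :: "'a pattern" and R :: "'a => 'a list" and al bl :: "'a => 'a => 'a"
  and Y :: "'a => 'a => bool" and nl :: "'a => 'a => 'a list" and w0 :: "'a => 'a"
 assumes sk: "skipping_pattern V H t \<pi>" and res: "perfectly_resilient V H t \<pi>"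
  and rot: "!!v. v \<in> V ==> v ~= t ==> rotational H t \<pi> (R v) v"
  and ends: "!!u v. {u, v} \<in> S0 ==> ~  front R u v ==>
   \<exists>xs ys As Bs. R u = xs @ ys & ys @ xs = As @ Bs & As ~= [] & Bs ~= [] &
    set As \<subseteq> sideA {u, v} & set Bs \<subseteq> sideB {u, v} & al u v = last As & bl u v = last Bs"
  and witness: "!!e. e \<in> S0 ==> \<exists>x y q j. e = {x, y} & ~  Y x y & Y y x & link_path H q & hd q = y & last q = x &
    (\<forall>i. 0 < i --> Suc i < length q --> q ! i \<in> sideB e) & 0 < j & Suc j < length q &
    rank (\<pi> (q ! j) None) {q ! j, q ! Suc j} < rank (\<pi> (q ! j) None) {q ! (j - 1), q ! j}"
  and nl: "!!u w. u \<in> V ==> u ~= t ==> {u, w} \<in> E ==> set (nl u w) = {v. {u, v} \<in> E} &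
    sorted_wrt (<) (map (key R al bl Y u w) (nl u w))"
  and \<pi>'_Some: "!!u w. u \<in> V ==> u ~= t ==> {u, w} \<in> E ==> \<pi>' u (Some {u, w}) = map (%v. {u, v}) (nl u w)"
  and \<pi>'_None: "!!u. u \<in> V ==> u ~= t ==> {u, w0 u} \<in> E & \<pi>' u None = \<pi>' u (Some {u, w0 u})"
  and w0: "!!u. u \<in> V ==> u ~= t ==> R u ~= [] ==> w0 u \<in> set (R u) & \<pi> u None = \<pi> u (Some {u, w0 u})"
begin

lemma inj_link: "inj_on (%v. {u, v}) X"
 by (auto simp: inj_on_def doubleton_eq_iff)

lemma skipping': "skipping_pattern V E t \<pi>'"
proof -
 have S: "distinct (\<pi>' u (Some {u, w})) & set (\<pi>' u (Some {u, w})) = links_at E u" if u: "u \<in> V" "u ~= t" "{u, w} \<in> E" for u w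
 proof -
  have "distinct (map (key R al bl Y u w) (nl u w))" using nl[OF u] strict_sorted_iff by blast
  then have "distinct (nl u w)" by (simp add: distinct_map)
  with nl[OF u] \<pi>'_Some[OF u] inj_link show ?thesis by (simp add: distinct_map links_at_image)
 qed
 show ?thesis
  unfolding skipping_pattern_def
 proof (intro ballI)
  fix u p assume u: "u \<in> V - {t}" and p: "p \<in> in_ports E u"
  then consider "p = None" | w where "p = Some {u, w}" "{u, w} \<in> E"
   by (auto simp: in_ports_def links_at_image)
  then show "distinct (\<pi>' u p) & set (\<pi>' u p) = links_at E u"
   by cases (use S u \<pi>'_None[of u] in auto)
 qed
qed

sublocale r: routed_graph V E t \<pi>'
 by unfold_locales (rule skipping')

sublocale h: routed_graph V H t \<pi>
 by (rule routed_graph_H[OF rooted_graph_axioms sk])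

lemma R_set: "u \<in> V ==> u ~= t ==> set (R u) = {w. {u, w} \<in> H} - {t} & distinct (R u)"
 using rot[of u] by (simp add: rotational_def)

lemma rank_key:
 assumes "u \<in> V" "u ~= t" "{u, w} \<in> E" "{u, x} \<in> E" "{u, y} \<in> E"
 shows "r.rk u (Some {u, w}) {u, x} < r.rk u (Some {u, w}) {u, y} \<longleftrightarrow> key R al bl Y u w x < key R al bl Y u w y"
 using nl[OF assms(1-3)] assms(4,5) unfolding \<pi>'_Some[OF assms(1-3)] rank_map_inj[OF inj_link]
 by (intro rank_sorted) auto

lemma key_t:
 assumes "u \<in> V" "u ~= t" "x ~= t" "{u, x} \<in> E"
 shows "key R al bl Y u w t < key R al bl Y u w x"
proof -
 have "0 < sub R Y u w x | 0 < slot R al bl Y u w x"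
  using assms card_sideB[of "{u, x}"] by (auto simp: sub_def slot_def)
 then show ?thesis by (auto simp: key_less slot_def sub_def)
qed

lemma t_first:
 assumes "u \<in> V" "u ~= t" "p \<in> in_ports E u" "{u, t} \<in> E" "l \<in> E" "u \<in> l"
 shows "r.rk u p {u, t} <= r.rk u p l"
proof -
 obtain x where x: "l = {u, x}" using assms(5,6) by (elim r.link_at_cases)
 have S: "r.rk u (Some {u, w}) {u, t} <= r.rk u (Some {u, w}) l" if "{u, w} \<in> E" for w
  using rank_key[OF assms(1,2) that assms(4), of x] key_t[OF assms(1,2), of x w] assms(5) x by (cases "x = t") auto
 show ?thesis
 proof (cases p)
  case None
  with S[of "w0 u"] \<pi>'_None[OF assms(1,2)] show ?thesis by simp
 next
  case (Some f)
  then have "f \<in> E" "u \<in> f" using assms(3) by auto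
  then obtain w where "f = {u, w}" by (elim r.link_at_cases)
  then show ?thesis using S[of w] Some assms(3) by auto
 qed
qed

text \<open>Restricted to the links of \<open>H\<close>, the new lists are the old ones, because the
  relative order of neighbours in \<open>R u\<close> is not affected by insertions into gaps. This
  starts the induction.\<close>

lemma order_H:
 assumes "u \<in> V" "u ~= t" "p = None | (\<exists>w\<in>set (R u). p = Some {u, w})" "l \<in> H" "l' \<in> H" "u \<in> l" "u \<in> l'"
 shows "r.rk u p l < r.rk u p l' \<longleftrightarrow> h.rk u p l < h.rk u p l'"
proof -
 obtain x where x: "l = {u, x}" using assms(4,6) by (elim h.link_at_cases)
 obtain y where y: "l' = {u, y}" using assms(5,7) by (elim h.link_at_cases)
 note ro = rot[OF assms(1,2)] and Rs = R_set[OF assms(1,2)]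
 have S: "r.rk u (Some {u, w}) l < r.rk u (Some {u, w}) l' \<longleftrightarrow> h.rk u (Some {u, w}) l < h.rk u (Some {u, w}) l'"
  if w: "w \<in> set (R u)" for w
 proof -
  have wE: "{u, w} \<in> E" "Some {u, w} \<in> in_ports H u" using w Rs by auto
  have st: "start R bl u w = w" using w by (simp add: start_def)
  have tf: "h.rk u (Some {u, w}) {u, t} < h.rk u (Some {u, w}) {u, z}" if "{u, t} \<in> H" "{u, z} \<in> H" "z ~= t" for z
  proof -
   have "h.rk u (Some {u, w}) {u, t} <= h.rk u (Some {u, w}) {u, z}" using ro wE that by (auto simp: rotational_def)
   moreover have "{u, t} ~= {u, z}" using that(3) by (auto simp: doubleton_eq_iff)
   then have "h.rk u (Some {u, w}) {u, t} ~= h.rk u (Some {u, w}) {u, z}"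
    using h.rk_inj[OF assms(1,2) wE(2), of "{u, t}" "{u, z}"] that by auto
   ultimately show ?thesis by simp
  qed
  have "key R al bl Y u w x < key R al bl Y u w y \<longleftrightarrow> h.rk u (Some {u, w}) l < h.rk u (Some {u, w}) l'"
  proof (cases "x = t | y = t")
   case True
   then show ?thesis
    using tf[of x] tf[of y] key_t[OF assms(1,2), of x w] key_t[OF assms(1,2), of y w] assms(4,5) x y
    by (cases "x = t"; cases "y = t") (auto simp: not_less less_imp_le)
  next
   case False
   then have xy: "x \<in> set (R u)" "y \<in> set (R u)" using Rs assms(4,5) x y by auto
   then have "key R al bl Y u w x < key R al bl Y u w y \<longleftrightarrow> rank (cut w (R u)) x < rank (cut w (R u)) y"
    using False st by (auto simp: key_less slot_def sub_def)
   also have "\<dots> \<longleftrightarrow> h.rk u (Some {u, w}) l < h.rk u (Some {u, w}) l'"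
   proof -
    have "\<forall>w\<in>set (R u). \<forall>a\<in>set (R u). \<forall>b\<in>set (R u). h.rk u (Some {u, w}) {u, a} < h.rk u (Some {u, w}) {u, b} \<longleftrightarrow>
      rank (cut w (R u)) a < rank (cut w (R u)) b"
     using ro unfolding rotational_def by (elim conjE)
    from bspec[OF bspec[OF bspec[OF this w] xy(1)] xy(2)] show ?thesis using x y by simp
   qed
   finally show ?thesis .
  qed
  then show ?thesis using rank_key[OF assms(1,2) wE(1), of x y] assms(4,5) x y by auto
 qed
 show ?thesis
 proof (cases "R u = []")
  case True
  then have "x = t" "y = t" using Rs assms(4,5) x y by auto
  with x y show ?thesis by simp
 next
  case False
  then show ?thesis using assms(3) S \<pi>'_None[OF assms(1,2)] w0[OF assms(1,2) False] by auto
 qed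
qed

lemma Res_H: "r.Res H"
 unfolding r.Res_def
proof (intro allI ballI impI)
 fix L s assume L: "L \<subseteq> H" "s \<in> V" "linked L s t"
 have "h.rch L s None" using h.ResD[OF h.Res_E[OF res] L] .
 \<comment> \<open>The orders are known to agree only for in-ports not coming from \<open>t\<close>;
   a run never has another in-port before it is finished.\<close>
 define ok where "ok v p \<longleftrightarrow> v \<in> V & (p = None | (\<exists>w. p = Some {v, w} & {v, w} \<in> H & w ~= t))" for v p
 have "ok s None --> r.rch L s None"
  using \<open>h.rch L s None\<close>
 proof (induction rule: h.rch_induct)
  case (hop v p l)
  show ?case
  proof
   assume "ok v p"
   then have v: "v \<in> V" and p: "p = None | (\<exists>w. p = Some {v, w} & {v, w} \<in> H & w ~= t)"
    by (auto simp: ok_def)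
   have pin: "p \<in> in_ports H v" "p \<in> in_ports E v" using p by auto
   have p': "p = None | (\<exists>w\<in>set (R v). p = Some {v, w})" using p R_set[OF v hop(1)] by auto
   have l: "l \<in> L" "v \<in> l" "!!b. b \<in> L ==> v \<in> b ==> h.rk v p l <= h.rk v p b"
    using hop(2) h.nxt_eq[OF v hop(1) pin(1) L(1)] by auto
   have "r.rk v p l <= r.rk v p b" if "b \<in> L" "v \<in> b" for b
    using order_H[OF v hop(1) p', of b l] l that L(1) by (auto simp: not_less[symmetric])
   then have n: "r.nxt L v p = Some l" using r.nxt_eq[OF v hop(1) pin(2), of L l] L(1) l by auto
   have "l \<in> H" using l(1) L(1) by auto
   then obtain w where w: "l = {v, w}" "v ~= w" "w \<in> V" using l(2) by (elim h.link_at_cases)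
   have "ok w (Some l)" using w \<open>l \<in> H\<close> hop(1) unfolding ok_def by (auto simp: insert_commute)
   then have "r.rch L w (Some l)" using hop.IH w(1,2) by simp
   then show "r.rch L v p" using n w by (intro r.rch_hop[of L v p w]) auto
  qed
 qed simp
 then show "r.rch L s None" using L(2) by (simp add: ok_def)
qed

end

section \<open>One insertion: the new link \<open>{u, v}\<close> relative to the links present at
  \<open>u\<close>\<close>

locale stage = assembled V E t \<pi> \<pi>' R al bl Y nl w0
 for V :: "'a set" and E t and \<pi> \<pi>' :: "'a pattern" and R :: "'a => 'a list" and al bl :: "'a => 'a => 'a"
  and Y :: "'a => 'a => bool" and nl :: "'a => 'a => 'a list" and w0 :: "'a => 'a" +
 fixes u v :: 'a and K :: "'a set set"
 assumes e: "{u, v} \<in> S0" and K: "H \<subseteq> K" "K \<subseteq> E" "{u, v} \<notin> K"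
  and small: "!!f. f \<in> K - H ==> f \<in> S0 & card (sideB f) <= card (sideB {u, v})"
begin

abbreviation "LA \<equiv> {a. {u, a} \<in> K & a \<in> sideA {u, v} & a ~= t}"
abbreviation "LB \<equiv> {b. {u, b} \<in> K & b \<in> sideB {u, v}}"
abbreviation "ky w x \<equiv> key R al bl Y u w x"
abbreviation "sl w x \<equiv> slot R al bl Y u w x"
abbreviation "sb w x \<equiv> sub R Y u w x"

lemma uv: "u ~= v" "u \<in> V" "v \<in> V" "u ~= t" "v ~= t" "{u, v} \<in> E" "{u, v} \<notin> H" "v \<notin> set (R u)"
 using S0_D[OF e] R_set[of u] by auto

text \<open>A near neighbour is an ordinary one or belongs to a separating link whose far side is
  disjoint from that of \<open>{u, v}\<close>; nesting is ruled out by the size bound.\<close>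

lemma LA_cases:
 assumes "a \<in> LA"
 obtains "a \<in> set (R u)" | "{u, a} \<in> S0" "a \<notin> set (R u)" "v \<in> sideA {u, a}" "sideB {u, v} \<subseteq> sideA {u, a}" "sideB {u, a} \<subseteq> sideA {u, v}"
proof (cases "{u, a} \<in> H")
 case True
 then show thesis using that(1) assms R_set[of u] uv by auto
next
 case False
 then have f: "{u, a} \<in> S0" "card (sideB {u, a}) <= card (sideB {u, v})" using assms small[of "{u, a}"] by auto
 have "a ~= v" using assms sides(3)[OF e] by auto
 moreover have "a \<notin> sideB {u, v}" using assms sides(2)[OF e] by auto
 ultimately show thesis using laminar_neighbour[OF e f(1) _ f(2)] that(2) f(1) False R_set[of u] uv by auto
qed

lemma LB_cases:
 assumes "b \<in> LB"
 obtains "b \<in> set (R u)" | "{u, b} \<in> S0" "b \<notin> set (R u)" "v \<in> sideA {u, b}" "sideB {u, b} \<subset> sideB {u, v}" "sideA {u, v} \<subseteq> sideA {u, b}"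
  "card (sideB {u, b}) < card (sideB {u, v})"
proof (cases "{u, b} \<in> H")
 case True
 then show thesis using that(1) assms R_set[of u] uv sides(6)[OF e] by auto
next
 case False
 then have f: "{u, b} \<in> S0" "card (sideB {u, b}) <= card (sideB {u, v})" using assms small[of "{u, b}"] by auto
 have "b ~= v" using assms sides(4)[OF e] by auto
 moreover have "b \<notin> sideA {u, v}" using assms sides(2)[OF e] by auto
 ultimately have l: "v \<in> sideA {u, b}" "sideB {u, b} \<subset> sideB {u, v}" "sideA {u, v} \<subseteq> sideA {u, b}"
  using laminar_neighbour[OF e f(1) _ f(2)] by auto
 moreover have "card (sideB {u, b}) < card (sideB {u, v})"
  using l(2) finite_V by (intro psubset_card_mono) (auto simp: sideB_def)
 ultimately show thesis using that(2) f(1) False R_set[of u] uv by auto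
qed

lemma R_far: "{u, w} \<in> S0 ==> set (R u) Int sideB {u, w} ~= {}"
 using side_neighbour[of u w "sideB {u, w}"] R_set[of u] uv sides(6)[of "{u, w}"] by fastforce

lemma R_sides: "x \<in> set (R u) ==> {u, w} \<in> S0 ==> x \<in> sideA {u, w} | x \<in> sideB {u, w}"
 using R_set[of u] uv sides(5)[of "{u, w}"] S0_D[of u w] link_ends[of u x] by auto

text \<open>A separating link on the near side has neighbours of \<open>u\<close> on its own far
  side, and these would be near for \<open>{u, v}\<close>. So without ordinary near neighbours there
  are no separating ones either.\<close>

lemma front_LA: "front R u v ==> LA = {}"
proof (rule ccontr)
 assume f: "front R u v" "LA ~= {}"
 then obtain a where a: "a \<in> LA" by auto
 then show False
  by (cases rule: LA_cases) (use a f R_far[of a] in "auto simp: front_def")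
qed

lemma front_e_first:
 assumes "front R u v" "b \<in> LB"
 shows "ky w v < ky w b"
 using assms(2)
proof (cases rule: LB_cases)
 case 1
 then show ?thesis using assms uv R_set[of u] by (auto simp: key_less slot_def)
next
 case 2
 then show ?thesis using assms uv sides(6)[OF e] card_sideB[of "{u, v}"] by (auto simp: key_less slot_def sub_def)
qed

end

locale nonfront_stage = stage +
 assumes nonfront: "~  front R u v"
begin

text \<open>If \<open>{u, w}\<close> were a front link, all of \<open>R u\<close> would lie in its
  far side and hence on a single side of \<open>{u, v}\<close>; but \<open>u\<close> has neighbours
  on both sides.\<close>

lemma nonfront_small: "{u, w} \<in> S0 ==> sideB {u, w} \<subseteq> sideA {u, v} | sideB {u, w} \<subseteq> sideB {u, v} ==> ~  front R u w"
proof
 assume *: "{u, w} \<in> S0" "sideB {u, w} \<subseteq> sideA {u, v} | sideB {u, w} \<subseteq> sideB {u, v}" "front R u w"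
 then have "set (R u) \<subseteq> sideB {u, w}" using R_sides[OF _ *(1)] by (auto simp: front_def)
 then show False using *(2) R_far[OF e] nonfront sides(2)[OF e] by (auto simp: front_def)
qed

end

text \<open>Positions are measured in the rotation of \<open>R u\<close> in which the \<open>p\<close> neighbours on the side of \<open>t\<close> come first.\<close>

locale coordinates = nonfront_stage +
 fixes \<rho> :: "'a => nat" and k p :: nat
 assumes pk: "p < k" "0 < p"
  and rho_less: "!!x. x \<in> set (R u) ==> \<rho> x < k"
  and rank_rho: "!!x y. x \<in> set (R u) ==> y \<in> set (R u) ==>
   rank (cut x (R u)) y = (if \<rho> x < \<rho> y then \<rho> y - \<rho> x - 1 else \<rho> y + k - \<rho> x - 1)"
  and rho_inj: "!!x y. x \<in> set (R u) ==> y \<in> set (R u) ==> \<rho> x = \<rho> y \<longleftrightarrow> x = y"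
  and rho_side: "!!x. x \<in> set (R u) ==> x \<in> sideA {u, v} \<longleftrightarrow> \<rho> x < p"
  and al: "al u v \<in> set (R u)" "\<rho> (al u v) = p - 1" and bl: "bl u v \<in> set (R u)" "\<rho> (bl u v) = k - 1"
  and other: "!!w. {u, w} \<in> S0 ==> ~  front R u w ==> al u w \<in> set (R u) & bl u w \<in> set (R u) Int sideB {u, w} &
   (\<exists>z\<in>set (R u) Int sideB {u, w}. (\<rho> (al u w) < k - 1 & \<rho> z = \<rho> (al u w) + 1) | \<rho> (al u w) = k - 1 & \<rho> z = 0)"

lemma (in nonfront_stage) ex_coordinates: "\<exists>\<rho> k p. coordinates V E t \<pi> \<pi>' R al bl Y nl w0 u v K \<rho> k p"
proof -
 obtain xs ys As Bs where R: "R u = xs @ ys" "ys @ xs = As @ Bs" "As ~= []" "Bs ~= []"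
  "set As \<subseteq> sideA {u, v}" "set Bs \<subseteq> sideB {u, v}" "al u v = last As" "bl u v = last Bs"
  using ends[OF e nonfront] by blast
 define Q where "Q = As @ Bs"
 have dR: "distinct (R u)" using R_set[of u] uv by auto
 have dQ: "distinct Q" "set Q = set (R u)" using dR R(1,2) by (auto simp: Q_def[symmetric])
 have len: "length Q = length As + length Bs" by (simp add: Q_def)
 have sR: "set (R u) = set As Un set Bs" using dQ(2) by (simp add: Q_def)
 have cutQ: "cut x (R u) = cut x Q" if "x \<in> set (R u)" for x
  using cut_rotate[of xs ys x] that dR R(1,2) by (simp add: Q_def)
 have rA: "x \<in> sideA {u, v} \<longleftrightarrow> rank Q x < length As" if "x \<in> set (R u)" for x
 proof (cases "x \<in> set As")
  case True
  then show ?thesis using R(5) rank_less[of x As] by (auto simp: Q_def rank_append)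
 next
  case False
  then have "x \<in> set Bs" using that dQ by (auto simp: Q_def)
  then show ?thesis using False R(6) sides(2)[OF e] by (auto simp: Q_def rank_append)
 qed
 have rk: "rank (cut x (R u)) y = (if rank Q x < rank Q y then rank Q y - rank Q x - 1 else rank Q y + length Q - rank Q x - 1)"
  if "x \<in> set (R u)" "y \<in> set (R u)" for x y
  using cutQ[OF that(1)] rank_cut[OF dQ(1), of x y] that dQ(2) by simp
 have al: "al u v \<in> set (R u)" "rank Q (al u v) = length As - 1"
 proof -
  have "Q ! (length As - 1) = al u v" using R(3,7) by (simp add: Q_def nth_append last_conv_nth)
  moreover have "length As - 1 < length Q" using R(4) len by (cases Bs) auto
  ultimately show "rank Q (al u v) = length As - 1" using rank_nth[OF dQ(1), of "length As - 1"] by simp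
  show "al u v \<in> set (R u)" using R(3,7) sR last_in_set[of As] by simp
 qed
 have bl: "bl u v \<in> set (R u)" "rank Q (bl u v) = length Q - 1"
 proof -
  have "last Q = bl u v" "Q ~= []" using R(4,8) by (simp_all add: Q_def)
  then have "Q ! (length Q - 1) = bl u v" "length Q - 1 < length Q" by (simp_all add: last_conv_nth)
  then show "rank Q (bl u v) = length Q - 1" using rank_nth[OF dQ(1), of "length Q - 1"] by simp
  show "bl u v \<in> set (R u)" using R(4,8) sR last_in_set[of Bs] by simp
 qed
 have other: "al u w \<in> set (R u) & bl u w \<in> set (R u) Int sideB {u, w} &
   (\<exists>z\<in>set (R u) Int sideB {u, w}. (rank Q (al u w) < length Q - 1 & rank Q z = rank Q (al u w) + 1) |
    rank Q (al u w) = length Q - 1 & rank Q z = 0)"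
  if w: "{u, w} \<in> S0" "~  front R u w" for w
 proof -
  obtain xs' ys' As' Bs' where R': "R u = xs' @ ys'" "ys' @ xs' = As' @ Bs'" "As' ~= []" "Bs' ~= []"
   "set Bs' \<subseteq> sideB {u, w}" "al u w = last As'" "bl u w = last Bs'"
   using ends[OF w] by blast
  have s: "set (R u) = set As' Un set Bs'" using R'(1) arg_cong[OF R'(2), of set] by auto
  let ?z = "hd Bs'"
  have z: "?z \<in> set (R u)" "?z \<in> sideB {u, w}" using R'(4,5) s hd_in_set[of Bs'] by auto
  have a: "al u w \<in> set (R u)" using R'(3,6) s last_in_set[of As'] by simp
  have "last Bs' \<in> set Bs'" using R'(4) by simp
  then have b: "bl u w \<in> set (R u) Int sideB {u, w}" using R'(5,7) s by auto
  have d: "distinct (butlast As' @ last As' # Bs')"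
  proof -
   have "distinct (As' @ Bs')" using dR R'(1) R'(2)[symmetric] by auto
   then show ?thesis using append_butlast_last_id[OF R'(3)] by (metis append.assoc append_Cons append_Nil)
  qed
  have "cut (al u w) (R u) = cut (al u w) (ys' @ xs')" using cut_rotate[of xs' ys' "al u w"] a dR R'(1) by simp
  also have "\<dots> = cut (last As') (butlast As' @ last As' # Bs')"
   using R'(2,6) append_butlast_last_id[OF R'(3)] by (metis append.assoc append_Cons append_Nil)
  also have "\<dots> = Bs' @ butlast As' @ [last As']" by (rule cut_split[OF d])
  finally have "rank (cut (al u w) (R u)) ?z = 0" using R'(4) by (cases Bs') (simp_all add: rank_Cons)
  then have "(if rank Q (al u w) < rank Q ?z then rank Q ?z - rank Q (al u w) - 1 else rank Q ?z + length Q - rank Q (al u w) - 1) = 0"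
   using rk[OF a z(1)] by simp
  moreover have "rank Q (al u w) < length Q" "rank Q ?z < length Q" using a z dQ rank_less by metis+
  ultimately have "(rank Q (al u w) < length Q - 1 & rank Q ?z = rank Q (al u w) + 1) | rank Q (al u w) = length Q - 1 & rank Q ?z = 0"
   by (auto split: if_splits)
  then show ?thesis using a b z by blast
 qed
 have "coordinates V E t \<pi> \<pi>' R al bl Y nl w0 u v K (rank Q) (length Q) (length As)"
 proof
  show "length As < length Q" "0 < length As" using R(3,4) len by auto
  show "rank Q x < length Q" if "x \<in> set (R u)" for x using rank_less[of x Q] that dQ by simp
  show "rank Q x = rank Q y \<longleftrightarrow> x = y" if "x \<in> set (R u)" "y \<in> set (R u)" for x y
   using rank_inj[of x Q y] that dQ by simp
 qed (use rk rA al bl other in auto)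
 then show ?thesis by blast
qed

context coordinates
begin

text \<open>Slot of the neighbour at position \<open>\<beta>\<close> when the reading starts behind
  position \<open>\<mu>\<close>.\<close>

definition SL :: "nat => nat => nat" where
 "SL \<mu> \<beta> = (if \<mu> < \<beta> then \<beta> - \<mu> else \<beta> + k - \<mu>)"

text \<open>Slot of the gap behind position \<open>\<gamma>\<close> in the reading that starts
  behind position \<open>\<mu>\<close>; it coincides with the slot of the next neighbour.\<close>

definition AF :: "nat => nat => nat" where
 "AF \<mu> \<gamma> = (if \<gamma> = \<mu> then 1 else if \<mu> < \<gamma> then \<gamma> - \<mu> + 1 else \<gamma> + k - \<mu> + 1)"

abbreviation "st w \<equiv> start R bl u w"
abbreviation "n \<equiv> card V"

lemma slot_R: "st w \<in> set (R u) ==> x \<in> set (R u) ==> sl w x = SL (\<rho> (st w)) (\<rho> x) & sb w x = 2 * n"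
proof -
 assume a: "st w \<in> set (R u)" "x \<in> set (R u)"
 have "x ~= t" using a(2) R_set[of u] uv(2,4) by blast
 with rho_less[OF a(1)] a(2) show ?thesis by (simp add: slot_def sub_def SL_def rank_rho[OF a]) arith
qed

lemma slot_after_eq: "st w \<in> set (R u) ==> x \<in> set (R u) ==> Suc (slot_after (R u) (st w) x) = AF (\<rho> (st w)) (\<rho> x)"
proof -
 assume a: "st w \<in> set (R u)" "x \<in> set (R u)"
 show ?thesis using rho_less[OF a(1)] by (simp add: slot_after_def AF_def rank_rho[OF a] rho_inj[OF a(2,1)]) arith
qed

lemma AF_next:
 assumes "\<mu> < k" "(\<gamma> < k - 1 & \<beta> = \<gamma> + 1) | \<gamma> = k - 1 & \<beta> = 0"
 shows "AF \<mu> \<gamma> = SL \<mu> \<beta>"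
 using assms by (auto simp: AF_def SL_def)

lemma slot_after_rule:
 assumes "st w \<in> set (R u)" "{u, x} \<in> S0" "x \<notin> set (R u)" "~  front R u x" "Y u x & w \<in> sideB {u, x}"
 shows "\<exists>z\<in>set (R u) Int sideB {u, x}. sl w x = AF (\<rho> (st w)) (\<rho> z) & sb w x = card (sideB {u, x})"
proof -
 have b: "bl u x \<in> set (R u) Int sideB {u, x}" using other[OF assms(2,4)] by simp
 have "x ~= t" using S0_D[OF assms(2)] by simp
 then have "sl w x = Suc (slot_after (R u) (st w) (bl u x))" "sb w x = card (sideB {u, x})"
  using assms by (simp_all add: slot_def sub_def)
 then show ?thesis using slot_after_eq[OF assms(1)] b by auto
qed

lemma slot_before_rule:
 assumes "st w \<in> set (R u)" "{u, x} \<in> S0" "x \<notin> set (R u)" "~  front R u x" "~  (Y u x & w \<in> sideB {u, x})"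
 shows "\<exists>z\<in>set (R u) Int sideB {u, x}. sl w x = SL (\<rho> (st w)) (\<rho> z) & sb w x = 2 * n - card (sideB {u, x})"
proof -
 obtain z where z: "al u x \<in> set (R u)" "z \<in> set (R u) Int sideB {u, x}"
  "(\<rho> (al u x) < k - 1 & \<rho> z = \<rho> (al u x) + 1) | \<rho> (al u x) = k - 1 & \<rho> z = 0"
  using other[OF assms(2,4)] by blast
 have "x ~= t" using S0_D[OF assms(2)] by simp
 then have "sl w x = Suc (slot_after (R u) (st w) (al u x))" "sb w x = 2 * n - card (sideB {u, x})"
  using assms by (auto simp: slot_def sub_def)
 then show ?thesis using slot_after_eq[OF assms(1) z(1)] AF_next[OF rho_less[OF assms(1)] z(3)] z(2) by auto
qed

lemma slot_e:
 assumes "st w \<in> set (R u)"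
 shows "Y u v & w \<in> sideB {u, v} ==> sl w v = AF (\<rho> (st w)) (k - 1) & sb w v = card (sideB {u, v})"
  and "~  (Y u v & w \<in> sideB {u, v}) ==> sl w v = SL (\<rho> (st w)) p & sb w v = 2 * n - card (sideB {u, v})"
proof -
 assume y: "Y u v & w \<in> sideB {u, v}"
 then have "sl w v = Suc (slot_after (R u) (st w) (bl u v))" "sb w v = card (sideB {u, v})"
  using uv nonfront by (simp_all add: slot_def sub_def)
 then show "sl w v = AF (\<rho> (st w)) (k - 1) & sb w v = card (sideB {u, v})"
  using slot_after_eq[OF assms bl(1)] bl(2) by simp
next
 assume y: "~  (Y u v & w \<in> sideB {u, v})"
 then have "sl w v = Suc (slot_after (R u) (st w) (al u v))" "sb w v = 2 * n - card (sideB {u, v})"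
  using uv nonfront by (auto simp: slot_def sub_def)
 then show "sl w v = SL (\<rho> (st w)) p & sb w v = 2 * n - card (sideB {u, v})"
  using slot_after_eq[OF assms al(1)] al(2) AF_next[OF rho_less[OF assms], of "p - 1" p] pk by simp
qed

lemma rho_far: "x \<in> set (R u) ==> x \<in> sideB {u, v} ==> p <= \<rho> x"
 using rho_side sides(2)[OF e] by (meson disjoint_iff not_le)

lemma sizes: "0 < card (sideB {u, v})" "card (sideB {u, v}) < n" "card (sideB {u, x}) < n"
 "0 < n" "2 * n - card (sideB {u, v}) < 2 * n" "n < 2 * n - card (sideB {u, x})"
proof -
 show 1: "0 < card (sideB {u, v})" using sideB_nonempty[OF e] finite_V by (auto simp: sideB_def card_gt_0_iff)
 show 2: "card (sideB {u, x}) < n" by (rule card_sideB)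
 then show "n < 2 * n - card (sideB {u, x})" by linarith
 show "card (sideB {u, v}) < n" by (rule card_sideB)
 then show "0 < n" "2 * n - card (sideB {u, v}) < 2 * n" using 1 by linarith+
qed

text \<open>The second alternative is the early placement in front of the near side of
  \<open>{u, a}\<close>. It is used only for packets from the far side of \<open>{u, a}\<close>,
  which is contained in the near side of \<open>{u, v}\<close>.\<close>

lemma near_link:
 assumes "st w \<in> set (R u)" "a \<in> LA"
 shows "(\<exists>\<beta><p. sl w a = SL (\<rho> (st w)) \<beta> & n < sb w a) |
  (w \<notin> sideB {u, v} & w ~= v & (\<exists>\<gamma><p. sl w a = AF (\<rho> (st w)) \<gamma> & sb w a < n))"
 using assms(2)
proof (cases rule: LA_cases)
 case 1
 then show ?thesis using slot_R[OF assms(1) 1] rho_side[OF 1] assms(2) sizes by auto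
next
 case 2
 have nf: "~  front R u a" using nonfront_small[OF 2(1)] 2(5) by simp
 show ?thesis
 proof (cases "Y u a & w \<in> sideB {u, a}")
  case True
  then have "w \<notin> sideB {u, v}" "w ~= v" using 2(3,4) sides(2)[OF 2(1)] by auto
  then show ?thesis using slot_after_rule[OF assms(1) 2(1,2) nf True] rho_side 2(5) sizes(3)[of a] by auto
 next
  case False
  then show ?thesis using slot_before_rule[OF assms(1) 2(1,2) nf False] rho_side 2(5) sizes(3)[of a] by fastforce
 qed
qed

lemma far_link:
 assumes "st w \<in> set (R u)" "b \<in> LB"
 shows "(\<exists>\<beta>. p <= \<beta> & \<beta> < k & sl w b = SL (\<rho> (st w)) \<beta> & 2 * n - card (sideB {u, v}) < sb w b) |
  (w \<notin> sideA {u, v} & w ~= v & (\<exists>\<gamma>. p <= \<gamma> & \<gamma> < k & sl w b = AF (\<rho> (st w)) \<gamma> & sb w b < card (sideB {u, v})))"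
 using assms(2)
proof (cases rule: LB_cases)
 case 1
 then show ?thesis using slot_R[OF assms(1) 1] rho_far[OF 1] rho_less[OF 1] assms(2) sizes by auto
next
 case 2
 have nf: "~  front R u b" using nonfront_small[OF 2(1)] 2(4) by auto
 show ?thesis
 proof (cases "Y u b & w \<in> sideB {u, b}")
  case True
  then have "w \<notin> sideA {u, v}" "w ~= v" using 2(3,5) sides(2)[OF 2(1)] by auto
  then show ?thesis using slot_after_rule[OF assms(1) 2(1,2) nf True] rho_far rho_less 2(4,6) by fastforce
 next
  case False
  then show ?thesis using slot_before_rule[OF assms(1) 2(1,2) nf False] rho_far rho_less 2(4,6) sizes(2) by fastforce
 qed
qed

lemma port_near: "w \<in> LA ==> st w \<in> set (R u) & \<rho> (st w) < p & w \<notin> sideB {u, v} & w \<in> sideA {u, v}"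
proof -
 assume w: "w \<in> LA"
 then have "w \<notin> sideB {u, v}" using sides(2)[OF e] by auto
 from w show ?thesis
 proof (cases rule: LA_cases)
  case 1
  with rho_side[OF 1] w \<open>w \<notin> sideB {u, v}\<close> show ?thesis by (simp add: start_def)
 next
  case 2
  have nf: "~  front R u w" using nonfront_small[OF 2(1)] 2(5) by simp
  then have "st w = bl u w" using 2 by (simp add: start_def)
  then show ?thesis using other[OF 2(1) nf] 2(5) rho_side w \<open>w \<notin> sideB {u, v}\<close> by auto
 qed
qed

lemma port_far: "w \<in> LB ==> st w \<in> set (R u) & p <= \<rho> (st w) & \<rho> (st w) < k & w \<in> sideB {u, v}"
proof -
 assume w: "w \<in> LB"
 from w show ?thesis
 proof (cases rule: LB_cases)
  case 1
  with rho_far[OF 1] rho_less[OF 1] w show ?thesis by (simp add: start_def)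
 next
  case 2
  have nf: "~  front R u w" using nonfront_small[OF 2(1)] 2(4) by auto
  then have "st w = bl u w" using 2 by (simp add: start_def)
  then show ?thesis using other[OF 2(1) nf] 2(4) rho_far rho_less w by auto
 qed
qed

lemma port_e: "st v \<in> set (R u) & \<rho> (st v) = k - 1 & v \<notin> sideB {u, v}"
 using uv nonfront e bl sides(4)[OF e] by (simp add: start_def)

text \<open>From a near in-port the reading meets some near neighbours, then the whole far block,
  then the remaining near neighbours. The new link opens the far block, so near links compare with
  it as with any far link.\<close>

lemma key_C1:
 assumes "w \<in> LA" "b \<in> LB"
 shows "ky w v < ky w b" and "a \<in> LA ==> ky w a < ky w v \<longleftrightarrow> ky w a < ky w b"
proof -
 define \<mu> where "\<mu> = \<rho> (st w)"
 have w: "st w \<in> set (R u)" "\<mu> < p" "w \<notin> sideB {u, v}" "w \<in> sideA {u, v}" using port_near[OF assms(1)] by (auto simp: \<mu>_def)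
 have ee: "sl w v = p - \<mu>" "sb w v = 2 * n - card (sideB {u, v})"
  using slot_e(2)[OF w(1)] w by (auto simp: \<mu>_def[symmetric] SL_def)
 obtain \<beta> where b: "p <= \<beta>" "\<beta> < k" "sl w b = \<beta> - \<mu>" "2 * n - card (sideB {u, v}) < sb w b"
  using far_link[OF w(1) assms(2)] w by (auto simp: \<mu>_def[symmetric] SL_def)
 show "ky w v < ky w b" using ee b w(2) by (auto simp: key_less)
 assume "a \<in> LA"
 from near_link[OF w(1) this] show "ky w a < ky w v \<longleftrightarrow> ky w a < ky w b"
 proof (elim disjE exE conjE)
  fix \<beta>' assume g: "\<beta>' < p" "sl w a = SL (\<rho> (st w)) \<beta>'" "n < sb w a"
  show ?thesis
  proof (cases "\<mu> < \<beta>'")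
   case True
   then have "sl w a = \<beta>' - \<mu>" using g(2) by (simp add: \<mu>_def[symmetric] SL_def)
   then have "sl w a < sl w v" "sl w a < sl w b" using ee(1) b(1,3) g(1) True by linarith+
   then show ?thesis by (simp add: key_less)
  next
   case False
   then have "sl w a = \<beta>' + k - \<mu>" using g(2) by (simp add: \<mu>_def[symmetric] SL_def)
   then have "sl w v < sl w a" "sl w b < sl w a" using ee(1) b(1,2,3) w(2) False pk by linarith+
   then show ?thesis by (simp add: key_less)
  qed
 next
  fix \<gamma> assume g: "\<gamma> < p" "sl w a = AF (\<rho> (st w)) \<gamma>" "sb w a < n"
  show ?thesis
  proof (cases "\<mu> <= \<gamma>")
   case True
   then have "sl w a = \<gamma> - \<mu> + 1" using g(2) by (simp add: \<mu>_def[symmetric] AF_def)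
   then have "sl w a <= sl w v" "sl w a <= sl w b" using ee(1) b(1,3) g(1) True by linarith+
   moreover have "sb w a < sb w v" "sb w a < sb w b" using ee(2) b(4) g(3) sizes(2) by linarith+
   ultimately show ?thesis by (auto simp: key_less)
  next
   case False
   then have "sl w a = \<gamma> + k - \<mu> + 1" using g(2) by (simp add: \<mu>_def[symmetric] AF_def)
   then have "sl w v < sl w a" "sl w b < sl w a" using ee(1) b(1,2,3) w(2) False pk by linarith+
   then show ?thesis by (simp add: key_less)
  qed
 qed
qed

text \<open>Read from behind the last far neighbour, the near block fills the slots 1 to
  \<open>p\<close> and the new link sits at \<open>p + 1\<close>, ahead of the far block. A far
  in-port merely shifts all near slots by the same amount.\<close>

lemma key_C2:
 shows "a \<in> LA ==> ky v a < ky v v" and "b \<in> LB ==> ky v v < ky v b"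
  and "a \<in> LA ==> a' \<in> LA ==> b \<in> LB ==> ky v a < ky v a' \<longleftrightarrow> ky b a < ky b a'"
proof -
 have w: "st v \<in> set (R u)" "\<rho> (st v) = k - 1" "v \<notin> sideB {u, v}" using port_e by auto
 have ee: "sl v v = p + 1" "sb v v = 2 * n - card (sideB {u, v})"
  using slot_e(2)[OF w(1)] w pk by (auto simp: SL_def)
 have near: "\<exists>\<beta><p. sl v a = \<beta> + 1 & n < sb v a" if "a \<in> LA" for a
  using near_link[OF w(1) that] w pk by (auto simp: SL_def)
 show "ky v a < ky v v" if "a \<in> LA"
  using near[OF that] ee by (auto simp: key_less)
 show "ky v v < ky v b" if b: "b \<in> LB"
 proof -
  obtain \<beta> where "p <= \<beta>" "\<beta> < k" "sl v b = \<beta> + 1" "2 * n - card (sideB {u, v}) < sb v b"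
   using far_link[OF w(1) b] w pk by (auto simp: SL_def)
  then show ?thesis using ee by (auto simp: key_less)
 qed
 show "ky v a < ky v a' \<longleftrightarrow> ky b a < ky b a'" if aa: "a \<in> LA" "a' \<in> LA" and b: "b \<in> LB"
 proof -
  have wb: "st b \<in> set (R u)" "p <= \<rho> (st b)" "\<rho> (st b) < k" "b \<in> sideB {u, v}" using port_far[OF b] by auto
  have "\<exists>\<beta>. sl v a = \<beta> + 1 & sl b a = \<beta> + (k - \<rho> (st b)) & sb v a = sb b a" if a: "a \<in> LA" for a
   using a
  proof (cases rule: LA_cases)
   case 1
   have "\<rho> a < p" using rho_side[OF 1] a by simp
   then show ?thesis using slot_R[OF w(1) 1] slot_R[OF wb(1) 1] w(2) wb(2,3) pk by (auto simp: SL_def)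
  next
   case 2
   have nf: "~  front R u a" using nonfront_small[OF 2(1)] 2(5) by simp
   have nv: "v \<notin> sideB {u, a}" "b \<notin> sideB {u, a}" using 2(3,4) wb(4) sides(2)[OF 2(1)] by auto
   obtain z where z: "al u a \<in> set (R u)" "z \<in> set (R u) Int sideB {u, a}"
    "(\<rho> (al u a) < k - 1 & \<rho> z = \<rho> (al u a) + 1) | \<rho> (al u a) = k - 1 & \<rho> z = 0"
    using other[OF 2(1) nf] by blast
   have zp: "\<rho> z < p" using z(2) 2(5) rho_side by auto
   have at: "a ~= t" using a by simp
   have "sl x a = SL (\<rho> (st x)) (\<rho> z) & sb x a = 2 * n - card (sideB {u, a})" if "st x \<in> set (R u)" "x \<notin> sideB {u, a}" for x
    using slot_after_eq[OF that(1) z(1)] AF_next[OF rho_less[OF that(1)] z(3)] that(2) nf 2(2) at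
    by (simp add: slot_def sub_def)
   then show ?thesis using w(1,2) wb(1-3) nv zp pk by (auto simp: SL_def)
  qed
  from this[OF aa(1)] this[OF aa(2)] show ?thesis by (auto simp: key_less)
 qed
qed

text \<open>From a far in-port the near block is read in one piece, between two pieces of the far
  block. The new link stands directly before or directly after this piece, depending on
  \<open>Y\<close>, so every far link is on the same side of it and of all near links.\<close>

lemma key_C3:
 assumes "w \<in> LB"
 shows "b \<in> LB ==> (ky w b < ky w v & (\<forall>a\<in>LA. ky w b < ky w a)) | (ky w v < ky w b & (\<forall>a\<in>LA. ky w a < ky w b))"
  and "~  Y u v ==> a \<in> LA ==> ky w a < ky w v" and "Y u v ==> a \<in> LA ==> ky w v < ky w a"
  and "w \<in> set (R u) ==> a \<in> LA ==> ky w a < ky w w"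
proof -
 define \<mu> where "\<mu> = \<rho> (st w)"
 have w: "st w \<in> set (R u)" "p <= \<mu>" "\<mu> < k" "w \<in> sideB {u, v}" using port_far[OF assms] by (auto simp: \<mu>_def)
 have ee: "sl w v = (if Y u v then k - \<mu> else p + k - \<mu>)"
  "sb w v = (if Y u v then card (sideB {u, v}) else 2 * n - card (sideB {u, v}))"
  using slot_e[OF w(1)] w by (auto simp: \<mu>_def[symmetric] SL_def AF_def)
 have near: "\<exists>\<beta><p. sl w a = \<beta> + k - \<mu> & n < sb w a" if "a \<in> LA" for a
  using near_link[OF w(1) that] w by (auto simp: \<mu>_def[symmetric] SL_def)
 show "ky w a < ky w v" if "~  Y u v" "a \<in> LA"
  using near[OF that(2)] ee that(1) w by (auto simp: key_less)
 show "ky w v < ky w a" if "Y u v" "a \<in> LA"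
  using near[OF that(2)] ee that(1) w sizes(2) by (auto simp: key_less)
 show "ky w a < ky w w" if "w \<in> set (R u)" "a \<in> LA"
 proof -
  have "\<rho> w = \<mu>" using that(1) by (simp add: \<mu>_def start_def)
  then have "sl w w = k" using slot_R[OF w(1) that(1)] by (simp add: \<mu>_def[symmetric] SL_def)
  then show ?thesis using near[OF that(2)] w by (auto simp: key_less)
 qed
 show "(ky w b < ky w v & (\<forall>a\<in>LA. ky w b < ky w a)) | (ky w v < ky w b & (\<forall>a\<in>LA. ky w a < ky w b))" if b: "b \<in> LB"
 proof -
  have "(sl w b < k - \<mu> | sl w b = k - \<mu> & sb w b < card (sideB {u, v})) |
   (p + k - \<mu> < sl w b | p + k - \<mu> = sl w b & 2 * n - card (sideB {u, v}) < sb w b)"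
   using far_link[OF w(1) b]
  proof (elim disjE exE conjE)
   fix \<beta> assume g: "p <= \<beta>" "\<beta> < k" "sl w b = SL (\<rho> (st w)) \<beta>" "2 * n - card (sideB {u, v}) < sb w b"
   show ?thesis
   proof (cases "\<mu> < \<beta>")
    case True
    then have "sl w b = \<beta> - \<mu>" using g(3) by (simp add: \<mu>_def[symmetric] SL_def)
    with True g(2) show ?thesis by linarith
   next
    case False
    then have "sl w b = \<beta> + k - \<mu>" using g(3) by (simp add: \<mu>_def[symmetric] SL_def)
    with g(1,4) w(3) show ?thesis by linarith
   qed
  next
   fix \<gamma> assume g: "p <= \<gamma>" "\<gamma> < k" "sl w b = AF (\<rho> (st w)) \<gamma>" "sb w b < card (sideB {u, v})"
   show ?thesis
   proof (cases "\<mu> <= \<gamma>")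
    case True
    then have "sl w b = \<gamma> - \<mu> + 1" using g(3) by (simp add: \<mu>_def[symmetric] AF_def)
    with True g(2,4) show ?thesis by linarith
   next
    case False
    then have "sl w b = \<gamma> + k - \<mu> + 1" using g(3) by (simp add: \<mu>_def[symmetric] AF_def)
    with g(1) w(3) show ?thesis by linarith
   qed
  qed
  then show ?thesis
  proof
   assume l: "sl w b < k - \<mu> | sl w b = k - \<mu> & sb w b < card (sideB {u, v})"
   have "ky w b < ky w a" if "a \<in> LA" for a using near[OF that] l sizes(2) w by (auto simp: key_less)
   moreover have "ky w b < ky w v" using ee l sizes(2) pk w by (auto simp: key_less)
   ultimately show ?thesis by blast
  next
   assume l: "p + k - \<mu> < sl w b | p + k - \<mu> = sl w b & 2 * n - card (sideB {u, v}) < sb w b"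
   have "ky w a < ky w b" if "a \<in> LA" for a using near[OF that] l w by (auto simp: key_less)
   moreover have "ky w v < ky w b" using ee l pk w sizes(2) by (auto simp: key_less)
   ultimately show ?thesis by blast
  qed
 qed
qed

end

context stage
begin

lemma keys_placed: "placed (%p x z. ky p x < ky p z) LA LB v (Y u v) (set (R u))"
proof (cases "front R u v")
 case True
 show ?thesis unfolding front_LA[OF True] using front_e_first[OF True] by (auto simp: placed_def)
next
 case False
 then interpret nonfront_stage V E t \<pi> \<pi>' R al bl Y nl w0 u v K by unfold_locales
 obtain \<rho> k p where "coordinates V E t \<pi> \<pi>' R al bl Y nl w0 u v K \<rho> k p" using ex_coordinates by blast
 then interpret coordinates V E t \<pi> \<pi>' R al bl Y nl w0 u v K \<rho> k p .
 obtain a0 where "a0 \<in> set (R u)" "a0 \<in> sideA {u, v}" using False by (auto simp: front_def)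
 then have "a0 \<in> LA" using R_set[of u] uv K(1) by auto
 then show ?thesis
  unfolding placed_def
 proof (intro conjI ballI impI, goal_cases)
  case (1 w b) then show ?case by (intro key_C1(1))
 next
  case (2 w b a) then show ?case by (intro key_C1(2))
 next
  case (3 a) then show ?case by (intro key_C2(1))
 next
  case (4 b) then show ?case by (intro key_C2(2))
 next
  case (5 b a a') then show ?case by (intro key_C2(3))
 next
  case (6 w b) then show ?case using key_C3(1)[of w b] by blast
 next
  case (7 w a) with key_C3(2,3)[of w a] show ?case by simp
 next
  case (8 w a) then show ?case by (intro key_C3(4))
 qed
qed

definition "LinkA = {l \<in> K. u \<in> l & l Int sideA {u, v} ~= {} & t \<notin> l}"
definition "LinkB = {l \<in> K. u \<in> l & l Int sideB {u, v} ~= {}}"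

lemma LinkA_eq: "LinkA = (%a. {u, a}) ` LA"
proof -
 have "l \<in> (%a. {u, a}) ` LA" if "l \<in> LinkA" for l
 proof -
  have "l \<in> links_at E u" using that K(2) by (auto simp: LinkA_def links_at_def)
  then obtain a where "l = {u, a}" by (auto simp: links_at_image)
  then show ?thesis using that sides(3)[OF e] by (auto simp: LinkA_def)
 qed
 then show ?thesis using uv by (auto simp: LinkA_def)
qed

lemma LinkB_eq: "LinkB = (%a. {u, a}) ` LB"
proof -
 have "l \<in> (%a. {u, a}) ` LB" if "l \<in> LinkB" for l
 proof -
  have "l \<in> links_at E u" using that K(2) by (auto simp: LinkB_def links_at_def)
  then obtain a where "l = {u, a}" by (auto simp: links_at_image)
  then show ?thesis using that sides(4)[OF e] by (auto simp: LinkB_def)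
 qed
 then show ?thesis by (auto simp: LinkB_def)
qed

lemma LA_LB_E: "a \<in> LA ==> {u, a} \<in> E" "b \<in> LB ==> {u, b} \<in> E"
 using K(2) by auto

lemma ranks_placed:
 "placed (%p a b. r.rk u (Some p) a < r.rk u (Some p) b) LinkA LinkB {u, v} (Y u v) H"
 unfolding LinkA_eq LinkB_eq
proof (rule placed_image[OF keys_placed])
 fix p a b assume "p \<in> insert v (LA Un LB)" "a \<in> insert v (LA Un LB)" "b \<in> insert v (LA Un LB)"
 then show "r.rk u (Some {u, p}) {u, a} < r.rk u (Some {u, p}) {u, b} \<longleftrightarrow> ky p a < ky p b"
  using LA_LB_E uv(6) by (intro rank_key[OF uv(2,4)]) blast+
next
 fix b assume "b \<in> LB" "{u, b} \<in> H"
 then show "b \<in> set (R u)" using R_set[OF uv(2,4)] sides(6)[OF e] by auto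
qed

lemma stage_None: "\<exists>f\<in>LinkA Un LinkB. \<pi>' u None = \<pi>' u (Some f)"
proof -
 have "R u ~= []" using R_far[OF e] by auto
 then have w: "w0 u \<in> set (R u)" using w0[OF uv(2,4)] by simp
 then have "w0 u \<in> LA | w0 u \<in> LB" using R_sides[OF w e] R_set[OF uv(2,4)] K(1) by auto
 then show ?thesis using \<pi>'_None[OF uv(2,4)] by (auto simp: LinkA_eq LinkB_eq)
qed

end

context assembled
begin

text \<open>Both ends of \<open>e\<close> are stages of their own; the orientation \<open>Y\<close>
  given by the witness path decides which of them plays the part of \<open>y\<close>.\<close>

lemma Res_step:
 assumes e: "e \<in> S0" "e \<notin> K" and K: "H \<subseteq> K" "K \<subseteq> E" "r.Res K"
  and small: "!!f. f \<in> K - H ==> f \<in> S0 & card (sideB f) <= card (sideB e)"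
 shows "r.Res (insert e K)"
proof -
 obtain x y q j where xy: "e = {x, y}" "~  Y x y" "Y y x" and q: "link_path H q" "hd q = y" "last q = x"
  "!!i. 0 < i ==> Suc i < length q ==> q ! i \<in> sideB e" "0 < j" "Suc j < length q"
  "h.rk (q ! j) None {q ! j, q ! Suc j} < h.rk (q ! j) None {q ! (j - 1), q ! j}"
  using witness[OF e(1)] by auto
 have st: "stage V E t \<pi> \<pi>' R al bl Y nl w0 z z' K" if "e = {z, z'}" for z z'
  by unfold_locales (use that e K small in auto)
 have ex: "\<exists>z'. e = {z, z'}" if "z \<in> e" for z using that xy by auto
 have zV: "z \<in> V" "z ~= t" if "z \<in> e" for z using that xy(1) S0_D[of x y] e(1) by auto
 have LA: "{l \<in> K. z \<in> l & l Int sideA e ~= {} & t \<notin> l} = stage.LinkA E t z z' K"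
  and LB: "{l \<in> K. z \<in> l & l Int sideB e ~= {}} = stage.LinkB V E t z z' K" if "e = {z, z'}" for z z'
  using stage.LinkA_def[OF st[OF that]] stage.LinkB_def[OF st[OF that]] that by auto
 have BV: "v \<in> V" "v ~= t" "v \<notin> e" if "v \<in> sideB e" for v using that sides[OF e(1)] by auto
 show ?thesis
 proof (rule r.Res_insert_link[OF K(3,1,2) e(2,1) xy(1) q(1-6)])
  have qj: "q ! j \<in> sideB e" using q by auto
  have l: "{q ! j, q ! Suc j} \<in> H" "{q ! (j - 1), q ! j} \<in> H"
   using link_pathD[OF q(1), of j] link_pathD[OF q(1), of "j - 1"] q(5,6) by simp_all
  show "r.rk (q ! j) None {q ! j, q ! Suc j} < r.rk (q ! j) None {q ! (j - 1), q ! j}"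
   using order_H[OF BV(1,2)[OF qj], of None, OF _ l] q(7) by auto
  show "r.rk v (Some f) l < r.rk v (Some f) f"
   if v: "v \<in> sideB e" "f \<in> H" "l \<in> H" "v \<in> f" "v \<in> l" "l ~= f" for v f l
  proof -
   have "t \<notin> f" using side_links(2)[OF e(1), of f] v sides[OF e(1)] xy(1) S0_D[of x y] e(1) by auto
   moreover obtain w where w: "f = {v, w}" using v(2,4) by (elim h.link_at_cases)
   ultimately have "w \<in> set (R v)" using R_set[OF BV(1,2)[OF v(1)]] v(2) by auto
   then show ?thesis
    using order_H[OF BV(1,2)[OF v(1)], of "Some f" l f] w v h.rotational_inport_last[OF rot[OF BV(1,2)[OF v(1)]] BV(1,2)[OF v(1)], of f l] \<open>t \<notin> f\<close>
    by auto
  qed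
 next
  fix z p l assume "z \<in> e" "p \<in> in_ports E z" "{z, t} \<in> E" "l \<in> E" "z \<in> l"
  then show "r.rk z p {z, t} <= r.rk z p l" using t_first zV by blast
 next
  fix z assume z: "z \<in> e"
  then obtain z' where z': "e = {z, z'}" using ex by auto
  show "\<exists>f\<in>{l \<in> K. z \<in> l & l Int sideA e ~= {} & t \<notin> l} Un {l \<in> K. z \<in> l & l Int sideB e ~= {}}. \<pi>' z None = \<pi>' z (Some f)"
   using stage.stage_None[OF st[OF z']] unfolding LA[OF z'] LB[OF z'] .
  have "Y z z' \<longleftrightarrow> z = y" using z' xy(1-3) S0_D[of x y] e(1) by (auto simp: doubleton_eq_iff)
  then show "placed (%p a b. r.rk z (Some p) a < r.rk z (Some p) b) {l \<in> K. z \<in> l & l Int sideA e ~= {} & t \<notin> l}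
    {l \<in> K. z \<in> l & l Int sideB e ~= {}} e (z = y) H"
   using stage.ranks_placed[OF st[OF z'], folded z', folded LA[OF z'] LB[OF z']] by simp
 qed
qed

lemma assembled_resilient: "perfectly_resilient V E t \<pi>'"
proof -
 have finS: "finite S" using finite_E S_E finite_subset by blast
 have finS0: "finite S0" using finS by (auto simp: S0_def)
 have "X \<subseteq> S0 --> r.Res (H Un X)" if "finite X" for X
  using that
 \<comment> \<open>This induction inserts the elements by increasing rank, so each new link has a
   far side at least as large as those present.\<close>
 proof (induction X rule: finite_ranking_induct[where f = "%e. card (sideB e)"])
  case empty
  with Res_H show ?case by simp
 next
  case (insert e X)
  show ?case
  proof
   assume X: "insert e X \<subseteq> S0"
   then have eS: "e \<in> S0" and XS: "X \<subseteq> S0" and res: "r.Res (H Un X)" using insert by auto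
   show "r.Res (H Un insert e X)"
   proof (cases "e \<in> X")
    case True
    with res show ?thesis by (simp add: insert_absorb)
   next
    case False
    have "r.Res (insert e (H Un X))"
     by (rule Res_step) (use eS False XS res insert S0_E in "auto simp: S0_def")
    then show ?thesis by simp
   qed
  qed
 qed
 then have base: "r.Res (H Un S0)" using finS0 by simp
 have "X \<subseteq> S - S0 --> r.Res (H Un S0 Un X)" if "finite X" for X
  using that
 proof (induction X rule: finite_induct)
  case empty
  with base show ?case by simp
 next
  case (insert e X)
  show ?case
  proof
   assume X: "insert e X \<subseteq> S - S0"
   then have e: "e \<in> S" "e \<in> E" "t \<in> e" using S_E by (auto simp: S0_def)
   then have "e \<in> links_at E t" by (simp add: links_at_def)
   then obtain u where u: "e = {u, t}" by (auto simp: links_at_image insert_commute)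
   have ut: "u \<in> V" "u ~= t" using link_ends[of u t] e(2) u by auto
   have "r.Res (insert e (H Un S0 Un X))"
   proof (rule r.Res_insert_root_link[OF _ _ _ e(1) u])
    show "r.rk u p e <= r.rk u p l" if "p \<in> in_ports E u" "l \<in> E" "u \<in> l" for p l
     using t_first[OF ut that(1) _ that(2,3)] e(2) u by simp
   qed (use insert X S0_E S_E in auto)
   then show "r.Res (H Un S0 Un insert e X)" by simp
  qed
 qed
 then have "r.Res (H Un S0 Un (S - S0))" using finS by blast
 moreover have "H Un S0 Un (S - S0) = E" using S_E by (auto simp: S0_def)
 ultimately show ?thesis using r.Res_perfectly_resilient by simp
qed

end

section \<open>Reasoning about programs\<close>

text \<open>Total correctness with the number of steps handed to the postcondition, so that
  functional and cost statements are proved together.\<close>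

definition run :: "com => store => (nat => store => bool) => bool" where
 "run c \<mu> Q \<longleftrightarrow> (\<exists>k \<nu>. exec c \<mu> k \<nu> & Q k \<nu>)"

lemma run_mono: "run c \<mu> P ==> (!!k \<nu>. P k \<nu> ==> Q k \<nu>) ==> run c \<mu> Q"
 unfolding run_def by blast

lemma run_Skip [simp]: "run Skip \<mu> Q \<longleftrightarrow> Q 1 \<mu>"
 unfolding run_def using exec.Skip[of \<mu>] by (auto elim: exec.cases)

lemma run_Write [simp]: "run (Write a x y) \<mu> Q \<longleftrightarrow> Q 1 (set_cell a (aval x \<mu>) (aval y \<mu>) \<mu>)"
 unfolding run_def using exec.Write[of a x y \<mu>] by (auto elim: exec.cases)

lemma run_Seq [simp]: "run (Seq c d) \<mu> Q \<longleftrightarrow> run c \<mu> (%k \<nu>. run d \<nu> (%l. Q (k + l)))"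
 unfolding run_def
proof
 assume "\<exists>k \<nu>. exec (Seq c d) \<mu> k \<nu> & Q k \<nu>"
 then obtain k \<nu> where *: "exec (Seq c d) \<mu> k \<nu>" "Q k \<nu>" by auto
 from *(1) show "\<exists>k \<nu>. exec c \<mu> k \<nu> & (\<exists>l \<nu>'. exec d \<nu> l \<nu>' & Q (k + l) \<nu>')"
  by cases (use *(2) in blast)
qed (auto intro: exec.Seq)

lemma run_SeqI: "run c \<mu> P ==> (!!k \<nu>. P k \<nu> ==> run d \<nu> (%l. Q (k + l))) ==> run (Seq c d) \<mu> Q"
 unfolding run_Seq by (rule run_mono)

lemma run_Cond [simp]: "run (Cond b c d) \<mu> Q \<longleftrightarrow> (if bval b \<mu> then run c \<mu> (%k. Q (Suc k)) else run d \<mu> (%k. Q (Suc k)))"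
 unfolding run_def
proof
 assume "\<exists>k \<nu>. exec (Cond b c d) \<mu> k \<nu> & Q k \<nu>"
 then obtain k \<nu> where *: "exec (Cond b c d) \<mu> k \<nu>" "Q k \<nu>" by auto
 from *(1) show "if bval b \<mu> then \<exists>k \<nu>. exec c \<mu> k \<nu> & Q (Suc k) \<nu> else \<exists>k \<nu>. exec d \<mu> k \<nu> & Q (Suc k) \<nu>"
  by cases (use *(2) in auto)
qed (auto intro: exec.CondTrue exec.CondFalse split: if_splits)

lemma run_While_True: "bval b \<mu> ==> run c \<mu> (%k \<nu>. run (While b c) \<nu> (%l. Q (Suc (k + l)))) ==> run (While b c) \<mu> Q"
 unfolding run_def by (auto intro: exec.WhileTrue)

lemma run_While_False: "~  bval b \<mu> ==> Q 1 \<mu> ==> run (While b c) \<mu> Q"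
 unfolding run_def using exec.WhileFalse[of b \<mu> c] by blast

lemma set_cell_other [simp]: "b ~= a ==> set_cell a i x \<mu> b = \<mu> b"
 by (simp add: set_cell_def)

lemma set_cell_same [simp]: "set_cell a i x \<mu> a = (\<mu> a)(i := x)"
 by (simp add: set_cell_def)

definition same :: "nat set => store => store => bool" where
 "same W \<mu> \<nu> \<longleftrightarrow> (\<forall>a. a \<notin> W --> \<nu> a = \<mu> a)"

lemma same_refl [simp]: "same W \<mu> \<mu>"
 by (simp add: same_def)

lemma same_trans: "same W \<mu> \<nu> ==> same W \<nu> \<xi> ==> same W \<mu> \<xi>"
 by (simp add: same_def)

lemma same_mono: "same W \<mu> \<nu> ==> W \<subseteq> W' ==> same W' \<mu> \<nu>"
 by (auto simp: same_def)

lemma same_set_cell [simp]: "a \<in> W ==> same W \<mu> (set_cell a i x \<nu>) \<longleftrightarrow> same W \<mu> \<nu>"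
 by (auto simp: same_def set_cell_def)

lemma same_set_cell_left [simp]: "a \<in> W ==> same W (set_cell a i x \<mu>) \<nu> \<longleftrightarrow> same W \<mu> \<nu>"
 by (auto simp: same_def set_cell_def)

lemma sameD: "same W \<mu> \<nu> ==> a \<notin> W ==> \<nu> a = \<mu> a"
 by (simp add: same_def)

abbreviation Var :: "nat => aexp" where "Var s \<equiv> Read s (Const 0)"
abbreviation Assign :: "nat => aexp => com" where "Assign s x \<equiv> Write s (Const 0) x"
abbreviation When :: "bexp => com => com" where "When b c \<equiv> Cond b c Skip"

definition For :: "nat => aexp => aexp => com => com" where
 "For i lo hi c = Seq (Assign i lo) (While (Less (Var i) hi) (Seq c (Assign i (Add (Var i) (Const 1)))))"

text \<open>The accumulated cost is an argument of the invariant, which permits amortised bounds.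
  Each round pays 2 for test and increment; the final 2 is the initial assignment and the failing
  test.\<close>

lemma run_For_cost:
 assumes lo: "aval lo \<mu>0 = a" and ab: "a <= b" and iW: "i \<in> W"
  and hi: "!!\<mu>. same W \<mu>0 \<mu> ==> aval hi \<mu> = b"
  and ins: "!!j c \<mu> x. P j c \<mu> ==> P j c (set_cell i 0 x \<mu>)"
  and init: "P a 0 \<mu>0"
  and step: "!!j c \<mu>. a <= j ==> j < b ==> same W \<mu>0 \<mu> ==> \<mu> i 0 = j ==> P j c \<mu> ==>
   run body \<mu> (%k \<nu>. same W \<mu> \<nu> & \<nu> i 0 = j & P (Suc j) (c + k + 2) \<nu>)"
  and post: "!!c \<mu>. same W \<mu>0 \<mu> ==> P b c \<mu> ==> Q (c + 2) \<mu>"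
 shows "run (For i lo hi body) \<mu>0 Q"
proof -
 let ?w = "While (Less (Var i) hi) (Seq body (Assign i (Add (Var i) (Const 1))))"
 have "run ?w \<mu> (%l. Q (Suc (c + l)))" if "a <= j" "j <= b" "same W \<mu>0 \<mu>" "\<mu> i 0 = j" "P j c \<mu>" for j c \<mu>
  using that
 proof (induction "b - j" arbitrary: j c \<mu>)
  case 0
  then have "j = b" by simp
  then show ?case using 0 hi[OF 0(4)] post[of \<mu> c] by (intro run_While_False) auto
 next
  case (Suc d)
  then have j: "j < b" by simp
  show ?case
  proof (rule run_While_True)
   show "bval (Less (Var i) hi) \<mu>" using hi[OF Suc.prems(3)] Suc.prems j by simp
   show "run (Seq body (Assign i (Add (Var i) (Const 1)))) \<mu> (%k \<nu>. run ?w \<nu> (%l. Q (Suc (c + Suc (k + l)))))"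
    unfolding run_Seq run_Write
   proof (rule run_mono[OF step[OF Suc.prems(1) j Suc.prems(3-5)]])
    fix k \<nu> assume t: "same W \<mu> \<nu> & \<nu> i 0 = j & P (Suc j) (c + k + 2) \<nu>"
    let ?\<nu> = "set_cell i (aval (Const 0) \<nu>) (aval (Add (Var i) (Const 1)) \<nu>) \<nu>"
    have "run ?w ?\<nu> (%l. Q (Suc (c + k + 2 + l)))"
     by (rule Suc.hyps(1)) (use Suc.hyps(2) Suc.prems j t iW ins in "auto intro: same_trans")
    then show "run ?w ?\<nu> (%l. Q (Suc (c + Suc (k + 1 + l))))" by (simp add: add.assoc)
   qed
  qed
 qed
 from this[of a "set_cell i 0 a \<mu>0" 0] show ?thesis
  unfolding For_def using lo ab iW ins init by simp
qed

lemma run_For: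
 assumes lo: "aval lo \<mu>0 = a" and ab: "a <= b" and iW: "i \<in> W"
  and hi: "!!\<mu>. same W \<mu>0 \<mu> ==> aval hi \<mu> = b"
  and ins: "!!j \<mu> x. P j \<mu> ==> P j (set_cell i 0 x \<mu>)"
  and init: "P a \<mu>0"
  and step: "!!j \<mu>. a <= j ==> j < b ==> same W \<mu>0 \<mu> ==> \<mu> i 0 = j ==> P j \<mu> ==>
   run body \<mu> (%k \<nu>. k <= C & same W \<mu> \<nu> & \<nu> i 0 = j & P (Suc j) \<nu>)"
  and post: "!!k \<mu>. same W \<mu>0 \<mu> ==> P b \<mu> ==> k <= (b - a) * (C + 2) + 2 ==> Q k \<mu>"
 shows "run (For i lo hi body) \<mu>0 Q"
proof (rule run_For_cost[where P = "%j c \<mu>. P j \<mu> & c <= (j - a) * (C + 2)" and W = W, OF lo ab iW hi])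
 fix j c \<mu> assume "a <= j" "j < b" "same W \<mu>0 \<mu>" "\<mu> i 0 = j" "P j \<mu> & c <= (j - a) * (C + 2)"
 then show "run body \<mu> (%k \<nu>. same W \<mu> \<nu> & \<nu> i 0 = j & P (Suc j) \<nu> & c + k + 2 <= (Suc j - a) * (C + 2))"
  by (intro run_mono[OF step]) (auto simp: Suc_diff_le)
next
 fix c \<mu> assume "same W \<mu>0 \<mu>" "P b \<mu> & c <= (b - a) * (C + 2)"
 then show "Q (c + 2) \<mu>" by (intro post) auto
qed (use ins init in auto)

definition off :: "nat list list => nat => nat" where
 "off xss j = length (concat (take j xss))"

lemma off_Suc: "v < length xss ==> off xss (Suc v) = off xss v + length (xss ! v)"
 by (simp add: off_def take_Suc_conv_app_nth)

definition stored :: "store => nat => nat => nat list list => bool" where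
 "stored \<mu> ofs dd xss \<longleftrightarrow> (\<forall>j\<le>length xss. \<mu> ofs j = off xss j) &
  (\<forall>v<length xss. \<forall>i<length (xss ! v). \<mu> dd (off xss v + i) = xss ! v ! i)"

lemma stored_same: "stored \<mu> ofs dd xss ==> \<nu> ofs = \<mu> ofs ==> \<nu> dd = \<mu> dd ==> stored \<nu> ofs dd xss"
 by (simp add: stored_def)

text \<open>The loop variable runs through absolute positions in the concatenated data, so the body
  can read the current entry directly.\<close>

definition Row :: "nat => nat => nat => com => com" where
 "Row j ofs s c = For j (Read ofs (Var s)) (Read ofs (Add (Var s) (Const 1))) c"

lemma run_Row:
 assumes st: "stored \<mu>0 ofs dd xss" "v < length xss" "\<mu>0 s 0 = v" and xs: "xs = xss ! v"
  and W: "ofs \<notin> W" "dd \<notin> W" "s \<notin> W" "j \<in> W"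
  and ins: "!!i \<mu> x. P i \<mu> ==> P i (set_cell j 0 x \<mu>)"
  and init: "P 0 \<mu>0"
  and step: "!!i \<mu>. i < length xs ==> same W \<mu>0 \<mu> ==> \<mu> dd (\<mu> j 0) = xs ! i ==> P i \<mu> ==>
   run body \<mu> (%k \<nu>. k <= C & same W \<mu> \<nu> & \<nu> j 0 = \<mu> j 0 & P (Suc i) \<nu>)"
  and post: "!!k \<mu>. same W \<mu>0 \<mu> ==> P (length xs) \<mu> ==> k <= length xs * (C + 2) + 2 ==> Q k \<mu>"
 shows "run (Row j ofs s body) \<mu>0 Q"
 unfolding Row_def
proof (rule run_For[where P = "%i. P (i - off xss v)" and W = W and a = "off xss v" and b = "off xss (Suc v)" and C = C])
 have cells: "\<mu>0 ofs v = off xss v" "\<mu>0 ofs (Suc v) = off xss (Suc v)" using st by (auto simp: stored_def)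
 show "aval (Read ofs (Var s)) \<mu>0 = off xss v" using cells st(3) by simp
 show "aval (Read ofs (Add (Var s) (Const 1))) \<mu> = off xss (Suc v)" if "same W \<mu>0 \<mu>" for \<mu>
  using cells st(3) sameD[OF that] W by simp
 show "off xss v <= off xss (Suc v)" using off_Suc[OF st(2)] by simp
 fix i \<mu> assume i: "off xss v <= i" "i < off xss (Suc v)" "same W \<mu>0 \<mu>" "\<mu> j 0 = i" "P (i - off xss v) \<mu>"
 let ?i = "i - off xss v"
 have l: "?i < length xs" using i off_Suc[OF st(2)] xs by simp
 have "\<mu>0 dd (off xss v + ?i) = xss ! v ! ?i" using st(1,2) l xs unfolding stored_def by blast
 then have "\<mu> dd (\<mu> j 0) = xs ! ?i" using i sameD[OF i(3) W(2)] xs by simp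
 from step[OF l i(3) this i(5)] show "run body \<mu> (%k \<nu>. k <= C & same W \<mu> \<nu> & \<nu> j 0 = i & P (Suc i - off xss v) \<nu>)"
  using i by (simp add: Suc_diff_le)
qed (use W ins init post off_Suc[OF st(2)] xs in auto)

text \<open>Distinct nodes of the queue have distinct rows, so scanning all of them costs no more
  than the total size of the graph.\<close>

lemma sum_rows_le:
 assumes "distinct Q" "set Q \<subseteq> {..<length xss}" "i <= length Q"
 shows "(\<Sum>k<i. length (xss ! (Q ! k))) <= (\<Sum>v<length xss. length (xss ! v))"
proof -
 have "(\<Sum>k<i. length (xss ! (Q ! k))) = (\<Sum>x\<in>set (take i Q). length (xss ! x))"
 proof (rule sum.reindex_bij_betw[symmetric, of "%k. Q ! k" "{..<i}" "set (take i Q)" "%x. length (xss ! x)", symmetric])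
  show "bij_betw (%k. Q ! k) {..<i} (set (take i Q))"
   using assms nth_image[of i Q] by (auto simp: bij_betw_def inj_on_def nth_eq_iff_index_eq lessThan_atLeast0)
 qed
 also have "\<dots> <= (\<Sum>v<length xss. length (xss ! v))"
  using assms(2) by (intro sum_mono2) (auto dest: in_set_takeD)
 finally show ?thesis .
qed

section \<open>Graph search\<close>

text \<open>Scalar variables are kept in cell 0 of the arrays 9 to 39.\<close>

abbreviation "aU \<equiv> 9 :: nat"
abbreviation "aV \<equiv> 10 :: nat"
abbreviation "aI \<equiv> 12 :: nat"
abbreviation "aTail \<equiv> 13 :: nat"
abbreviation "aMark \<equiv> 14 :: nat"
abbreviation "aBase \<equiv> 15 :: nat"
abbreviation "aX \<equiv> 22 :: nat"
abbreviation "aJ \<equiv> 23 :: nat"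
abbreviation "aW \<equiv> 25 :: nat"
abbreviation "aRoot \<equiv> 35 :: nat"
abbreviation "aM \<equiv> 40 :: nat"
abbreviation "aQ \<equiv> 41 :: nat"
abbreviation "aPar \<equiv> 42 :: nat"

definition visit :: com where
 "visit = Seq (Assign aW (Read 4 (Var aJ)))
  (When (Equal (Read aM (Add (Var aBase) (Var aW))) (Const 0))
   (Seq (Write aM (Add (Var aBase) (Var aW)) (Var aMark))
   (Seq (Write aPar (Var aW) (Var aX))
   (Seq (Write aQ (Var aTail) (Var aW))
      (Assign aTail (Add (Var aTail) (Const 1)))))))"

text \<open>Breadth-first search with exactly \<open>n\<close> rounds; rounds beyond the tail of the
  queue are idle. The root has to be marked by the caller, and every marked node acts as an
  obstacle.\<close>

definition search :: com where
 "search = Seq (Write aQ (Const 0) (Var aRoot)) (Seq (Assign aTail (Const 1))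
  (For aI (Const 0) (Var 0)
   (When (Less (Var aI) (Var aTail)) (Seq (Assign aX (Read aQ (Var aI))) (Row aJ 3 aX visit)))))"

abbreviation "searchW \<equiv> {aI, aTail, aX, aJ, aW, aM, aQ, aPar}"
abbreviation "visitW \<equiv> {aTail, aW, aM, aQ, aPar}"

text \<open>The result is described by the nodes \<open>U\<close> unmarked beforehand: the search
  explores what is reachable through \<open>U\<close> and changes no other mark. This allows two
  searches in the same block, and blocks of different links side by side.\<close>

lemma run_search:
 fixes \<mu>0 :: store and rot :: "nat list list" and L :: "nat set set"
 defines "b \<equiv> \<mu>0 aBase 0" and "r \<equiv> \<mu>0 aRoot 0" and "mk \<equiv> \<mu>0 aMark 0"
 defines "U \<equiv> {w. w < length rot & \<mu>0 aM (b + w) = 0}"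
 assumes st: "stored \<mu>0 3 4 rot" "\<mu>0 0 0 = length rot"
  and L: "!!x. x < length rot ==> set (rot ! x) = {w. {x, w} \<in> L}" "!!x w. {x, w} \<in> L ==> x < length rot & w < length rot"
  and r: "r < length rot" "\<mu>0 aM (b + r) ~= 0" and mk: "mk ~= 0"
  and post: "!!k \<mu> Q. same searchW \<mu>0 \<mu> ==> distinct Q ==> set Q = {w. linked {l \<in> L. l \<subseteq> insert r U} r w} ==>
   set Q \<subseteq> insert r U ==>
   \<mu> aTail 0 = length Q ==> (!!w. w \<in> U ==> \<mu> aM (b + w) = (if w \<in> set Q then mk else 0)) ==>
   (!!a. (!!w. w \<in> U ==> a ~= b + w) ==> \<mu> aM a = \<mu>0 aM a) ==>
   (!!w. w \<in> set Q ==> w ~= r ==> \<exists>q. link_path L q & hd q = w & last q = r & 2 <= length q &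
    q ! 1 = \<mu> aPar w & set (butlast q) \<subseteq> U) ==>
   k <= 7 * length rot + 9 * (\<Sum>v<length rot. length (rot ! v)) + 4 ==> T k \<mu>"
 shows "run search \<mu>0 T"
proof -
 define n where "n = length rot"
 have rU: "r \<notin> U" using r(2) by (simp add: U_def)
 define mark where "mark Q \<mu> \<longleftrightarrow> (\<forall>w\<in>U. \<mu> aM (b + w) = (if w \<in> set Q then mk else 0)) &
  (\<forall>a. (\<forall>w\<in>U. a ~= b + w) --> \<mu> aM a = \<mu>0 aM a)" for Q and \<mu> :: store
 \<comment> \<open>Following the first parent pointer starts a simple path to the root with all
   earlier nodes in \<open>U\<close>. A newly found node is not yet queued, so it can be prefixed to
   the path of its parent.\<close>
 define path where "path Q \<mu> w q \<longleftrightarrow> link_path L q & hd q = w & last q = r & set q \<subseteq> set Q & set (butlast q) \<subseteq> U &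
  (w ~= r --> 2 <= length q & q ! 1 = \<mu> aPar w)" for Q w q and \<mu> :: store
 define inv where "inv Q \<mu> \<longleftrightarrow> distinct Q & Q ~= [] & Q ! 0 = r & set Q \<subseteq> insert r U & \<mu> aTail 0 = length Q &
  (\<forall>k<length Q. \<mu> aQ k = Q ! k) & mark Q \<mu> & (\<forall>w\<in>set Q. \<exists>q. path Q \<mu> w q)" for Q \<mu>
 define saturated where "saturated Q x \<longleftrightarrow> (\<forall>w. {x, w} \<in> L --> w \<in> U --> w \<in> set Q)" for Q x
 have inv_frame: "inv Q (set_cell a i x \<mu>)" if "inv Q \<mu>" "a \<notin> {aTail, aQ, aM, aPar}" for Q a i x \<mu>
  using that by (auto simp: inv_def mark_def path_def)
 have visit: "run visit \<mu> (%k \<nu>. k <= 7 & same visitW \<mu> \<nu> &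
   (\<exists>zs. inv (Q @ zs) \<nu> & (w \<in> U --> w \<in> set (Q @ zs))))"
  if w: "\<mu> 4 (\<mu> aJ 0) = w" "\<mu> aMark 0 = mk" "\<mu> aBase 0 = b" and i: "inv Q \<mu>" and x: "\<mu> aX 0 \<in> set Q" "{\<mu> aX 0, w} \<in> L" for w \<mu> Q
 proof (cases "\<mu> aM (b + w) = 0")
  case False
  have "w \<in> U --> w \<in> set Q" using i False by (auto simp: inv_def mark_def split: if_splits)
  then show ?thesis
   unfolding visit_def using w False inv_frame[OF i, of aW] by (auto intro!: exI[of _ "[]"])
 next
  case True
  have wn: "w < length rot" using L(2)[OF x(2)] by simp
  have wU: "w \<in> U"
  proof (rule ccontr)
   assume "w \<notin> U"
   then have "\<forall>z\<in>U. b + w ~= b + z" by auto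
   then have "\<mu> aM (b + w) = \<mu>0 aM (b + w)" using i by (auto simp: inv_def mark_def)
   then show False using True \<open>w \<notin> U\<close> wn by (simp add: U_def)
  qed
  have wQ: "w \<notin> set Q" using i wU True mk by (auto simp: inv_def mark_def)
  let ?x = "\<mu> aX 0"
  define \<nu> where "\<nu> = set_cell aTail 0 (Suc (length Q)) (set_cell aQ (length Q) w (set_cell aPar w ?x
   (set_cell aM (b + w) mk (set_cell aW 0 w \<mu>))))"
  have t: "\<mu> aTail 0 = length Q" using i by (simp add: inv_def)
  have "inv (Q @ [w]) \<nu>"
  proof -
   have "mark (Q @ [w]) \<nu>" using i wU by (auto simp: inv_def mark_def \<nu>_def)
   moreover have "\<exists>q. path (Q @ [w]) \<nu> z q" if "z \<in> set (Q @ [w])" for z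
   proof (cases "z = w")
    case True
    obtain q where q: "path Q \<mu> ?x q" using i x(1) by (auto simp: inv_def)
    then have qq: "link_path L q" "hd q = ?x" "last q = r" "set q \<subseteq> set Q" "set (butlast q) \<subseteq> U" by (auto simp: path_def)
    have ne: "q ~= []" using qq(1) by (simp add: link_path_def)
    have "link_path L (w # q)"
     by (rule link_path_Cons) (use qq x(2) wQ in "auto simp: insert_commute")
    moreover have "(w # q) ! 1 = ?x" using qq(2) ne by (simp add: hd_conv_nth)
    ultimately have "path (Q @ [w]) \<nu> w (w # q)" using qq ne wU by (auto simp: path_def \<nu>_def Suc_le_eq)
    then show ?thesis using True by auto
   next
    case False
    then have "z \<in> set Q" using that by simp
    then obtain q where "path Q \<mu> z q" using i unfolding inv_def by blast
    then have "path (Q @ [w]) \<nu> z q" using False by (auto simp: path_def \<nu>_def)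
    then show ?thesis by auto
   qed
   ultimately show ?thesis using i wQ wU by (auto simp: inv_def \<nu>_def nth_append less_Suc_eq)
  qed
  moreover have "run visit \<mu> (%k \<nu>'. k <= 7 & \<nu>' = \<nu>)"
   unfolding visit_def using w True t by (simp add: \<nu>_def)
  ultimately show ?thesis
   by (intro run_mono[OF \<open>run visit \<mu> (%k \<nu>'. k <= 7 & \<nu>' = \<nu>)\<close>])
    (auto simp: \<nu>_def intro!: exI[of _ "[w]"])
 qed
 define \<mu>1 where "\<mu>1 = set_cell aTail 0 1 (set_cell aQ 0 r \<mu>0)"
 have "run (For aI (Const 0) (Var 0) (When (Less (Var aI) (Var aTail)) (Seq (Assign aX (Read aQ (Var aI))) (Row aJ 3 aX visit)))) \<mu>1
  (%k. T (1 + (1 + k)))"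
 \<comment> \<open>Potential argument: 7 per round, and 9 per scanned entry, namely at most 7 for
   \<open>visit\<close> and 2 for the inner loop.\<close>
 proof (rule run_For_cost[where W = searchW and a = 0 and b = n and
    P = "%i c \<mu>. \<exists>Q. inv Q \<mu> & (\<forall>k<i. k < length Q --> saturated Q (Q ! k)) &
     c <= 7 * i + 9 * (\<Sum>k<min i (length Q). length (rot ! (Q ! k)))"])
  show "aval (Var 0) \<mu> = n" if "same searchW \<mu>1 \<mu>" for \<mu> using that st(2) by (simp add: n_def same_def \<mu>1_def)
  have "inv [r] \<mu>1"
   unfolding inv_def
  proof (intro conjI ballI)
   show "mark [r] \<mu>1" using rU by (auto simp: mark_def U_def \<mu>1_def)
   show "\<exists>q. path [r] \<mu>1 w q" if "w \<in> set [r]" for w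
    using that by (intro exI[of _ "[r]"]) (auto simp: path_def link_path_def)
  qed (auto simp: \<mu>1_def)
  then show "\<exists>Q. inv Q \<mu>1 & (\<forall>k<0. k < length Q --> saturated Q (Q ! k)) & 0 <= 7 * 0 + 9 * (\<Sum>k<min 0 (length Q). length (rot ! (Q ! k)))"
   by auto
  fix i c \<mu> assume i: "i < n" and sm: "same searchW \<mu>1 \<mu>" and ai: "\<mu> aI 0 = i"
   and "\<exists>Q. inv Q \<mu> & (\<forall>k<i. k < length Q --> saturated Q (Q ! k)) & c <= 7 * i + 9 * (\<Sum>k<min i (length Q). length (rot ! (Q ! k)))"
  then obtain Q where Q: "inv Q \<mu>" "\<forall>k<i. k < length Q --> saturated Q (Q ! k)"
   "c <= 7 * i + 9 * (\<Sum>k<min i (length Q). length (rot ! (Q ! k)))" by auto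
  have tl: "\<mu> aTail 0 = length Q" using Q(1) by (simp add: inv_def)
  let ?P = "%k \<nu>. same searchW \<mu> \<nu> & \<nu> aI 0 = i & (\<exists>Q. inv Q \<nu> & (\<forall>k<Suc i. k < length Q --> saturated Q (Q ! k)) &
    c + k + 2 <= 7 * Suc i + 9 * (\<Sum>k<min (Suc i) (length Q). length (rot ! (Q ! k))))"
  show "run (When (Less (Var aI) (Var aTail)) (Seq (Assign aX (Read aQ (Var aI))) (Row aJ 3 aX visit))) \<mu> ?P"
  proof (cases "i < length Q")
   case False
   then have "~  bval (Less (Var aI) (Var aTail)) \<mu>" using ai tl by simp
   moreover have "min (Suc i) (length Q) = length Q" "min i (length Q) = length Q" using False by auto
   moreover have "\<forall>k<Suc i. k < length Q --> saturated Q (Q ! k)" using Q(2) False by (auto simp: less_Suc_eq)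
   ultimately show ?thesis using Q(1,3) ai by (simp, intro exI[of _ Q]) simp
  next
   case True
   then have b: "bval (Less (Var aI) (Var aTail)) \<mu>" using ai tl by simp
   let ?x = "Q ! i"
   have xQ: "\<mu> aQ i = ?x" "?x \<in> set Q" using Q(1) True by (auto simp: inv_def)
   have xn: "?x < length rot" using Q(1) xQ(2) r(1) by (auto simp: inv_def U_def)
   let ?\<nu> = "set_cell aX 0 ?x \<mu>"
   have "run (Row aJ 3 aX visit) ?\<nu> (%k. ?P (Suc (1 + k)))"
   proof (rule run_Row[where dd = 4 and xss = rot and v = ?x and xs = "rot ! ?x" and W = "insert aJ visitW" and C = 7 and
      P = "%m \<nu>. \<exists>zs. inv (Q @ zs) \<nu> & (\<forall>k<m. rot ! ?x ! k \<in> U --> rot ! ?x ! k \<in> set (Q @ zs))"])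
    show "stored ?\<nu> 3 4 rot" using sm by (intro stored_same[OF st(1)]) (auto simp: same_def \<mu>1_def)
    show "\<exists>zs. inv (Q @ zs) ?\<nu> & (\<forall>k<0. rot ! ?x ! k \<in> U --> rot ! ?x ! k \<in> set (Q @ zs))"
     using inv_frame[OF Q(1), of aX] by (auto intro!: exI[of _ "[]"])
    fix m \<nu> assume m: "m < length (rot ! ?x)" and sm2: "same (insert aJ visitW) ?\<nu> \<nu>" and el: "\<nu> 4 (\<nu> aJ 0) = rot ! ?x ! m"
     and "\<exists>zs. inv (Q @ zs) \<nu> & (\<forall>k<m. rot ! ?x ! k \<in> U --> rot ! ?x ! k \<in> set (Q @ zs))"
    then obtain zs where zs: "inv (Q @ zs) \<nu>" "\<forall>k<m. rot ! ?x ! k \<in> U --> rot ! ?x ! k \<in> set (Q @ zs)" by auto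
    have tx: "\<nu> aX 0 = ?x" using sm2 by (simp add: same_def)
    have "{?x, rot ! ?x ! m} \<in> L" using L(1)[OF xn] nth_mem[OF m] by auto
    then have "run visit \<nu> (%k \<nu>'. k <= 7 & same visitW \<nu> \<nu>' &
      (\<exists>ys. inv ((Q @ zs) @ ys) \<nu>' & (rot ! ?x ! m \<in> U --> rot ! ?x ! m \<in> set ((Q @ zs) @ ys))))"
     using sm sm2 tx xQ(2) by (intro visit[OF el _ _ zs(1)]) (auto simp: same_def mk_def b_def \<mu>1_def)
    then show "run visit \<nu> (%k \<nu>'. k <= 7 & same (insert aJ visitW) \<nu> \<nu>' & \<nu>' aJ 0 = \<nu> aJ 0 &
      (\<exists>zs. inv (Q @ zs) \<nu>' & (\<forall>k<Suc m. rot ! ?x ! k \<in> U --> rot ! ?x ! k \<in> set (Q @ zs))))"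
    proof (rule run_mono, elim conjE exE)
     fix k \<nu>' ys
     assume *: "k <= 7" "same visitW \<nu> \<nu>'"
      "inv ((Q @ zs) @ ys) \<nu>'" "rot ! ?x ! m \<in> U --> rot ! ?x ! m \<in> set ((Q @ zs) @ ys)"
     have "\<forall>k<Suc m. rot ! ?x ! k \<in> U --> rot ! ?x ! k \<in> set (Q @ zs @ ys)"
      using zs(2) *(4) by (auto simp: less_Suc_eq)
     moreover have "inv (Q @ zs @ ys) \<nu>'" using *(3) by simp
     moreover have "same (insert aJ visitW) \<nu> \<nu>'" "\<nu>' aJ 0 = \<nu> aJ 0" using *(2) by (auto simp: same_def)
     ultimately show "k <= 7 & same (insert aJ visitW) \<nu> \<nu>' & \<nu>' aJ 0 = \<nu> aJ 0 &
      (\<exists>zs. inv (Q @ zs) \<nu>' & (\<forall>k<Suc m. rot ! ?x ! k \<in> U --> rot ! ?x ! k \<in> set (Q @ zs)))"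
      using *(1) by blast
    qed
   next
    fix k \<nu> assume sm2: "same (insert aJ visitW) ?\<nu> \<nu>" and k: "k <= length (rot ! ?x) * (7 + 2) + 2"
     and "\<exists>zs. inv (Q @ zs) \<nu> & (\<forall>k<length (rot ! ?x). rot ! ?x ! k \<in> U --> rot ! ?x ! k \<in> set (Q @ zs))"
    then obtain zs where zs: "inv (Q @ zs) \<nu>" "\<forall>k<length (rot ! ?x). rot ! ?x ! k \<in> U --> rot ! ?x ! k \<in> set (Q @ zs)" by auto
    have "saturated (Q @ zs) ?x"
     unfolding saturated_def
    proof (intro allI impI)
     fix w assume "{?x, w} \<in> L" "w \<in> U"
     then have "w \<in> set (rot ! ?x)" using L(1)[OF xn] by auto
     then show "w \<in> set (Q @ zs)" using zs(2) \<open>w \<in> U\<close> by (auto simp: in_set_conv_nth)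
    qed
    then have "\<forall>k<Suc i. k < length (Q @ zs) --> saturated (Q @ zs) ((Q @ zs) ! k)"
     using Q(2) True by (auto simp: less_Suc_eq nth_append saturated_def)
    moreover have "(\<Sum>k<min (Suc i) (length (Q @ zs)). length (rot ! ((Q @ zs) ! k))) =
      (\<Sum>k<min i (length Q). length (rot ! (Q ! k))) + length (rot ! ?x)"
    proof -
     have "min (Suc i) (length (Q @ zs)) = Suc i" "min i (length Q) = i" using True by auto
     moreover have "(\<Sum>k<i. length (rot ! ((Q @ zs) ! k))) = (\<Sum>k<i. length (rot ! (Q ! k)))"
      by (rule sum.cong) (use True in "auto simp: nth_append")
     ultimately show ?thesis using True by (simp add: nth_append)
    qed
    moreover have "same searchW \<mu> \<nu>" "\<nu> aI 0 = i" using sm2 ai by (auto simp: same_def)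
    ultimately show "?P (Suc (1 + k)) \<nu>" using zs(1) Q(3) k by (intro conjI exI[of _ "Q @ zs"]) auto
   next
    fix m \<nu> x assume "\<exists>zs. inv (Q @ zs) \<nu> & (\<forall>k<m. rot ! ?x ! k \<in> U --> rot ! ?x ! k \<in> set (Q @ zs))"
    then obtain zs where "inv (Q @ zs) \<nu>" "\<forall>k<m. rot ! ?x ! k \<in> U --> rot ! ?x ! k \<in> set (Q @ zs)" by blast
    moreover from this(1) have "inv (Q @ zs) (set_cell aJ 0 x \<nu>)" by (rule inv_frame) simp
    ultimately show "\<exists>zs. inv (Q @ zs) (set_cell aJ 0 x \<nu>) & (\<forall>k<m. rot ! ?x ! k \<in> U --> rot ! ?x ! k \<in> set (Q @ zs))"
     by blast
   qed (use xn in auto)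
   with b xQ ai show ?thesis by simp
  qed
 next
  fix j c \<mu> x
  assume "\<exists>Q. inv Q \<mu> & (\<forall>k<j. k < length Q --> saturated Q (Q ! k)) & c <= 7 * j + 9 * (\<Sum>k<min j (length Q). length (rot ! (Q ! k)))"
  then show "\<exists>Q. inv Q (set_cell aI 0 x \<mu>) & (\<forall>k<j. k < length Q --> saturated Q (Q ! k)) & c <= 7 * j + 9 * (\<Sum>k<min j (length Q). length (rot ! (Q ! k)))"
   using inv_frame[where a = aI and i = 0] by (elim exE conjE) (intro exI conjI, simp_all)
 next
  fix c \<mu> assume sm: "same searchW \<mu>1 \<mu>"
   and "\<exists>Q. inv Q \<mu> & (\<forall>k<n. k < length Q --> saturated Q (Q ! k)) & c <= 7 * n + 9 * (\<Sum>k<min n (length Q). length (rot ! (Q ! k)))"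
  then obtain Q where Q: "inv Q \<mu>" "\<forall>k<n. k < length Q --> saturated Q (Q ! k)"
   "c <= 7 * n + 9 * (\<Sum>k<min n (length Q). length (rot ! (Q ! k)))" by auto
  have dQ: "distinct Q" "set Q \<subseteq> insert r U" "r \<in> set Q" using Q(1) by (auto simp: inv_def)
  have sub: "set Q \<subseteq> {..<length rot}" using dQ(2) r(1) by (auto simp: U_def)
  have len: "length Q <= n" using card_mono[OF _ sub] distinct_card[OF dQ(1)] by (simp add: n_def)
  have all: "saturated Q x" if "x \<in> set Q" for x using Q(2) that len by (auto simp: in_set_conv_nth)
  have "w \<in> set Q" if "linked {l \<in> L. l \<subseteq> insert r U} r w" for w
   using that
  proof (induction rule: linked_induct)
   case (step a b)
   then show ?case using all[OF step(3)] dQ(3) by (auto simp: saturated_def)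
  qed (rule dQ(3))
  moreover have "linked {l \<in> L. l \<subseteq> insert r U} r w" if "w \<in> set Q" for w
  proof -
   have "\<forall>w\<in>set Q. \<exists>q. path Q \<mu> w q" using Q(1) unfolding inv_def by (elim conjE)
   from bspec[OF this that] obtain q where "path Q \<mu> w q" by (elim exE)
   then have q: "link_path L q" "hd q = w" "last q = r" "set q \<subseteq> set Q" by (auto simp: path_def)
   then have ne: "q ~= []" by (simp add: link_path_def)
   then have "linked {l \<in> L. l \<subseteq> set q} w r"
    using link_path_linked_nth[OF q(1), of 0 "length q - 1"] q(2,3) by (simp add: hd_conv_nth last_conv_nth)
   then have "linked {l \<in> L. l \<subseteq> insert r U} w r" by (rule linked_mono) (use q(4) dQ(2) in auto)
   then show ?thesis by (rule linked_sym)
  qed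
  ultimately have sQ: "set Q = {w. linked {l \<in> L. l \<subseteq> insert r U} r w}" by blast
  have "(\<Sum>k<min n (length Q). length (rot ! (Q ! k))) <= (\<Sum>v<length rot. length (rot ! v))"
   by (rule sum_rows_le[OF dQ(1) sub]) simp
  then have cost: "1 + (1 + (c + 2)) <= 7 * length rot + 9 * (\<Sum>v<length rot. length (rot ! v)) + 4"
   using Q(3) by (simp add: n_def)
  have sm0: "same searchW \<mu>0 \<mu>" using sm by (simp add: \<mu>1_def)
  show "T (1 + (1 + (c + 2))) \<mu>"
  proof (rule post[OF sm0 dQ(1) sQ dQ(2)])
   fix w assume "w \<in> set Q" "w ~= r"
   then show "\<exists>q. link_path L q & hd q = w & last q = r & 2 <= length q & q ! 1 = \<mu> aPar w & set (butlast q) \<subseteq> U"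
    using Q(1) by (auto simp: inv_def path_def)
  qed (use Q(1) cost in "auto simp: inv_def mark_def")
 qed (simp_all add: n_def)
 then show ?thesis unfolding search_def by (simp add: \<mu>1_def r_def)
qed

lemma run_For_sum:
 assumes lo: "aval lo \<mu>0 = a" and ab: "a <= b" and iW: "i \<in> W"
  and hi: "!!\<mu>. same W \<mu>0 \<mu> ==> aval hi \<mu> = b"
  and ins: "!!j \<mu> x. P j \<mu> ==> P j (set_cell i 0 x \<mu>)"
  and init: "P a \<mu>0"
  and step: "!!j \<mu>. a <= j ==> j < b ==> same W \<mu>0 \<mu> ==> \<mu> i 0 = j ==> P j \<mu> ==>
   run body \<mu> (%k \<nu>. k <= C j & same W \<mu> \<nu> & \<nu> i 0 = j & P (Suc j) \<nu>)"
  and post: "!!k \<mu>. same W \<mu>0 \<mu> ==> P b \<mu> ==> k <= (\<Sum>j=a..<b. C j + 2) + 2 ==> Q k \<mu>"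
 shows "run (For i lo hi body) \<mu>0 Q"
proof (rule run_For_cost[where P = "%j c \<mu>. P j \<mu> & c <= (\<Sum>j=a..<j. C j + 2)" and W = W, OF lo ab iW hi])
 fix j c \<mu> assume "a <= j" "j < b" "same W \<mu>0 \<mu>" "\<mu> i 0 = j" "P j \<mu> & c <= (\<Sum>j=a..<j. C j + 2)"
 then show "run body \<mu> (%k \<nu>. same W \<mu> \<nu> & \<nu> i 0 = j & P (Suc j) \<nu> & c + k + 2 <= (\<Sum>j=a..<Suc j. C j + 2))"
  by (intro run_mono[OF step]) (auto simp: sum.atLeastLessThan_Suc)
next
 fix c \<mu> assume "same W \<mu>0 \<mu>" "P b \<mu> & c <= (\<Sum>j=a..<b. C j + 2)"
 then show "Q (c + 2) \<mu>" by (intro post) auto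
qed (use ins init in auto)

lemma sum_degrees:
 assumes "simple_graph {..<n::nat} L"
 shows "(\<Sum>v<n. card {w. {v, w} \<in> L}) <= 2 * card L"
proof -
 have l: "\<exists>a b. a < n & b < n & l = {a, b}" if "l \<in> L" for l
  using assms that unfolding simple_graph_def by (metis lessThan_iff)
 have "L \<subseteq> Pow {..<n}" using l by force
 then have fin: "finite L" by (rule finite_subset) simp
 have "{w. {v, w} \<in> L} \<subseteq> {..<n}" for v using l by (force simp: doubleton_eq_iff)
 then have "(\<Sum>v<n. card {w. {v, w} \<in> L}) = card (SIGMA v:{..<n}. {w. {v, w} \<in> L})"
  by (intro card_SigmaI[symmetric]) (auto intro: finite_subset)
 also have "\<dots> <= card (\<Union>l\<in>L. {(v, w). {v, w} = l})"
 proof (rule card_mono)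
  have "(\<Union>l\<in>L. {(v, w). {v, w} = l}) \<subseteq> {..<n} \<times> {..<n}" using l by (force simp: doubleton_eq_iff)
  then show "finite (\<Union>l\<in>L. {(v, w). {v, w} = l})" by (rule finite_subset) simp
 qed auto
 also have "\<dots> <= (\<Sum>l\<in>L. card {(v, w). {v, w} = l})" by (rule card_UN_le[OF fin])
 also have "\<dots> <= (\<Sum>l\<in>L. 2)"
 proof (rule sum_mono)
  fix l assume "l \<in> L"
  then obtain a b where "l = {a, b}" using l by blast
  then have "{(v, w). {v, w} = l} \<subseteq> set [(a, b), (b, a)]" by (auto simp: doubleton_eq_iff)
  then have "card {(v, w). {v, w} = l} <= card (set [(a, b), (b, a)])" by (rule card_mono[rotated]) simp
  also have "\<dots> <= 2" using card_length[of "[(a, b), (b, a)]"] by simp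
  finally show "card {(v, w). {v, w} = l} <= 2" .
 qed
 finally show ?thesis by (simp add: mult.commute)
qed

lemma sorted_offsets: "stored (store_of as) o1 d1 xss"
 if "o1 < length as" "d1 < length as" "as ! o1 = offsets xss" "as ! d1 = concat xss"
proof -
 have "off xss v + i < length (concat xss) & concat xss ! (off xss v + i) = xss ! v ! i"
  if "v < length xss" "i < length (xss ! v)" for v i
 proof -
  have "concat xss = concat (take v xss) @ xss ! v @ concat (drop (Suc v) xss)"
   using id_take_nth_drop[OF that(1)] by (metis concat.simps(2) concat_append)
  with that(2) show ?thesis by (simp add: off_def nth_append)
 qed
 then show ?thesis using that by (auto simp: stored_def store_of_def offsets_def off_def simp del: upt_Suc)
qed

section \<open>The input of the program and linear bounds for its size\<close>

locale routing_input =
 fixes n t :: nat and E :: "nat set set" and D :: "nat drawing" and \<pi> :: "nat pattern" and adj rot :: "nat list list"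
 assumes graph: "simple_graph {..<n} E" and root: "t < n" and bic: "biconnected {..<n} E"
  and plane: "plane_embedding {..<n} (E - separating_links {..<n} E) D"
  and right_hand: "right_hand_pattern {..<n} (E - separating_links {..<n} E) D t \<pi>"
  and resilient: "perfectly_resilient {..<n} (E - separating_links {..<n} E) t \<pi>"
  and adj: "adjacency_lists n E adj" and rotation: "rotation_lists n (E - separating_links {..<n} E) D rot"

sublocale routing_input \<subseteq> rooted_graph "{..<n}" E t
 using graph root bic by unfold_locales auto

context routing_input
begin

definition R :: "nat => nat list" where "R u = filter (%w. w ~= t) (rot ! u)"
definition "tab = pattern_table rot t \<pi>"

lemma graph_H: "simple_graph {..<n} H"
 using graph by (auto simp: simple_graph_def)

lemma length_rows [simp]: "length adj = n" "length rot = n" "length tab = n"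
 using adj rotation by (auto simp: adjacency_lists_def rotation_lists_def tab_def pattern_table_def)

lemma adj_row: "u < n ==> distinct (adj ! u) & set (adj ! u) = {w. {u, w} \<in> E}"
 using adj by (simp add: adjacency_lists_def)

lemma rot_row: "u < n ==> distinct (rot ! u) & set (rot ! u) = {w. {u, w} \<in> H}"
proof (cases "links_at H u = {}")
 case True
 assume u: "u < n"
 then have "rot ! u = []" using rotation True unfolding rotation_lists_def by (metis (full_types))
 then show ?thesis using True by (auto simp: links_at_def)
next
 case False
 assume u: "u < n"
 then obtain f where f: "f \<in> links_at H u" "rot ! u = map (other_end u) (right_hand H D u f)"
  using rotation False unfolding rotation_lists_def by (metis (full_types))
 interpret plane_node "{..<n}" H D u using plane graph_H u by unfold_locales auto
 show ?thesis using right_hand_neighbours(2,3)[OF f(1)] f(2) by simp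
qed

lemma H_link_ends: "{u, w} \<in> H ==> u ~= w & u < n & w < n"
 using link_ends[of u w] by auto

lemma R_row: "u < n ==> distinct (R u) & set (R u) = {w. {u, w} \<in> H} - {t}"
 using rot_row[of u] by (auto simp: R_def)

lemma row_pattern:
 assumes u: "u < n" "u ~= t"
 shows "rotational H t \<pi> (R u) u"
  "w \<in> set (R u) ==> \<pi> u (Some {u, w}) = map (%w. {u, w}) ((if {u, t} \<in> H then [t] else []) @ cut w (R u))"
  "R u ~= [] ==> \<exists>w\<in>set (R u). \<pi> u None = \<pi> u (Some {u, w})"
  "p \<in> in_ports H u ==> distinct (\<pi> u p) & set (\<pi> u p) = links_at H u"
  "links_at H u ~= {}"
proof -
 show ne: "links_at H u ~= {}" using right_hand u by (auto simp: right_hand_pattern_def)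
 then obtain f where f: "f \<in> links_at H u" "rot ! u = map (other_end u) (right_hand H D u f)"
  using rotation u unfolding rotation_lists_def by (metis (full_types))
 have uV: "u \<in> {..<n}" using u by simp
 have t: "t \<in> set (rot ! u) \<longleftrightarrow> {u, t} \<in> H" using rot_row[OF u(1)] by auto
 note l = right_hand_pattern_lists[OF plane graph_H right_hand uV u(2) f(1), folded f(2) R_def]
 show "rotational H t \<pi> (R u) u"
  using right_hand_rotational[OF plane graph_H right_hand uV u(2) f(1)] by (simp add: R_def f(2))
 show "w \<in> set (R u) ==> \<pi> u (Some {u, w}) = map (%w. {u, w}) ((if {u, t} \<in> H then [t] else []) @ cut w (R u))"
  using l(3) t by simp
 show "R u ~= [] ==> \<exists>w\<in>set (R u). \<pi> u None = \<pi> u (Some {u, w})" by (rule l(4))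
 show "p \<in> in_ports H u ==> distinct (\<pi> u p) & set (\<pi> u p) = links_at H u" by (rule l(5))
qed

lemma skipping_H: "skipping_pattern {..<n} H t \<pi>"
 unfolding skipping_pattern_def using row_pattern(4) by blast

sublocale h: routed_graph "{..<n}" H t \<pi>
 by (rule routed_graph_H[OF rooted_graph_axioms skipping_H])

lemma rotational_rows: "v \<in> {..<n} ==> v ~= t ==> rotational H t \<pi> (R v) v"
 using row_pattern(1) by simp

lemma card_H: "card H <= 16 * n"
 using h.card_links[OF h.Res_E[OF resilient] rotational_rows] by simp

text \<open>The 18 is 16 for \<open>H\<close>, and one each for the separating links without
  \<open>t\<close>, which have private far nodes, and for the star of \<open>t\<close>.\<close>

lemma card_E: "card E <= 18 * n"
proof -
 have "E \<subseteq> H Un S0 Un (%w. {t, w}) ` {..<n}"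
 proof
  fix l assume l: "l \<in> E"
  then obtain u v where "l = {u, v}" "u < n" "v < n" by (auto elim: linkE)
  then show "l \<in> H Un S0 Un (%w. {t, w}) ` {..<n}"
   using l by (cases "t \<in> l") (auto simp: S0_def insert_commute)
 qed
 moreover have "finite (H Un S0 Un (%w. {t, w}) ` {..<n})"
  using finite_E S0_E by (auto intro: finite_subset[of S0 E])
 ultimately have "card E <= card (H Un S0 Un (%w. {t, w}) ` {..<n})" by (intro card_mono)
 also have "\<dots> <= card H + card S0 + card ((%w. {t, w}) ` {..<n})"
  by (meson card_Un_le add_mono order_refl order_trans)
 also have "card ((%w. {t, w}) ` {..<n}) <= n" using card_image_le[of "{..<n}" "%w. {t, w}"] by simp
 finally show ?thesis using card_H card_S0 by simp
qed

lemma sum_rot: "(\<Sum>v<n. length (rot ! v)) <= 32 * n"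
proof -
 have "(\<Sum>v<n. length (rot ! v)) = (\<Sum>v<n. card {w. {v, w} \<in> H})"
  by (rule sum.cong) (use rot_row distinct_card in "fastforce+")
 with sum_degrees[OF graph_H] card_H show ?thesis by simp
qed

lemma sum_adj: "(\<Sum>v<n. length (adj ! v)) <= 36 * n"
proof -
 have "(\<Sum>v<n. length (adj ! v)) = (\<Sum>v<n. card {w. {v, w} \<in> E})"
  by (rule sum.cong) (use adj_row distinct_card in "fastforce+")
 with sum_degrees[OF graph] card_E show ?thesis by simp
qed

lemma length_row: "u < n ==> length (adj ! u) <= n" "u < n ==> length (rot ! u) <= n"
proof -
 assume u: "u < n"
 have "set (adj ! u) \<subseteq> {..<n}" "set (rot ! u) \<subseteq> {..<n}"
  using adj_row[OF u] rot_row[OF u] link_ends[of u] by auto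
 then show "length (adj ! u) <= n" "length (rot ! u) <= n"
  using adj_row[OF u] rot_row[OF u] card_mono[of "{..<n}" "set (adj ! u)"] card_mono[of "{..<n}" "set (rot ! u)"]
   distinct_card[of "adj ! u"] distinct_card[of "rot ! u"]
  by simp_all
qed

definition input :: "store => bool" where
 "input \<mu> \<longleftrightarrow> \<mu> 0 0 = n & \<mu> 0 1 = t & stored \<mu> 1 2 adj & stored \<mu> 3 4 rot & stored \<mu> 5 6 tab"

lemma input_same: "input \<mu> ==> same W \<mu> \<nu> ==> W Int {..6} = {} ==> input \<nu>"
proof -
 assume *: "input \<mu>" "same W \<mu> \<nu>" "W Int {..6} = {}"
 have "\<nu> a = \<mu> a" if "a <= 6" for a using *(2,3) that by (auto simp: same_def)
 then show "input \<nu>" using *(1) by (auto simp: input_def stored_def)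
qed

lemma input_store: "input (input_store n t adj rot tab)"
 unfolding input_def input_store_def
 by (intro conjI sorted_offsets) (simp_all add: store_of_def)

end

section \<open>Listing the separating links and locating the two sides around a node\<close>

abbreviation "aF \<equiv> 11 :: nat"
abbreviation "aP \<equiv> 16 :: nat"
abbreviation "aZ \<equiv> 18 :: nat"
abbreviation "aD \<equiv> 19 :: nat"
abbreviation "aPrev \<equiv> 20 :: nat"
abbreviation "aK \<equiv> 24 :: nat"
abbreviation "aSrc \<equiv> 43 :: nat"
abbreviation "aDst \<equiv> 44 :: nat"
abbreviation "aAl \<equiv> 45 :: nat"
abbreviation "aBl \<equiv> 46 :: nat"
abbreviation Root :: aexp where "Root \<equiv> Read 0 (Const 1)"
abbreviation Here :: aexp where "Here \<equiv> Read 4 (Var aJ)"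

text \<open>The test on the end numbers stores each link only once. The two orientations get
  adjacent indices.\<close>

definition record_pair :: com where
 "record_pair = When (Conj (Less (Var aU) (Var aV)) (Conj (Neg (Equal (Var aV) Root)) (Equal (Var aF) (Const 0))))
   (Seq (Write aSrc (Add (Var aP) (Var aP)) (Var aU))
   (Seq (Write aDst (Add (Var aP) (Var aP)) (Var aV))
   (Seq (Write aSrc (Add (Add (Var aP) (Var aP)) (Const 1)) (Var aV))
   (Seq (Write aDst (Add (Add (Var aP) (Var aP)) (Const 1)) (Var aU))
     (Assign aP (Add (Var aP) (Const 1)))))))"

text \<open>Separating links need no computation: they are the links of the adjacency lists missing
  from the rotation lists, and a linear scan of one row per adjacency entry detects them.\<close>

definition pick :: com where
 "pick = Seq (Assign aV (Read 2 (Var aK))) (Seq (Assign aF (Const 0))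
  (Seq (Row aJ 3 aU (When (Equal (Read 4 (Var aJ)) (Var aV)) (Assign aF (Const 1)))) record_pair))"

definition collect :: com where
 "collect = For aU (Const 0) (Var 0) (When (Neg (Equal (Var aU) Root)) (Row aK 1 aU pick))"

text \<open>The first scan finds the last neighbour, the cyclic predecessor of the first one. The
  second scan looks for changes between near and far marks and records the node before each change.
  The default \<open>n\<close> remains if there is no change.\<close>

definition endpoint :: com where
 "endpoint = Seq (Row aJ 3 aZ (When (Neg (Equal Here Root)) (Assign aPrev Here)))
  (Seq (Write aAl (Var aD) (Var 0)) (Seq (Write aBl (Var aD) (Var 0))
  (Row aJ 3 aZ (When (Neg (Equal Here Root))
   (Seq (When (Conj (Equal (Read aM (Add (Var aBase) (Var aPrev))) (Const 1))
           (Equal (Read aM (Add (Var aBase) Here)) (Const 3)))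
      (Write aAl (Var aD) (Var aPrev)))
   (Seq (When (Conj (Equal (Read aM (Add (Var aBase) (Var aPrev))) (Const 3))
           (Equal (Read aM (Add (Var aBase) Here)) (Const 1)))
      (Write aBl (Var aD) (Var aPrev)))
     (Assign aPrev Here)))))))"

definition collected :: "(nat \<times> nat) list => store => bool" where
 "collected ps \<mu> \<longleftrightarrow> \<mu> aP 0 = length ps & (\<forall>i<length ps. \<mu> aSrc (i + i) = fst (ps ! i) &
  \<mu> aDst (i + i) = snd (ps ! i) & \<mu> aSrc (Suc (i + i)) = snd (ps ! i) & \<mu> aDst (Suc (i + i)) = fst (ps ! i))"

lemma collected_cong: "collected ps \<mu> ==> \<nu> aP = \<mu> aP ==> \<nu> aSrc = \<mu> aSrc ==> \<nu> aDst = \<mu> aDst ==> collected ps \<nu>"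
 by (simp add: collected_def)

definition prev_in :: "'b list => nat => 'b" where
 "prev_in xs i = (if i = 0 then last xs else xs ! (i - 1))"

lemma prev_in_rotation:
 assumes "xs = us @ vs" "vs @ us = ys" "i < length xs"
 shows "\<exists>j<length ys. prev_in xs i = ys ! j & xs ! i = ys ! (Suc j mod length ys)"
proof -
 let ?s = "length vs" and ?N = "length ys"
 have xs: "xs = rotate ?s ys" using assms rotate_append[of vs us] by simp
 have N: "length xs = ?N" "0 < ?N" using xs assms(3) by auto
 then have ne: "xs ~= []" by auto
 have nth: "xs ! k = ys ! ((?s + k) mod ?N)" if "k < ?N" for k
  using nth_rotate[of k ys ?s] that xs by simp
 let ?k = "if i = 0 then ?N - 1 else i - 1"
 have k: "?k < ?N" "prev_in xs i = xs ! ?k" using assms(3) N ne by (auto simp: prev_in_def last_conv_nth)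
 have sk: "Suc ?k = (if i = 0 then ?N else i)" using N by auto
 have "Suc ((?s + ?k) mod ?N) mod ?N = (?s + Suc ?k) mod ?N" by (simp add: mod_Suc_eq)
 also have "\<dots> = (?s + i) mod ?N" unfolding sk by (cases "i = 0"; simp)
 finally have "xs ! i = ys ! (Suc ((?s + ?k) mod ?N) mod ?N)" using nth[of i] assms(3) N by simp
 then show ?thesis using k nth[of ?k] N by (intro exI[of _ "(?s + ?k) mod ?N"]) auto
qed

text \<open>A cyclic order consisting of two blocks changes block at two places only, just behind
  the last elements of the blocks. So the block ends can be found without knowing where the stored
  row starts.\<close>

lemma turns:
 assumes R: "xs = us @ vs" "vs @ us = as @ bs" "distinct xs" "as ~= []" "bs ~= []"
 shows "i < length xs ==> prev_in xs i \<in> set as ==> xs ! i \<in> set bs ==> prev_in xs i = last as"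
  "i < length xs ==> prev_in xs i \<in> set bs ==> xs ! i \<in> set as ==> prev_in xs i = last bs"
  "\<exists>i<length xs. prev_in xs i \<in> set as & xs ! i \<in> set bs"
  "\<exists>i<length xs. prev_in xs i \<in> set bs & xs ! i \<in> set as"
proof -
 let ?L = "as @ bs" let ?N = "length ?L"
 have d: "distinct ?L" using R by (metis distinct_append inf_commute)
 have a: "j < ?N ==> ?L ! j \<in> set as \<longleftrightarrow> j < length as" and b: "j < ?N ==> ?L ! j \<in> set bs \<longleftrightarrow> length as <= j" for j
 proof -
  assume j: "j < ?N"
  have "j < length as ==> ?L ! j \<in> set as" by (simp add: nth_append)
  moreover have "length as <= j ==> ?L ! j \<in> set bs" using j by (simp add: nth_append)
  moreover have "?L ! j \<notin> set as | ?L ! j \<notin> set bs" using d by auto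
  ultimately show "?L ! j \<in> set as \<longleftrightarrow> j < length as" "?L ! j \<in> set bs \<longleftrightarrow> length as <= j"
   by (meson linorder_not_le)+
 qed
 have la: "last as = ?L ! (length as - 1)" and lb: "last bs = ?L ! (?N - 1)"
  using R(4,5) last_conv_nth[of as] last_conv_nth[of ?L] by (auto simp: nth_append)
 note ex = prev_in_rotation[OF R(1,2)]
 have N: "length as < ?N" "0 < length as" "0 < ?N" using R(4,5) by auto
 show "prev_in xs i = last as" if i: "i < length xs" "prev_in xs i \<in> set as" "xs ! i \<in> set bs"
 proof -
  obtain j where j: "j < ?N" "prev_in xs i = ?L ! j" "xs ! i = ?L ! (Suc j mod ?N)" using ex[OF i(1)] by blast
  have "j < length as" using i(2) j a by simp
  moreover have "length as <= Suc j mod ?N" using i(3) j(3) b[of "Suc j mod ?N"] N by simp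
  moreover have "Suc j mod ?N = Suc j" by (intro mod_less) (use \<open>j < length as\<close> N in linarith)
  ultimately have "j = length as - 1" by simp
  with j la show ?thesis by simp
 qed
 show "prev_in xs i = last bs" if i: "i < length xs" "prev_in xs i \<in> set bs" "xs ! i \<in> set as"
 proof -
  obtain j where j: "j < ?N" "prev_in xs i = ?L ! j" "xs ! i = ?L ! (Suc j mod ?N)" using ex[OF i(1)] by blast
  have "length as <= j" using i(2) j b by simp
  moreover have "Suc j mod ?N < length as" using i(3) j(3) a[of "Suc j mod ?N"] N by simp
  moreover have "Suc j < ?N ==> Suc j mod ?N = Suc j" by (rule mod_less)
  ultimately have "j = ?N - 1" using j(1) by linarith
  with j lb show ?thesis by simp
 qed
 have sx: "set xs = set ?L" using R(1,2) by (metis set_append sup_commute)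
 obtain i where i: "i < length xs" "xs ! i = ?L ! length as" using sx N by (metis in_set_conv_nth nth_mem)
 obtain j where j: "j < ?N" "prev_in xs i = ?L ! j" "xs ! i = ?L ! (Suc j mod ?N)" using ex[OF i(1)] by blast
 have "Suc j mod ?N = length as" using j(3) i(2) d N nth_eq_iff_index_eq[OF d, of "Suc j mod ?N" "length as"] by simp
 then have "Suc j ~= ?N" using N(2) by auto
 then have "Suc j = length as" using j(1) mod_less[of "Suc j" ?N] \<open>Suc j mod ?N = length as\<close> by linarith
 then have "j < length as" by simp
 then show "\<exists>i<length xs. prev_in xs i \<in> set as & xs ! i \<in> set bs" using i j a b N by auto
 obtain i where i: "i < length xs" "xs ! i = ?L ! 0" using sx N by (metis in_set_conv_nth nth_mem)
 obtain j where j: "j < ?N" "prev_in xs i = ?L ! j" "xs ! i = ?L ! (Suc j mod ?N)" using ex[OF i(1)] by blast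
 have "Suc j mod ?N = 0" using j(3) i(2) d N nth_eq_iff_index_eq[OF d, of "Suc j mod ?N" 0] by simp
 then have "Suc j = ?N" using j(1) mod_less[of "Suc j" ?N] by linarith
 then have "length as <= j" using N(1) by linarith
 then show "\<exists>i<length xs. prev_in xs i \<in> set bs & xs ! i \<in> set as" using i j a b N by auto
qed

context routing_input
begin

abbreviation "pickW \<equiv> {aV, aF, aJ, aP, aSrc, aDst}"

lemma run_pick:
 assumes i: "input \<mu>" and u: "\<mu> aU 0 = u" "u < n" and v: "\<mu> 2 (\<mu> aK 0) = v" and c: "collected ps \<mu>"
 shows "run pick \<mu> (%k \<nu>. k <= 4 * n + 12 & same pickW \<mu> \<nu> &
  collected (if u < v & v ~= t & v \<notin> set (rot ! u) then ps @ [(u, v)] else ps) \<nu>)"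
proof -
 let ?\<mu> = "set_cell aF 0 0 (set_cell aV 0 v \<mu>)"
 let ?Q = "%k \<nu>. k <= 4 * n + 12 & same pickW \<mu> \<nu> &
  collected (if u < v & v ~= t & v \<notin> set (rot ! u) then ps @ [(u, v)] else ps) \<nu>"
 have "run (Row aJ 3 aU (When (Equal (Read 4 (Var aJ)) (Var aV)) (Assign aF (Const 1)))) ?\<mu>
  (%k \<nu>. k <= 4 * n + 2 & same {aJ, aF} ?\<mu> \<nu> & (\<nu> aF 0 = 0 \<longleftrightarrow> v \<notin> set (rot ! u)))"
 proof (rule run_Row[where W = "{aJ, aF}" and dd = 4 and xss = rot and v = u and xs = "rot ! u" and C = 2 and
    P = "%m \<nu>. \<nu> aF 0 = 0 \<longleftrightarrow> v \<notin> set (take m (rot ! u))"])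
  fix k \<nu> assume "same {aJ, aF} ?\<mu> \<nu>" "\<nu> aF 0 = 0 \<longleftrightarrow> v \<notin> set (take (length (rot ! u)) (rot ! u))"
   "k <= length (rot ! u) * (2 + 2) + 2"
  then show "k <= 4 * n + 2 & same {aJ, aF} ?\<mu> \<nu> & (\<nu> aF 0 = 0 \<longleftrightarrow> v \<notin> set (rot ! u))"
   using length_row(2)[OF u(2)] by simp
 next
  fix m \<nu> assume m: "m < length (rot ! u)" and s: "same {aJ, aF} ?\<mu> \<nu>" "\<nu> 4 (\<nu> aJ 0) = rot ! u ! m"
   "\<nu> aF 0 = 0 \<longleftrightarrow> v \<notin> set (take m (rot ! u))"
  have "\<nu> aV 0 = v" using s(1) by (simp add: same_def)
  then show "run (When (Equal (Read 4 (Var aJ)) (Var aV)) (Assign aF (Const 1))) \<nu> (%k \<nu>'. k <= 2 &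
    same {aJ, aF} \<nu> \<nu>' & \<nu>' aJ 0 = \<nu> aJ 0 & (\<nu>' aF 0 = 0 \<longleftrightarrow> v \<notin> set (take (Suc m) (rot ! u))))"
   using s m by (auto simp: take_Suc_conv_app_nth)
 qed (use i u in "auto simp: input_def stored_def")
 then have "run (Row aJ 3 aU (When (Equal (Read 4 (Var aJ)) (Var aV)) (Assign aF (Const 1)))) ?\<mu>
  (%k \<nu>. run record_pair \<nu> (%l. ?Q (1 + (1 + (k + l)))))"
 proof (rule run_mono)
  fix k \<nu> assume *: "k <= 4 * n + 2 & same {aJ, aF} ?\<mu> \<nu> & (\<nu> aF 0 = 0 \<longleftrightarrow> v \<notin> set (rot ! u))"
  then have e: "\<nu> aU 0 = u" "\<nu> aV 0 = v" "\<nu> 0 1 = t" "\<nu> aP = \<mu> aP" "\<nu> aSrc = \<mu> aSrc" "\<nu> aDst = \<mu> aDst"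
   using u i by (auto simp: same_def input_def)
  have s: "same pickW \<mu> \<nu>" using * by (auto simp: same_def)
  have c': "collected ps \<nu>" by (rule collected_cong[OF c]) (use e in simp_all)
  have p: "\<nu> aP 0 = length ps" using c' by (simp add: collected_def)
  have col: "collected (ps @ [(u, v)]) (set_cell aP 0 (Suc (length ps)) (set_cell aDst (Suc (length ps + length ps)) u
   (set_cell aSrc (Suc (length ps + length ps)) v (set_cell aDst (length ps + length ps) v
   (set_cell aSrc (length ps + length ps) u \<nu>)))))"
   using c' by (auto simp: collected_def nth_append less_Suc_eq)
  show "run record_pair \<nu> (%l. ?Q (1 + (1 + (k + l))))"
   unfolding record_pair_def
   using * e(1-3) s c' p col by (cases "u < v & v ~= t & v \<notin> set (rot ! u)") auto
 qed
 then show ?thesis by (simp only: pick_def run_Seq run_Write aval.simps v)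
qed

lemma S0_iff: "u ~= t ==> {u, v} \<in> E ==> u < n ==> {u, v} \<in> S0 \<longleftrightarrow> v ~= t & v \<notin> set (rot ! u)"
 using rot_row[of u] by (auto simp: S0_def)

abbreviation "collectW \<equiv> {aU, aK} Un pickW"

lemma run_collect:
 assumes i: "input \<mu>" and z: "\<mu> aP 0 = 0"
 shows "run collect \<mu> (%k \<nu>. k <= 36 * n * (4 * n + 14) + 5 * n + 3 & same collectW \<mu> \<nu> &
  (\<exists>ps. collected ps \<nu> & distinct ps & set ps = {(x, y). x < y & {x, y} \<in> S0}))"
 unfolding collect_def
proof (rule run_For_sum[where W = collectW and a = 0 and b = n and C = "%u. length (adj ! u) * (4 * n + 14) + 3" and
   P = "%u \<nu>. \<exists>ps. collected ps \<nu> & distinct ps & set ps = {(x, y). x < u & x < y & {x, y} \<in> S0}"])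
 fix k \<nu> assume "same collectW \<mu> \<nu>" and ps: "\<exists>ps. collected ps \<nu> & distinct ps & set ps = {(x, y). x < n & x < y & {x, y} \<in> S0}"
  and k: "k <= (\<Sum>j = 0..<n. length (adj ! j) * (4 * n + 14) + 3 + 2) + 2"
 have "{(x, y). x < n & x < y & {x, y} \<in> S0} = {(x, y). x < y & {x, y} \<in> S0}" using S0_D by fastforce
 moreover have "(\<Sum>j = 0..<n. length (adj ! j) * (4 * n + 14) + 3 + 2) = (\<Sum>j<n. length (adj ! j)) * (4 * n + 14) + 5 * n"
  by (simp add: sum.distrib sum_distrib_right lessThan_atLeast0)
 moreover have "(\<Sum>j<n. length (adj ! j)) * (4 * n + 14) <= 36 * n * (4 * n + 14)" using sum_adj by (rule mult_le_mono1)
 ultimately have "k <= 36 * n * (4 * n + 14) + 5 * n + 3" using k by linarith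
 with \<open>{(x, y). x < n & x < y & {x, y} \<in> S0} = {(x, y). x < y & {x, y} \<in> S0}\<close>
 show "k <= 36 * n * (4 * n + 14) + 5 * n + 3 & same collectW \<mu> \<nu> &
  (\<exists>ps. collected ps \<nu> & distinct ps & set ps = {(x, y). x < y & {x, y} \<in> S0})"
  using ps \<open>same collectW \<mu> \<nu>\<close> by simp
next
 fix u \<nu> assume u: "u < n" and s: "same collectW \<mu> \<nu>" "\<nu> aU 0 = u"
  and "\<exists>ps. collected ps \<nu> & distinct ps & set ps = {(x, y). x < u & x < y & {x, y} \<in> S0}"
 then obtain ps where ps: "collected ps \<nu>" "distinct ps" "set ps = {(x, y). x < u & x < y & {x, y} \<in> S0}" by blast
 have inp: "input \<nu>" using input_same[OF i s(1)] by simp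
 let ?Q = "%k \<nu>'. k <= length (adj ! u) * (4 * n + 14) + 3 & same collectW \<nu> \<nu>' & \<nu>' aU 0 = u &
   (\<exists>ps. collected ps \<nu>' & distinct ps & set ps = {(x, y). x < Suc u & x < y & {x, y} \<in> S0})"
 show "run (When (Neg (Equal (Var aU) Root)) (Row aK 1 aU pick)) \<nu> ?Q"
 proof (cases "u = t")
  case True
  have "{(x, y). x < u & x < y & {x, y} \<in> S0} = {(x, y). x < Suc u & x < y & {x, y} \<in> S0}"
   using True by (auto simp: less_Suc_eq S0_def)
  then have "?Q 2 \<nu>" using ps s(2) by simp blast
  with True s inp show ?thesis by (simp add: input_def numeral_2_eq_2)
 next
  case False
  have "run (Row aK 1 aU pick) \<nu> (%k. ?Q (Suc k))"
  proof (rule run_Row[where W = "insert aK pickW" and dd = 2 and xss = adj and v = u and xs = "adj ! u" and C = "4 * n + 12" and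
    P = "%m \<nu>. \<exists>ps. collected ps \<nu> & distinct ps & set ps = {(x, y). x < u & x < y & {x, y} \<in> S0} Un
     {(x, y). x = u & u < y & {u, y} \<in> S0 & y \<in> set (take m (adj ! u))}"])
   fix k \<nu>' assume "same (insert aK pickW) \<nu> \<nu>'" and k: "k <= length (adj ! u) * (4 * n + 12 + 2) + 2"
    and ex: "\<exists>ps. collected ps \<nu>' & distinct ps & set ps = {(x, y). x < u & x < y & {x, y} \<in> S0} Un
     {(x, y). x = u & u < y & {u, y} \<in> S0 & y \<in> set (take (length (adj ! u)) (adj ! u))}"
   have "{(x, y). x < u & x < y & {x, y} \<in> S0} Un
     {(x, y). x = u & u < y & {u, y} \<in> S0 & y \<in> set (take (length (adj ! u)) (adj ! u))} =
     {(x, y). x < Suc u & x < y & {x, y} \<in> S0}"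
    using adj_row[OF u] S0_E by (auto simp: less_Suc_eq)
   moreover have "same collectW \<nu> \<nu>'" using \<open>same (insert aK pickW) \<nu> \<nu>'\<close> by (rule same_mono) auto
   moreover have "\<nu>' aU 0 = u" using sameD[OF \<open>same (insert aK pickW) \<nu> \<nu>'\<close>, of aU] s(2) by simp
   moreover have "Suc k <= length (adj ! u) * (4 * n + 14) + 3" using k by (simp add: add.commute)
   ultimately show "?Q (Suc k) \<nu>'" using ex by simp
  next
   fix m \<nu>1 assume m: "m < length (adj ! u)" and s1: "same (insert aK pickW) \<nu> \<nu>1" "\<nu>1 2 (\<nu>1 aK 0) = adj ! u ! m"
    and "\<exists>ps. collected ps \<nu>1 & distinct ps & set ps = {(x, y). x < u & x < y & {x, y} \<in> S0} Un
     {(x, y). x = u & u < y & {u, y} \<in> S0 & y \<in> set (take m (adj ! u))}"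
   then obtain ps where ps: "collected ps \<nu>1" "distinct ps" "set ps = {(x, y). x < u & x < y & {x, y} \<in> S0} Un
     {(x, y). x = u & u < y & {u, y} \<in> S0 & y \<in> set (take m (adj ! u))}" by blast
   let ?v = "adj ! u ! m"
   have E: "{u, ?v} \<in> E" using adj_row[OF u] nth_mem[OF m] by auto
   have nt: "?v \<notin> set (take m (adj ! u))"
    using adj_row[OF u] m by (auto simp: in_set_conv_nth nth_eq_iff_index_eq)
   have "run pick \<nu>1 (%k \<nu>'. k <= 4 * n + 12 & same pickW \<nu>1 \<nu>' &
    collected (if u < ?v & ?v ~= t & ?v \<notin> set (rot ! u) then ps @ [(u, ?v)] else ps) \<nu>')"
    by (rule run_pick[OF _ _ u s1(2) ps(1)])
     (use input_same[OF inp s1(1)] sameD[OF s1(1), of aU] s(2) in simp_all)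
   then show "run pick \<nu>1 (%k \<nu>'. k <= 4 * n + 12 & same (insert aK pickW) \<nu>1 \<nu>' & \<nu>' aK 0 = \<nu>1 aK 0 &
    (\<exists>ps. collected ps \<nu>' & distinct ps & set ps = {(x, y). x < u & x < y & {x, y} \<in> S0} Un
     {(x, y). x = u & u < y & {u, y} \<in> S0 & y \<in> set (take (Suc m) (adj ! u))}))"
   proof (rule run_mono, intro conjI; (elim conjE)?)
    fix k \<nu>' assume sm: "same pickW \<nu>1 \<nu>'"
    then show "same (insert aK pickW) \<nu>1 \<nu>'" by (rule same_mono) auto
    show "\<nu>' aK 0 = \<nu>1 aK 0" using sameD[OF sm, of aK] by simp
   next
    fix k \<nu>' assume "collected (if u < ?v & ?v ~= t & ?v \<notin> set (rot ! u) then ps @ [(u, ?v)] else ps) \<nu>'"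
    then have "collected (if u < ?v & {u, ?v} \<in> S0 then ps @ [(u, ?v)] else ps) \<nu>'"
     using S0_iff[OF False E u] by simp
    moreover have tk: "set (take (Suc m) (adj ! u)) = insert ?v (set (take m (adj ! u)))"
     using m by (simp add: take_Suc_conv_app_nth)
    moreover have "(u, ?v) \<notin> set ps" using ps(3) nt by simp
    ultimately show "\<exists>ps. collected ps \<nu>' & distinct ps & set ps = {(x, y). x < u & x < y & {x, y} \<in> S0} Un
     {(x, y). x = u & u < y & {u, y} \<in> S0 & y \<in> set (take (Suc m) (adj ! u))}"
     using ps(2,3) by (cases "u < ?v & {u, ?v} \<in> S0")
      ((rule exI[of _ "ps @ [(u, ?v)]"], force), (rule exI[of _ ps], force))
   qed
  next
   show "\<exists>ps. collected ps \<nu> & distinct ps & set ps = {(x, y). x < u & x < y & {x, y} \<in> S0} Un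
     {(x, y). x = u & u < y & {u, y} \<in> S0 & y \<in> set (take 0 (adj ! u))}"
    using ps by auto
  qed (use u s inp in "auto simp: input_def collected_def")
  with False s inp show ?thesis by (simp add: input_def)
 qed
next
 show "\<exists>ps. collected ps \<mu> & distinct ps & set ps = {(x, y). x < 0 & x < y & {x, y} \<in> S0}"
  using z by (intro exI[of _ "[]"]) (auto simp: collected_def)
 show "aval (Var 0) \<nu> = n" if "same collectW \<mu> \<nu>" for \<nu>
  using i sameD[OF that, of 0] by (simp add: input_def)
 show "\<exists>ps. collected ps (set_cell aU 0 x \<nu>) & distinct ps & set ps = {(x, y). x < u & x < y & {x, y} \<in> S0}"
  if "\<exists>ps. collected ps \<nu> & distinct ps & set ps = {(x, y). x < u & x < y & {x, y} \<in> S0}" for u \<nu> x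
  using that by (simp add: collected_def)
qed simp_all

text \<open>In the array \<open>aBl\<close>, the value \<open>n\<close>, which is no node, marks an end without neighbours on the near side.\<close>

definition ends_spec :: "store => nat => nat => nat => bool" where
 "ends_spec \<mu> d z v \<longleftrightarrow> (if front R z v then \<mu> aBl d = n else
  \<exists>xs ys As Bs. R z = xs @ ys & ys @ xs = As @ Bs & As ~= [] & Bs ~= [] &
   set As \<subseteq> sideA {z, v} & set Bs \<subseteq> sideB {z, v} & \<mu> aAl d = last As & \<mu> aBl d = last Bs)"

lemma R_nonempty: "{z, v} \<in> S0 ==> R z ~= []"
proof -
 assume e: "{z, v} \<in> S0"
 obtain w where "w \<in> sideB {z, v}" "{z, w} \<in> H" using side_neighbour[OF e] by blast
 then show "R z ~= []" using R_row[of z] S0_D[OF e] sides(1,2)[OF e] by auto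
qed

lemma run_R_row:
 assumes i: "input \<mu>0" and z: "\<mu>0 s 0 = z" "z < n" and W: "0 \<notin> W" "3 \<notin> W" "4 \<notin> W" "s \<notin> W" "aJ \<in> W"
  and ins: "!!i \<mu> x. P i \<mu> ==> P i (set_cell aJ 0 x \<mu>)" and init: "P 0 \<mu>0"
  and step: "!!i \<mu>. i < length (R z) ==> same W \<mu>0 \<mu> ==> \<mu> 4 (\<mu> aJ 0) = R z ! i ==> P i \<mu> ==>
   run c \<mu> (%k \<nu>. k <= C & same W \<mu> \<nu> & \<nu> aJ 0 = \<mu> aJ 0 & P (Suc i) \<nu>)"
  and post: "!!k \<mu>. same W \<mu>0 \<mu> ==> P (length (R z)) \<mu> ==> k <= n * (C + 4) + 2 ==> Q k \<mu>"
 shows "run (Row aJ 3 s (When (Neg (Equal Here Root)) c)) \<mu>0 Q"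
proof -
 \<comment> \<open>Translates an index of the stored row, which may contain \<open>t\<close>, into
   the index reached in \<open>R z\<close>.\<close>
 define K where "K i = length (filter (%w. w ~= t) (take i (rot ! z)))" for i
 have K_len: "K (length (rot ! z)) = length (R z)" and K_0: "K 0 = 0" by (simp_all add: K_def R_def)
 have K_Suc: "i < length (rot ! z) ==> K (Suc i) = (if rot ! z ! i = t then K i else Suc (K i))" for i
  by (simp add: K_def take_Suc_conv_app_nth)
 have K_nth: "K i < length (R z) & R z ! K i = rot ! z ! i" if "i < length (rot ! z)" "rot ! z ! i ~= t" for i
 proof -
  have "R z = filter (%w. w ~= t) (take i (rot ! z) @ rot ! z ! i # drop (Suc i) (rot ! z))"
   unfolding R_def using id_take_nth_drop[OF that(1)] by simp
  with that(2) show ?thesis by (simp add: K_def)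
 qed
 show ?thesis
 proof (rule run_Row[where W = W and dd = 4 and xss = rot and v = z and xs = "rot ! z" and C = "C + 2" and P = "%i. P (K i)"])
  fix k \<mu> assume "same W \<mu>0 \<mu>" "P (K (length (rot ! z))) \<mu>" and k: "k <= length (rot ! z) * (C + 2 + 2) + 2"
  have le: "length (rot ! z) * (C + 2 + 2) <= n * (C + 2 + 2)" using length_row(2)[OF z(2)] by (rule mult_le_mono1)
  have e: "C + 2 + 2 = C + 4" by simp
  have "k <= n * (C + 4) + 2" using k le unfolding e by linarith
  with \<open>same W \<mu>0 \<mu>\<close> \<open>P (K (length (rot ! z))) \<mu>\<close> show "Q k \<mu>" using post[of \<mu> k] unfolding K_len by blast
 next
  fix i \<mu> assume il: "i < length (rot ! z)" and sm: "same W \<mu>0 \<mu>" and el: "\<mu> 4 (\<mu> aJ 0) = rot ! z ! i" and P: "P (K i) \<mu>"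
  have r: "\<mu> 0 (Suc 0) = t" using sameD[OF sm W(1)] i by (simp add: input_def)
  show "run (When (Neg (Equal Here Root)) c) \<mu> (%k \<nu>. k <= C + 2 & same W \<mu> \<nu> & \<nu> aJ 0 = \<mu> aJ 0 & P (K (Suc i)) \<nu>)"
  proof (cases "rot ! z ! i = t")
   case True
   with P r el K_Suc[OF il] show ?thesis by simp
  next
   case False
   have "run c \<mu> (%k \<nu>. k <= C & same W \<mu> \<nu> & \<nu> aJ 0 = \<mu> aJ 0 & P (Suc (K i)) \<nu>)"
    by (rule step) (use K_nth[OF il False] sm el P in auto)
   then have "run c \<mu> (%k \<nu>. Suc k <= C + 2 & same W \<mu> \<nu> & \<nu> aJ 0 = \<mu> aJ 0 & P (K (Suc i)) \<nu>)"
    by (rule run_mono) (use False K_Suc[OF il] in auto)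
   with False r el show ?thesis by simp
  qed
 qed (use i z W ins init K_0 in "auto simp: input_def")
qed

lemma run_last_R:
 assumes i: "input \<mu>" and z: "\<mu> s 0 = z" "z < n" "s \<notin> {aJ, aPrev}"
 shows "run (Row aJ 3 s (When (Neg (Equal Here Root)) (Assign aPrev Here))) \<mu>
  (%k \<nu>. k <= 5 * n + 2 & same {aJ, aPrev} \<mu> \<nu> & (R z ~= [] --> \<nu> aPrev 0 = last (R z)))"
proof (rule run_R_row[OF i z(1,2), where W = "{aJ, aPrev}" and C = 1 and P = "%i \<nu>. i > 0 --> \<nu> aPrev 0 = R z ! (i - 1)"], goal_cases)
 case (9 k \<nu>)
 then show ?case by (simp add: last_conv_nth)
qed (use z in simp_all)

lemma run_endpoint:
 assumes i: "input \<mu>" and e: "{z, v} \<in> S0" and z: "\<mu> aZ 0 = z" and d: "\<mu> aD 0 = d" and b: "\<mu> aBase 0 = b"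
  and M: "!!w. w < n ==> \<mu> aM (b + w) = (if w \<in> sideB {z, v} then 3 else if w \<in> {z, v} then 2 else 1)"
 shows "run endpoint \<mu> (%k \<nu>. k <= 14 * n + 6 & same {aJ, aPrev, aAl, aBl} \<mu> \<nu> &
  (\<forall>i. i ~= d --> \<nu> aAl i = \<mu> aAl i & \<nu> aBl i = \<mu> aBl i) & ends_spec \<nu> d z v)"
proof -
 let ?A = "sideA {z, v}" and ?B = "sideB {z, v}"
 have zn: "z < n" "z ~= t" using S0_D[OF e] by auto
 have Rne: "R z ~= []" by (rule R_nonempty[OF e])
 have Rs: "w < n & (w \<in> ?A | w \<in> ?B) & w \<notin> {z, v} & w ~= t" if "w \<in> set (R z)" for w
  using that R_row[OF zn(1)] H_link_ends[of z w] sides[OF e] S0_D[OF e] by auto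
 have M1: "\<mu> aM (b + w) = 1 \<longleftrightarrow> w \<in> ?A" and M3: "\<mu> aM (b + w) = 3 \<longleftrightarrow> w \<in> ?B" if "w \<in> set (R z)" for w
  using M[of w] Rs[OF that] sides(2)[OF e] by auto
 let ?p = "%j. prev_in (R z) j \<in> ?A & R z ! j \<in> ?B"
 let ?q = "%j. prev_in (R z) j \<in> ?B & R z ! j \<in> ?A"
 let ?N = "length (R z)"
 have pR: "prev_in (R z) j \<in> set (R z)" if "j < ?N" for j
  using that Rne by (auto simp: prev_in_def)
 obtain x0 y0 where xy: "!!j. j < ?N ==> ?p j ==> prev_in (R z) j = x0" "!!j. j < ?N ==> ?q j ==> prev_in (R z) j = y0"
  and fin: "!!\<nu>. \<nu> aAl d = (if \<exists>j<?N. ?p j then x0 else n) ==> \<nu> aBl d = (if \<exists>j<?N. ?q j then y0 else n) ==> ends_spec \<nu> d z v"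
 proof (cases "front R z v")
  case True
  then have "~  ?p j" "~  ?q j" if "j < ?N" for j
   using pR[OF that] nth_mem[OF that] True unfolding front_def by blast+
  then show ?thesis using True by (intro that) (auto simp: ends_spec_def)
 next
  case False
  then have "set (R z) Int sideA {z, v} ~= {}" by (simp add: front_def)
  from side_contiguous[OF skipping_H resilient rotational_rows e this]
  obtain us vs As Bs where AB: "R z = us @ vs" "vs @ us = As @ Bs" "As ~= []" "Bs ~= []" "set As \<subseteq> ?A" "set Bs \<subseteq> ?B" by blast
  have "set (R z) = set As Un set Bs" using AB(1,2) by (metis set_append sup_commute)
  then have mem: "w \<in> ?A \<longleftrightarrow> w \<in> set As" "w \<in> ?B \<longleftrightarrow> w \<in> set Bs" if "w \<in> set (R z)" for w
   using that AB(5,6) sides(2)[OF e] by auto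
  have dR: "distinct (R z)" using R_row[OF zn(1)] by simp
  note tn = turns[OF AB(1,2) dR AB(3,4)]
  show ?thesis
  proof (rule that[of "last As" "last Bs"])
   show "prev_in (R z) j = last As" if "j < ?N" "?p j" for j
    using tn(1)[OF that(1)] mem[OF pR[OF that(1)]] mem[OF nth_mem[OF that(1)]] that(2) by simp
   show "prev_in (R z) j = last Bs" if "j < ?N" "?q j" for j
    using tn(2)[OF that(1)] mem[OF pR[OF that(1)]] mem[OF nth_mem[OF that(1)]] that(2) by simp
   fix \<nu> :: store assume "\<nu> aAl d = (if \<exists>j<?N. ?p j then last As else n)" "\<nu> aBl d = (if \<exists>j<?N. ?q j then last Bs else n)"
   moreover have "\<exists>j<?N. ?p j" using tn(3) AB(5,6) by blast
   moreover have "\<exists>j<?N. ?q j" using tn(4) AB(5,6) by blast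
   ultimately show "ends_spec \<nu> d z v" unfolding ends_spec_def using False AB by auto
  qed
 qed
 let ?w = "Seq (When (Conj (Equal (Read aM (Add (Var aBase) (Var aPrev))) (Const 1)) (Equal (Read aM (Add (Var aBase) Here)) (Const 3)))
    (Write aAl (Var aD) (Var aPrev)))
   (Seq (When (Conj (Equal (Read aM (Add (Var aBase) (Var aPrev))) (Const 3)) (Equal (Read aM (Add (Var aBase) Here)) (Const 1)))
    (Write aBl (Var aD) (Var aPrev))) (Assign aPrev Here))"
 let ?Q = "%k \<nu>. k <= 14 * n + 6 & same {aJ, aPrev, aAl, aBl} \<mu> \<nu> &
  (\<forall>i. i ~= d --> \<nu> aAl i = \<mu> aAl i & \<nu> aBl i = \<mu> aBl i) & ends_spec \<nu> d z v"
 let ?P = "%m \<nu>. \<nu> aPrev 0 = prev_in (R z) m & (\<forall>i. i ~= d --> \<nu> aAl i = \<mu> aAl i & \<nu> aBl i = \<mu> aBl i) &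
  \<nu> aAl d = (if \<exists>j<m. ?p j then x0 else n) & \<nu> aBl d = (if \<exists>j<m. ?q j then y0 else n)"
 show ?thesis
  unfolding endpoint_def
 proof (rule run_SeqI[OF run_last_R[OF i z zn(1)]], simp, elim conjE)
  fix k1 \<nu>1 assume k1: "k1 <= 5 * n + 2" and s1: "same {aJ, aPrev} \<mu> \<nu>1" and "R z ~= [] --> \<nu>1 aPrev 0 = last (R z)"
  then have p1: "\<nu>1 aPrev 0 = last (R z)" using Rne by blast
  let ?\<nu> = "set_cell aBl d n (set_cell aAl d n \<nu>1)"
  have e1: "\<nu>1 aD 0 = d" "\<nu>1 0 0 = n" "\<nu>1 aAl = \<mu> aAl" "\<nu>1 aBl = \<mu> aBl" using sameD[OF s1] d i by (auto simp: input_def)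
  have s2: "same {aJ, aPrev, aAl, aBl} \<mu> ?\<nu>" using s1 by (auto simp: same_def)
  have "run (Row aJ 3 aZ (When (Neg (Equal Here Root)) ?w)) ?\<nu> (%k4. ?Q (k1 + (1 + (1 + k4))))"
  proof (rule run_R_row[where z = z and W = "{aJ, aPrev, aAl, aBl}" and C = 5 and P = ?P], goal_cases)
   case 1
   show ?case by (rule input_same[OF i s2]) auto
  next
   case 2
   with sameD[OF s2, of aZ] z show ?case by simp
  next
   case 3
   show ?case by (rule zn(1))
  next
   case 10
   show ?case using p1 e1 by (simp add: prev_in_def)
  next
   case (11 j \<nu>)
   then have j: "j < ?N" and sm: "same {aJ, aPrev, aAl, aBl} ?\<nu> \<nu>" and w: "\<nu> 4 (\<nu> aJ 0) = R z ! j" and c: "?P j \<nu>" by blast+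
   have ee: "\<nu> aBase 0 = b" "\<nu> aD 0 = d" "\<nu> aM = \<mu> aM" using sameD[OF sm] sameD[OF s2] b d by auto
   have pw: "\<mu> aM (b + prev_in (R z) j) = Suc 0 \<longleftrightarrow> prev_in (R z) j \<in> ?A" "\<mu> aM (b + prev_in (R z) j) = 3 \<longleftrightarrow> prev_in (R z) j \<in> ?B"
    "\<mu> aM (b + R z ! j) = Suc 0 \<longleftrightarrow> R z ! j \<in> ?A" "\<mu> aM (b + R z ! j) = 3 \<longleftrightarrow> R z ! j \<in> ?B"
    using M1[OF pR[OF j]] M3[OF pR[OF j]] M1[OF nth_mem[OF j]] M3[OF nth_mem[OF j]] by simp_all
   have ex: "(\<exists>i<Suc j. ?p i) \<longleftrightarrow> (\<exists>i<j. ?p i) | ?p j" "(\<exists>i<Suc j. ?q i) \<longleftrightarrow> (\<exists>i<j. ?q i) | ?q j"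
    by (auto simp: less_Suc_eq)
   have pv: "prev_in (R z) (Suc j) = R z ! j" by (simp add: prev_in_def)
   have "~  (prev_in (R z) j \<in> ?A & prev_in (R z) j \<in> ?B)" using sides(2)[OF e] by blast
   then consider "?p j" "~  ?q j" | "~  ?p j" "?q j" | "~  ?p j" "~  ?q j" by blast
   then show ?case
   proof cases
    case 1
    then show ?thesis using xy(1)[OF j 1(1)] c w ee pw unfolding ex pv by auto
   next
    case 2
    then show ?thesis using xy(2)[OF j 2(2)] c w ee pw unfolding ex pv by auto
   next
    case 3
    then show ?thesis using c w ee pw unfolding ex pv by auto
   qed
  next
   case (12 k \<nu>)
   have "ends_spec \<nu> d z v" by (rule fin) (use 12(2) in blast)+
   moreover have "same {aJ, aPrev, aAl, aBl} \<mu> \<nu>" using same_trans[OF s2 12(1)] .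
   moreover have "k1 + (1 + (1 + k)) <= 14 * n + 6" using 12(3) k1 by simp
   ultimately show ?case using 12(2) by blast
  qed simp_all
  then show "run (Seq (Write aAl (Var aD) (Var 0)) (Seq (Write aBl (Var aD) (Var 0)) (Row aJ 3 aZ (When (Neg (Equal Here Root)) ?w)))) \<nu>1 (%k. ?Q (k1 + k))"
   using e1 by simp
 qed
qed


end

section \<open>Marking the sides of each separating link and orienting it\<close>

abbreviation "aH \<equiv> 17 :: nat"
abbreviation "aCnt \<equiv> 21 :: nat"
abbreviation "aS \<equiv> 26 :: nat"
abbreviation "aDec \<equiv> 27 :: nat"
abbreviation "aYc \<equiv> 47 :: nat"
abbreviation "aMo \<equiv> 48 :: nat"
abbreviation "aSize \<equiv> 49 :: nat"

text \<open>Every separating link gets a block of \<open>n\<close> cells of \<open>aM\<close>, with marks 1 for the near side, 2 for the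
 ends, and 3 for the far side. Arc \<open>2 i\<close> and arc \<open>2 i + 1\<close> are the two orientations of link \<open>i\<close>.\<close>

definition near_marks :: com where
 "near_marks = Seq (Write aM (Add (Var aBase) (Var aU)) (Const 2))
  (Seq (Write aM (Add (Var aBase) (Var aV)) (Const 2))
  (Seq (Write aM (Add (Var aBase) Root) (Const 1))
  (Seq (Assign aMark (Const 1)) (Seq (Assign aRoot Root) search))))"

text \<open>The tail of the first search is the size of the near side and is saved. Unmarked cells
  now are exactly the far side, and the second search is rooted at \<open>v\<close> so that parent
  pointers lead to \<open>v\<close>.\<close>

definition far_marks :: com where
 "far_marks = Seq (Assign aCnt (Var aTail)) (Seq (Assign aMark (Const 3)) (Seq (Assign aRoot (Var aV)) search))"

text \<open>For a far neighbour \<open>s\<close> of \<open>u\<close>, the path from \<open>u\<close>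
  over \<open>s\<close> along parent pointers to \<open>v\<close> runs through the far side.
  Whichever of \<open>u\<close> and the parent of \<open>s\<close> comes first in the starting list
  of \<open>s\<close> shows the direction that \<open>s\<close> prefers.\<close>

definition decide :: com where
 "decide = Seq (Row aJ 3 aU (When (Equal (Read aM (Add (Var aBase) (Read 4 (Var aJ)))) (Const 3)) (Assign aS (Read 4 (Var aJ)))))
  (Seq (Assign aDec (Const 0))
  (For aJ (Read 5 (Var aS)) (Add (Read 5 (Var aS)) (Sub (Read 3 (Add (Var aS) (Const 1))) (Read 3 (Var aS))))
   (When (Equal (Var aDec) (Const 0))
    (Cond (Equal (Read 6 (Var aJ)) (Var aU)) (Assign aDec (Const 1))
     (When (Equal (Read 6 (Var aJ)) (Read aPar (Var aS))) (Assign aDec (Const 2)))))))"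

abbreviation Arc :: aexp where "Arc \<equiv> Add (Var aH) (Var aH)"
abbreviation Arc' :: aexp where "Arc' \<equiv> Add (Add (Var aH) (Var aH)) (Const 1)"

text \<open>If \<open>s\<close> prefers \<open>u\<close>, then \<open>v\<close> is the end that
  sends far packets to the link early, and conversely; the two subtractions turn the decision 1 or 2
  into complementary bits.\<close>

definition arcs :: com where
 "arcs = Seq (Write aMo Arc (Var aBase)) (Seq (Write aMo Arc' (Var aBase))
  (Seq (Write aSize Arc (Var aCnt)) (Seq (Write aSize Arc' (Var aCnt))
  (Seq (Write aYc Arc (Sub (Var aDec) (Const 1))) (Write aYc Arc' (Sub (Const 2) (Var aDec)))))))"

definition handle :: com where
 "handle = Seq (Seq (Assign aU (Read aSrc Arc)) (Assign aV (Read aDst Arc))) (Seq near_marks (Seq far_marks (Seq decide (Seq arcs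
  (Seq (Seq (Assign aZ (Var aU)) (Assign aD Arc)) (Seq endpoint (Seq (Seq (Assign aZ (Var aV)) (Assign aD Arc'))
  (Seq endpoint (Assign aBase (Add (Var aBase) (Var 0)))))))))))"

context routing_input
begin

text \<open>The orientation needed for an insertion: some inner node of a far-side path from
  \<open>y\<close> to \<open>x\<close> starts its packets towards \<open>x\<close>.\<close>

definition wit :: "nat => nat => bool" where
 "wit y x \<longleftrightarrow> (\<exists>q j. link_path H q & hd q = y & last q = x &
    (\<forall>i. 0 < i --> Suc i < length q --> q ! i \<in> sideB {y, x}) & 0 < j & Suc j < length q &
    rank (\<pi> (q ! j) None) {q ! j, q ! Suc j} < rank (\<pi> (q ! j) None) {q ! j, q ! (j - 1)})"

text \<open>The path \<open>u # q\<close> is used as it stands if \<open>s\<close> prefers its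
  parent \<open>p\<close>, and reversed if \<open>s\<close> prefers \<open>u\<close>.\<close>

lemma wit_path:
 assumes q: "link_path H q" "hd q = s" "last q = v" "2 <= length q" "q ! 1 = p" "set (butlast q) \<subseteq> sideB {u, v}"
  and us: "{u, s} \<in> H" and e: "{u, v} \<in> S0"
 shows "rank (\<pi> s None) {s, p} < rank (\<pi> s None) {s, u} ==> wit u v"
  "rank (\<pi> s None) {s, u} < rank (\<pi> s None) {s, p} ==> wit v u"
proof -
 have ne: "q ~= []" using q(4) by auto
 have "set q = insert v (set (butlast q))" using ne q(3) append_butlast_last_id[OF ne] by (metis Un_insert_right list.set(1) list.simps(15) set_append sup_bot_right)
 then have un: "u \<notin> set q" using q(6) sides(4)[OF e] S0_D[OF e] by auto
 have lp: "link_path H (u # q)" by (rule link_path_Cons[OF q(1)]) (use us q(2) un in auto)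
 have q0: "q ! 0 = s" using q(2) ne by (simp add: hd_conv_nth)
 have far: "q ! i \<in> sideB {u, v}" if "Suc i < length q" for i
 proof -
  have "butlast q ! i \<in> set (butlast q)" using that by (intro nth_mem) simp
  then show ?thesis using that q(6) by (auto simp: nth_butlast)
 qed
 show "wit u v" if r: "rank (\<pi> s None) {s, p} < rank (\<pi> s None) {s, u}"
  unfolding wit_def
 proof (intro exI[of _ "u # q"] exI[of _ "1::nat"] conjI allI impI)
  show "(u # q) ! i \<in> sideB {u, v}" if "0 < i" "Suc i < length (u # q)" for i
   using that far[of "i - 1"] by (cases i) auto
 qed (use lp ne q r q0 in auto)
 let ?q = "rev q @ [u]" and ?l = "length q"
 have rq: "?q = rev (u # q)" by simp
 have nth: "?q ! i = q ! (?l - 1 - i)" if "i < ?l" for i using that by (simp add: nth_append rev_nth)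
 show "wit v u" if r: "rank (\<pi> s None) {s, u} < rank (\<pi> s None) {s, p}"
  unfolding wit_def
 proof (intro exI[of _ ?q] exI[of _ "?l - 1"] conjI allI impI)
  show "link_path H ?q" unfolding rq by (rule link_path_rev[OF lp])
  show "hd ?q = v" using ne q(3) by (simp add: hd_rev)
  show "?q ! i \<in> sideB {v, u}" if i: "0 < i" "Suc i < length ?q" for i
   using nth[of i] far[of "?l - 1 - i"] i by (simp add: insert_commute)
  have "?q ! (?l - 1) = s" using nth[of "?l - 1"] q(4) q0 by simp
  moreover have "?q ! Suc (?l - 1) = u"
  proof -
   have "Suc (?l - 1) = length (rev q)" using q(4) by simp
   then show ?thesis by (simp only: nth_append_length)
  qed
  moreover have "?q ! (?l - 1 - 1) = p"
  proof -
   have "?l - 1 - 1 < ?l" "?l - 1 - (?l - 1 - 1) = 1" using q(4) by linarith+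
   with nth[of "?l - 1 - 1"] q(5) show ?thesis by simp
  qed
  ultimately show "rank (\<pi> (?q ! (?l - 1)) None) {?q ! (?l - 1), ?q ! Suc (?l - 1)}
   < rank (\<pi> (?q ! (?l - 1)) None) {?q ! (?l - 1), ?q ! (?l - 1 - 1)}" using r by simp
 qed (use q(4) in auto)
qed

text \<open>A table row begins with the list for \<open>None\<close>, a permutation of the links at
  \<open>s\<close>; its length can thus be taken from the offsets of the rotation lists.\<close>

lemma None_block:
 assumes s: "s < n" "s ~= t"
 shows "length (\<pi> s None) = length (rot ! s)"
  "j < length (rot ! s) ==> j < length (tab ! s) & {s, tab ! s ! j} = \<pi> s None ! j"
proof -
 have p: "distinct (\<pi> s None)" "set (\<pi> s None) = links_at H s" using row_pattern(4)[OF s] by (auto simp: in_ports_def)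
 have "links_at H s = (%v. {s, v}) ` set (rot ! s)"
 proof -
  have "links_at H s = (%v. {s, v}) ` {v. {s, v} \<in> H}"
  proof -
   have "links_at H s = links_at E s - S" by (auto simp: links_at_def)
   then show ?thesis unfolding links_at_image by auto
  qed
  with rot_row[OF s(1)] show ?thesis by simp
 qed
 moreover have "inj_on (%v. {s, v}) (set (rot ! s))" by (auto simp: inj_on_def doubleton_eq_iff)
 ultimately show l: "length (\<pi> s None) = length (rot ! s)"
  using p rot_row[OF s(1)] distinct_card[of "\<pi> s None"] distinct_card[of "rot ! s"] by (simp add: card_image)
 assume j: "j < length (rot ! s)"
 have ts: "tab ! s = map (other_end s) (\<pi> s None) @ concat (map (%p. map (other_end s) (\<pi> s p)) (map (%w. Some {s, w}) (rot ! s)))"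
  using s by (simp add: tab_def pattern_table_def)
 then have "tab ! s ! j = other_end s (\<pi> s None ! j)" using j l by (simp add: nth_append)
 moreover have "\<pi> s None ! j \<in> links_at H s" using p(2) j l nth_mem by metis
 then obtain v where "\<pi> s None ! j = {s, v}" "s ~= v" using \<open>links_at H s = _\<close> rot_row[OF s(1)] H_link_ends by auto
 ultimately show "j < length (tab ! s) & {s, tab ! s ! j} = \<pi> s None ! j" using ts j l by simp
qed

lemma H_rows: "x < length rot ==> set (rot ! x) = {w. {x, w} \<in> H}" "{x, w} \<in> H ==> x < length rot & w < length rot"
 using rot_row H_link_ends by auto

lemma run_near_marks:
 assumes i: "input \<mu>" and e: "{u, v} \<in> S0" and uv: "\<mu> aU 0 = u" "\<mu> aV 0 = v" "\<mu> aBase 0 = b"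
  and M: "!!w. w < n ==> \<mu> aM (b + w) = 0"
 shows "run near_marks \<mu> (%k \<nu>. k <= 295 * n + 9 & same ({aMark, aRoot} Un searchW) \<mu> \<nu> & \<nu> aTail 0 = card (sideA {u, v}) &
  (\<forall>w<n. \<nu> aM (b + w) = (if w \<in> sideA {u, v} then 1 else if w \<in> {u, v} then 2 else 0)) &
  (\<forall>a. a < b | b + n <= a --> \<nu> aM a = \<mu> aM a))"
proof -
 let ?A = "sideA {u, v}"
 let ?T = "%k \<nu>. k <= 295 * n + 9 & same ({aMark, aRoot} Un searchW) \<mu> \<nu> & \<nu> aTail 0 = card ?A &
  (\<forall>w<n. \<nu> aM (b + w) = (if w \<in> ?A then 1 else if w \<in> {u, v} then 2 else 0)) &
  (\<forall>a. a < b | b + n <= a --> \<nu> aM a = \<mu> aM a)"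
 have d: "u ~= v" "u < n" "v < n" "u ~= t" "v ~= t" using S0_D[OF e] by auto
 note sd = sides[OF e]
 define \<mu>1 where "\<mu>1 = set_cell aRoot 0 t (set_cell aMark 0 1 (set_cell aM (b + t) 1 (set_cell aM (b + v) 2 (set_cell aM (b + u) 2 \<mu>))))"
 have m1: "\<mu>1 aM (b + w) = (if w = t then 1 else if w = u | w = v then 2 else 0)" if "w < n" for w
  using M[OF that] by (auto simp: \<mu>1_def)
 have m2: "\<mu>1 aM a = \<mu> aM a" if "a < b | b + n <= a" for a using that d root by (auto simp: \<mu>1_def)
 have U: "{w. w < length rot & \<mu>1 aM (\<mu>1 aBase 0 + w) = 0} = {..<n} - {u, v, t}"
 proof -
  have "\<mu>1 aBase 0 = b" using uv by (simp add: \<mu>1_def)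
  then show ?thesis using m1 by (auto split: if_splits)
 qed
 have i1: "input \<mu>1" unfolding \<mu>1_def by (rule input_same[OF i, of "{aRoot, aMark, aM}"]) (auto simp: same_def)
 have AV: "?A \<subseteq> {..<n}" using sd by auto
 have sA: "{w. linked {l \<in> H. l \<subseteq> insert t ({..<n} - {u, v, t})} t w} = ?A"
 proof
  show "{w. linked {l \<in> H. l \<subseteq> insert t ({..<n} - {u, v, t})} t w} \<subseteq> ?A"
  proof
   fix w assume "w \<in> {w. linked {l \<in> H. l \<subseteq> insert t ({..<n} - {u, v, t})} t w}"
   then have "linked {l \<in> H. l \<subseteq> insert t ({..<n} - {u, v, t})} t w" by simp
   then have "linked (avoid E {u, v}) t w" by (rule linked_mono) (use d in auto)
   then show "w \<in> ?A" by (simp add: sideA_def comp_def)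
  qed
  show "?A \<subseteq> {w. linked {l \<in> H. l \<subseteq> insert t ({..<n} - {u, v, t})} t w}"
  proof
   fix w assume "w \<in> ?A"
   from sideA_linked[OF e this] have "linked {l \<in> H. l \<subseteq> insert t ({..<n} - {u, v, t})} t w"
    by (rule linked_mono) (use AV sd(3) in auto)
   then show "w \<in> {w. linked {l \<in> H. l \<subseteq> insert t ({..<n} - {u, v, t})} t w}" by simp
  qed
 qed
 have "run search \<mu>1 (%k. ?T (1 + (1 + (1 + (1 + (1 + k))))))"
 proof (rule run_search[where rot = rot and L = H])
  show "stored \<mu>1 3 4 rot" "\<mu>1 0 0 = length rot" using i1 by (auto simp: input_def)
  have b1: "\<mu>1 aRoot 0 = t" "\<mu>1 aMark 0 = 1" "\<mu>1 aBase 0 = b" using uv by (auto simp: \<mu>1_def)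
  show "\<mu>1 aRoot 0 < length rot" "\<mu>1 aMark 0 ~= 0" using b1 root by auto
  show "\<mu>1 aM (\<mu>1 aBase 0 + \<mu>1 aRoot 0) ~= 0" unfolding b1 m1[OF root] by simp
  fix k \<nu> Q
  assume sm: "same searchW \<mu>1 \<nu>" and Q: "distinct Q" "set Q = {w. linked {l \<in> H. l \<subseteq> insert (\<mu>1 aRoot 0)
    {w. w < length rot & \<mu>1 aM (\<mu>1 aBase 0 + w) = 0}} (\<mu>1 aRoot 0) w}" "\<nu> aTail 0 = length Q"
   and mk: "!!w. w \<in> {w. w < length rot & \<mu>1 aM (\<mu>1 aBase 0 + w) = 0} ==> \<nu> aM (\<mu>1 aBase 0 + w) = (if w \<in> set Q then \<mu>1 aMark 0 else 0)"
   and mo: "!!a. (!!w. w \<in> {w. w < length rot & \<mu>1 aM (\<mu>1 aBase 0 + w) = 0} ==> a ~= \<mu>1 aBase 0 + w) ==> \<nu> aM a = \<mu>1 aM a"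
   and k: "k <= 7 * length rot + 9 * (\<Sum>v<length rot. length (rot ! v)) + 4"
  note mk' = mk[unfolded U, unfolded b1] and mo' = mo[unfolded U, unfolded b1]
  have QA: "set Q = ?A" using Q(2) unfolding U unfolding b1(1) sA .
  have "\<nu> aM (b + w) = (if w \<in> ?A then 1 else if w \<in> {u, v} then 2 else 0)" if w: "w < n" for w
  proof (cases "w \<in> {u, v, t}")
   case True
   then have "\<nu> aM (b + w) = \<mu>1 aM (b + w)" by (intro mo') auto
   then show ?thesis using True m1[OF w] sd d by auto
  next
   case False
   then have "\<nu> aM (b + w) = (if w \<in> set Q then 1 else 0)" using w by (intro mk') auto
   with False QA show ?thesis by simp
  qed
  moreover have "\<nu> aM a = \<mu> aM a" if "a < b | b + n <= a" for a
  proof -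
   have "\<nu> aM a = \<mu>1 aM a" using that root d by (intro mo') auto
   with m2[OF that] show ?thesis by simp
  qed
  moreover have "\<nu> aTail 0 = card ?A" using Q(1,3) QA by (simp add: distinct_card[symmetric])
  moreover have "same ({aMark, aRoot} Un searchW) \<mu> \<nu>" using sm by (auto simp: \<mu>1_def same_def)
  \<comment> \<open>The 295 is 7 for the rounds of the search plus 9 times the bound 32 for the
    rotation lists.\<close>
  moreover have "1 + (1 + (1 + (1 + (1 + k)))) <= 295 * n + 9" using k sum_rot by simp
  ultimately show "?T (1 + (1 + (1 + (1 + (1 + k))))) \<nu>" by blast
 qed (use H_rows in auto)
 then show ?thesis unfolding near_marks_def using uv i by (simp add: \<mu>1_def input_def)
qed

lemma run_far_marks:
 assumes i: "input \<mu>" and e: "{u, v} \<in> S0" and uv: "\<mu> aV 0 = v" "\<mu> aBase 0 = b"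
  and M: "!!w. w < n ==> \<mu> aM (b + w) = (if w \<in> sideA {u, v} then 1 else if w \<in> {u, v} then 2 else 0)"
 shows "run far_marks \<mu> (%k \<nu>. k <= 295 * n + 9 & same ({aCnt, aMark, aRoot} Un searchW) \<mu> \<nu> & \<nu> aCnt 0 = \<mu> aTail 0 &
  (\<forall>w<n. \<nu> aM (b + w) = (if w \<in> sideB {u, v} then 3 else if w \<in> {u, v} then 2 else 1)) &
  (\<forall>a. a < b | b + n <= a --> \<nu> aM a = \<mu> aM a) &
  (\<forall>w\<in>sideB {u, v}. \<exists>q. link_path H q & hd q = w & last q = v & 2 <= length q &
    q ! 1 = \<nu> aPar w & set (butlast q) \<subseteq> sideB {u, v}))"
proof -
 let ?A = "sideA {u, v}" and ?B = "sideB {u, v}"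
 let ?T = "%k \<nu>. k <= 295 * n + 9 & same ({aCnt, aMark, aRoot} Un searchW) \<mu> \<nu> & \<nu> aCnt 0 = \<mu> aTail 0 &
  (\<forall>w<n. \<nu> aM (b + w) = (if w \<in> ?B then 3 else if w \<in> {u, v} then 2 else 1)) &
  (\<forall>a. a < b | b + n <= a --> \<nu> aM a = \<mu> aM a) &
  (\<forall>w\<in>?B. \<exists>q. link_path H q & hd q = w & last q = v & 2 <= length q & q ! 1 = \<nu> aPar w & set (butlast q) \<subseteq> ?B)"
 have d: "u ~= v" "u < n" "v < n" "u ~= t" "v ~= t" using S0_D[OF e] by auto
 note sd = sides[OF e]
 have Bn: "?B \<subseteq> {..<n}" by (auto simp: sideB_def)
 define \<mu>1 where "\<mu>1 = set_cell aRoot 0 v (set_cell aMark 0 3 (set_cell aCnt 0 (\<mu> aTail 0) \<mu>))"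
 have m1: "\<mu>1 aM = \<mu> aM" by (simp add: \<mu>1_def)
 have U: "{w. w < length rot & \<mu>1 aM (\<mu>1 aBase 0 + w) = 0} = ?B"
 proof -
  have "\<mu>1 aBase 0 = b" using uv by (simp add: \<mu>1_def)
  moreover have "\<mu> aM (b + w) = 0 \<longleftrightarrow> w \<in> ?B" if "w < n" for w
   using M[OF that] that by (auto simp: sideB_def)
  ultimately show ?thesis unfolding m1 using Bn by auto
 qed
 have i1: "input \<mu>1" unfolding \<mu>1_def by (rule input_same[OF i, of "{aRoot, aMark, aCnt}"]) (auto simp: same_def)
 have sB: "?B \<subseteq> {w. linked {l \<in> H. l \<subseteq> insert v ?B} v w}"
 proof
  fix w assume "w \<in> ?B"
  then have "linked {l \<in> H. l \<subseteq> insert v ?B} w v" by (intro side_attach[OF e]) auto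
  then show "w \<in> {w. linked {l \<in> H. l \<subseteq> insert v ?B} v w}" by (simp add: linked_sym)
 qed
 have "run search \<mu>1 (%k. ?T (1 + (1 + (1 + k))))"
 proof (rule run_search[where rot = rot and L = H])
  show "stored \<mu>1 3 4 rot" "\<mu>1 0 0 = length rot" using i1 by (auto simp: input_def)
  have b1: "\<mu>1 aRoot 0 = v" "\<mu>1 aMark 0 = 3" "\<mu>1 aBase 0 = b" using uv by (auto simp: \<mu>1_def)
  have vA: "v \<notin> ?A" using sd(3) by auto
  show "\<mu>1 aRoot 0 < length rot" "\<mu>1 aMark 0 ~= 0" using b1 d by auto
  show "\<mu>1 aM (\<mu>1 aBase 0 + \<mu>1 aRoot 0) ~= 0" unfolding b1 m1 M[OF d(3)] using vA by simp
  fix k \<nu> Q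
  assume sm: "same searchW \<mu>1 \<nu>" and Q: "set Q = {w. linked {l \<in> H. l \<subseteq> insert (\<mu>1 aRoot 0)
    {w. w < length rot & \<mu>1 aM (\<mu>1 aBase 0 + w) = 0}} (\<mu>1 aRoot 0) w}"
   and mk: "!!w. w \<in> {w. w < length rot & \<mu>1 aM (\<mu>1 aBase 0 + w) = 0} ==> \<nu> aM (\<mu>1 aBase 0 + w) = (if w \<in> set Q then \<mu>1 aMark 0 else 0)"
   and mo: "!!a. (!!w. w \<in> {w. w < length rot & \<mu>1 aM (\<mu>1 aBase 0 + w) = 0} ==> a ~= \<mu>1 aBase 0 + w) ==> \<nu> aM a = \<mu>1 aM a"
   and pt: "!!w. w \<in> set Q ==> w ~= \<mu>1 aRoot 0 ==> \<exists>q. link_path H q & hd q = w & last q = \<mu>1 aRoot 0 & 2 <= length q &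
    q ! 1 = \<nu> aPar w & set (butlast q) \<subseteq> {w. w < length rot & \<mu>1 aM (\<mu>1 aBase 0 + w) = 0}"
   and k: "k <= 7 * length rot + 9 * (\<Sum>v<length rot. length (rot ! v)) + 4"
  note mk' = mk[unfolded U, unfolded b1] and mo' = mo[unfolded U, unfolded b1] and pt' = pt[unfolded U, unfolded b1]
  have QB: "?B \<subseteq> set Q" using Q sB unfolding U unfolding b1(1) by simp
  have "\<nu> aM (b + w) = (if w \<in> ?B then 3 else if w \<in> {u, v} then 2 else 1)" if w: "w < n" for w
  proof (cases "w \<in> ?B")
   case True
   then have "\<nu> aM (b + w) = (if w \<in> set Q then 3 else 0)" by (rule mk')
   then show ?thesis using True QB by auto
  next
   case False
   then have "\<nu> aM (b + w) = \<mu> aM (b + w)" unfolding m1[symmetric] by (intro mo') auto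
   moreover have "w \<in> ?A | w \<in> {u, v}" using False w by (auto simp: sideB_def)
   ultimately show ?thesis using False M[OF w] sd(3) by auto
  qed
  moreover have "\<nu> aM a = \<mu> aM a" if "a < b | b + n <= a" for a
   unfolding m1[symmetric] using that Bn by (intro mo') auto
  moreover have "\<exists>q. link_path H q & hd q = w & last q = v & 2 <= length q & q ! 1 = \<nu> aPar w & set (butlast q) \<subseteq> ?B"
   if "w \<in> ?B" for w
  proof -
   have "w ~= v" using that sd(4) by auto
   then show ?thesis using pt'[of w] that QB by blast
  qed
  moreover have "\<nu> aCnt 0 = \<mu> aTail 0" using sameD[OF sm, of aCnt] by (simp add: \<mu>1_def)
  moreover have "same ({aCnt, aMark, aRoot} Un searchW) \<mu> \<nu>" using sm by (auto simp: \<mu>1_def same_def)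
  moreover have "1 + (1 + (1 + k)) <= 295 * n + 9" using k sum_rot by simp
  ultimately show "?T (1 + (1 + (1 + k))) \<nu>" by blast
 qed (use H_rows in auto)
 then show ?thesis unfolding far_marks_def using uv by (simp add: \<mu>1_def)
qed

lemma run_decide:
 assumes i: "input \<mu>" and e: "{u, v} \<in> S0" and uv: "\<mu> aU 0 = u" "\<mu> aBase 0 = b"
  and M: "!!w. w < n ==> \<mu> aM (b + w) = (if w \<in> sideB {u, v} then 3 else if w \<in> {u, v} then 2 else 1)"
  and par: "!!w. w \<in> sideB {u, v} ==> \<exists>q. link_path H q & hd q = w & last q = v & 2 <= length q &
    q ! 1 = \<mu> aPar w & set (butlast q) \<subseteq> sideB {u, v}"
 shows "run decide \<mu> (%k \<nu>. k <= 10 * n + 5 & same {aJ, aS, aDec} \<mu> \<nu> &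
  (\<nu> aDec 0 = 1 & wit v u | \<nu> aDec 0 = 2 & wit u v))"
proof -
 let ?B = "sideB {u, v}"
 let ?T = "%k \<nu>. k <= 10 * n + 5 & same {aJ, aS, aDec} \<mu> \<nu> & (\<nu> aDec 0 = 1 & wit v u | \<nu> aDec 0 = 2 & wit u v)"
 have d: "u ~= v" "u < n" "v < n" "u ~= t" "v ~= t" using S0_D[OF e] by auto
 note sd = sides[OF e]
 obtain s0 where s0: "s0 \<in> ?B" "{u, s0} \<in> H" using side_neighbour[OF e] by blast
 let ?w1 = "When (Equal (Read aM (Add (Var aBase) (Read 4 (Var aJ)))) (Const 3)) (Assign aS (Read 4 (Var aJ)))"
 have r1: "run (Row aJ 3 aU ?w1) \<mu> (%k \<nu>. k <= 4 * n + 2 & same {aJ, aS} \<mu> \<nu> & \<nu> aS 0 \<in> ?B & {u, \<nu> aS 0} \<in> H)"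
 proof (rule run_Row[where W = "{aJ, aS}" and dd = 4 and xss = rot and v = u and xs = "rot ! u" and C = 2 and
    P = "%m \<nu>. set (take m (rot ! u)) Int ?B ~= {} --> \<nu> aS 0 \<in> ?B & {u, \<nu> aS 0} \<in> H"])
  fix k \<nu> assume "same {aJ, aS} \<mu> \<nu>" "set (take (length (rot ! u)) (rot ! u)) Int ?B ~= {} --> \<nu> aS 0 \<in> ?B & {u, \<nu> aS 0} \<in> H"
   "k <= length (rot ! u) * (2 + 2) + 2"
  moreover have "s0 \<in> set (rot ! u) Int ?B" using s0 rot_row[OF d(2)] by simp
  ultimately show "k <= 4 * n + 2 & same {aJ, aS} \<mu> \<nu> & \<nu> aS 0 \<in> ?B & {u, \<nu> aS 0} \<in> H"
   using length_row(2)[OF d(2)] by auto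
 next
  fix m \<nu> assume m: "m < length (rot ! u)" and s: "same {aJ, aS} \<mu> \<nu>" "\<nu> 4 (\<nu> aJ 0) = rot ! u ! m"
   "set (take m (rot ! u)) Int ?B ~= {} --> \<nu> aS 0 \<in> ?B & {u, \<nu> aS 0} \<in> H"
  have ee: "\<nu> aBase 0 = b" "\<nu> aM = \<mu> aM" using sameD[OF s(1)] uv by auto
  have h: "{u, rot ! u ! m} \<in> H" using rot_row[OF d(2)] nth_mem[OF m] by simp
  have "rot ! u ! m < n" using H_link_ends[OF h] by simp
  then have "\<mu> aM (b + rot ! u ! m) = 3 \<longleftrightarrow> rot ! u ! m \<in> ?B" using M[of "rot ! u ! m"] by auto
  then show "run ?w1 \<nu> (%k \<nu>'. k <= 2 & same {aJ, aS} \<nu> \<nu>' & \<nu>' aJ 0 = \<nu> aJ 0 &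
    (set (take (Suc m) (rot ! u)) Int ?B ~= {} --> \<nu>' aS 0 \<in> ?B & {u, \<nu>' aS 0} \<in> H))"
   using s(2,3) m ee h by (auto simp: take_Suc_conv_app_nth)
 qed (use i d uv in "auto simp: input_def")
 show ?thesis
  unfolding decide_def
 proof (rule run_SeqI[OF r1], elim conjE)
  fix k1 \<nu>1 assume k1: "k1 <= 4 * n + 2" and sm1: "same {aJ, aS} \<mu> \<nu>1" and s: "\<nu>1 aS 0 \<in> ?B" "{u, \<nu>1 aS 0} \<in> H"
  let ?s = "\<nu>1 aS 0" let ?p = "\<nu>1 aPar ?s"
  have i1: "input \<nu>1" by (rule input_same[OF i sm1]) auto
  have par1: "\<nu>1 aPar = \<mu> aPar" "\<nu>1 aU 0 = u" using sameD[OF sm1] uv by auto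
  obtain q where q: "link_path H q" "hd q = ?s" "last q = v" "2 <= length q" "q ! 1 = ?p" "set (butlast q) \<subseteq> ?B"
   using par[OF s(1)] unfolding par1(1)[symmetric] by blast
  have sn: "?s < n" "?s ~= t" using s(1) sd by (auto simp: sideB_def)
  have q0: "q ! 0 = ?s" using q(2,4) by (cases q) auto
  have sp: "{?s, ?p} \<in> H" using link_pathD[OF q(1), of 0] q(4,5) q0 by simp
  \<comment> \<open>The parent is \<open>v\<close> or a far node, hence differs from
    \<open>u\<close>; otherwise the comparison of the two positions would decide nothing.\<close>
  have pu: "?p ~= u"
  proof (cases "length q = 2")
   case True
   have "last q = q ! (length q - 1)" using q(4) by (intro last_conv_nth) auto
   then have "?p = v" using True q(3,5) by simp
   with d show ?thesis by simp
  next
   case False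
   then have l: "1 < length (butlast q)" using q(4) by simp
   then have "butlast q ! 1 = ?p" using q(5) by (simp add: nth_butlast)
   then have "?p \<in> ?B" using nth_mem[OF l] q(6) by auto
   then show ?thesis using sd(4) by auto
  qed
  let ?x = "tab ! ?s" and ?m = "length (rot ! ?s)"
  note nb = None_block[OF sn]
  have ps: "distinct (\<pi> ?s None)" "set (\<pi> ?s None) = links_at H ?s" using row_pattern(4)[OF sn] by (auto simp: in_ports_def)
  have rk: "rank (\<pi> ?s None) {?s, ?x ! j} = j" if "j < ?m" for j
   using rank_nth[OF ps(1), of j] nb that by simp
  have occ: "\<exists>j<?m. ?x ! j = w" if "{?s, w} \<in> H" for w
  proof -
   have "{?s, w} \<in> set (\<pi> ?s None)" using that ps(2) by (simp add: links_at_def)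
   then obtain j where "j < ?m" "\<pi> ?s None ! j = {?s, w}" using nb(1) by (auto simp: in_set_conv_nth)
   then have "{?s, ?x ! j} = {?s, w}" using nb(2) by simp
   then show ?thesis using \<open>j < ?m\<close> H_link_ends[OF that] by (auto simp: doubleton_eq_iff)
  qed
  obtain ju where ju: "ju < ?m" "?x ! ju = u" using occ[of u] s(2) by (auto simp: insert_commute)
  obtain jp where jp: "jp < ?m" "?x ! jp = ?p" using occ[OF sp] by blast
  have rku: "rank (\<pi> ?s None) {?s, u} = ju" "rank (\<pi> ?s None) {?s, ?p} = jp" using rk[OF ju(1)] rk[OF jp(1)] ju jp by auto
  have uniq: "j = ju" if "j < ?m" "?x ! j = u" for j using rk[OF that(1)] that(2) rku by simp
  have uniqp: "j = jp" if "j < ?m" "?x ! j = ?p" for j using rk[OF that(1)] that(2) rku by simp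
  have neq: "ju ~= jp" using ju jp pu by auto
  let ?o = "off tab ?s"
  have cells: "\<nu> 5 ?s = ?o" "\<nu> 3 (Suc ?s) - \<nu> 3 ?s = ?m" "j < ?m ==> \<nu> 6 (?o + j) = ?x ! j" if "input \<nu>" for \<nu> j
   using that sn nb(2)[of j] off_Suc[of ?s rot] unfolding input_def stored_def by auto
  let ?\<nu> = "set_cell aDec 0 0 \<nu>1"
  let ?w2 = "When (Equal (Var aDec) (Const 0))
    (Cond (Equal (Read 6 (Var aJ)) (Var aU)) (Assign aDec (Const 1))
     (When (Equal (Read 6 (Var aJ)) (Read aPar (Var aS))) (Assign aDec (Const 2))))"
  have keep: "input \<nu>" "\<nu> aS 0 = ?s" "\<nu> aU 0 = u" "\<nu> aPar ?s = ?p" if "same {aJ, aDec} ?\<nu> \<nu>" for \<nu>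
  proof -
   have "same {aJ, aDec} \<nu>1 \<nu>" using that by simp
   then show "input \<nu>" by (rule input_same[OF i1]) auto
  qed (use sameD[OF that] par1 in auto)
  have "run (For aJ (Read 5 (Var aS)) (Add (Read 5 (Var aS)) (Sub (Read 3 (Add (Var aS) (Const 1))) (Read 3 (Var aS)))) ?w2) ?\<nu>
   (%k. ?T (k1 + (1 + k)))"
  proof (rule run_For[where W = "{aJ, aDec}" and a = ?o and b = "?o + ?m" and C = 4 and
     P = "%j \<nu>. \<nu> aDec 0 = (if j - ?o <= ju & j - ?o <= jp then 0 else if ju < jp then 1 else 2)"])
   fix j \<nu> assume j: "?o <= j" "j < ?o + ?m" and sm: "same {aJ, aDec} ?\<nu> \<nu>" and aj: "\<nu> aJ 0 = j"
    and P: "\<nu> aDec 0 = (if j - ?o <= ju & j - ?o <= jp then 0 else if ju < jp then 1 else 2)"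
   define i where "i = j - ?o"
   have im: "i < ?m" "j = ?o + i" using j by (auto simp: i_def)
   have c: "\<nu> 6 j = ?x ! i" using cells(3)[OF keep(1)[OF sm] im(1)] im by simp
   have P': "\<nu> aDec 0 = (if i <= ju & i <= jp then 0 else if ju < jp then 1 else 2)" using P by (simp add: i_def)
   have Si: "Suc j - ?o = Suc i" using im(2) by simp
   have xu: "?x ! i = u \<longleftrightarrow> i = ju" using uniq[OF im(1)] ju(2) by metis
   have xp: "?x ! i = ?p \<longleftrightarrow> i = jp" using uniqp[OF im(1)] jp(2) by metis
   show "run ?w2 \<nu> (%k \<nu>'. k <= 4 & same {aJ, aDec} \<nu> \<nu>' & \<nu>' aJ 0 = j &
    \<nu>' aDec 0 = (if Suc j - ?o <= ju & Suc j - ?o <= jp then 0 else if ju < jp then 1 else 2))"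
    unfolding Si using P' aj c keep(2-4)[OF sm] xu xp neq by (auto simp: Suc_le_eq)
  next
   fix k \<nu> assume sm: "same {aJ, aDec} ?\<nu> \<nu>" and k: "k <= (?o + ?m - ?o) * (4 + 2) + 2"
    and P: "\<nu> aDec 0 = (if ?o + ?m - ?o <= ju & ?o + ?m - ?o <= jp then 0 else if ju < jp then 1 else 2)"
   have "\<nu> aDec 0 = (if ju < jp then 1 else 2)" using P ju(1) by simp
   moreover have "ju < jp ==> wit v u" "~  ju < jp ==> wit u v"
    using wit_path[OF q s(2) e] rku neq by simp_all
   moreover have "k1 + (1 + k) <= 10 * n + 5" using k k1 length_row(2)[OF sn(1)] by simp
   moreover have "same {aJ, aS, aDec} \<mu> \<nu>" using sm sm1 by (auto simp: same_def)
   ultimately show "?T (k1 + (1 + k)) \<nu>" by auto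
  next
   fix \<nu> assume sm: "same {aJ, aDec} ?\<nu> \<nu>"
   show "aval (Add (Read 5 (Var aS)) (Sub (Read 3 (Add (Var aS) (Const 1))) (Read 3 (Var aS)))) \<nu> = ?o + ?m"
    using cells(1,2)[OF keep(1)[OF sm]] keep(2)[OF sm] by simp
  qed (use cells(1)[OF i1] in auto)
  then show "run (Seq (Assign aDec (Const 0)) (For aJ (Read 5 (Var aS)) (Add (Read 5 (Var aS)) (Sub (Read 3 (Add (Var aS) (Const 1))) (Read 3 (Var aS)))) ?w2)) \<nu>1
    (%k. ?T (k1 + k))" by (simp only: run_Seq run_Write aval.simps)
 qed
qed

end

definition arcs_of :: "('b \<times> 'b) list => ('b \<times> 'b) list" where
 "arcs_of ps = concat (map (%p. [p, prod.swap p]) ps)"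

lemma length_arcs_of [simp]: "length (arcs_of ps) = length ps + length ps"
 by (induction ps) (simp_all add: arcs_of_def)

lemma nth_arcs_of: "i < length ps ==> arcs_of ps ! (i + i) = ps ! i & arcs_of ps ! Suc (i + i) = prod.swap (ps ! i)"
proof (induction ps arbitrary: i)
 case (Cons p ps)
 then show ?case by (cases i) (simp_all add: arcs_of_def)
qed simp

lemma set_arcs_of: "set (arcs_of ps) = set ps Un prod.swap ` set ps"
 by (induction ps) (auto simp: arcs_of_def)

lemma distinct_arcs_of:
 fixes ps :: "(nat \<times> nat) list"
 shows "distinct ps ==> (!!x y. (x, y) \<in> set ps ==> x < y) ==> distinct (arcs_of ps)"
proof (induction ps)
 case (Cons p ps)
 obtain x y where p: "p = (x, y)" by force
 have lt: "a < b" if "(a, b) \<in> set ps" for a b using Cons.prems(2) that by simp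
 have "x < y" using Cons.prems(2)[of x y] p by simp
 then have "(x, y) \<notin> set (arcs_of ps)" "(y, x) \<notin> set (arcs_of ps)"
  using Cons.prems(1) p lt[of y x] by (auto simp: set_arcs_of dest: lt)
 moreover have "distinct (arcs_of ps)" using Cons by simp
 moreover have "arcs_of (p # ps) = (x, y) # (y, x) # arcs_of ps" by (simp add: arcs_of_def p)
 ultimately show ?case using \<open>x < y\<close> by simp
qed (simp add: arcs_of_def)

lemma arc_index: "d < m + m ==> \<exists>i<m. d = i + i | d = Suc (i + i)" for d m :: nat
 by presburger

definition prepare :: com where
 "prepare = Seq collect (For aH (Const 0) (Var aP) handle)"

context routing_input
begin

text \<open>Link \<open>i\<close> owns the cells from \<open>i * n\<close> of the marks and two arc
  indices, so what holds after its round is untouched by later rounds.\<close>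

definition handled :: "nat => nat => nat => store => bool" where
 "handled i u v \<mu> \<longleftrightarrow>
  (\<forall>w<n. \<mu> aM (i * n + w) = (if w \<in> sideB {u, v} then 3 else if w \<in> {u, v} then 2 else 1)) &
  \<mu> aMo (i + i) = i * n & \<mu> aMo (Suc (i + i)) = i * n &
  \<mu> aSize (i + i) = card (sideA {u, v}) & \<mu> aSize (Suc (i + i)) = card (sideA {u, v}) &
  ends_spec \<mu> (i + i) u v & ends_spec \<mu> (Suc (i + i)) v u &
  (\<mu> aYc (i + i) = 0 & \<mu> aYc (Suc (i + i)) = 1 & wit v u | \<mu> aYc (i + i) = 1 & \<mu> aYc (Suc (i + i)) = 0 & wit u v)"

lemma ends_spec_cong: "ends_spec \<mu> d z v ==> \<nu> aAl d = \<mu> aAl d ==> \<nu> aBl d = \<mu> aBl d ==> ends_spec \<nu> d z v"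
 by (simp only: ends_spec_def)

lemma handled_cong:
 assumes "handled i u v \<mu>" "!!w. w < n ==> \<nu> aM (i * n + w) = \<mu> aM (i * n + w)"
  "!!A. A \<in> {aMo, aSize, aYc, aAl, aBl} ==> \<nu> A (i + i) = \<mu> A (i + i) & \<nu> A (Suc (i + i)) = \<mu> A (Suc (i + i))"
 shows "handled i u v \<nu>"
proof -
 have "ends_spec \<nu> (i + i) u v" "ends_spec \<nu> (Suc (i + i)) v u"
  using assms(1) assms(3)[of aAl] assms(3)[of aBl] unfolding handled_def
  by (auto intro: ends_spec_cong[of \<mu>])
 then show ?thesis
  using assms(1,2) assms(3)[of aMo] assms(3)[of aSize] assms(3)[of aYc] by (simp add: handled_def)
qed

abbreviation "handleW \<equiv> {aU, aV, aMark, aRoot, aCnt, aS, aDec, aZ, aD, aPrev, aBase, aMo, aSize, aYc, aAl, aBl} Un searchW"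

lemma run_handle:
 assumes i: "input \<mu>" and e: "{u, v} \<in> S0" and ci: "\<mu> aSrc (i + i) = u" "\<mu> aDst (i + i) = v"
  and s: "\<mu> aH 0 = i" "\<mu> aBase 0 = i * n" and M: "!!a. i * n <= a ==> \<mu> aM a = 0"
 shows "run handle \<mu> (%k \<nu>. k <= 628 * n + 60 & same handleW \<mu> \<nu> & \<nu> aBase 0 = Suc i * n & handled i u v \<nu> &
  (\<forall>a. a < i * n | Suc i * n <= a --> \<nu> aM a = \<mu> aM a) &
  (\<forall>A\<in>{aMo, aSize, aYc, aAl, aBl}. \<forall>d. d ~= i + i --> d ~= Suc (i + i) --> \<nu> A d = \<mu> A d))"
  (is "run _ _ ?T")
proof -
 have e': "{v, u} \<in> S0" using e by (simp add: insert_commute)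
 let ?b = "i * n"
 show ?thesis
  unfolding handle_def
 proof (rule run_SeqI[where P = "%k \<nu>. k = 2 & same {aU, aV} \<mu> \<nu> & \<nu> aU 0 = u & \<nu> aV 0 = v"], goal_cases)
  case 1
  show ?case using ci s by simp
 next
  case (2 k1 \<nu>1)
  then have s1: "same {aU, aV} \<mu> \<nu>1" and v1: "\<nu>1 aU 0 = u" "\<nu>1 aV 0 = v" and k1: "k1 = 2" by auto
  have i1: "input \<nu>1" by (rule input_same[OF i s1]) auto
  have b1: "\<nu>1 aBase 0 = ?b" "\<nu>1 aH 0 = i" "\<nu>1 aM = \<mu> aM" using sameD[OF s1] s by auto
  show ?case
  proof (rule run_SeqI[OF run_near_marks[OF i1 e v1 b1(1)]], goal_cases)
   case (1 w) with M b1 show ?case by simp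
  next
   case (2 k2 \<nu>2)
   then have s2: "same ({aMark, aRoot} Un searchW) \<nu>1 \<nu>2" and k2: "k2 <= 295 * n + 9" and t2: "\<nu>2 aTail 0 = card (sideA {u, v})"
    and M2: "!!w. w < n ==> \<nu>2 aM (?b + w) = (if w \<in> sideA {u, v} then 1 else if w \<in> {u, v} then 2 else 0)"
    and O2: "!!a. a < ?b | ?b + n <= a ==> \<nu>2 aM a = \<nu>1 aM a" by auto
   have i2: "input \<nu>2" by (rule input_same[OF i1 s2]) auto
   have b2: "\<nu>2 aBase 0 = ?b" "\<nu>2 aH 0 = i" "\<nu>2 aU 0 = u" "\<nu>2 aV 0 = v" using sameD[OF s2] b1 v1 by auto
   show ?case
   proof (rule run_SeqI[OF run_far_marks[OF i2 e b2(4) b2(1) M2]], assumption, goal_cases)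
    case (1 k3 \<nu>3)
    then have s3: "same ({aCnt, aMark, aRoot} Un searchW) \<nu>2 \<nu>3" and k3: "k3 <= 295 * n + 9" and t3: "\<nu>3 aCnt 0 = \<nu>2 aTail 0"
     and M3: "!!w. w < n ==> \<nu>3 aM (?b + w) = (if w \<in> sideB {u, v} then 3 else if w \<in> {u, v} then 2 else 1)"
     and O3: "!!a. a < ?b | ?b + n <= a ==> \<nu>3 aM a = \<nu>2 aM a"
     and P3: "!!w. w \<in> sideB {u, v} ==> \<exists>q. link_path H q & hd q = w & last q = v & 2 <= length q &
      q ! 1 = \<nu>3 aPar w & set (butlast q) \<subseteq> sideB {u, v}" by auto
    have i3: "input \<nu>3" by (rule input_same[OF i2 s3]) auto
    have b3: "\<nu>3 aBase 0 = ?b" "\<nu>3 aH 0 = i" "\<nu>3 aU 0 = u" "\<nu>3 aV 0 = v" using sameD[OF s3] b2 by auto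
    show ?case
    proof (rule run_SeqI[OF run_decide[OF i3 e b3(3) b3(1) M3 P3]], assumption, assumption, goal_cases)
     case (1 k4 \<nu>4)
     then have s4: "same {aJ, aS, aDec} \<nu>3 \<nu>4" and k4: "k4 <= 10 * n + 5"
      and dec: "\<nu>4 aDec 0 = 1 & wit v u | \<nu>4 aDec 0 = 2 & wit u v" by auto
     have i4: "input \<nu>4" by (rule input_same[OF i3 s4]) auto
     have b4: "\<nu>4 aBase 0 = ?b" "\<nu>4 aH 0 = i" "\<nu>4 aU 0 = u" "\<nu>4 aV 0 = v" "\<nu>4 aCnt 0 = card (sideA {u, v})" "\<nu>4 aM = \<nu>3 aM"
      using sameD[OF s4] b3 t2 t3 by auto
     have sm4: "same handleW \<mu> \<nu>4" using s1 s2 s3 s4 by (auto simp: same_def)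
     show ?case
     proof (rule run_SeqI[where P = "%k \<nu>. k = 6 & same {aMo, aSize, aYc} \<nu>4 \<nu> & \<nu> aMo = (\<nu>4 aMo)(i + i := ?b, Suc (i + i) := ?b) &
       \<nu> aSize = (\<nu>4 aSize)(i + i := card (sideA {u, v}), Suc (i + i) := card (sideA {u, v})) &
       \<nu> aYc = (\<nu>4 aYc)(i + i := \<nu>4 aDec 0 - 1, Suc (i + i) := 2 - \<nu>4 aDec 0)"], goal_cases)
      case 1
      show ?case unfolding arcs_def using b4 by simp
     next
      case (2 k5 \<nu>5)
      then have s5: "same {aMo, aSize, aYc} \<nu>4 \<nu>5" and k5: "k5 = 6" and a5: "\<nu>5 aMo = (\<nu>4 aMo)(i + i := ?b, Suc (i + i) := ?b)"
       "\<nu>5 aSize = (\<nu>4 aSize)(i + i := card (sideA {u, v}), Suc (i + i) := card (sideA {u, v}))"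
       "\<nu>5 aYc = (\<nu>4 aYc)(i + i := \<nu>4 aDec 0 - 1, Suc (i + i) := 2 - \<nu>4 aDec 0)" by auto
      have b5: "\<nu>5 aBase 0 = ?b" "\<nu>5 aH 0 = i" "\<nu>5 aU 0 = u" "\<nu>5 aV 0 = v" "\<nu>5 aM = \<nu>3 aM" using sameD[OF s5] b4 by auto
      show ?case
      proof (rule run_SeqI[where P = "%k \<nu>. k = 2 & same {aZ, aD} \<nu>5 \<nu> & \<nu> aZ 0 = u & \<nu> aD 0 = i + i"], goal_cases)
       case 1
       show ?case using b5 by simp
      next
       case (2 k6 \<nu>6)
       then have s6: "same {aZ, aD} \<nu>5 \<nu>6" and k6: "k6 = 2" and v6: "\<nu>6 aZ 0 = u" "\<nu>6 aD 0 = i + i" by auto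
       have b6: "\<nu>6 aBase 0 = ?b" "\<nu>6 aH 0 = i" "\<nu>6 aV 0 = v" "\<nu>6 aM = \<nu>3 aM" using sameD[OF s6] b5 by auto
       have sm6: "same handleW \<mu> \<nu>6" using sm4 s5 s6 by (auto simp: same_def)
       have i6: "input \<nu>6" by (rule input_same[OF i sm6]) auto
       show ?case
       proof (rule run_SeqI[OF run_endpoint[OF i6 e v6 b6(1)]], goal_cases)
        case (1 w) then show ?case unfolding b6(4) by (rule M3)
       next
        case (2 k7 \<nu>7)
        then have s7: "same {aJ, aPrev, aAl, aBl} \<nu>6 \<nu>7" and k7: "k7 <= 14 * n + 6"
         and a7: "!!d. d ~= i + i ==> \<nu>7 aAl d = \<nu>6 aAl d & \<nu>7 aBl d = \<nu>6 aBl d" and e7: "ends_spec \<nu>7 (i + i) u v" by auto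
        have b7: "\<nu>7 aBase 0 = ?b" "\<nu>7 aH 0 = i" "\<nu>7 aV 0 = v" "\<nu>7 aM = \<nu>3 aM" using sameD[OF s7] b6 by auto
        show ?case
        proof (rule run_SeqI[where P = "%k \<nu>. k = 2 & same {aZ, aD} \<nu>7 \<nu> & \<nu> aZ 0 = v & \<nu> aD 0 = Suc (i + i)"], goal_cases)
         case 1
         show ?case using b7 by simp
        next
         case (2 k8 \<nu>8)
         then have s8: "same {aZ, aD} \<nu>7 \<nu>8" and k8: "k8 = 2" and v8: "\<nu>8 aZ 0 = v" "\<nu>8 aD 0 = Suc (i + i)" by auto
         have b8: "\<nu>8 aBase 0 = ?b" "\<nu>8 aM = \<nu>3 aM" using sameD[OF s8] b7 by auto
         have sm8: "same handleW \<mu> \<nu>8" using sm6 s7 s8 by (auto simp: same_def)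
         have i8: "input \<nu>8" by (rule input_same[OF i sm8]) auto
         show ?case
         proof (rule run_SeqI[OF run_endpoint[OF i8 e' v8 b8(1)]], goal_cases)
          case (1 w) then show ?case unfolding b8(2) using M3[of w] by (simp add: insert_commute conj_commute disj_commute)
         next
          case (2 k9 \<nu>9)
          then have s9: "same {aJ, aPrev, aAl, aBl} \<nu>8 \<nu>9" and k9: "k9 <= 14 * n + 6"
           and a9: "!!d. d ~= Suc (i + i) ==> \<nu>9 aAl d = \<nu>8 aAl d & \<nu>9 aBl d = \<nu>8 aBl d" and e9: "ends_spec \<nu>9 (Suc (i + i)) v u" by auto
          have sm9: "same handleW \<mu> \<nu>9" using sm8 s9 by (auto simp: same_def)
          have n9: "\<nu>9 0 0 = n" using sameD[OF sm9, of 0] i by (simp add: input_def)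
          have A: "\<nu>9 aMo = \<nu>5 aMo" "\<nu>9 aSize = \<nu>5 aSize" "\<nu>9 aYc = \<nu>5 aYc" "\<nu>9 aM = \<nu>3 aM" "\<nu>9 aBase 0 = ?b"
           "\<nu>8 aAl = \<nu>7 aAl" "\<nu>8 aBl = \<nu>7 aBl" "\<nu>6 aAl = \<mu> aAl" "\<nu>6 aBl = \<mu> aBl"
           "\<nu>4 aMo = \<mu> aMo" "\<nu>4 aSize = \<mu> aSize" "\<nu>4 aYc = \<mu> aYc"
           using s1 s2 s3 s4 s5 s6 s7 s8 s9 b8 by (simp_all add: same_def)
          let ?\<nu> = "set_cell aBase 0 (Suc i * n) \<nu>9"
          have "ends_spec ?\<nu> (i + i) u v"
           by (rule ends_spec_cong[OF e7]) (use a9[of "i + i"] A(6,7) in simp_all)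
          moreover have "ends_spec ?\<nu> (Suc (i + i)) v u" by (rule ends_spec_cong[OF e9]) simp_all
          ultimately have f4: "handled i u v ?\<nu>" unfolding handled_def using M3 dec by (auto simp: A a5)
          have f5: "\<forall>a. a < ?b | Suc i * n <= a --> ?\<nu> aM a = \<mu> aM a"
           using O2 O3 by (simp add: A b1(3) add.commute)
          have f6: "\<forall>A\<in>{aMo, aSize, aYc, aAl, aBl}. \<forall>d. d ~= i + i --> d ~= Suc (i + i) --> ?\<nu> A d = \<mu> A d"
           using a7 a9 by (simp add: A a5)
          have f2: "same handleW \<mu> ?\<nu>" using sm9 by simp
          have f1: "k1 + (k2 + (k3 + (k4 + (k5 + (k6 + (k7 + (k8 + (k9 + 1)))))))) <= 628 * n + 60"
           using k1 k2 k3 k4 k5 k6 k7 k8 k9 by linarith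
          have f3: "?\<nu> aBase 0 = Suc i * n" by simp
          have eq: "set_cell aBase (aval (Const 0) \<nu>9) (aval (Add (Var aBase) (Var 0)) \<nu>9) \<nu>9 = ?\<nu>"
           using A(5) n9 by (simp add: add.commute)
          show ?case unfolding run_Write eq by (intro conjI f1 f2 f3 f4 f5 f6)
         qed
        qed
       qed
      qed
     qed
    qed
   qed
  qed
 qed
qed

lemma length_pairs:
 assumes "distinct ps" "set ps = {(x, y). x < y & {x, y} \<in> S0}"
 shows "length ps <= n"
proof -
 have "inj_on (%(x, y). {x, y}) (set ps)" using assms(2) by (auto simp: inj_on_def doubleton_eq_iff)
 then have "card (set ps) = card ((%(x, y). {x, y}) ` set ps)" by (simp add: card_image)
 also have "\<dots> <= card S0"
  using assms(2) S0_E by (intro card_mono) (auto intro: finite_subset[OF _ finite_E])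
 also have "\<dots> <= n" using card_S0 by simp
 finally show ?thesis using assms(1) by (simp add: distinct_card)
qed

lemma run_prepare:
 assumes i: "input \<mu>" and z: "!!a. 7 <= a ==> \<mu> a = (%_. 0)"
 shows "run prepare \<mu> (%k \<nu>. k <= 800 * n\<^sup>2 + 700 * n + 10 & same (insert aH (collectW Un handleW)) \<mu> \<nu> &
  (\<exists>ps. collected ps \<nu> & distinct ps & set ps = {(x, y). x < y & {x, y} \<in> S0} &
   (\<forall>i<length ps. handled i (fst (ps ! i)) (snd (ps ! i)) \<nu>)))"
 unfolding prepare_def
proof (rule run_SeqI[OF run_collect[OF i]], goal_cases)
 case 1
 show ?case using z[of aP] by simp
next
 case (2 k1 \<nu>1)
 then obtain ps where s1: "same collectW \<mu> \<nu>1" and k1: "k1 <= 36 * n * (4 * n + 14) + 5 * n + 3"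
  and ps: "collected ps \<nu>1" "distinct ps" "set ps = {(x, y). x < y & {x, y} \<in> S0}" by blast
 have i1: "input \<nu>1" by (rule input_same[OF i s1]) auto
 have z1: "\<nu>1 a = (%_. 0)" if "a \<notin> collectW" "7 <= a" for a using z[OF that(2)] sameD[OF s1 that(1)] by simp
 show ?case
 proof (rule run_For[where W = "insert aH handleW" and a = 0 and b = "length ps" and C = "628 * n + 60" and
   P = "%i \<nu>. \<nu> aBase 0 = i * n & (\<forall>a\<ge>i * n. \<nu> aM a = 0) & (\<forall>j<i. handled j (fst (ps ! j)) (snd (ps ! j)) \<nu>)"], goal_cases)
  case (4 \<nu>)
  with sameD[OF 4, of aP] ps(1) show ?case by (simp add: collected_def)
 next
  case (5 j \<nu> x)
  then show ?case by (auto intro: handled_cong)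
 next
  case 6
  with z1[of aM] z1[of aBase] show ?case by simp
 next
  case (7 i \<nu>)
  then have ip: "i < length ps" and sm: "same (insert aH handleW) \<nu>1 \<nu>" and aH: "\<nu> aH 0 = i"
   and P: "\<nu> aBase 0 = i * n" "!!a. i * n <= a ==> \<nu> aM a = 0" "!!j. j < i ==> handled j (fst (ps ! j)) (snd (ps ! j)) \<nu>" by auto
  obtain u v where uv: "ps ! i = (u, v)" by force
  have it: "input \<nu>" by (rule input_same[OF i1 sm]) auto
  have e: "{u, v} \<in> S0" using nth_mem[OF ip] ps(3) uv by auto
  have ci: "\<nu> aSrc (i + i) = u" "\<nu> aDst (i + i) = v" using sameD[OF sm] ps(1) ip uv by (auto simp: collected_def)
  show ?case
  proof (rule run_mono[OF run_handle[OF it e ci aH P(1,2)]], assumption, elim conjE, intro conjI, goal_cases)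
   case (2 k \<nu>')
   then show ?case by (auto simp: same_def)
  next
   case (3 k \<nu>')
   with sameD[OF 3(2), of aH] aH show ?case by simp
  next
   case (5 k \<nu>')
   show ?case
   proof (intro allI impI)
    fix a assume "Suc i * n <= a"
    then show "\<nu>' aM a = 0" using 5(5) P(2)[of a] by simp
   qed
  next
   case (6 k \<nu>')
   show ?case
   proof (intro allI impI)
    fix j assume "j < Suc i"
    then consider "j = i" | "j < i" by linarith
    then show "handled j (fst (ps ! j)) (snd (ps ! j)) \<nu>'"
    proof cases
     case 1
     with 6(4) uv show ?thesis by simp
    next
     case 2
     show ?thesis
     proof (rule handled_cong[OF P(3)[OF 2]])
      fix w assume w: "w < n"
      have "Suc j * n <= i * n" using 2 by (intro mult_le_mono1) simp
      then have "j * n + w < i * n" using w by simp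
      then show "\<nu>' aM (j * n + w) = \<nu> aM (j * n + w)" using 6(5) by blast
     next
      fix A assume A: "A \<in> {aMo, aSize, aYc, aAl, aBl}"
      have "j + j ~= i + i" "j + j ~= Suc (i + i)" "Suc (j + j) ~= i + i" "Suc (j + j) ~= Suc (i + i)" using 2 by presburger+
      then show "\<nu>' A (j + j) = \<nu> A (j + j) & \<nu>' A (Suc (j + j)) = \<nu> A (Suc (j + j))" using bspec[OF 6(6) A] by blast
     qed
    qed
   qed
  qed
 next
  case (8 k \<nu>)
  have "collected ps \<nu>" by (rule collected_cong[OF ps(1)]) (use sameD[OF 8(1)] in auto)
  moreover have "same (insert aH (collectW Un handleW)) \<mu> \<nu>" using s1 8(1) by (auto simp: same_def)
  moreover have "k1 + k <= 800 * n\<^sup>2 + 700 * n + 10"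
  proof -
   have "length ps * (628 * n + 60 + 2) <= n * (628 * n + 60 + 2)" using length_pairs[OF ps(2,3)] by (rule mult_le_mono1)
   then have "k <= 628 * n\<^sup>2 + 62 * n + 2" using 8(3) by (simp add: power2_eq_square algebra_simps)
   moreover have "k1 <= 144 * n\<^sup>2 + 509 * n + 3" using k1 by (simp add: power2_eq_square algebra_simps)
   ultimately show ?thesis by linarith
  qed
  ultimately show ?case using ps(2,3) 8(2) by blast
 qed simp_all
qed

text \<open>Restates the memory in terms of functions of the two ends, which is the form required by
  the definition of keys; only mark 3 is still consulted.\<close>

definition arc_tables :: "(nat \<times> nat) list => (nat => nat => nat) => (nat => nat => nat) => (nat => nat => bool) => store => bool" where
 "arc_tables as al bl Y \<mu> \<longleftrightarrow> \<mu> aP 0 + \<mu> aP 0 = length as & (\<forall>d<length as. \<forall>x y. as ! d = (x, y) -->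
  \<mu> aSrc d = x & \<mu> aDst d = y & \<mu> aAl d = al x y & \<mu> aBl d = (if front R x y then n else bl x y) &
  \<mu> aYc d = (if Y x y then 1 else 0) & \<mu> aSize d = card (sideA {x, y}) &
  (\<forall>w<n. \<mu> aM (\<mu> aMo d + w) = 3 \<longleftrightarrow> w \<in> sideB {x, y}))"

lemma arc_tables_cong:
 "arc_tables as al bl Y \<mu> ==> same W \<mu> \<nu> ==> W Int {aP, aSrc, aDst, aAl, aBl, aYc, aSize, aMo, aM} = {} ==> arc_tables as al bl Y \<nu>"
proof -
 assume *: "arc_tables as al bl Y \<mu>" "same W \<mu> \<nu>" "W Int {aP, aSrc, aDst, aAl, aBl, aYc, aSize, aMo, aM} = {}"
 have "\<nu> a = \<mu> a" if "a \<in> {aP, aSrc, aDst, aAl, aBl, aYc, aSize, aMo, aM}" for a using *(2,3) that by (auto simp: same_def)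
 with *(1) show ?thesis by (simp add: arc_tables_def)
qed

definition arc_choice :: "(nat => nat => nat) => (nat => nat => nat) => (nat => nat => bool) => bool" where
 "arc_choice al bl Y \<longleftrightarrow>
  (\<forall>u v. {u, v} \<in> S0 --> ~  front R u v -->
   (\<exists>xs ys As Bs. R u = xs @ ys & ys @ xs = As @ Bs & As ~= [] & Bs ~= [] &
    set As \<subseteq> sideA {u, v} & set Bs \<subseteq> sideB {u, v} & al u v = last As & bl u v = last Bs)) &
  (\<forall>e\<in>S0. \<exists>x y. e = {x, y} & ~  Y x y & Y y x & wit y x)"

text \<open>The functions \<open>al\<close>, \<open>bl\<close> and \<open>Y\<close> are read off the
  final memory through the index of the ordered pair in the list of arcs.\<close>

lemma arc_tables_of_handled:
 assumes ps: "collected ps \<mu>" "distinct ps" "set ps = {(x, y). x < y & {x, y} \<in> S0}"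
  and h: "!!i. i < length ps ==> handled i (fst (ps ! i)) (snd (ps ! i)) \<mu>"
 shows "\<exists>as al bl Y. distinct as & set as = {(x, y). {x, y} \<in> S0} & length as <= n + n & arc_tables as al bl Y \<mu> & arc_choice al bl Y"
proof -
 define as where "as = arcs_of ps"
 define ix where "ix x y = rank as (x, y)" for x y
 define al where "al x y = \<mu> aAl (ix x y)" for x y
 define bl where "bl x y = \<mu> aBl (ix x y)" for x y
 define Y where "Y x y \<longleftrightarrow> \<mu> aYc (ix x y) = 1" for x y
 have d: "distinct as" unfolding as_def by (rule distinct_arcs_of[OF ps(2)]) (use ps(3) in auto)
 have sas: "set as = {(x, y). {x, y} \<in> S0}"
 proof -
  have "(x, y) \<in> set as \<longleftrightarrow> {x, y} \<in> S0" for x y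
  proof -
   have "(x, y) \<in> set as \<longleftrightarrow> (x, y) \<in> set ps | (y, x) \<in> set ps" by (force simp: as_def set_arcs_of)
   then show ?thesis using ps(3) S0_D[of x y] by (auto simp: insert_commute)
  qed
  then show ?thesis by auto
 qed
 have len: "length as = length ps + length ps" by (simp add: as_def)
 have nth: "as ! (i + i) = ps ! i" "as ! Suc (i + i) = prod.swap (ps ! i)" if "i < length ps" for i
  using nth_arcs_of[OF that] by (simp_all add: as_def)
 have ix: "ix x y = d" if "d < length as" "as ! d = (x, y)" for d x y
  using rank_nth[OF d that(1)] that(2) by (simp add: ix_def)
 have main: "\<mu> aSrc d = x & \<mu> aDst d = y & ends_spec \<mu> d x y & (\<mu> aYc d = 0 | \<mu> aYc d = 1) & \<mu> aSize d = card (sideA {x, y}) &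
  (\<forall>w<n. \<mu> aM (\<mu> aMo d + w) = 3 \<longleftrightarrow> w \<in> sideB {x, y})" if dl: "d < length as" and xy: "as ! d = (x, y)" for d x y
 proof -
  obtain i where i: "i < length ps" "d = i + i | d = Suc (i + i)" using arc_index dl len by metis
  have c: "\<mu> aSrc (i + i) = fst (ps ! i)" "\<mu> aDst (i + i) = snd (ps ! i)" "\<mu> aSrc (Suc (i + i)) = snd (ps ! i)" "\<mu> aDst (Suc (i + i)) = fst (ps ! i)"
   using ps(1) i(1) by (auto simp: collected_def)
  show ?thesis
  proof (cases "d = i + i")
   case True
   then have "ps ! i = (x, y)" using xy nth[OF i(1)] by simp
   then show ?thesis using c h[OF i(1)] unfolding handled_def True by auto
  next
   case False
   then have d': "d = Suc (i + i)" using i(2) by simp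
   have "prod.swap (ps ! i) = (x, y)" using xy nth[OF i(1)] d' by simp
   then have "ps ! i = (y, x)" by (metis prod.swap_def fst_conv snd_conv swap_swap)
   then show ?thesis using c h[OF i(1)] unfolding handled_def d' by (auto simp: insert_commute)
  qed
 qed
 have "arc_tables as al bl Y \<mu>"
  unfolding arc_tables_def
 proof (intro conjI allI impI)
  show "\<mu> aP 0 + \<mu> aP 0 = length as" using ps(1) len by (simp add: collected_def)
  fix d x y assume *: "d < length as" "as ! d = (x, y)"
  note m = main[OF *] and ixd = ix[OF *]
  show "\<mu> aSrc d = x" "\<mu> aDst d = y" "\<mu> aSize d = card (sideA {x, y})" using m by auto
  show "\<mu> aAl d = al x y" by (simp add: al_def ixd)
  show "\<mu> aBl d = (if front R x y then n else bl x y)" using m by (simp add: bl_def ixd ends_spec_def)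
  show "\<mu> aYc d = (if Y x y then 1 else 0)" using m by (auto simp: Y_def ixd)
  show "(\<mu> aM (\<mu> aMo d + w) = 3) = (w \<in> sideB {x, y})" if "w < n" for w using m that by blast
 qed
 moreover have "arc_choice al bl Y"
  unfolding arc_choice_def
 proof (intro conjI allI impI ballI)
  fix u v assume "{u, v} \<in> S0" and nf: "~  front R u v"
  then have "(u, v) \<in> set as" using sas by simp
  then obtain d where *: "d < length as" "as ! d = (u, v)" by (auto simp: in_set_conv_nth)
  show "\<exists>xs ys As Bs. R u = xs @ ys & ys @ xs = As @ Bs & As ~= [] & Bs ~= [] &
    set As \<subseteq> sideA {u, v} & set Bs \<subseteq> sideB {u, v} & al u v = last As & bl u v = last Bs"
   using main[OF *] nf unfolding ends_spec_def al_def bl_def ix[OF *] by simp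
 next
  fix e assume e: "e \<in> S0"
  obtain u v where "u ~= v" "e = {u, v}" using linkE[OF S0_E[OF e]] by metis
  then obtain x y where xy: "x < y" "e = {x, y}" by (metis insert_commute nat_neq_iff)
  then have "(x, y) \<in> set ps" using ps(3) e by simp
  then obtain i where i: "i < length ps" "ps ! i = (x, y)" by (auto simp: in_set_conv_nth)
  have "ix x y = i + i" "ix y x = Suc (i + i)" using ix[of "i + i"] ix[of "Suc (i + i)"] nth[OF i(1)] i len by auto
  then have "(~  Y x y & Y y x & wit y x) | (~  Y y x & Y x y & wit x y)"
   using h[OF i(1)] i(2) unfolding handled_def Y_def by auto
  then show "\<exists>x y. e = {x, y} & ~  Y x y & Y y x & wit y x" using xy(2) by (metis insert_commute)
 qed
 ultimately show ?thesis using d sas len length_pairs[OF ps(2,3)] by (intro exI[of _ as]) auto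
qed

end

section \<open>Sorting the separating links by the sizes of their sides\<close>

abbreviation "aL \<equiv> 28 :: nat"
abbreviation "aOrd \<equiv> 50 :: nat"
abbreviation Arcs :: aexp where "Arcs \<equiv> Add (Var aP) (Var aP)"

text \<open>Round \<open>i\<close> collects the arcs with near size \<open>n - i\<close>, so far
  sides increase. Near sides contain \<open>t\<close>, hence \<open>n\<close> rounds reach all
  sizes; with at most \<open>2 * n\<close> arcs this naive sort is quadratic.\<close>

definition order :: com where
 "order = Seq (Assign aL (Const 0)) (For aI (Const 0) (Var 0)
  (For aJ (Const 0) Arcs (When (Equal (Add (Read aSize (Var aJ)) (Var aI)) (Var 0))
   (Seq (Write aOrd (Var aL) (Var aJ)) (Assign aL (Add (Var aL) (Const 1)))))))"

lemma run_order:
 assumes m: "\<mu> aP 0 + \<mu> aP 0 = m" "\<mu> 0 0 = n" "m <= n + n" and f: "!!d. d < m ==> 0 < \<mu> aSize d & \<mu> aSize d <= n"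
 shows "run order \<mu> (%k \<nu>. k <= 12 * n\<^sup>2 + 4 * n + 3 & same {aI, aJ, aL, aOrd} \<mu> \<nu> &
  (\<exists>os. distinct os & set os = {..<m} & sorted_wrt (%d d'. \<mu> aSize d' <= \<mu> aSize d) os & (\<forall>k<m. \<nu> aOrd k = os ! k)))"
proof -
 define inv where "inv D os \<nu> \<longleftrightarrow> distinct os & set os = D & sorted_wrt (%d d'. \<mu> aSize d' <= \<mu> aSize d) os &
  \<nu> aL 0 = length os & (\<forall>k<length os. \<nu> aOrd k = os ! k)" for D os and \<nu> :: store
 have frame: "inv D os \<nu> ==> inv D os (set_cell i 0 x \<nu>)" if "i \<notin> {aL, aOrd}" for D os \<nu> i x
  using that by (auto simp: inv_def)
 let ?D = "%z. {d. d < m & n < \<mu> aSize d + z}"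
 let ?\<mu> = "set_cell aL 0 0 \<mu>"
 let ?w = "When (Equal (Add (Read aSize (Var aJ)) (Var aI)) (Var 0))
   (Seq (Write aOrd (Var aL) (Var aJ)) (Assign aL (Add (Var aL) (Const 1))))"
 have "run (For aI (Const 0) (Var 0) (For aJ (Const 0) Arcs ?w)) ?\<mu> (%k \<nu>. 1 + k <= 12 * n\<^sup>2 + 4 * n + 3 & same {aI, aJ, aL, aOrd} \<mu> \<nu> &
  (\<exists>os. distinct os & set os = {..<m} & sorted_wrt (%d d'. \<mu> aSize d' <= \<mu> aSize d) os & (\<forall>k<m. \<nu> aOrd k = os ! k)))"
 proof (rule run_For[where W = "{aI, aJ, aL, aOrd}" and a = 0 and b = n and C = "12 * n + 2" and P = "%z \<nu>. \<exists>os. inv (?D z) os \<nu>"])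
  have "?D 0 = {}" using f by force
  then have "inv (?D 0) [] ?\<mu>" by (simp add: inv_def)
  then show "\<exists>os. inv (?D 0) os ?\<mu>" by blast
  show "aval (Var 0) \<nu> = n" if "same {aI, aJ, aL, aOrd} ?\<mu> \<nu>" for \<nu> using sameD[OF that, of 0] m by simp
  show "\<exists>os. inv (?D z) os (set_cell aI 0 x \<nu>)" if "\<exists>os. inv (?D z) os \<nu>" for z \<nu> x
  proof -
   from that obtain os where "inv (?D z) os \<nu>" ..
   from frame[OF _ this, of aI x] show ?thesis by (intro exI) simp
  qed
  fix z \<nu> assume z: "z < n" and s: "same {aI, aJ, aL, aOrd} ?\<mu> \<nu>" and ai: "\<nu> aI 0 = z" and "\<exists>os. inv (?D z) os \<nu>"
  then obtain os where os: "inv (?D z) os \<nu>" by blast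
  let ?I = "%j. ?D z Un {d. d < j & \<mu> aSize d + z = n}"
  show "run (For aJ (Const 0) Arcs ?w) \<nu> (%k \<nu>'. k <= 12 * n + 2 & same {aI, aJ, aL, aOrd} \<nu> \<nu>' & \<nu>' aI 0 = z & (\<exists>os. inv (?D (Suc z)) os \<nu>'))"
  proof (rule run_For[where W = "{aJ, aL, aOrd}" and a = 0 and b = m and C = 4 and P = "%j \<nu>. \<exists>os. inv (?I j) os \<nu>"])
   show "aval Arcs \<nu>' = m" if "same {aJ, aL, aOrd} \<nu> \<nu>'" for \<nu>'
    using sameD[OF that, of aP] sameD[OF s, of aP] m by simp
   show "\<exists>os. inv (?I j) os (set_cell aJ 0 x \<nu>)" if "\<exists>os. inv (?I j) os \<nu>" for j \<nu> x
   proof -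
    from that obtain os where "inv (?I j) os \<nu>" ..
    from frame[OF _ this, of aJ x] show ?thesis by (intro exI) simp
   qed
   show "\<exists>os. inv (?I 0) os \<nu>" using os by auto
   fix j \<nu>1 assume j: "j < m" and s1: "same {aJ, aL, aOrd} \<nu> \<nu>1" and aj: "\<nu>1 aJ 0 = j" and "\<exists>os. inv (?I j) os \<nu>1"
   then obtain os where os: "inv (?I j) os \<nu>1" by blast
   have e: "\<nu>1 aSize = \<mu> aSize" "\<nu>1 aI 0 = z" "\<nu>1 0 0 = n" using sameD[OF s1] sameD[OF s] ai m by auto
   show "run ?w \<nu>1 (%k \<nu>'. k <= 4 & same {aJ, aL, aOrd} \<nu>1 \<nu>' & \<nu>' aJ 0 = j & (\<exists>os. inv (?I (Suc j)) os \<nu>'))"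
   proof (cases "\<mu> aSize j + z = n")
    case True
    have "?I (Suc j) = insert j (?I j)" "j \<notin> ?I j" using True by (auto simp: less_Suc_eq)
    moreover have "\<mu> aSize j <= \<mu> aSize d" if "d \<in> ?I j" for d using that True by auto
    ultimately have "inv (?I (Suc j)) (os @ [j]) (set_cell aL 0 (Suc (length os)) (set_cell aOrd (length os) j \<nu>1))"
     using os by (auto simp: inv_def sorted_wrt_append nth_append less_Suc_eq)
    moreover have "\<nu>1 aL 0 = length os" using os by (simp add: inv_def)
    ultimately show ?thesis using True e aj by (auto intro!: exI[of _ "os @ [j]"])
   next
    case False
    then have "?I (Suc j) = ?I j" by (auto simp: less_Suc_eq)
    then show ?thesis using False e aj os by (auto intro!: exI[of _ os])
   qed
  next
   fix k \<nu>' assume s1: "same {aJ, aL, aOrd} \<nu> \<nu>'" and ex: "\<exists>os. inv (?I m) os \<nu>'" and k: "k <= (m - 0) * (4 + 2) + 2"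
   have "?I m = ?D (Suc z)" by auto
   moreover have "k <= 12 * n + 2" using k m(3) by simp
   moreover have "\<nu>' aI 0 = z" "same {aI, aJ, aL, aOrd} \<nu> \<nu>'" using s1 ai by (auto simp: same_def)
   ultimately show "k <= 12 * n + 2 & same {aI, aJ, aL, aOrd} \<nu> \<nu>' & \<nu>' aI 0 = z & (\<exists>os. inv (?D (Suc z)) os \<nu>')" using ex by simp
  qed simp_all
 next
  fix k \<nu> assume s: "same {aI, aJ, aL, aOrd} ?\<mu> \<nu>" and "\<exists>os. inv (?D n) os \<nu>" and k: "k <= (n - 0) * (12 * n + 2 + 2) + 2"
  then obtain os where os: "inv (?D n) os \<nu>" by blast
  have D: "?D n = {..<m}" using f by auto
  have "distinct os" "set os = {..<m}" using os unfolding inv_def D by simp_all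
  then have "length os = m" using distinct_card[of os] by simp
  moreover have "1 + k <= 12 * n\<^sup>2 + 4 * n + 3" using k by (simp add: power2_eq_square algebra_simps)
  ultimately show "1 + k <= 12 * n\<^sup>2 + 4 * n + 3 & same {aI, aJ, aL, aOrd} \<mu> \<nu> &
  (\<exists>os. distinct os & set os = {..<m} & sorted_wrt (%d d'. \<mu> aSize d' <= \<mu> aSize d) os & (\<forall>k<m. \<nu> aOrd k = os ! k))"
   using s os unfolding inv_def D by auto
 qed simp_all
 then show ?thesis unfolding order_def by simp
qed

section \<open>Linked lists\<close>

text \<open>The successor of the last element is left open: the number of entries is known from the
  degree, so no end marker is maintained.\<close>

definition chain :: "(nat => nat) => nat list => bool" where
 "chain nx xs \<longleftrightarrow> distinct xs & (\<forall>i. Suc i < length xs --> nx (xs ! i) = xs ! Suc i)"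

lemma chain_insert:
 assumes "chain nx (xs @ p # ys)" "x \<notin> set (xs @ p # ys)"
 shows "chain (nx(x := nx p, p := x)) (xs @ p # x # ys)"
 unfolding chain_def
proof (intro conjI allI impI)
 show "distinct (xs @ p # x # ys)" using assms by (auto simp: chain_def)
 let ?L = "xs @ p # ys" and ?L' = "xs @ p # x # ys" and ?l = "length xs"
 have d: "distinct ?L" using assms(1) by (simp add: chain_def)
 fix i assume i: "Suc i < length ?L'"
 have c: "nx (?L ! j) = ?L ! Suc j" if "Suc j < length ?L" for j using assms(1) that by (simp add: chain_def)
 have nx: "?L ! j ~= x" if "j < length ?L" for j using nth_mem[OF that] assms(2) by metis
 have np: "?L ! j = p \<longleftrightarrow> j = ?l" if "j < length ?L" for j
  using nth_eq_iff_index_eq[OF d that, of ?l] by simp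
 consider "i < ?l" | "i = ?l" | "i = Suc ?l" | "Suc ?l < i" by linarith
 then show "(nx(x := nx p, p := x)) (?L' ! i) = ?L' ! Suc i"
 proof cases
  case 1
  have "?L' ! i = ?L ! i" "?L' ! Suc i = ?L ! Suc i" using 1 by (auto simp: nth_append)
  then show ?thesis using 1 c[of i] nx[of i] np[of i] by auto
 next
  case 2
  then show ?thesis by (simp add: nth_append)
 next
  case 3
  then have "?L' ! i = x" "?L' ! Suc i = ?L ! Suc ?l" by (auto simp: nth_append)
  moreover have "x ~= p" using assms(2) by auto
  ultimately show ?thesis using c[of ?l] i 3 by simp
 next
  case 4
  then obtain k where k: "i = Suc (Suc (?l + k))" by (auto dest: less_imp_Suc_add)
  define j where "j = Suc (?l + k)"
  have "?L' ! i = ?L ! j" "?L' ! Suc i = ?L ! Suc j" by (simp_all add: k j_def nth_append)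
  with k c[of j] nx[of j] np[of j] i show ?thesis by (simp add: j_def)
 qed
qed

text \<open>The head \<open>z\<close> is a sentinel without a key; as predecessor it demands only
  that the new key be below all others.\<close>

lemma chain_insert_sorted:
 fixes K :: "nat => nat"
 assumes c: "chain nx (z # L)" and s: "sorted_wrt (<) (map K L)" and p: "p \<in> set (z # L)" and x: "x \<notin> set (z # L)"
  and below: "p ~= z ==> K p < K x" and above: "!!b. b \<in> set L ==> (p ~= z ==> K p < K b) ==> K x < K b"
 shows "\<exists>L'. chain (nx(x := nx p, p := x)) (z # L') & sorted_wrt (<) (map K L') & set L' = insert x (set L)"
proof (cases "p = z")
 case True
 have "chain (nx(x := nx p, p := x)) ([] @ p # x # L)" by (rule chain_insert) (use c x True in auto)
 then show ?thesis using s above True by (intro exI[of _ "x # L"]) auto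
next
 case False
 then obtain xs ys where L: "L = xs @ p # ys" using p by (auto dest: split_list)
 have "chain (nx(x := nx p, p := x)) ((z # xs) @ p # x # ys)" by (rule chain_insert) (use c x L in auto)
 moreover have "sorted_wrt (<) (map K (xs @ p # x # ys))"
  using s below[OF False] above unfolding L by (auto simp: sorted_wrt_append intro: less_trans)
 ultimately show ?thesis using L by (intro exI[of _ "xs @ p # x # ys"]) auto
qed

lemma sorted_map_unique:
 fixes K :: "'b => nat"
 assumes "sorted_wrt (<) (map K xs)" "sorted_wrt (<) (map K ys)" "set xs = set ys"
 shows "xs = ys"
proof -
 have "map K xs = map K ys" using assms by (intro strict_sorted_equal) auto
 moreover have "inj_on K (set xs Un set ys)"
 proof -
  have "distinct (map K xs)" using assms(1) strict_sorted_iff by blast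
  with assms(3) show ?thesis by (simp add: distinct_map)
 qed
 ultimately show ?thesis by (rule map_inj_on)
qed

definition (in routing_input) arc_order :: "(nat \<times> nat) list => nat list => bool" where
 "arc_order as os \<longleftrightarrow> distinct as & set as = {(x, y). {x, y} \<in> S0} & length as <= n + n & distinct os & set os = {..<length as} &
  sorted_wrt (%d d'. card (sideA {fst (as ! d'), snd (as ! d')}) <= card (sideA {fst (as ! d), snd (as ! d)})) os"

section \<open>The list for one in-port, obtained by insertions at known places\<close>

locale port_order = routing_input +
 fixes al bl :: "nat => nat => nat" and Y :: "nat => nat => bool" and u w :: nat
 assumes choice: "arc_choice al bl Y" and u: "u < n" "u ~= t" and w: "{u, w} \<in> E"
begin

abbreviation "K \<equiv> key R al bl Y u w"
abbreviation "sl \<equiv> slot R al bl Y u w"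
abbreviation "sb \<equiv> sub R Y u w"
abbreviation "st \<equiv> start R bl u w"

text \<open>The numbers give the order of insertion: 1 for links before the far side, 2 for links
  before the near side, 3 for front links.\<close>

definition cls :: "nat => nat" where
 "cls v = (if front R u v then 3 else if Y u v & w \<in> sideB {u, v} then 2 else 1)"

definition anchor :: "nat => nat" where
 "anchor v = (if cls v = 2 then bl u v else al u v)"

lemmas choice_ends = conjunct1[OF choice[unfolded arc_choice_def], rule_format]

lemma card_far: "{u, v} \<in> S0 ==> 0 < card (sideB {u, v}) & card (sideB {u, v}) < n"
 using sideB_nonempty[of "{u, v}"] card_sideB[of "{u, v}"] by (auto simp: sideB_def card_gt_0_iff)

lemma far_notin_R: "{u, v} \<in> S0 ==> v \<notin> set (R u) & v ~= t"
 using R_row[OF u(1)] S0_D[of u v] by auto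

lemma start_in_R: "R u ~= [] ==> st \<in> set (R u)"
proof (cases "{u, w} \<in> S0 & ~  front R u w")
 case True
 assume "R u ~= []"
 from True obtain xs ys As Bs where *: "R u = xs @ ys" "ys @ xs = As @ Bs" "Bs ~= []" "bl u w = last Bs"
  using choice_ends[of u w] by blast
 have "last Bs \<in> set (ys @ xs)" unfolding *(2) using *(3) by simp
 then have "last Bs \<in> set (R u)" unfolding *(1) by auto
 then show ?thesis using *(4) True by (auto simp: start_def)
qed (auto simp: start_def)

lemma anchor_props:
 assumes v: "{u, v} \<in> S0" "~  front R u v"
 shows "al u v \<in> set (R u)" "bl u v \<in> set (R u)" "bl u v \<in> sideB {u, v}" "hd (cut (al u v) (R u)) \<in> sideB {u, v}"
proof -
 obtain xs ys As Bs where *: "R u = xs @ ys" "ys @ xs = As @ Bs" "As ~= []" "Bs ~= []" "set Bs \<subseteq> sideB {u, v}"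
  "al u v = last As" "bl u v = last Bs"
  using choice_ends[OF v] by blast
 have s: "set (R u) = set As Un set Bs" using *(1,2) by (metis set_append sup_commute)
 show "al u v \<in> set (R u)" "bl u v \<in> set (R u)" "bl u v \<in> sideB {u, v}" using s * by auto
 have d: "distinct (xs @ ys)" using R_row[OF u(1)] *(1) by simp
 have "cut (al u v) (R u) = cut (last As) (ys @ xs)"
  using cut_rotate[OF d, of "last As"] \<open>al u v \<in> set (R u)\<close> *(1,6) by simp
 also have e: "ys @ xs = butlast As @ last As # Bs"
  unfolding *(2) using *(3) by (metis append_butlast_last_id append.assoc append_Cons append_Nil)
 also have "cut (last As) (butlast As @ last As # Bs) = Bs @ butlast As @ [last As]"
 proof (rule cut_split)
  show "distinct (butlast As @ last As # Bs)" unfolding e[symmetric] using d by auto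
 qed
 finally show "hd (cut (al u v) (R u)) \<in> sideB {u, v}" using *(4,5) hd_in_set[of Bs] by auto
qed

lemma slot_sub:
 shows "sl t = 0 & sb t = 0"
  "r \<in> set (R u) ==> sl r = Suc (rank (cut st (R u)) r) & sb r = 2 * n"
  "{u, v} \<in> S0 ==> cls v = 3 ==> sl v = 0 & sb v = 2 * n - card (sideB {u, v})"
  "{u, v} \<in> S0 ==> cls v = 2 ==> sl v = Suc (slot_after (R u) st (bl u v)) & sb v = card (sideB {u, v})"
  "{u, v} \<in> S0 ==> cls v = 1 ==> sl v = Suc (slot_after (R u) st (al u v)) & sb v = 2 * n - card (sideB {u, v})"
 using far_notin_R[of v] R_row[OF u(1)]
 by (auto simp: slot_def sub_def cls_def split: if_splits)

lemma neighbour_cases: "{u, x} \<in> E ==> x = t | x \<in> set (R u) | {u, x} \<in> S0"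
 using R_row[OF u(1)] u by (auto simp: S0_def)

lemma cls_cases: "cls v = 1 | cls v = 2 | cls v = 3"
 by (simp add: cls_def)

lemma cls_nonfront: "cls v ~= 3 ==> ~  front R u v"
 by (simp add: cls_def split: if_splits)

text \<open>Far sides with a common node are strictly nested by laminarity. Links competing for the
  same gap always have such a node, so sizes never tie.\<close>

lemma far_sizes_differ:
 assumes "{u, x} \<in> S0" "{u, y} \<in> S0" "x ~= y" "z \<in> sideB {u, x}" "z \<in> sideB {u, y}"
 shows "card (sideB {u, x}) ~= card (sideB {u, y})"
proof -
 have fin: "finite (sideB e)" for e by (simp add: sideB_def)
 have "{u, x} ~= {u, y}" using assms(3) by (auto simp: doubleton_eq_iff)
 from laminar[OF assms(1,2) this[symmetric]] have "sideB {u, x} \<subset> sideB {u, y} | sideB {u, y} \<subset> sideB {u, x}"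
  using assms(4,5) sides(2)[OF assms(2)] by (elim disjE conjE) auto
 then show ?thesis using psubset_card_mono[OF fin] by (metis less_irrefl)
qed

lemma slot_after_inj:
 assumes "R u ~= []" "a \<in> set (R u)" "b \<in> set (R u)" "slot_after (R u) st a = slot_after (R u) st b"
 shows "a = b"
 using assms start_in_R rank_inj[of a "cut st (R u)" b] by (auto simp: slot_after_def split: if_splits)

lemma key_eq: "K x = K y \<longleftrightarrow> sl x = sl y & sb x = sb y"
proof
 assume e: "K x = K y"
 have "~  (sl x < sl y | sl x = sl y & sb x < sb y)" "~  (sl y < sl x | sl y = sl x & sb y < sb x)"
  unfolding key_less[symmetric] using e by simp_all
 then show "sl x = sl y & sb x = sb y" by linarith
qed (simp add: key_def)

lemma key_inj:
 assumes "{u, x} \<in> E" "{u, y} \<in> E" "K x = K y"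
 shows "x = y"
proof (rule ccontr)
 assume xy: "x ~= y"
 have eq: "sl x = sl y" "sb x = sb y" using assms(3) by (simp_all add: key_eq)
 have R1: "x = y" if "x \<in> set (R u)" "y \<in> set (R u)" "sl x = sl y" for x y
  using that slot_sub(2)[of x] slot_sub(2)[of y] rank_inj[of x "cut st (R u)" y] by simp
 have S: False if x: "{u, x} \<in> S0" and y: "{u, y} \<in> S0" and xy: "x ~= y" and eq: "sl x = sl y" "sb x = sb y" for x y
 proof -
  have Rne: "R u ~= []" by (rule R_nonempty[OF x])
  note cx = card_far[OF x] and cy = card_far[OF y]
  have same_cls: "cls x = cls y"
   using cls_cases[of x] cls_cases[of y] slot_sub(3-5)[OF x] slot_sub(3-5)[OF y] eq cx cy by auto
  have "card (sideB {u, x}) = card (sideB {u, y})"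
   using cls_cases[of x] same_cls slot_sub(3-5)[OF x] slot_sub(3-5)[OF y] eq cx cy by auto
  \<comment> \<open>The common far node is the neighbour behind the gap in class 1, the neighbour
    before it in class 2, and any neighbour in class 3.\<close>
  moreover have "\<exists>z. z \<in> sideB {u, x} & z \<in> sideB {u, y}"
   using cls_cases[of x]
  proof (elim disjE)
   assume c: "cls x = 1"
   then have f: "~  front R u x" "~  front R u y" using same_cls cls_nonfront by simp_all
   have "al u x = al u y"
    using slot_sub(5)[OF x c] slot_sub(5)[OF y] c same_cls eq slot_after_inj[OF Rne]
     anchor_props(1)[OF x f(1)] anchor_props(1)[OF y f(2)] by auto
   then show ?thesis using anchor_props(4)[OF x f(1)] anchor_props(4)[OF y f(2)] by auto
  next
   assume c: "cls x = 2"
   then have f: "~  front R u x" "~  front R u y" using same_cls cls_nonfront by simp_all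
   have "bl u x = bl u y"
    using slot_sub(4)[OF x c] slot_sub(4)[OF y] c same_cls eq slot_after_inj[OF Rne]
     anchor_props(2)[OF x f(1)] anchor_props(2)[OF y f(2)] by auto
   then show ?thesis using anchor_props(3)[OF x f(1)] anchor_props(3)[OF y f(2)] by auto
  next
   assume c: "cls x = 3"
   then have f: "front R u x" "front R u y" using same_cls by (auto simp: cls_def split: if_splits)
   have h: "hd (R u) \<in> set (R u)" using Rne by simp
   then have "{u, hd (R u)} \<in> H" "hd (R u) ~= t" using R_row[OF u(1)] by auto
   then have "hd (R u) < n" "hd (R u) ~= u" "hd (R u) ~= x" "hd (R u) ~= y"
    using H_link_ends[of u "hd (R u)"] S0_D[OF x] S0_D[OF y] by auto
   then show ?thesis using f h by (intro exI[of _ "hd (R u)"]) (auto simp: sideB_def front_def)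
  qed
  ultimately show False using far_sizes_differ[OF x y xy] by blast
 qed
 have RS: False if x: "x \<in> set (R u)" and y: "{u, y} \<in> S0" and eq: "sb x = sb y" for x y
  using slot_sub(2)[OF x] slot_sub(3-5)[OF y] cls_cases[of y] card_far[OF y] eq by auto
 have tR: False if "{u, y} \<in> S0 | y \<in> set (R u)" and eq: "sb t = sb y" for y
  using slot_sub(1) slot_sub(2)[of y] slot_sub(3-5)[of y] cls_cases[of y] card_far[of y] root that by auto
 show False
  using neighbour_cases[OF assms(1)] neighbour_cases[OF assms(2)]
 proof (elim disjE)
  assume "x = t" "y = t" then show False using xy by simp
 next
  assume "x = t" "y \<in> set (R u)" then show False using tR[of y] eq by simp
 next
  assume "x = t" "{u, y} \<in> S0" then show False using tR[of y] eq by simp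
 next
  assume "x \<in> set (R u)" "y = t" then show False using tR[of x] eq by simp
 next
  assume "x \<in> set (R u)" "y \<in> set (R u)" then show False using R1[of x y] eq xy by simp
 next
  assume "x \<in> set (R u)" "{u, y} \<in> S0" then show False using RS[of x y] eq by simp
 next
  assume "{u, x} \<in> S0" "y = t" then show False using tR[of x] eq by simp
 next
  assume "{u, x} \<in> S0" "y \<in> set (R u)" then show False using RS[of y x] eq by simp
 next
  assume "{u, x} \<in> S0" "{u, y} \<in> S0" then show False using S[of x y] eq xy by blast
 qed
qed

lemma key_le: "sl x < sl y | sl x = sl y & sb x <= sb y ==> K x <= K y"
 using key_less[of R al bl Y u w y x] by (auto simp: not_less[symmetric])

text \<open>The number \<open>n\<close>, which is no node, is the sentinel. It replaces the anchor
  \<open>st\<close>, because the gap behind \<open>st\<close> is the front of the reading.\<close>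

definition pred_node :: "nat => nat" where
 "pred_node v = (if cls v = 3 | anchor v = st then n else anchor v)"

text \<open>An element put directly behind its anchor precedes everything inserted there earlier.
  The list therefore stays sorted if entries of one slot arrive with decreasing \<open>sub\<close>,
  and if nothing of slot 0 is present while the sentinel still serves as anchor for slot 1.\<close>

lemma insert_arc:
 assumes c: "chain nx (n # L)" and s: "sorted_wrt (<) (map K L)" and L: "set (R u) \<subseteq> set L" "set L \<subseteq> {x. {u, x} \<in> E}"
  and v: "{u, v} \<in> S0" "v \<notin> set L"
  and order: "!!b. b \<in> set L ==> sl b = sl v ==> sb v <= sb b" and pos: "!!b. cls v ~= 3 ==> b \<in> set L ==> 0 < sl b"
 shows "\<exists>L'. chain (nx(v := nx (pred_node v), pred_node v := v)) (n # L') & sorted_wrt (<) (map K L') & set L' = insert v (set L)"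
proof (rule chain_insert_sorted[OF c s])
 have Rn: "x < n" if "x \<in> set (R u)" for x using that R_row[OF u(1)] H_link_ends[of u x] by auto
 have Rne: "R u ~= []" by (rule R_nonempty[OF v(1)])
 have an: "anchor v \<in> set (R u)" if "cls v ~= 3"
  using that anchor_props(1,2)[OF v(1)] by (auto simp: anchor_def cls_def split: if_splits)
 have slv: "sl v = Suc (slot_after (R u) st (anchor v))" if "cls v ~= 3"
  using that cls_cases[of v] slot_sub(4,5)[OF v(1)] by (auto simp: anchor_def)
 have p: "cls v ~= 3 & pred_node v = anchor v & anchor v ~= st" if "pred_node v ~= n"
  using that by (auto simp: pred_node_def split: if_splits)
 have slp: "sl v = Suc (sl (pred_node v)) & sb (pred_node v) = 2 * n" if "pred_node v ~= n"
  using p[OF that] slv an slot_sub(2)[of "anchor v"] by (simp add: slot_after_def)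
 have sb2: "sb b <= 2 * n" for b using card_far[of b] by (auto simp: sub_def intro: order_trans[OF less_imp_le[OF card_sideB]])
 show "pred_node v \<in> set (n # L)" using an L(1) by (auto simp: pred_node_def)
 show "v \<notin> set (n # L)" using v S0_D[OF v(1)] by auto
 show "K (pred_node v) < K v" if "pred_node v ~= n" using slp[OF that] by (simp add: key_less)
 show "K v < K b" if b: "b \<in> set L" "pred_node v ~= n ==> K (pred_node v) < K b" for b
 proof -
  have "sl v <= sl b"
  proof (cases "pred_node v = n")
   case True
   show ?thesis
   proof (cases "cls v = 3")
    case True
    with slot_sub(3)[OF v(1)] show ?thesis by simp
   next
    case False
    then have "anchor v = st" using True an Rn by (auto simp: pred_node_def split: if_splits)
    then have "sl v = Suc 0" using slv[OF False] by (simp add: slot_after_def)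
    with pos[OF False b(1)] show ?thesis by simp
   qed
  next
   case False
   then have "sl (pred_node v) < sl b" using b(2)[OF False] slp[OF False] sb2[of b] by (auto simp: key_less)
   with slp[OF False] show ?thesis by simp
  qed
  then have "K v <= K b" using order[OF b(1)] by (intro key_le) auto
  moreover have "K v ~= K b" using key_inj[of v b] b(1) L(2) v S0_E[OF v(1)] by auto
  ultimately show ?thesis by simp
 qed
qed

end

section \<open>Programs that build and print the list for one in-port\<close>

abbreviation "aOut \<equiv> 29 :: nat"
abbreviation "aWp \<equiv> 31 :: nat"
abbreviation "aSt \<equiv> 32 :: nat"
abbreviation "aCur \<equiv> 33 :: nat"
abbreviation "aNx \<equiv> 51 :: nat"
abbreviation "aCls \<equiv> 52 :: nat"
abbreviation "aAnc \<equiv> 53 :: nat"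

text \<open>Pointers are first set around the whole cycle; the place to open it is the last
  neighbour, unless \<open>w\<close> is a neighbour or a separating link with a recorded block end.
  Directing the sentinel to the successor of \<open>st\<close> opens the cycle.\<close>

definition base_list :: com where
 "base_list = Seq (Row aJ 3 aU (When (Neg (Equal Here Root)) (Assign aPrev Here)))
  (Seq (Assign aSt (Var aPrev))
  (Seq (Row aJ 3 aU (When (Neg (Equal Here Root))
   (Seq (When (Equal Here (Var aWp)) (Assign aSt Here)) (Seq (Write aNx (Var aPrev) Here) (Assign aPrev Here)))))
  (Seq (For aD (Const 0) Arcs (When (Conj (Conj (Equal (Read aSrc (Var aD)) (Var aU)) (Equal (Read aDst (Var aD)) (Var aWp)))
    (Neg (Equal (Read aBl (Var aD)) (Var 0)))) (Assign aSt (Read aBl (Var aD)))))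
   (Write aNx (Var 0) (Read aNx (Var aSt))))))"

definition classify_arc :: com where
 "classify_arc = Cond (Equal (Read aSrc (Var aD)) (Var aU))
  (Seq (Cond (Equal (Read aBl (Var aD)) (Var 0)) (Seq (Write aCls (Var aD) (Const 3)) (Write aAnc (Var aD) (Var 0)))
   (Cond (Conj (Equal (Read aYc (Var aD)) (Const 1)) (Equal (Read aM (Add (Read aMo (Var aD)) (Var aWp))) (Const 3)))
     (Seq (Write aCls (Var aD) (Const 2)) (Write aAnc (Var aD) (Read aBl (Var aD))))
     (Seq (Write aCls (Var aD) (Const 1)) (Write aAnc (Var aD) (Read aAl (Var aD))))))
   (When (Equal (Read aAnc (Var aD)) (Var aSt)) (Write aAnc (Var aD) (Var 0))))
  (Write aCls (Var aD) (Const 0))"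

definition classify :: com where
 "classify = For aD (Const 0) Arcs classify_arc"

text \<open>The index expression chooses the direction through the sorted arcs. Classes 1 and 3 need
  increasing far sides and class 2 decreasing ones, so that \<open>sub\<close> decreases in each
  case.\<close>

definition pass :: "nat => aexp => com" where
 "pass c ix = For aI (Const 0) Arcs (Seq (Assign aD (Read aOrd ix)) (When (Equal (Read aCls (Var aD)) (Const c))
  (Seq (Write aNx (Read aDst (Var aD)) (Read aNx (Read aAnc (Var aD)))) (Write aNx (Read aAnc (Var aD)) (Read aDst (Var aD))))))"

definition add_root :: com where
 "add_root = Row aJ 1 aU (When (Equal (Read 2 (Var aJ)) Root) (Seq (Write aNx Root (Read aNx (Var 0))) (Write aNx (Var 0) Root)))"

definition output_list :: com where
 "output_list = Seq (Assign aCur (Read aNx (Var 0))) (Row aJ 1 aU (Seq (Write 8 (Var aOut) (Var aCur))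
  (Seq (Assign aCur (Read aNx (Var aCur))) (Assign aOut (Add (Var aOut) (Const 1))))))"

text \<open>In a common slot, class 2 has smaller \<open>sub\<close> than class 1 and is inserted
  later. Front links and finally \<open>t\<close> go to the front of everything, so they come after
  both. All phases are linear in \<open>n\<close>.\<close>

definition emit :: com where
 "emit = Seq base_list (Seq classify (Seq (pass 1 (Var aI)) (Seq (pass 2 (Sub (Sub Arcs (Const 1)) (Var aI)))
  (Seq (pass 3 (Var aI)) (Seq add_root output_list)))))"

text \<open>Pointers along the cyclic order become the list read from behind \<open>s\<close> by
  redirecting only the sentinel; the pointer of \<open>s\<close> to the first element is simply
  never followed.\<close>

lemma chain_cut:
 assumes R: "distinct xs" "s \<in> set xs" "z \<notin> set xs" and nx: "!!j. j < length xs ==> nx (prev_in xs j) = xs ! j"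
 shows "chain (nx(z := nx s)) (z # cut s xs)"
proof -
 obtain ps qs where xs: "xs = ps @ s # qs" using R(2) by (auto dest: split_list)
 let ?L = "qs @ ps @ [s]" let ?N = "length ?L"
 have c: "cut s xs = ?L" using cut_split[of ps s qs] R(1) xs by simp
 have d: "distinct ?L" using R(1) xs by auto
 have step: "nx (?L ! i) = ?L ! (Suc i mod ?N)" if i: "i < ?N" for i
 proof -
  have "?L ! (Suc i mod ?N) \<in> set xs" using nth_mem[of "Suc i mod ?N" ?L] xs by auto
  then obtain j where j: "j < length xs" "xs ! j = ?L ! (Suc i mod ?N)" by (auto simp: in_set_conv_nth)
  obtain k where k: "k < ?N" "prev_in xs j = ?L ! k" "xs ! j = ?L ! (Suc k mod ?N)"
   using prev_in_rotation[of xs "ps @ [s]" qs ?L j] xs j(1) by auto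
  have "Suc k mod ?N = Suc i mod ?N"
   using nth_eq_iff_index_eq[OF d, of "Suc k mod ?N" "Suc i mod ?N"] j(2) k(3) by simp
  then have "k = i" using k(1) i by (cases "Suc k = ?N"; cases "Suc i = ?N") (simp_all add: mod_less del: length_append)
  with nx[OF j(1)] k j(2) show ?thesis by simp
 qed
 show ?thesis
  unfolding c chain_def
 proof (intro conjI allI impI)
  show "distinct (z # ?L)" using d R(3) xs by auto
  fix i assume i: "Suc i < length (z # ?L)"
  show "(nx(z := nx s)) ((z # ?L) ! i) = (z # ?L) ! Suc i"
  proof (cases i)
   case 0
   have "?L ! (?N - 1) = s" by (simp add: nth_append)
   moreover have "Suc (?N - 1) mod ?N = 0" by simp
   ultimately show ?thesis using step[of "?N - 1"] 0 by simp
  next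
   case (Suc k)
   then have k: "Suc k < ?N" using i by simp
   then have "?L ! k \<in> set ?L" by (intro nth_mem) simp
   then have "?L ! k ~= z" using R(3) xs by auto
   moreover have "Suc k mod ?N = Suc k" using k by (rule mod_less)
   ultimately show ?thesis using step[of k] k Suc by (simp del: length_append)
  qed
 qed
qed

locale emission = port_order +
 fixes as :: "(nat \<times> nat) list" and os :: "nat list"
 assumes ord: "arc_order as os"
begin

lemma as: "distinct as" "set as = {(x, y). {x, y} \<in> S0}" "length as <= n + n"
 and os: "distinct os" "set os = {..<length as}"
  "sorted_wrt (%d d'. card (sideA {fst (as ! d'), snd (as ! d')}) <= card (sideA {fst (as ! d), snd (as ! d)})) os"
 using ord by (simp_all add: arc_order_def)

abbreviation "m \<equiv> length as"

lemma arc_S0: "d < m ==> as ! d = (x, y) ==> {x, y} \<in> S0"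
 using as(2) nth_mem[of d as] by auto

lemma R_less: "r \<in> set (R u) ==> r < n"
 using R_row[OF u(1)] H_link_ends[of u r] by auto

lemma run_base_list:
 assumes i: "input \<mu>" and s: "\<mu> aU 0 = u" "\<mu> aWp 0 = w" and a: "arc_tables as al bl Y \<mu>"
 shows "run base_list \<mu> (%k \<nu>. k <= 27 * n + 8 & same {aJ, aPrev, aSt, aNx, aD} \<mu> \<nu> & (R u ~= [] --> \<nu> aSt 0 = st) &
  chain (\<nu> aNx) (n # (if R u = [] then [] else cut st (R u))))"
  (is "run _ _ ?T")
 unfolding base_list_def
proof (rule run_SeqI[OF run_last_R[OF i s(1) u(1)]], simp, goal_cases)
 case (1 k1 \<nu>1)
 then have k1: "k1 <= 5 * n + 2" and s1: "same {aJ, aPrev} \<mu> \<nu>1" and p1: "R u ~= [] ==> \<nu>1 aPrev 0 = last (R u)" by auto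
 let ?\<nu>1 = "set_cell aSt 0 (\<nu>1 aPrev 0) \<nu>1"
 have s1': "same {aJ, aPrev, aSt} \<mu> ?\<nu>1" using s1 by (auto simp: same_def)
 have i1: "input ?\<nu>1" by (rule input_same[OF i s1']) auto
 let ?st1 = "if w \<in> set (R u) then w else last (R u)"
 let ?w = "Seq (When (Equal Here (Var aWp)) (Assign aSt Here)) (Seq (Write aNx (Var aPrev) Here) (Assign aPrev Here))"
 let ?P = "%i \<nu>. R u ~= [] --> \<nu> aPrev 0 = prev_in (R u) i & \<nu> aSt 0 = (if w \<in> set (take i (R u)) then w else last (R u)) &
  (\<forall>j<i. \<nu> aNx (prev_in (R u) j) = R u ! j)"
 have dR: "distinct (R u)" using R_row[OF u(1)] by simp
 have pinj: "prev_in (R u) j ~= prev_in (R u) i" if "j < i" "i < length (R u)" for i j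
 proof -
  have ne: "R u ~= []" using that by auto
  have "prev_in (R u) l = R u ! (if l = 0 then length (R u) - 1 else l - 1)" for l
   using ne by (simp add: prev_in_def last_conv_nth)
  then show ?thesis using that dR by (auto simp: nth_eq_iff_index_eq)
 qed
 have r2: "run (Row aJ 3 aU (When (Neg (Equal Here Root)) ?w)) ?\<nu>1 (%k \<nu>. k <= 8 * n + 2 & same {aJ, aPrev, aSt, aNx} \<mu> \<nu> &
   (R u ~= [] --> \<nu> aSt 0 = ?st1 & (\<forall>j<length (R u). \<nu> aNx (prev_in (R u) j) = R u ! j)))"
 proof (rule run_R_row[OF i1, where z = u and W = "{aJ, aPrev, aSt, aNx}" and C = 4 and P = ?P], goal_cases)
  case 1 with sameD[OF s1', of aU] s show ?case by simp
 next
  case 2 show ?case by (rule u(1))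
 next
  case 9
  with p1 show ?case by (simp add: prev_in_def)
 next
  case (10 i \<nu>)
  then have il: "i < length (R u)" and sm: "same {aJ, aPrev, aSt, aNx} ?\<nu>1 \<nu>" and el: "\<nu> 4 (\<nu> aJ 0) = R u ! i" and P: "?P i \<nu>" by auto
  have ne: "R u ~= []" using il by auto
  have "\<nu> aWp 0 = w" using sameD[OF sm, of aWp] sameD[OF s1', of aWp] s by simp
  moreover have "prev_in (R u) (Suc i) = R u ! i" by (simp add: prev_in_def)
  moreover have "set (take (Suc i) (R u)) = insert (R u ! i) (set (take i (R u)))" using il by (simp add: take_Suc_conv_app_nth)
  ultimately show ?case using P ne el il pinj by (auto simp: less_Suc_eq)
 next
  case (11 k \<nu>)
  then show ?case using s1' by (auto simp: same_def)
 qed simp_all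
 have "run (Seq (Row aJ 3 aU (When (Neg (Equal Here Root)) ?w))
  (Seq (For aD (Const 0) Arcs (When (Conj (Conj (Equal (Read aSrc (Var aD)) (Var aU)) (Equal (Read aDst (Var aD)) (Var aWp)))
    (Neg (Equal (Read aBl (Var aD)) (Var 0)))) (Assign aSt (Read aBl (Var aD)))))
   (Write aNx (Var 0) (Read aNx (Var aSt))))) ?\<nu>1 (%k. ?T (k1 + (1 + k)))"
 proof (rule run_SeqI[OF r2], elim conjE)
  fix k2 \<nu>2 assume k2: "k2 <= 8 * n + 2" and s2: "same {aJ, aPrev, aSt, aNx} \<mu> \<nu>2"
   and "R u ~= [] --> \<nu>2 aSt 0 = ?st1 & (\<forall>j<length (R u). \<nu>2 aNx (prev_in (R u) j) = R u ! j)"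
  then have st2: "R u ~= [] ==> \<nu>2 aSt 0 = ?st1" and nx2: "R u ~= [] ==> j < length (R u) ==> \<nu>2 aNx (prev_in (R u) j) = R u ! j" for j by auto
  let ?w = "When (Conj (Conj (Equal (Read aSrc (Var aD)) (Var aU)) (Equal (Read aDst (Var aD)) (Var aWp)))
    (Neg (Equal (Read aBl (Var aD)) (Var 0)))) (Assign aSt (Read aBl (Var aD)))"
  let ?Q = "%d. \<exists>d'<d. as ! d' = (u, w) & ~  front R u w"
  have "run (For aD (Const 0) Arcs ?w) \<nu>2 (%k \<nu>. k <= 8 * n + 2 & same {aD, aSt} \<nu>2 \<nu> & \<nu> aSt 0 = (if ?Q m then bl u w else \<nu>2 aSt 0))"
  proof (rule run_For[where W = "{aD, aSt}" and a = 0 and b = m and C = 2 and P = "%d \<nu>. \<nu> aSt 0 = (if ?Q d then bl u w else \<nu>2 aSt 0)"])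
   show "aval Arcs \<nu> = m" if "same {aD, aSt} \<nu>2 \<nu>" for \<nu>
    using sameD[OF that, of aP] sameD[OF s2, of aP] a by (simp add: arc_tables_def)
   show "k <= 8 * n + 2 & same {aD, aSt} \<nu>2 \<nu> & \<nu> aSt 0 = (if ?Q m then bl u w else \<nu>2 aSt 0)"
    if "same {aD, aSt} \<nu>2 \<nu>" "\<nu> aSt 0 = (if ?Q m then bl u w else \<nu>2 aSt 0)" "k <= (m - 0) * (2 + 2) + 2" for k \<nu>
    using that as(3) by simp
   fix d \<nu> assume d: "d < m" and sm: "same {aD, aSt} \<nu>2 \<nu>" and ad: "\<nu> aD 0 = d" and P: "\<nu> aSt 0 = (if ?Q d then bl u w else \<nu>2 aSt 0)"
   obtain x y where xy: "as ! d = (x, y)" by force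
   have e: "\<nu> aSrc d = x" "\<nu> aDst d = y" "\<nu> aBl d = (if front R x y then n else bl x y)" "\<nu> aU 0 = u" "\<nu> aWp 0 = w" "\<nu> 0 0 = n"
    using sameD[OF sm] sameD[OF s2] a d xy s i by (auto simp: arc_tables_def input_def)
   have nb: "bl u w < n" if "x = u" "y = w" "~  front R u w"
    using anchor_props(2)[of w] R_less arc_S0[OF d xy] that by auto
   have Qs: "?Q (Suc d) \<longleftrightarrow> ?Q d | x = u & y = w & ~  front R u w" using xy by (auto simp: less_Suc_eq)
   show "run ?w \<nu> (%k \<nu>'. k <= 2 & same {aD, aSt} \<nu> \<nu>' & \<nu>' aD 0 = d & \<nu>' aSt 0 = (if ?Q (Suc d) then bl u w else \<nu>2 aSt 0))"
    unfolding Qs using e P ad nb by auto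
  qed simp_all
  then show "run (Seq (For aD (Const 0) Arcs ?w) (Write aNx (Var 0) (Read aNx (Var aSt)))) \<nu>2 (%k. ?T (k1 + (1 + (k2 + k))))"
  proof (rule run_SeqI, elim conjE)
   fix k3 \<nu>3 assume k3: "k3 <= 8 * n + 2" and s3: "same {aD, aSt} \<nu>2 \<nu>3" and st3: "\<nu>3 aSt 0 = (if ?Q m then bl u w else \<nu>2 aSt 0)"
   have Qm: "?Q m \<longleftrightarrow> {u, w} \<in> S0 & ~  front R u w"
   proof -
    have "(\<exists>d<m. as ! d = (u, w)) \<longleftrightarrow> (u, w) \<in> set as" by (auto simp: in_set_conv_nth)
    then show ?thesis using as(2) by auto
   qed
   have st: "\<nu>3 aSt 0 = st" if "R u ~= []"
    unfolding st3 Qm st2[OF that] using far_notin_R[of w] by (auto simp: start_def)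
   have n3: "\<nu>3 0 0 = n" "\<nu>3 aNx = \<nu>2 aNx" using sameD[OF s3] sameD[OF s2] i by (auto simp: input_def)
   let ?\<nu> = "set_cell aNx n (\<nu>3 aNx (\<nu>3 aSt 0)) \<nu>3"
   have "chain (?\<nu> aNx) (n # (if R u = [] then [] else cut st (R u)))"
   proof (cases "R u = []")
    case True
    then show ?thesis by (simp add: chain_def)
   next
    case False
    have "chain ((\<nu>3 aNx)(n := \<nu>3 aNx st)) (n # cut st (R u))"
     by (rule chain_cut[OF dR start_in_R[OF False]]) (use R_less nx2[OF False] n3 in auto)
    with False st show ?thesis by simp
   qed
   moreover have "k1 + (1 + (k2 + (k3 + 1))) <= 27 * n + 8" using k1 k2 k3 by linarith
   moreover have "same {aJ, aPrev, aSt, aNx, aD} \<mu> ?\<nu>" using s2 s3 by (auto simp: same_def)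
   moreover have "?\<nu> aSt = \<nu>3 aSt" by simp
   ultimately have "?T (k1 + (1 + (k2 + (k3 + 1)))) ?\<nu>" using st by simp
   then show "run (Write aNx (Var 0) (Read aNx (Var aSt))) \<nu>3 (%l. ?T (k1 + (1 + (k2 + (k3 + l)))))"
    using n3(1) by simp
  qed
 qed
 then show ?case by (simp only: run_Seq[of "Assign aSt (Var aPrev)"] run_Write aval.simps)
qed

lemma run_classify:
 assumes i: "input \<mu>" and s: "\<mu> aU 0 = u" "\<mu> aWp 0 = w" and a: "arc_tables as al bl Y \<mu>" and st: "R u ~= [] ==> \<mu> aSt 0 = st"
 shows "run classify \<mu> (%k \<nu>. k <= 20 * n + 2 & same {aD, aCls, aAnc} \<mu> \<nu> &
  (\<forall>d<m. \<forall>x y. as ! d = (x, y) --> (if x = u then \<nu> aCls d = cls y & \<nu> aAnc d = pred_node y else \<nu> aCls d = 0)))"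
 unfolding classify_def
proof (rule run_For[where W = "{aD, aCls, aAnc}" and a = 0 and b = m and C = 8 and P = "%d \<nu>. \<forall>d'<d. \<forall>x y. as ! d' = (x, y) -->
  (if x = u then \<nu> aCls d' = cls y & \<nu> aAnc d' = pred_node y else \<nu> aCls d' = 0)"], goal_cases)
 case (4 \<nu>)
 with sameD[OF 4, of aP] a show ?case by (simp add: arc_tables_def)
next
 case (7 d \<nu>)
 then have d: "d < m" and sm: "same {aD, aCls, aAnc} \<mu> \<nu>" and ad: "\<nu> aD 0 = d" by auto
 have P: "!!d' x y. d' < d ==> as ! d' = (x, y) ==> (if x = u then \<nu> aCls d' = cls y & \<nu> aAnc d' = pred_node y else \<nu> aCls d' = 0)"
  using 7 by blast
 obtain x y where xy: "as ! d = (x, y)" by force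
 have e: "\<nu> aSrc d = x" "\<nu> aAl d = al x y" "\<nu> aBl d = (if front R x y then n else bl x y)" "\<nu> aYc d = (if Y x y then 1 else 0)"
  "\<nu> aM (\<nu> aMo d + w) = 3 \<longleftrightarrow> w \<in> sideB {x, y}" "\<nu> aU 0 = u" "\<nu> aWp 0 = w" "\<nu> 0 0 = n" "\<nu> aSt = \<mu> aSt"
  using sameD[OF sm] a d xy s i link_ends[OF w] by (auto simp: arc_tables_def input_def)
 have "run classify_arc \<nu> (%k \<nu>'. k <= 8 & same {aD, aCls, aAnc} \<nu> \<nu>' & \<nu>' aD 0 = d & (\<forall>d'. d' ~= d --> \<nu>' aCls d' = \<nu> aCls d' & \<nu>' aAnc d' = \<nu> aAnc d') &
  (if x = u then \<nu>' aCls d = cls y & \<nu>' aAnc d = pred_node y else \<nu>' aCls d = 0))"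
 proof (cases "x = u")
  case False
  with e ad show ?thesis by (simp add: classify_arc_def)
 next
  case True
  have S: "{u, y} \<in> S0" using arc_S0[OF d xy] True by simp
  have st': "\<mu> aSt 0 = st" using st R_nonempty[OF S] by simp
  have nf: "al u y < n & bl u y < n" if "~  front R u y" using anchor_props(1,2)[OF S that] R_less by simp
  consider "front R u y" | "~  front R u y" "Y u y & w \<in> sideB {u, y}" | "~  front R u y" "~  (Y u y & w \<in> sideB {u, y})" by blast
  then show ?thesis
  proof cases
   case 1
   with e ad True show ?thesis by (simp add: classify_arc_def cls_def pred_node_def)
  next
   case 2
   with e ad True st' nf show ?thesis by (simp add: classify_arc_def cls_def pred_node_def anchor_def)
  next
   case 3
   then show ?thesis using e ad True st' nf by (auto simp: classify_arc_def cls_def pred_node_def anchor_def)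
  qed
 qed
 then show ?case
 proof (rule run_mono, elim conjE, intro conjI, goal_cases)
  case (4 k \<nu>')
  show ?case
  proof (intro allI impI)
   fix d' x' y' assume *: "d' < Suc d" "as ! d' = (x', y')"
   show "if x' = u then \<nu>' aCls d' = cls y' & \<nu>' aAnc d' = pred_node y' else \<nu>' aCls d' = 0"
    using 4 P[of d' x' y'] * xy by (cases "d' = d") auto
  qed
 qed
next
 case (8 k \<nu>)
 with as(3) show ?case by simp
qed simp_all

definition listed :: "(nat => nat) => nat set => bool" where
 "listed nx X \<longleftrightarrow> (\<exists>L. chain nx (n # L) & sorted_wrt (<) (map K L) & set L = X)"

definition upto_class :: "nat => nat set" where
 "upto_class c = set (R u) Un {v. {u, v} \<in> S0 & cls v < c}"

text \<open>Compared with entries of earlier classes the tie-breaking is automatic: class 2 values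
  are below \<open>n\<close> and class 1 values above it, and slot 0 holds class 3 only. Just the
  order inside a class remains an assumption.\<close>

lemma listed_insert_arc:
 assumes l: "listed nx X" and X: "upto_class c \<subseteq> X" "X \<subseteq> upto_class (Suc c)" and v: "{u, v} \<in> S0" "v \<notin> X" "cls v = c"
  and order: "!!b. b \<in> X ==> {u, b} \<in> S0 ==> cls b = c ==> sb v <= sb b"
 shows "listed (nx(v := nx (pred_node v), pred_node v := v)) (insert v X)"
proof -
 obtain L where L: "chain nx (n # L)" "sorted_wrt (<) (map K L)" "set L = X" using l by (auto simp: listed_def)
 have cs: "b \<in> set (R u) | {u, b} \<in> S0 & cls b < c | {u, b} \<in> S0 & cls b = c" if "b \<in> set L" for b
  using that X(2) L(3) by (auto simp: upto_class_def less_Suc_eq)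
 note cv = card_far[OF v(1)] and sv = slot_sub(3-5)[OF v(1)]
 have "\<exists>L'. chain (nx(v := nx (pred_node v), pred_node v := v)) (n # L') & sorted_wrt (<) (map K L') & set L' = insert v (set L)"
 proof (rule insert_arc[OF L(1,2)])
  show "set (R u) \<subseteq> set L" using X(1) L(3) by (auto simp: upto_class_def)
  show "set L \<subseteq> {x. {u, x} \<in> E}"
  proof
   fix b assume "b \<in> set L"
   then show "b \<in> {x. {u, x} \<in> E}" using cs[of b] R_row[OF u(1)] S0_E[of "{u, b}"] by auto
  qed
  show "{u, v} \<in> S0" "v \<notin> set L" using v L(3) by auto
  fix b assume b: "b \<in> set L"
  show "0 < sl b" if "cls v ~= 3"
   using cs[OF b]
  proof (elim disjE conjE)
   assume "b \<in> set (R u)" with slot_sub(2) show ?thesis by simp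
  next
   assume "{u, b} \<in> S0" "cls b < c"
   then show ?thesis using slot_sub(4,5)[of b] cls_cases[of b] v(3) cls_cases[of v] by auto
  next
   assume "{u, b} \<in> S0" "cls b = c"
   then show ?thesis using slot_sub(4,5)[of b] cls_cases[of b] v(3) that by auto
  qed
  show "sb v <= sb b" if eq: "sl b = sl v"
   using cs[OF b]
  proof (elim disjE conjE)
   assume "b \<in> set (R u)" then show ?thesis using slot_sub(2)[of b] sv cls_cases[of v] cv by auto
  next
   assume S: "{u, b} \<in> S0" and c: "cls b < c"
   note cb = card_far[OF S] and sbb = slot_sub(3-5)[OF S]
   show ?thesis
   proof (cases "cls v = 3")
    case True
    then show ?thesis using eq sv sbb cls_cases[of b] c v(3) by auto
   next
    case False
    then have "cls v = 2" "cls b = 1" using c v(3) cls_cases[of b] cls_cases[of v] by auto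
    then show ?thesis using sv sbb cv cb by auto
   qed
  next
   assume "{u, b} \<in> S0" "cls b = c"
   with order[of b] b L(3) show ?thesis by simp
  qed
 qed
 then show ?thesis using L(3) by (auto simp: listed_def)
qed

lemma run_pass:
 assumes i: "input \<mu>" and a: "arc_tables as al bl Y \<mu>" and c: "0 < c"
  and cl: "!!d x y. d < m ==> as ! d = (x, y) ==> (if x = u then \<mu> aCls d = cls y & \<mu> aAnc d = pred_node y else \<mu> aCls d = 0)"
  and l: "listed (\<mu> aNx) (upto_class c)"
  and ds: "distinct ds" "set ds = {..<m}" and ix: "!!\<nu> j. same {aI, aD, aNx} \<mu> \<nu> ==> \<nu> aI 0 = j ==> j < m ==> \<mu> aOrd (aval ix \<nu>) = ds ! j"
  and order: "!!j k v b. j < k ==> k < m ==> as ! (ds ! j) = (u, b) ==> as ! (ds ! k) = (u, v) ==> cls b = c ==> cls v = c ==> sb v <= sb b"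
 shows "run (pass c ix) \<mu> (%k \<nu>. k <= 14 * n + 2 & same {aI, aD, aNx} \<mu> \<nu> & listed (\<nu> aNx) (upto_class (Suc c)))"
proof -
 have len: "length ds = m" using ds distinct_card[of ds] by simp
 define G where "G j = upto_class c Un {v. cls v = c & (\<exists>k<j. as ! (ds ! k) = (u, v))}" for j
 show ?thesis
  unfolding pass_def
 proof (rule run_For[where W = "{aI, aD, aNx}" and a = 0 and b = m and C = 5 and P = "%j \<nu>. listed (\<nu> aNx) (G j)"], goal_cases)
  case (4 \<nu>)
  with sameD[OF 4, of aP] a show ?case by (simp add: arc_tables_def)
 next
  case 6
  with l show ?case by (simp add: G_def)
 next
  case (8 k \<nu>)
  have "G m = upto_class (Suc c)"
  proof -
   have "(\<exists>k<m. as ! (ds ! k) = (u, v)) \<longleftrightarrow> {u, v} \<in> S0" for v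
   proof -
    have "(\<exists>k<m. as ! (ds ! k) = (u, v)) \<longleftrightarrow> (\<exists>d\<in>set ds. as ! d = (u, v))" using len by (metis in_set_conv_nth)
    also have "\<dots> \<longleftrightarrow> (u, v) \<in> set as" unfolding ds(2) by (auto simp: in_set_conv_nth)
    finally show ?thesis using as(2) by simp
   qed
   then show ?thesis by (auto simp: G_def upto_class_def less_Suc_eq)
  qed
  with 8 as(3) show ?case by simp
 next
  case (7 j \<nu>)
  then have j: "j < m" and sm: "same {aI, aD, aNx} \<mu> \<nu>" and aj: "\<nu> aI 0 = j" and P: "listed (\<nu> aNx) (G j)" by auto
  let ?d = "ds ! j"
  have dm: "?d < m" using nth_mem[of j ds] ds(2) j len by auto
  obtain x y where xy: "as ! ?d = (x, y)" by force
  have e: "\<nu> aOrd (aval ix \<nu>) = ?d" "\<nu> aDst ?d = y" "\<nu> aCls = \<mu> aCls" "\<nu> aAnc = \<mu> aAnc"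
   using ix[OF sm aj j] sameD[OF sm] a dm xy by (auto simp: arc_tables_def)
  show ?case
  proof (cases "\<mu> aCls ?d = c")
   case False
   have "G (Suc j) = G j" using False cl[OF dm xy] xy by (auto simp: G_def less_Suc_eq split: if_splits)
   with False e aj P show ?thesis by simp
  next
   case True
   then have xu: "x = u" "cls y = c" "\<mu> aAnc ?d = pred_node y" using cl[OF dm xy] c by (auto split: if_splits)
   have S: "{u, y} \<in> S0" using arc_S0[OF dm xy] xu by simp
   have yG: "y \<notin> G j"
   proof
    assume "y \<in> G j"
    then obtain k where k: "k < j" "as ! (ds ! k) = (u, y)" using xu far_notin_R[OF S] by (auto simp: G_def upto_class_def)
    then have "ds ! k < m" using nth_mem[of k ds] ds(2) j len by auto
    then have "ds ! k = ?d" using nth_eq_iff_index_eq[OF as(1), of "ds ! k" ?d] dm k(2) xy xu by simp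
    then show False using nth_eq_iff_index_eq[OF ds(1), of k j] k(1) j len by simp
   qed
   have "listed ((\<nu> aNx)(y := \<nu> aNx (pred_node y), pred_node y := y)) (insert y (G j))"
   proof (rule listed_insert_arc[OF P _ _ S yG xu(2)])
    show "upto_class c \<subseteq> G j" by (simp add: G_def)
    have "{u, v} \<in> S0" if k: "k < j" "as ! (ds ! k) = (u, v)" for k v
    proof -
     have "ds ! k < m" using nth_mem[of k ds] ds(2) j len k by auto
     then show ?thesis using arc_S0 k(2) by blast
    qed
    then show "G j \<subseteq> upto_class (Suc c)" by (auto simp: G_def upto_class_def)
    fix b assume "b \<in> G j" "{u, b} \<in> S0" "cls b = c"
    then obtain k where "k < j" "as ! (ds ! k) = (u, b)" using far_notin_R[of b] by (auto simp: G_def upto_class_def)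
    then show "sb y <= sb b" using order[of k j b y] j xy xu \<open>cls b = c\<close> by simp
   qed
   moreover have "G (Suc j) = insert y (G j)" using xy xu by (auto simp: G_def less_Suc_eq)
   ultimately show ?thesis using True e aj xu(3) by simp
  qed
 qed simp_all
qed

end

text \<open>The list for \<open>None\<close> is produced as that of an in-port. A right-hand list
  ends with its in-port, so the last entry of the given starting list names the in-port to be
  used.\<close>

definition rows :: com where
 "rows = Seq (Assign aOut (Const 0)) (Seq (For aU (Const 0) (Var 0) (Seq (Write 7 (Var aU) (Var aOut))
  (When (Neg (Equal (Var aU) Root))
   (Seq (Assign aWp (Read 6 (Sub (Add (Read 5 (Var aU)) (Sub (Read 3 (Add (Var aU) (Const 1))) (Read 3 (Var aU)))) (Const 1))))
   (Seq emit (Row aK 1 aU (Seq (Assign aWp (Read 2 (Var aK))) emit)))))))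
  (Write 7 (Var 0) (Var aOut)))"

definition written :: "store => nat list => bool" where
 "written \<mu> xs \<longleftrightarrow> \<mu> aOut 0 = length xs & (\<forall>i<length xs. \<mu> 8 i = xs ! i)"

context emission
begin

lemma card_sides: "e \<in> S0 ==> card (sideA e) + card (sideB e) + 2 = n"
proof -
 assume e: "e \<in> S0"
 obtain x y where xy: "x \<in> {..<n}" "y \<in> {..<n}" "x ~= y" "e = {x, y}" using S0_E[OF e] by (elim linkE)
 note sd = sides[OF e]
 have AV: "sideA e \<subseteq> {..<n}" using sd by auto
 then have fin: "finite (sideA e)" "finite (sideB e)" by (auto simp: sideB_def intro: finite_subset)
 have "{..<n} = (sideA e Un sideB e) Un e" using AV xy by (auto simp: sideB_def)
 then have "n = card ((sideA e Un sideB e) Un e)" using card_lessThan[of n] by metis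
 also have "\<dots> = card (sideA e Un sideB e) + card e" using fin sd xy by (intro card_Un_disjoint) auto
 also have "card (sideA e Un sideB e) = card (sideA e) + card (sideB e)" using fin sd by (intro card_Un_disjoint) auto
 finally show ?thesis using xy by simp
qed

lemma os_length: "length os = m"
 using os(1,2) distinct_card[of os] by simp

lemma os_sorted:
 assumes "j < k" "k < m" "as ! (os ! j) = (u, b)" "as ! (os ! k) = (u, v)"
 shows "card (sideB {u, b}) <= card (sideB {u, v})"
proof -
 have jk: "os ! j < m" "os ! k < m" using nth_mem[of j os] nth_mem[of k os] os(2) os_length assms(1,2) by auto
 have "card (sideA {u, v}) <= card (sideA {u, b})"
  using sorted_wrt_nth_less[OF os(3), of j k] assms os_length by simp
 moreover have "card (sideA {u, b}) + card (sideB {u, b}) + 2 = n" "card (sideA {u, v}) + card (sideB {u, v}) + 2 = n"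
  using card_sides arc_S0 jk assms(3,4) by auto
 ultimately show ?thesis by linarith
qed

lemma sorted_nl: "sorted_wrt (<) (map K (sort_key K (adj ! u)))" "set (sort_key K (adj ! u)) = {v. {u, v} \<in> E}"
proof -
 note r = adj_row[OF u(1)]
 show "set (sort_key K (adj ! u)) = {v. {u, v} \<in> E}" using r by simp
 have "distinct (map K (sort_key K (adj ! u)))"
  using r key_inj by (auto simp: distinct_map inj_on_def)
 then show "sorted_wrt (<) (map K (sort_key K (adj ! u)))" by (simp add: strict_sorted_iff)
qed

lemma listed_base: "chain nx (n # (if R u = [] then [] else cut st (R u))) ==> listed nx (upto_class 1)"
 unfolding listed_def
proof (intro exI conjI)
 let ?L = "if R u = [] then [] else cut st (R u)"
 have d: "distinct (cut st (R u))" using R_row[OF u(1)] by simp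
 show "sorted_wrt (<) (map K ?L)"
 proof (cases "R u = []")
  case False
  have "K (cut st (R u) ! i) < K (cut st (R u) ! j)" if "i < j" "j < length (cut st (R u))" for i j
  proof -
   have "cut st (R u) ! i \<in> set (R u)" "cut st (R u) ! j \<in> set (R u)"
    using nth_mem[of i "cut st (R u)"] nth_mem[of j "cut st (R u)"] that by auto
   then show ?thesis using slot_sub(2) rank_nth[OF d] that unfolding key_less by simp
  qed
  with False show ?thesis by (simp add: sorted_wrt_iff_nth_less)
 qed simp
 have c0: "cls v ~= 0" for v by (simp add: cls_def)
 show "set ?L = upto_class 1" by (auto simp: upto_class_def c0)
qed

lemma run_add_root:
 assumes i: "input \<mu>" and s: "\<mu> aU 0 = u" and l: "listed (\<mu> aNx) (upto_class 4)"
 shows "run add_root \<mu> (%k \<nu>. k <= 5 * n + 2 & same {aJ, aNx} \<mu> \<nu> & listed (\<nu> aNx) {v. {u, v} \<in> E})"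
 unfolding add_root_def
proof (rule run_Row[where W = "{aJ, aNx}" and dd = 2 and xss = adj and v = u and xs = "adj ! u" and C = 3 and
   P = "%k \<nu>. listed (\<nu> aNx) (upto_class 4 Un ({t} Int set (take k (adj ! u))))"], goal_cases)
 case (11 k \<nu>)
 then have k: "k < length (adj ! u)" and sm: "same {aJ, aNx} \<mu> \<nu>" and el: "\<nu> 2 (\<nu> aJ 0) = adj ! u ! k"
  and P: "listed (\<nu> aNx) (upto_class 4 Un ({t} Int set (take k (adj ! u))))" by auto
 have e: "\<nu> 0 0 = n" "\<nu> 0 (Suc 0) = t" using sameD[OF sm, of 0] i by (auto simp: input_def)
 have tk: "set (take (Suc k) (adj ! u)) = insert (adj ! u ! k) (set (take k (adj ! u)))" using k by (simp add: take_Suc_conv_app_nth)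
 show ?case
 proof (cases "adj ! u ! k = t")
  case False
  then show ?thesis using P el e unfolding tk by simp
 next
  case True
  have E: "{u, t} \<in> E" using adj_row[OF u(1)] nth_mem[OF k] True by auto
  have nt: "t \<notin> set (take k (adj ! u))" using adj_row[OF u(1)] k True by (auto simp: in_set_conv_nth nth_eq_iff_index_eq)
  have tu: "t \<notin> upto_class 4" using R_row[OF u(1)] far_notin_R[of t] by (auto simp: upto_class_def)
  obtain L where L: "chain (\<nu> aNx) (n # L)" "sorted_wrt (<) (map K L)" "set L = upto_class 4"
   using P nt by (auto simp: listed_def)
  have "\<exists>L'. chain ((\<nu> aNx)(t := \<nu> aNx n, n := t)) (n # L') & sorted_wrt (<) (map K L') & set L' = insert t (set L)"
  proof (rule chain_insert_sorted[OF L(1,2)])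
   show "t \<notin> set (n # L)" using tu L(3) root by auto
   fix b assume b: "b \<in> set L"
   have "K t <= K b" by (rule key_le) (use slot_sub(1) in auto)
   moreover have "{u, b} \<in> E" using b L(3) R_row[OF u(1)] S0_E[of "{u, b}"] by (auto simp: upto_class_def)
   then have "K t ~= K b" using key_inj[OF E, of b] b tu L(3) by auto
   ultimately show "K t < K b" by simp
  qed auto
  then have "listed ((\<nu> aNx)(t := \<nu> aNx n, n := t)) (insert t (upto_class 4))" using L(3) by (auto simp: listed_def)
  then show ?thesis using True el e unfolding tk by simp
 qed
next
 case (12 k \<nu>)
 have "upto_class 4 Un ({t} Int set (adj ! u)) = {v. {u, v} \<in> E}"
 proof -
  have "cls v < 4" for v by (simp add: cls_def)
  then have "upto_class 4 = set (R u) Un {v. {u, v} \<in> S0}" by (auto simp: upto_class_def)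
  then show ?thesis using adj_row[OF u(1)] neighbour_cases R_row[OF u(1)] S0_E by auto
 qed
 with 12 length_row(1)[OF u(1)] show ?case by simp
qed (use i s u l in "auto simp: input_def")

lemma run_output_list:
 assumes i: "input \<mu>" and s: "\<mu> aU 0 = u" and l: "listed (\<mu> aNx) {v. {u, v} \<in> E}" and wr: "written \<mu> xs"
 shows "run output_list \<mu> (%k \<nu>. k <= 5 * n + 3 & same {aJ, aCur, aOut, 8} \<mu> \<nu> & written \<nu> (xs @ sort_key K (adj ! u)))"
proof -
 obtain L where L: "chain (\<mu> aNx) (n # L)" "sorted_wrt (<) (map K L)" "set L = {v. {u, v} \<in> E}" using l by (auto simp: listed_def)
 have Ls: "L = sort_key K (adj ! u)" using sorted_map_unique[OF L(2) sorted_nl(1)] L(3) sorted_nl(2) by simp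
 then have len: "length L = length (adj ! u)" by simp
 have nx: "\<mu> aNx ((n # L) ! j) = L ! j" if "j < length L" for j using L(1) that by (simp add: chain_def)
 let ?\<mu> = "set_cell aCur 0 (\<mu> aNx n) \<mu>"
 have i1: "input ?\<mu>" by (rule input_same[OF i, of "{aCur}"]) (auto simp: same_def)
 have "run (Row aJ 1 aU (Seq (Write 8 (Var aOut) (Var aCur))
  (Seq (Assign aCur (Read aNx (Var aCur))) (Assign aOut (Add (Var aOut) (Const 1)))))) ?\<mu>
  (%k \<nu>. 1 + k <= 5 * n + 3 & same {aJ, aCur, aOut, 8} \<mu> \<nu> & written \<nu> (xs @ sort_key K (adj ! u)))"
 proof (rule run_Row[where W = "{aJ, aCur, aOut, 8}" and dd = 2 and xss = adj and v = u and xs = "adj ! u" and C = 3 and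
   P = "%j \<nu>. written \<nu> (xs @ take j L) & (j < length L --> \<nu> aCur 0 = L ! j)"], goal_cases)
  case (10)
  with wr nx[of 0] show ?case by (simp add: written_def)
 next
  case (11 j \<nu>)
  then have j: "j < length L" and sm: "same {aJ, aCur, aOut, 8} ?\<mu> \<nu>" and P: "written \<nu> (xs @ take j L)" "\<nu> aCur 0 = L ! j"
   by (auto simp: len)
  have o: "\<nu> aOut 0 = length xs + j" using P(1) j by (simp add: written_def)
  have "\<nu> aNx (L ! j) = L ! Suc j" if "Suc j < length L" using nx[OF that] sameD[OF sm, of aNx] by simp
  moreover have "written (set_cell aOut 0 (Suc (length xs + j)) (set_cell aCur 0 c (set_cell 8 (length xs + j) (L ! j) \<nu>)))
   (xs @ take (Suc j) L)" for c
   using P(1) j by (auto simp: written_def take_Suc_conv_app_nth nth_append less_Suc_eq)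
  ultimately show ?case using P(2) o by simp
 next
  case (12 k \<nu>)
  with length_row(1)[OF u(1)] show ?case by (simp add: Ls len)
 qed (use i1 s u in "auto simp: input_def written_def")
 then show ?thesis unfolding output_list_def using i by (simp add: input_def)
qed

abbreviation "emitW \<equiv> {aJ, aPrev, aSt, aNx, aD, aCls, aAnc, aI, aCur, aOut, 8}"

lemma run_emit:
 assumes i: "input \<mu>" and s: "\<mu> aU 0 = u" "\<mu> aWp 0 = w" and a: "arc_tables as al bl Y \<mu>"
  and od: "!!k. k < m ==> \<mu> aOrd k = os ! k" and wr: "written \<mu> xs"
 shows "run emit \<mu> (%k \<nu>. k <= 99 * n + 21 & same emitW \<mu> \<nu> & written \<nu> (xs @ sort_key K (adj ! u)))"
  (is "run _ _ ?T")
 unfolding emit_def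
proof (rule run_SeqI[OF run_base_list[OF i s a]], elim conjE)
 fix k1 \<nu>1 assume k1: "k1 <= 27 * n + 8" and s1: "same {aJ, aPrev, aSt, aNx, aD} \<mu> \<nu>1" and st: "R u ~= [] --> \<nu>1 aSt 0 = st"
  and c1: "chain (\<nu>1 aNx) (n # (if R u = [] then [] else cut st (R u)))"
 have i1: "input \<nu>1" by (rule input_same[OF i s1]) auto
 have a1: "arc_tables as al bl Y \<nu>1" by (rule arc_tables_cong[OF a s1]) auto
 have e1: "\<nu>1 aU 0 = u" "\<nu>1 aWp 0 = w" using sameD[OF s1] s by auto
 show "run (Seq classify (Seq (pass 1 (Var aI)) (Seq (pass 2 (Sub (Sub Arcs (Const 1)) (Var aI)))
  (Seq (pass 3 (Var aI)) (Seq add_root output_list))))) \<nu>1 (%l. ?T (k1 + l))"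
 proof (rule run_SeqI[OF run_classify[OF i1 e1 a1]], use st in blast, elim conjE)
  fix k2 \<nu>2 assume k2: "k2 <= 20 * n + 2" and s2: "same {aD, aCls, aAnc} \<nu>1 \<nu>2"
   and "\<forall>d<m. \<forall>x y. as ! d = (x, y) --> (if x = u then \<nu>2 aCls d = cls y & \<nu>2 aAnc d = pred_node y else \<nu>2 aCls d = 0)"
  then have cl: "!!d x y. d < m ==> as ! d = (x, y) ==> (if x = u then \<nu>2 aCls d = cls y & \<nu>2 aAnc d = pred_node y else \<nu>2 aCls d = 0)" by blast
  have i2: "input \<nu>2" by (rule input_same[OF i1 s2]) auto
  have a2: "arc_tables as al bl Y \<nu>2" by (rule arc_tables_cong[OF a1 s2]) auto
  have l2: "listed (\<nu>2 aNx) (upto_class 1)" using listed_base[OF c1] sameD[OF s2, of aNx] by simp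
  have o2: "\<nu>2 aOrd = \<mu> aOrd" "\<nu>2 aP = \<mu> aP" using sameD[OF s1] sameD[OF s2] by auto
  have far: "{u, v} \<in> S0" if "k < m" "as ! (os ! k) = (u, v)" for k v
   using arc_S0[OF _ that(2)] nth_mem[of k os] os(2) os_length that(1) by auto
  have up: "sb v <= sb b" if "j < k" "k < m" "as ! (os ! j) = (u, b)" "as ! (os ! k) = (u, v)" "cls b = c" "cls v = c" "c = 1 | c = 3" for j k v b c
   using os_sorted[OF that(1-4)] slot_sub(3,5)[OF far[OF that(2,4)]] slot_sub(3,5)[of b] far[of j b] that by auto
  have r3: "run (pass 1 (Var aI)) \<nu>2 (%k \<nu>. k <= 14 * n + 2 & same {aI, aD, aNx} \<nu>2 \<nu> & listed (\<nu> aNx) (upto_class (Suc 1)))"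
  proof (rule run_pass[OF i2 a2 _ _ _ os(1,2)], goal_cases)
   case (2 d x y)
   then show ?case by (rule cl)
  next
   case 3
   show ?case by (rule l2)
  next
   case (4 \<nu> j)
   with od o2 show ?case by simp
  next
   case (5 j k v b)
   then show ?case by (intro up) auto
  qed auto
  show "run (Seq (pass 1 (Var aI)) (Seq (pass 2 (Sub (Sub Arcs (Const 1)) (Var aI)))
  (Seq (pass 3 (Var aI)) (Seq add_root output_list)))) \<nu>2 (%l. ?T (k1 + (k2 + l)))"
  proof (rule run_SeqI[OF r3], elim conjE)
   fix k3 \<nu>3 assume k3: "k3 <= 14 * n + 2" and s3: "same {aI, aD, aNx} \<nu>2 \<nu>3" and l3: "listed (\<nu>3 aNx) (upto_class (Suc 1))"
   have i3: "input \<nu>3" by (rule input_same[OF i2 s3]) auto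
   have a3: "arc_tables as al bl Y \<nu>3" by (rule arc_tables_cong[OF a2 s3]) auto
   have o3: "\<nu>3 aOrd = \<mu> aOrd" "\<nu>3 aP = \<mu> aP" "\<nu>3 aCls = \<nu>2 aCls" "\<nu>3 aAnc = \<nu>2 aAnc" using sameD[OF s3] o2 by auto
   have m3: "\<mu> aP 0 + \<mu> aP 0 = m" using a by (simp add: arc_tables_def)
   have r4: "run (pass 2 (Sub (Sub Arcs (Const 1)) (Var aI))) \<nu>3 (%k \<nu>. k <= 14 * n + 2 & same {aI, aD, aNx} \<nu>3 \<nu> & listed (\<nu> aNx) (upto_class (Suc 2)))"
   proof (rule run_pass[OF i3 a3 _ _ _, where ds = "rev os"], goal_cases)
    case (2 d x y)
    with cl[of d x y] o3 show ?case by simp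
   next
    case 3
    with l3 show ?case by (simp add: numeral_2_eq_2)
   next
    case (6 \<nu> j)
    then have "\<nu> aP = \<mu> aP" using sameD[OF 6(1), of aP] o3 by simp
    then have "aval (Sub (Sub Arcs (Const 1)) (Var aI)) \<nu> = m - Suc j" using 6 m3 by simp
    with od[of "m - Suc j"] 6 o3 os_length show ?case by (simp add: rev_nth)
   next
    case (7 j k v b)
    have idx: "rev os ! j = os ! (m - Suc j)" "rev os ! k = os ! (m - Suc k)" using 7 os_length by (simp_all add: rev_nth)
    have lt: "m - Suc k < m - Suc j" "m - Suc j < m" "m - Suc k < m" using 7 by auto
    \<comment> \<open>Reading the sorted arcs backwards makes far sides decrease, as class 2
      requires.\<close>
    have "card (sideB {u, v}) <= card (sideB {u, b})"
     by (rule os_sorted[OF lt(1,2)]) (use 7 idx in auto)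
    moreover have "{u, v} \<in> S0" "{u, b} \<in> S0" using far[OF lt(3)] far[OF lt(2)] 7 idx by auto
    ultimately show ?case using slot_sub(4) 7 by simp
   qed (use os in auto)
   show "run (Seq (pass 2 (Sub (Sub Arcs (Const 1)) (Var aI)))
    (Seq (pass 3 (Var aI)) (Seq add_root output_list))) \<nu>3 (%l. ?T (k1 + (k2 + (k3 + l))))"
   proof (rule run_SeqI[OF r4], elim conjE)
    fix k4 \<nu>4 assume k4: "k4 <= 14 * n + 2" and s4: "same {aI, aD, aNx} \<nu>3 \<nu>4" and l4: "listed (\<nu>4 aNx) (upto_class (Suc 2))"
    have i4: "input \<nu>4" by (rule input_same[OF i3 s4]) auto
    have a4: "arc_tables as al bl Y \<nu>4" by (rule arc_tables_cong[OF a3 s4]) auto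
    have o4: "\<nu>4 aOrd = \<mu> aOrd" "\<nu>4 aP = \<mu> aP" "\<nu>4 aCls = \<nu>2 aCls" "\<nu>4 aAnc = \<nu>2 aAnc" using sameD[OF s4] o3 by auto
    have r5: "run (pass 3 (Var aI)) \<nu>4 (%k \<nu>. k <= 14 * n + 2 & same {aI, aD, aNx} \<nu>4 \<nu> & listed (\<nu> aNx) (upto_class (Suc 3)))"
    proof (rule run_pass[OF i4 a4 _ _ _ os(1,2)], goal_cases)
     case (2 d x y)
     with cl[of d x y] o4 show ?case by simp
    next
     case 3
     with l4 show ?case by (simp add: numeral_3_eq_3 numeral_2_eq_2)
    next
     case (4 \<nu> j)
     with od o4 show ?case by simp
    next
     case (5 j k v b)
     then show ?case by (intro up) auto
    qed auto
    show "run (Seq (pass 3 (Var aI)) (Seq add_root output_list)) \<nu>4 (%l. ?T (k1 + (k2 + (k3 + (k4 + l)))))"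
    proof (rule run_SeqI[OF r5], elim conjE)
     fix k5 \<nu>5 assume k5: "k5 <= 14 * n + 2" and s5: "same {aI, aD, aNx} \<nu>4 \<nu>5" and l5: "listed (\<nu>5 aNx) (upto_class (Suc 3))"
     have i5: "input \<nu>5" by (rule input_same[OF i4 s5]) auto
     have e5: "\<nu>5 aU 0 = u" using sameD[OF s5] sameD[OF s4] sameD[OF s3] sameD[OF s2] e1 by auto
     have l5': "listed (\<nu>5 aNx) (upto_class 4)" using l5 by simp
     show "run (Seq add_root output_list) \<nu>5 (%l. ?T (k1 + (k2 + (k3 + (k4 + (k5 + l))))))"
     proof (rule run_SeqI[OF run_add_root[OF i5 e5 l5']], elim conjE)
      fix k6 \<nu>6 assume k6: "k6 <= 5 * n + 2" and s6: "same {aJ, aNx} \<nu>5 \<nu>6" and l6: "listed (\<nu>6 aNx) {v. {u, v} \<in> E}"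
      have i6: "input \<nu>6" by (rule input_same[OF i5 s6]) auto
      have e6: "\<nu>6 aU 0 = u" using sameD[OF s6] e5 by auto
      have sm6: "same {aJ, aPrev, aSt, aNx, aD, aCls, aAnc, aI} \<mu> \<nu>6" using s1 s2 s3 s4 s5 s6 by (auto simp: same_def)
      have wr6: "written \<nu>6 xs" using wr sameD[OF sm6, of aOut] sameD[OF sm6, of 8] by (simp add: written_def)
      show "run output_list \<nu>6 (%l. ?T (k1 + (k2 + (k3 + (k4 + (k5 + (k6 + l)))))))"
      proof (rule run_mono[OF run_output_list[OF i6 e6 l6 wr6]], elim conjE, intro conjI)
       fix k \<nu> assume "same {aJ, aCur, aOut, 8} \<nu>6 \<nu>"
       then show "same emitW \<mu> \<nu>" using sm6 by (auto simp: same_def)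
      next
       \<comment> \<open>The 99 adds up as 27 and 20 for the cycle and the classes, three times 14
         for the passes, and 5 each for the root and the output.\<close>
       fix k \<nu> assume "k <= 5 * n + 3"
       then show "k1 + (k2 + (k3 + (k4 + (k5 + (k6 + k))))) <= 99 * n + 21" using k1 k2 k3 k4 k5 k6 by linarith
      qed
     qed
    qed
   qed
  qed
 qed
qed

end

section \<open>Correctness of the complete table and the quadratic time bound\<close>

lemma last_cut: "distinct xs ==> p \<in> set xs ==> last (cut p xs) = p"
 by (auto dest!: split_list simp: cut_split)

context routing_input
begin

definition first_port :: "nat => nat" where
 "first_port u = tab ! u ! (length (rot ! u) - 1)"

text \<open>If \<open>u\<close> has neighbours besides \<open>t\<close>, the old starting list is
  that of the in-port \<open>first_port u\<close>; the new starting list keeps this in-port, as the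
  induction base requires. Otherwise the entry is \<open>t\<close> itself.\<close>

lemma first_port:
 assumes u: "u < n" "u ~= t"
 shows "rot ! u ~= []" "{u, first_port u} \<in> H"
  "R u ~= [] ==> first_port u \<in> set (R u) & \<pi> u None = \<pi> u (Some {u, first_port u})"
proof -
 have p: "set (\<pi> u None) = links_at H u" using row_pattern(4)[OF u, of None] by (simp add: in_ports_def)
 note b = None_block[OF u]
 have ne: "\<pi> u None ~= []" using p row_pattern(5)[OF u] by auto
 then show rne: "rot ! u ~= []" using b(1) by auto
 have l: "{u, first_port u} = last (\<pi> u None)"
  using b(2)[of "length (rot ! u) - 1"] b(1) rne ne by (simp add: first_port_def last_conv_nth)
 then show H: "{u, first_port u} \<in> H" using p ne last_in_set[of "\<pi> u None"] by (auto simp: links_at_def)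
 assume R: "R u ~= []"
 then obtain w where w: "w \<in> set (R u)" "\<pi> u None = \<pi> u (Some {u, w})" using row_pattern(3)[OF u] by blast
 have "cut w (R u) ~= []" using w(1) by (metis set_cut empty_iff list.set(1))
 then have "last (\<pi> u None) = {u, last (cut w (R u))}"
  unfolding w(2) row_pattern(2)[OF u w(1)] by (simp add: last_map)
 also have "last (cut w (R u)) = w" using R_row[OF u(1)] w(1) by (intro last_cut) blast+
 finally have "first_port u = w" using l by (auto simp: doubleton_eq_iff)
 then show "first_port u \<in> set (R u) & \<pi> u None = \<pi> u (Some {u, first_port u})" using w by simp
qed

lemma emission_intro:
 assumes "arc_choice al bl Y" "arc_order as os" "u < n" "u ~= t" "{u, w} \<in> E"
 shows "emission n t E D \<pi> adj rot al bl Y u w as os"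
 by (intro emission.intro port_order.intro port_order_axioms.intro emission_axioms.intro routing_input_axioms assms)

abbreviation "rowsW \<equiv> {aOut, aU, aK, aWp, 7} Un {aJ, aPrev, aSt, aNx, aD, aCls, aAnc, aI, aCur, aOut, 8}"

lemma run_rows:
 assumes i: "input \<mu>" and choice: "arc_choice al bl Y" and a: "arc_tables as al bl Y \<mu>"
  and ord: "arc_order as os"
  and od: "!!k. k < length as ==> \<mu> aOrd k = os ! k"
 defines "nl \<equiv> %u w. sort_key (key R al bl Y u w) (adj ! u)"
 defines "rlist \<equiv> %u. if u = t then [] else nl u (first_port u) @ concat (map (nl u) (adj ! u))"
 shows "run rows \<mu> (%k \<nu>. k <= 3663 * n\<^sup>2 + 900 * n + 10 &
  (\<forall>j\<le>n. \<nu> 7 j = length (concat (map rlist [0..<j]))) & (\<forall>k<length (concat (map rlist [0..<n])). \<nu> 8 k = concat (map rlist [0..<n]) ! k))"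
proof -
 note em = emission_intro[OF choice ord]
 have emit: "run emit \<nu> (%k \<nu>'. k <= 99 * n + 21 & same {aJ, aPrev, aSt, aNx, aD, aCls, aAnc, aI, aCur, aOut, 8} \<nu> \<nu>' & written \<nu>' (xs @ nl u w))"
  if s: "same rowsW \<mu> \<nu>" and u: "u < n" "u ~= t" "{u, w} \<in> E" and c: "\<nu> aU 0 = u" "\<nu> aWp 0 = w" and wr: "written \<nu> xs" for \<nu> u w xs
 proof -
  have "input \<nu>" by (rule input_same[OF i s]) auto
  moreover have "arc_tables as al bl Y \<nu>" by (rule arc_tables_cong[OF a s]) auto
  moreover have "\<nu> aOrd = \<mu> aOrd" using sameD[OF s] by auto
  ultimately show ?thesis unfolding nl_def using od by (intro emission.run_emit[OF em[OF u]] c wr) auto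
 qed
 let ?pre = "%u. concat (map rlist [0..<u])"
 let ?W = "Assign aWp (Read 6 (Sub (Add (Read 5 (Var aU)) (Sub (Read 3 (Add (Var aU) (Const 1))) (Read 3 (Var aU)))) (Const 1)))"
 let ?P = "%u \<nu>. written \<nu> (?pre u) & (\<forall>j<u. \<nu> 7 j = length (?pre j))"
 let ?body = "Seq (Write 7 (Var aU) (Var aOut)) (When (Neg (Equal (Var aU) Root))
   (Seq ?W (Seq emit (Row aK 1 aU (Seq (Assign aWp (Read 2 (Var aK))) emit)))))"
 have body: "run ?body \<nu> (%k \<nu>'. k <= length (adj ! u) * (99 * n + 24) + (99 * n + 30) & same rowsW \<nu> \<nu>' & \<nu>' aU 0 = u & ?P (Suc u) \<nu>')"
  if u: "u < n" and s: "same rowsW \<mu> \<nu>" and au: "\<nu> aU 0 = u" and P: "?P u \<nu>" for u \<nu>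
 proof -
  let ?\<nu> = "set_cell 7 u (length (?pre u)) \<nu>"
  have o: "\<nu> aOut 0 = length (?pre u)" using P by (simp add: written_def)
  have s1: "same rowsW \<mu> ?\<nu>" using s by simp
  have i1: "input ?\<nu>" by (rule input_same[OF i s1]) auto
  have w1: "written ?\<nu> (?pre u)" and h1: "\<forall>j<Suc u. ?\<nu> 7 j = length (?pre j)" using P by (auto simp: written_def less_Suc_eq)
  have rt: "\<nu> 0 (Suc 0) = t" using i1 by (simp add: input_def)
  show ?thesis
  proof (cases "u = t")
   case True
   have "?pre (Suc u) = ?pre u" using True by (simp add: rlist_def)
   with True au o rt w1 h1 show ?thesis by simp
  next
   case False
   note fp = first_port[OF u False]
   let ?f = "first_port u"
   have fE: "{u, ?f} \<in> E" using fp(2) by simp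
   have f: "?\<nu> 6 (?\<nu> 5 u + (?\<nu> 3 (Suc u) - ?\<nu> 3 u) - 1) = ?f"
   proof -
    have "?\<nu> 5 u = off tab u" "?\<nu> 3 u = off rot u" "?\<nu> 3 (Suc u) = off rot u + length (rot ! u)"
     using i1 u off_Suc[of u rot] by (auto simp: input_def stored_def)
    moreover have "off tab u + length (rot ! u) - 1 = off tab u + (length (rot ! u) - 1)" using fp(1) by (cases "rot ! u") auto
    moreover have "length (rot ! u) - 1 < length (tab ! u)"
     using None_block(2)[OF u False, of "length (rot ! u) - 1"] fp(1) by simp
    ultimately show ?thesis using i1 u unfolding input_def stored_def first_port_def by simp
   qed
   let ?\<nu>2 = "set_cell aWp 0 ?f ?\<nu>"
   have s2: "same rowsW \<mu> ?\<nu>2" using s by simp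
   have e2: "run emit ?\<nu>2 (%k \<nu>'. k <= 99 * n + 21 & same {aJ, aPrev, aSt, aNx, aD, aCls, aAnc, aI, aCur, aOut, 8} ?\<nu>2 \<nu>' & written \<nu>' (?pre u @ nl u ?f))"
    by (rule emit[OF s2 u False fE]) (use au w1 in "auto simp: written_def")
   let ?T = "%k \<nu>'. 2 + (1 + k) <= length (adj ! u) * (99 * n + 24) + (99 * n + 30) & same rowsW \<nu> \<nu>' & \<nu>' aU 0 = u & ?P (Suc u) \<nu>'"
   have "run (Seq emit (Row aK 1 aU (Seq (Assign aWp (Read 2 (Var aK))) emit))) ?\<nu>2 ?T"
   proof (rule run_SeqI[OF e2], elim conjE)
    fix k3 \<nu>3 assume k3: "k3 <= 99 * n + 21" and s3: "same {aJ, aPrev, aSt, aNx, aD, aCls, aAnc, aI, aCur, aOut, 8} ?\<nu>2 \<nu>3"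
     and w3: "written \<nu>3 (?pre u @ nl u ?f)"
    have s3': "same rowsW \<nu> \<nu>3" "same rowsW \<mu> \<nu>3" using s3 s by (auto simp: same_def)
    have i3: "input \<nu>3" by (rule input_same[OF i s3'(2)]) auto
    have e3: "\<nu>3 aU 0 = u" "\<nu>3 7 = ?\<nu> 7" using sameD[OF s3] au by auto
    show "run (Row aK 1 aU (Seq (Assign aWp (Read 2 (Var aK))) emit)) \<nu>3 (%l. ?T (k3 + l))"
    proof (rule run_Row[where W = "{aK, aWp, aJ, aPrev, aSt, aNx, aD, aCls, aAnc, aI, aCur, aOut, 8}" and dd = 2 and xss = adj and v = u and xs = "adj ! u"
      and C = "99 * n + 22" and P = "%m \<nu>'. written \<nu>' (?pre u @ nl u ?f @ concat (map (nl u) (take m (adj ! u))))"], goal_cases)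
     case (11 m \<nu>4)
     then have m: "m < length (adj ! u)" and s4: "same {aK, aWp, aJ, aPrev, aSt, aNx, aD, aCls, aAnc, aI, aCur, aOut, 8} \<nu>3 \<nu>4"
      and el: "\<nu>4 2 (\<nu>4 aK 0) = adj ! u ! m" and w4: "written \<nu>4 (?pre u @ nl u ?f @ concat (map (nl u) (take m (adj ! u))))" by auto
     have E: "{u, adj ! u ! m} \<in> E" using adj_row[OF u] nth_mem[OF m] by auto
     let ?\<nu>5 = "set_cell aWp 0 (adj ! u ! m) \<nu>4"
     have s5: "same rowsW \<mu> ?\<nu>5" using s3'(2) s4 by (auto simp: same_def)
     have "run emit ?\<nu>5 (%k \<nu>'. k <= 99 * n + 21 & same {aJ, aPrev, aSt, aNx, aD, aCls, aAnc, aI, aCur, aOut, 8} ?\<nu>5 \<nu>' &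
      written \<nu>' ((?pre u @ nl u ?f @ concat (map (nl u) (take m (adj ! u)))) @ nl u (adj ! u ! m)))"
      by (rule emit[OF s5 u False E]) (use sameD[OF s4, of aU] e3 w4 in "auto simp: written_def")
     then have "run emit ?\<nu>5 (%k \<nu>'. 1 + k <= 99 * n + 22 & same {aK, aWp, aJ, aPrev, aSt, aNx, aD, aCls, aAnc, aI, aCur, aOut, 8} \<nu>4 \<nu>' &
      \<nu>' aK 0 = \<nu>4 aK 0 & written \<nu>' (?pre u @ nl u ?f @ concat (map (nl u) (take (Suc m) (adj ! u)))))"
      by (rule run_mono) (use m in "auto simp: same_def take_Suc_conv_app_nth")
     with el show ?case by simp
    next
     case (12 k \<nu>4)
     have pr: "?pre (Suc u) = ?pre u @ nl u ?f @ concat (map (nl u) (adj ! u))" using False by (simp add: rlist_def)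
     have "written \<nu>4 (?pre (Suc u))" unfolding pr using 12(2) by simp
     moreover have "\<nu>4 7 = ?\<nu> 7" "\<nu>4 aU 0 = u" using sameD[OF 12(1)] e3 by auto
     moreover have "same rowsW \<nu> \<nu>4" using s3'(1) 12(1) by (auto simp: same_def)
     moreover have "2 + (1 + (k3 + k)) <= length (adj ! u) * (99 * n + 24) + (99 * n + 30)"
     proof -
      have e: "99 * n + 22 + 2 = 99 * n + 24" by simp
      show ?thesis using 12(3) k3 unfolding e by linarith
     qed
     ultimately show ?case using h1 by simp
    qed (use i3 e3 u w3 in "auto simp: input_def written_def")
   qed
   then have "run (Seq ?W (Seq emit (Row aK 1 aU (Seq (Assign aWp (Read 2 (Var aK))) emit)))) ?\<nu> (%k \<nu>'.
     Suc (Suc k) <= length (adj ! u) * (99 * n + 24) + (99 * n + 30) & same rowsW \<nu> \<nu>' & \<nu>' aU 0 = u & ?P (Suc u) \<nu>')"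
    using f au by (simp only: run_Seq[of ?W] run_Write aval.simps set_cell_other) (simp add: add.commute)
   with False au o rt show ?thesis by simp
  qed
 qed
 have "run (For aU (Const 0) (Var 0) ?body) (set_cell aOut 0 0 \<mu>)
  (%k \<nu>. k <= 3663 * n\<^sup>2 + 897 * n + 2 & same rowsW \<mu> \<nu> & ?P n \<nu>)"
 proof (rule run_For_sum[where W = rowsW and a = 0 and b = n and C = "%u. length (adj ! u) * (99 * n + 24) + (99 * n + 30)" and P = ?P], goal_cases)
  case (4 \<nu>)
  with sameD[OF 4, of 0] i show ?case by (simp add: input_def)
 next
  case (7 u \<nu>)
  then show ?case by (intro body) auto
 next
  case (8 k \<nu>)
  have "(\<Sum>j = 0..<n. length (adj ! j) * (99 * n + 24) + (99 * n + 30) + 2) = (\<Sum>j<n. length (adj ! j)) * (99 * n + 24) + (n * (99 * n + 30) + 2 * n)"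
   by (simp add: sum.distrib lessThan_atLeast0 flip: sum_distrib_right) (simp add: algebra_simps)
  moreover have "(\<Sum>j<n. length (adj ! j)) * (99 * n + 24) <= 36 * n * (99 * n + 24)" using sum_adj by (rule mult_le_mono1)
  ultimately have "k <= 36 * n * (99 * n + 24) + (n * (99 * n + 30) + 2 * n) + 2" using 8(3) by linarith
  \<comment> \<open>Here 3663 is 36 times 99 for the lists of all in-ports that are links, plus 99
    for the starting lists.\<close>
  then have "k <= 3663 * n\<^sup>2 + 897 * n + 2" by (simp add: power2_eq_square algebra_simps)
  with 8 show ?case by simp
 qed (auto simp: written_def)
 then have "run (Seq (For aU (Const 0) (Var 0) ?body) (Write 7 (Var 0) (Var aOut))) (set_cell aOut 0 0 \<mu>) (%k \<nu>. 1 + k <= 3663 * n\<^sup>2 + 900 * n + 10 &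
  (\<forall>j\<le>n. \<nu> 7 j = length (?pre j)) & (\<forall>k<length (?pre n). \<nu> 8 k = ?pre n ! k))"
 proof (rule run_SeqI, elim conjE)
  fix k \<nu> assume k: "k <= 3663 * n\<^sup>2 + 897 * n + 2" and s: "same rowsW \<mu> \<nu>" and P: "written \<nu> (?pre n)" "\<forall>j<n. \<nu> 7 j = length (?pre j)"
  have "\<nu> 0 0 = n" using sameD[OF s, of 0] i by (simp add: input_def)
  then show "run (Write 7 (Var 0) (Var aOut)) \<nu> (%l \<nu>. 1 + (k + l) <= 3663 * n\<^sup>2 + 900 * n + 10 &
   (\<forall>j\<le>n. \<nu> 7 j = length (?pre j)) & (\<forall>k<length (?pre n). \<nu> 8 k = ?pre n ! k))"
   using k P by (auto simp: written_def)
 qed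
 then show ?thesis by (simp only: rows_def run_Seq[of "Assign aOut (Const 0)"] run_Write aval.simps)
qed

definition out_pattern :: "(nat => nat => nat list) => nat pattern" where
 "out_pattern nl u p = map (%v. {u, v}) (nl u (case p of None => first_port u | Some e => other_end u e))"

text \<open>The lists printed by the program are the keys' sorted adjacency rows, whose uniqueness
  follows from injectivity of the keys; this is where the computation meets the resilience
  proof.\<close>

lemma out_pattern_correct:
 assumes choice: "arc_choice al bl Y" and ord: "arc_order as os"
 defines "nl \<equiv> %u w. sort_key (key R al bl Y u w) (adj ! u)"
 shows "skipping_pattern {..<n} E t (out_pattern nl)" "perfectly_resilient {..<n} E t (out_pattern nl)"
  "pattern_table adj t (out_pattern nl) = map (%u. if u = t then [] else nl u (first_port u) @ concat (map (nl u) (adj ! u))) [0..<n]"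
proof -
 note em = emission_intro[OF choice ord]
 have o: "other_end u {u, w} = w" if "{u, w} \<in> E" for u w using link_ends[OF that] by simp
 interpret A: assembled "{..<n}" E t \<pi> "out_pattern nl" R al bl Y nl first_port
 proof (unfold_locales, goal_cases)
  case 1 show ?case by (rule skipping_H)
 next
  case 2 show ?case by (rule resilient)
 next
  case (3 v) then show ?case by (rule rotational_rows)
 next
  case (4 u v) then show ?case by (rule conjunct1[OF choice[unfolded arc_choice_def], rule_format])
 next
  case (5 e)
  then obtain x y where "e = {x, y}" "~  Y x y" "Y y x" "wit y x"
   using conjunct2[OF choice[unfolded arc_choice_def]] by blast
  then show ?case unfolding wit_def by (intro exI[of _ x] exI[of _ y]) (auto simp: insert_commute)
 next
  case (6 u w)
  then show ?case using emission.sorted_nl[OF em[of u w]] unfolding nl_def by simp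
 next
  case (7 u w)
  with o[of u w] show ?case by (simp add: out_pattern_def)
 next
  case (8 u)
  then have "{u, first_port u} \<in> E" using first_port(2)[of u] by simp
  with o[of u "first_port u"] show ?case by (simp add: out_pattern_def)
 next
  case (9 u)
  with first_port(3)[of u] show ?case by simp
 qed
 show "skipping_pattern {..<n} E t (out_pattern nl)" by (rule A.skipping')
 show "perfectly_resilient {..<n} E t (out_pattern nl)" by (rule A.assembled_resilient)
 have ends: "map (other_end u) (map (%v. {u, v}) (nl u w)) = nl u w" if u: "u < n" for u w
 proof -
  have "other_end u {u, v} = v" if "v \<in> set (nl u w)" for v using that adj_row[OF u] o[of u v] by (simp add: nl_def)
  then show ?thesis by (simp add: map_idI)
 qed
 have "concat (map (%p. map (other_end u) (out_pattern nl u p)) (None # map (%w. Some {u, w}) (adj ! u)))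
   = nl u (first_port u) @ concat (map (nl u) (adj ! u))" if u: "u < n" for u
 proof -
  have "map (other_end u) (out_pattern nl u (Some {u, w})) = nl u w" if "w \<in> set (adj ! u)" for w
   using that adj_row[OF u] o[of u w] ends[OF u] by (simp add: out_pattern_def del: map_map)
  moreover have "map (other_end u) (out_pattern nl u None) = nl u (first_port u)"
   using ends[OF u] by (simp add: out_pattern_def del: map_map)
  ultimately show ?thesis by (simp add: comp_def cong: map_cong)
 qed
 then show "pattern_table adj t (out_pattern nl) = map (%u. if u = t then [] else nl u (first_port u) @ concat (map (nl u) (adj ! u))) [0..<n]"
  unfolding pattern_table_def by (intro map_cong) simp_all
qed

theorem run_program:
 "run (Seq prepare (Seq order rows)) (input_store n t adj rot tab) (%k \<nu>. k <= 10000 * n\<^sup>2 &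
  (\<exists>\<pi>'. skipping_pattern {..<n} E t \<pi>' & perfectly_resilient {..<n} E t \<pi>' & output_table \<nu> (pattern_table adj t \<pi>')))"
proof -
 let ?\<mu> = "input_store n t adj rot tab"
 let ?T = "%k \<nu>. k <= 10000 * n\<^sup>2 &
  (\<exists>\<pi>'. skipping_pattern {..<n} E t \<pi>' & perfectly_resilient {..<n} E t \<pi>' & output_table \<nu> (pattern_table adj t \<pi>'))"
 have z: "?\<mu> a = (%_. 0)" if "7 <= a" for a using that by (auto simp: input_store_def store_of_def)
 show ?thesis
 proof (rule run_SeqI[OF run_prepare[OF input_store z]], assumption, elim conjE exE)
  fix k1 \<nu>1 ps assume k1: "k1 <= 800 * n\<^sup>2 + 700 * n + 10" and s1: "same (insert aH (collectW Un handleW)) ?\<mu> \<nu>1"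
   and ps: "collected ps \<nu>1" "distinct ps" "set ps = {(x, y). x < y & {x, y} \<in> S0}"
   and h: "\<forall>i<length ps. handled i (fst (ps ! i)) (snd (ps ! i)) \<nu>1"
  have i1: "input \<nu>1" by (rule input_same[OF input_store s1]) auto
  obtain as al bl Y where as: "distinct as" "set as = {(x, y). {x, y} \<in> S0}" "length as <= n + n"
   and a1: "arc_tables as al bl Y \<nu>1" and choice: "arc_choice al bl Y"
   using arc_tables_of_handled[OF ps] h by blast
  have sz: "\<nu>1 aSize d = card (sideA {fst (as ! d), snd (as ! d)})" if "d < length as" for d
   using a1 that unfolding arc_tables_def by (metis prod.collapse)
  have pos: "0 < \<nu>1 aSize d & \<nu>1 aSize d <= n" if "d < length as" for d
  proof -
   have e: "{fst (as ! d), snd (as ! d)} \<in> S0" using nth_mem[OF that] as(2) by auto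
   note sd = sides[OF e]
   let ?A = "sideA {fst (as ! d), snd (as ! d)}"
   have "?A \<subseteq> {..<n}" using sd by auto
   moreover have "t \<in> ?A" using sd by auto
   ultimately show ?thesis using sz[OF that] card_mono[of "{..<n}" ?A] by (auto simp: card_gt_0_iff intro: finite_subset)
  qed
  have n1: "\<nu>1 aP 0 + \<nu>1 aP 0 = length as" "\<nu>1 0 0 = n" using a1 i1 by (auto simp: arc_tables_def input_def)
  show "run (Seq order rows) \<nu>1 (%l. ?T (k1 + l))"
  proof (rule run_SeqI[OF run_order[where \<mu> = \<nu>1 and m = "length as" and n = n, OF n1 as(3) pos]], assumption, elim conjE exE)
   fix k2 \<nu>2 os assume k2: "k2 <= 12 * n\<^sup>2 + 4 * n + 3" and s2: "same {aI, aJ, aL, aOrd} \<nu>1 \<nu>2"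
    and os: "distinct os" "set os = {..<length as}" "sorted_wrt (%d d'. \<nu>1 aSize d' <= \<nu>1 aSize d) os" and od: "\<forall>k<length as. \<nu>2 aOrd k = os ! k"
   have i2: "input \<nu>2" by (rule input_same[OF i1 s2]) auto
   have a2: "arc_tables as al bl Y \<nu>2" by (rule arc_tables_cong[OF a1 s2]) auto
   have "sorted_wrt (%d d'. card (sideA {fst (as ! d'), snd (as ! d')}) <= card (sideA {fst (as ! d), snd (as ! d)})) os"
    by (rule sorted_wrt_mono_rel[OF _ os(3)]) (use os(2) sz in auto)
   then have ord: "arc_order as os" using as os(1,2) by (simp add: arc_order_def)
   note rr = run_rows[OF i2 choice a2 ord] and oc = out_pattern_correct[OF choice ord]
   show "run rows \<nu>2 (%l. ?T (k1 + (k2 + l)))"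
   proof (rule run_mono[OF rr], use od in blast, elim conjE, goal_cases)
    case (1 k \<nu>)
    \<comment> \<open>There is at least the node \<open>t\<close>, so lower-order terms are
      absorbed: 800, 12 and 3663 for the quadratic parts, the rest of the 10000 for linear and
      constant ones.\<close>
    have "n <= n\<^sup>2" "1 <= n\<^sup>2" using root by (simp_all add: power2_eq_square)
    then have "k1 + (k2 + k) <= 10000 * n\<^sup>2" using 1(1) k1 k2 by linarith
    moreover have "output_table \<nu> (pattern_table adj t (out_pattern (%u w. sort_key (key R al bl Y u w) (adj ! u))))"
     unfolding oc(3) output_table_def holds_list_def
     using 1(2,3) by (simp add: offsets_def take_map del: upt_Suc)
    ultimately show ?case using oc(1,2) by blast
   qed
  qed
 qed
qed

end

theorem theorem6p18:
  shows "\<exists>(P :: com) (T :: nat \<Rightarrow> nat).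
    (\<lambda>n. real (T n)) \<in> O(\<lambda>n. real n ^ 2) \<and>
    (\<forall>(n :: nat) (t :: nat) (E :: nat set set) (S :: nat set set) (D :: nat drawing)
      (\<pi> :: nat pattern) (adj :: nat list list) (rot :: nat list list).
      simple_graph {..<n} E \<and> t \<in> {..<n} \<and>
      planar {..<n} E \<and> biconnected {..<n} E \<and>
      S = separating_links {..<n} E \<and>
      plane_embedding {..<n} (E - S) D \<and>
      right_hand_pattern {..<n} (E - S) D t \<pi> \<and>
      perfectly_resilient {..<n} (E - S) t \<pi> \<and>
      adjacency_lists n E adj \<and> rotation_lists n (E - S) D rot
      \<longrightarrow>
      (\<exists>k \<tau> \<pi>'.
        exec P (input_store n t adj rot (pattern_table rot t \<pi>)) k \<tau> \<and> k \<le> T n \<and>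
        skipping_pattern {..<n} E t \<pi>' \<and>
        perfectly_resilient {..<n} E t \<pi>' \<and>
        output_table \<tau> (pattern_table adj t \<pi>')))"
proof (rule exI[of _ "Seq prepare (Seq order rows)"], rule exI[of _ "%n. 10000 * n\<^sup>2"], intro conjI allI impI)
 show "(%n. real (10000 * n\<^sup>2)) \<in> O(%n. real n ^ 2)" by simp
 fix n t :: nat and E S :: "nat set set" and D :: "nat drawing" and \<pi> :: "nat pattern" and adj rot :: "nat list list"
 assume "simple_graph {..<n} E & t \<in> {..<n} & planar {..<n} E & biconnected {..<n} E &
   S = separating_links {..<n} E & plane_embedding {..<n} (E - S) D & right_hand_pattern {..<n} (E - S) D t \<pi> &
   perfectly_resilient {..<n} (E - S) t \<pi> & adjacency_lists n E adj & rotation_lists n (E - S) D rot"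
 then interpret routing_input n t E D \<pi> adj rot by unfold_locales auto
 show "\<exists>k \<nu> \<pi>'. exec (Seq prepare (Seq order rows)) (input_store n t adj rot (pattern_table rot t \<pi>)) k \<nu> & k <= 10000 * n\<^sup>2 &
    skipping_pattern {..<n} E t \<pi>' & perfectly_resilient {..<n} E t \<pi>' & output_table \<nu> (pattern_table adj t \<pi>')"
  using run_program unfolding run_def tab_def by blast
qed

end
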